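(* Let $A_{i,j},B_{i,j}$ (with $i,j\ge 0$, $i+j=2$) be six independent normal random variables with mean $0$ and standard deviation $1$, and consider the random planar quadratic homogeneous vector field $$F_2(x,y)=\Big(\sum_{i+j=2}A_{i,j}x^iy^j\Big)\frac{\partial}{\partial x}+\Big(\sum_{i+j=2}B_{i,j}x^iy^j\Big)\frac{\partial}{\partial y}.$$ The phase portraits of $F_2$ which occur with positive probability are exactly five, $Q_1,\dots,Q_5$. They are completely determined by the couple $(i,l)$, where $i$ is the index of the vector field at the origin and $l$ is the number of invariant straight lines through the origin: $$Q_1:(i,l)=(-2,3),\quad Q_2:(i,l)=(0,3),\quad Q_3:(i,l)=(2,3),\quad Q_4:(i,l)=(0,1),\quad Q_5:(i,l)=(2,1).$$ Moreover, writing $P(Q_j)$ for the probability that the phase portrait of $F_2$ is $Q_j$, in addition to $\sum_{j=1}^5P(Q_j)=1$ one has $$P(Q_1)+P(Q_2)+P(Q_3)=\frac{\Lambda_2-1}{2}\simeq 0.32172,\qquad P(Q_1)=P(Q_3)+P(Q_5),$$ where $$\Lambda_2=\frac1\pi\int_{-\infty}^{\infty}\frac{\sqrt{2t^8+8t^6+13t^4+8t^2+2}}{(t^2+1)(t^4+t^2+1)}\,dt\simeq 1.64343.$$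
   Context: Phase portraits are considered in the Poincaré disk (the closed disk obtained by the Poincaré compactification of the plane, to which the flow of a polynomial vector field, after a positive rescaling of time, extends, with the boundary circle, "infinity", invariant). Two vector fields have the same phase portrait (modulo time orientation) if there is a homeomorphism of the closed Poincaré disk, preserving the boundary circle, carrying orbits of one to orbits of the other and either preserving the time orientation of all orbits or reversing the time orientation of all orbits. (For even degree the change $(x,y,t)\to(-x,-y,-t)$ leaves the homogeneous system invariant, so reversing time does not change the phase portrait.) $P(W)$ denotes the probability that a phase portrait of type $W$ occurs, modulo time orientation. The index of a planar vector field $f$ at an isolated zero $\mathbf 0$ is the degree of the map $f/\|f\|$ from a small circle around $\mathbf 0$ (enclosing no other zero) to the unit circle. *)

theory Defs
  imports "HOL-Probability.Probability" "HOL-Complex_Analysis.Complex_Analysis"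
begin

text \<open>The plane is identified with \<^typ>\<open>complex\<close>, so that \<^term>\<open>x \<bullet> y\<close> and \<^term>\<open>norm x\<close> are the
  Euclidean inner product and norm, and planar vector fields are functions on \<^typ>\<open>complex\<close>.\<close>

definition exponents :: "nat \<Rightarrow> (nat \<times> nat) set" where
  "exponents n = {(i, j). i + j = n}"

definition hom_poly :: "nat \<Rightarrow> (nat \<times> nat \<Rightarrow> real) \<Rightarrow> complex \<Rightarrow> real" where
  "hom_poly n a z = (\<Sum>(i, j)\<in>exponents n. a (i, j) * Re z ^ i * Im z ^ j)"

definition hom_field :: "nat \<Rightarrow> (nat \<times> nat \<Rightarrow> real) \<Rightarrow> (nat \<times> nat \<Rightarrow> real) \<Rightarrow> complex \<Rightarrow> complex" where
  "hom_field n a b z = Complex (hom_poly n a z) (hom_poly n b z)"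

definition hom_fields :: "nat \<Rightarrow> (complex \<Rightarrow> complex) set" where
  "hom_fields n = {hom_field n a b | a b. True}"


definition trajectory_on :: "real set \<Rightarrow> (complex \<Rightarrow> complex) \<Rightarrow> (real \<Rightarrow> complex) \<Rightarrow> bool" where
  "trajectory_on I F \<gamma> \<longleftrightarrow> (\<forall>t\<in>I. (\<gamma> has_vector_derivative F (\<gamma> t)) (at t within I))"

definition flow_invariant :: "(complex \<Rightarrow> complex) \<Rightarrow> complex set \<Rightarrow> bool" where
  "flow_invariant F S \<longleftrightarrow>
     (\<forall>I \<gamma>. is_interval I \<and> trajectory_on I F \<gamma> \<and> \<gamma> ` I \<inter> S \<noteq> {} \<longrightarrow> \<gamma> ` I \<subseteq> S)"

definition invariant_lines :: "(complex \<Rightarrow> complex) \<Rightarrow> complex set set" where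
  "invariant_lines F = {L. (\<exists>v. v \<noteq> 0 \<and> L = span {v}) \<and> flow_invariant F L}"


text \<open>The degree of a map from a circle to the unit circle is the winding number about \<open>0\<close> of
  the loop obtained by traversing the circle once counterclockwise; \<^term>\<open>sgn z\<close> is \<open>z / norm z\<close>.\<close>

definition has_index :: "(complex \<Rightarrow> complex) \<Rightarrow> complex \<Rightarrow> int \<Rightarrow> bool" where
  "has_index F z i \<longleftrightarrow>
     F z = 0 \<and> (\<forall>\<^sub>F w in at z. F w \<noteq> 0) \<and>
     (\<forall>\<^sub>F r in at_right 0. winding_number (\<lambda>t. sgn (F (circlepath z r t))) 0 = of_int i)"


text \<open>Central projection onto the upper unit hemisphere followed by orthogonal projection maps
  the plane onto the open unit disk.\<close>

definition to_disk :: "complex \<Rightarrow> complex" where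
  "to_disk x = x /\<^sub>R sqrt (1 + (norm x)\<^sup>2)"

text \<open>For a homogeneous field of degree \<open>n \<ge> 1\<close>, the field below is the push-forward under
  \<^const>\<open>to_disk\<close> multiplied by the \<open>(n - 1)\<close>-st power of the (positive) last coordinate
  of the hemisphere, see the lemma \<open>poincare_field_push_forward\<close>. It is polynomial, and it is
  considered on the closed unit disk, whose boundary circle is invariant.\<close>

definition poincare_field :: "(complex \<Rightarrow> complex) \<Rightarrow> complex \<Rightarrow> complex" where
  "poincare_field F u = F u - (u \<bullet> F u) *\<^sub>R u"

lemma hom_field_scaleR: "hom_field n a b (r *\<^sub>R z) = r ^ n *\<^sub>R hom_field n a b z"
proof -
  have "hom_poly n c (r *\<^sub>R z) = r ^ n * hom_poly n c z" for c
    unfolding hom_poly_def sum_distrib_left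
    by (rule sum.cong) (auto simp: exponents_def power_mult_distrib power_add)
  then show ?thesis
    by (simp add: hom_field_def complex_eq_iff)
qed

lemma poincare_field_push_forward:
  fixes x :: complex
  assumes "F \<in> hom_fields n" and "n \<ge> 1"
  defines "s \<equiv> 1 / sqrt (1 + (norm x)\<^sup>2)"
  obtains D where "(to_disk has_derivative D) (at x)"
    and "poincare_field F (to_disk x) = s ^ (n - 1) *\<^sub>R D (F x)"
proof
  have pos: "1 + (norm x)\<^sup>2 > 0"
    by (simp add: add_pos_nonneg)
  define D where "D = (\<lambda>v. s *\<^sub>R v - (s ^ 3 * (x \<bullet> v)) *\<^sub>R x)"
  have eq: "to_disk = (\<lambda>y. inverse (sqrt (1 + y \<bullet> y)) *\<^sub>R y)"
    by (simp add: to_disk_def fun_eq_iff power2_norm_eq_inner)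
  have pos': "1 + x \<bullet> x > 0"
    using pos by (simp add: power2_norm_eq_inner)
  have s3: "s ^ 3 = inverse (sqrt (1 + x \<bullet> x)) * inverse (sqrt (1 + x \<bullet> x)) * inverse (sqrt (1 + x \<bullet> x))"
    by (simp add: s_def power2_norm_eq_inner power3_eq_cube field_simps)
  show "(to_disk has_derivative D) (at x)"
    unfolding eq
    apply (rule derivative_eq_intros refl | use pos' in force)+
    apply (simp add: D_def fun_eq_iff s3)
    apply (simp add: s_def power2_norm_eq_inner inner_commute divide_simps)
    done
  obtain a b where F: "F = hom_field n a b"
    using assms(1) by (auto simp: hom_fields_def)
  obtain m where n: "n = Suc m"
    using assms(2) by (cases n) auto
  have "to_disk x = s *\<^sub>R x"
    by (simp add: to_disk_def s_def divide_inverse)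
  then show "poincare_field F (to_disk x) = s ^ (n - 1) *\<^sub>R D (F x)"
    by (simp add: poincare_field_def F hom_field_scaleR D_def n algebra_simps power3_eq_cube)
qed


text \<open>Since the closed disk is compact and invariant, the maximal trajectories of the
  compactified field are defined for all times.\<close>

definition disk_trajectory :: "(complex \<Rightarrow> complex) \<Rightarrow> (real \<Rightarrow> complex) \<Rightarrow> bool" where
  "disk_trajectory F \<gamma> \<longleftrightarrow> trajectory_on UNIV (poincare_field F) \<gamma> \<and> range \<gamma> \<subseteq> cball 0 1"

text \<open>The reparametrization \<open>\<tau>\<close> below is an increasing homeomorphism of the line, so
  orbits are carried onto orbits; the sign \<open>\<sigma>\<close>, common to all orbits, tells whether their
  time orientation is preserved or reversed.\<close>

definition same_phase_portrait :: "(complex \<Rightarrow> complex) \<Rightarrow> (complex \<Rightarrow> complex) \<Rightarrow> bool" where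
  "same_phase_portrait F G \<longleftrightarrow>
     (\<exists>h h'. homeomorphism (cball 0 1) (cball 0 1) h h' \<and> h ` sphere 0 1 = sphere 0 1 \<and>
        (\<exists>\<sigma>\<in>{1, -1}. \<forall>\<gamma>. disk_trajectory F \<gamma> \<longrightarrow>
           (\<exists>\<delta> \<tau>. disk_trajectory G \<delta> \<and> strict_mono \<tau> \<and> surj \<tau> \<and>
              (\<forall>t. h (\<gamma> t) = \<delta> (\<sigma> * \<tau> t)))))"

text \<open>A phase portrait of a homogeneous field of degree \<open>n\<close> is its equivalence class.\<close>

definition phase_portrait :: "nat \<Rightarrow> (complex \<Rightarrow> complex) \<Rightarrow> (complex \<Rightarrow> complex) set" where
  "phase_portrait n F = {G \<in> hom_fields n. same_phase_portrait F G}"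

definition determined_by :: "(complex \<Rightarrow> complex) set \<Rightarrow> int \<Rightarrow> nat \<Rightarrow> bool" where
  "determined_by Q i l \<longleftrightarrow>
     (\<forall>F\<in>hom_fields 2. phase_portrait 2 F = Q \<longleftrightarrow>
        has_index F 0 i \<and> finite (invariant_lines F) \<and> card (invariant_lines F) = l)"

definition portrait_prob ::
    "'w measure \<Rightarrow> ('w \<Rightarrow> complex \<Rightarrow> complex) \<Rightarrow> (complex \<Rightarrow> complex) set \<Rightarrow> real" where
  "portrait_prob M X Q = measure M {\<omega> \<in> space M. phase_portrait 2 (X \<omega>) = Q}"

definition Lambda2 :: real where
  "Lambda2 = 1 / pi * (LBINT t. sqrt (2 * t ^ 8 + 8 * t ^ 6 + 13 * t ^ 4 + 8 * t ^ 2 + 2) /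
     ((t ^ 2 + 1) * (t ^ 4 + t ^ 2 + 1)))"

end

theory Submission
  imports Defs
begin

text \<open>A homogeneous quadratic field is written in polar coordinates with a radial part
\<open>f(\<theta>)\<close> and an angular part \<open>g(\<theta>)\<close>, both cubic forms in \<open>(cos \<theta>, sin \<theta>)\<close>. The zeros of \<open>g\<close> in
\<open>[0, \<pi>)\<close> are the invariant lines (\<open>invariant_lines_eq\<close>), and the origin is an isolated zero of the field
exactly if \<open>f\<close> and \<open>g\<close> have no common zero.

The portrait is combinatorial. The rays over the zeros of \<open>g\<close> cut the disk into sectors, in each of
which the orbits are graphs over the angle, given by \<open>log (\<rho> / sqrt (1 - \<rho>^2)) = H(\<theta>) + const\<close> with
\<open>H' = f / g\<close>. A ray is called a node if orbits of both adjacent sectors reach the origin along it,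
that is, if \<open>f\<close> has there the sign that \<open>g\<close> takes just after it; otherwise it is a saddle and these orbits go to the
boundary. Hence the cyclic sequence of nodes and saddles determines the whole portrait
(\<open>sectored_equivalent\<close>), and counting the turns of the field across the sectors gives the index
\<open>1 - l + 2 N\<close>, where \<open>N\<close> of the \<open>l\<close> lines are nodes (\<open>sectored_index\<close>). With \<open>l = 3\<close> all three
lines cannot be nodes (\<open>not_three_nodes\<close>), so \<open>N\<close> takes the values \<open>0, 1, 2\<close> for three lines and
\<open>0, 1\<close> for one line: five classes, distinguished by \<open>(i, l)\<close>. Conversely, a homeomorphism of portraits
preserves \<open>l\<close> (the singular points on the boundary), and it preserves \<open>N\<close> because \<open>N\<close> can be read off
from the existence of homoclinic orbits and of several orbits joining the origin to the same point at
infinity (\<open>portrait_determined\<close>).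

The five classes fill the coefficient space. A point where a discriminant and a resultant do not
vanish is in one of the classes, and the excluded set is null. The classes contain nonempty open
sets, so they have positive probability. Replacing the second component by its negative preserves the
law of the coefficients and changes the sign of the index; index \<open>-2\<close> forces three lines, whence
\<open>P(Q_1) = P(Q_3) + P(Q_5)\<close>.

It remains to find the expected number of lines. \<open>g\<close> is a Gaussian process on \<open>[0, \<pi>]\<close>. The number of its sign changes on
the grid \<open>i \<pi> / n\<close> converges almost surely to \<open>l\<close> and is at most \<open>3\<close>, while the probability of a sign
change between two points is the angle between the two weight vectors divided by \<open>\<pi>\<close>
(\<open>sign_disagreement\<close>). Hence the expected value of \<open>l\<close>, which is \<open>1 + 2 P(l = 3)\<close>, is the length of the
curve of normalised weight vectors divided by \<open>\<pi>\<close>. The substitution \<open>t = tan \<theta>\<close> identifies this number with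
\<open>\<Lambda>_2\<close> (\<open>Lambda2_eq\<close>, \<open>three_lines_probability\<close>).\<close>

section \<open>Uniqueness of trajectories and flow along arcs\<close>

text \<open>Gronwall's lemma for a function vanishing at one point, proved by multiplying with the exponential
factors \<open>exp (- L t)\<close> and \<open>exp (L t)\<close> to the right and to the left of this point.\<close>

lemma gronwall_zero:
 fixes D D' :: "real => real"
 assumes I: "is_interval I" "t0 \<in> I" "t \<in> I"
  and der: "!!s. s \<in> I ==> (D has_real_derivative D' s) (at s within I)"
  and bound: "!!s. s \<in> I ==> \<bar>D' s\<bar> <= L * D s"
  and D0: "D t0 = 0" and nonneg: "!!s. s \<in> I ==> 0 <= D s"
 shows "D t = 0"
proof -
 have sub: "{p..q} \<subseteq> I" if "p \<in> I" "q \<in> I" for p q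
  using I(1) that by (meson atLeastAtMost_iff interval_subset_is_interval mem_is_interval_1_I subsetI)
 have mvt: "\<exists>x\<in>{p<..<q}. D q * exp (c * q) - D p * exp (c * p) = (q - p) * ((D' x + c * D x) * exp (c * x))"
  if pq: "p \<in> I" "q \<in> I" "p < q" for p q c
 proof (rule mvt_simple[OF \<open>p < q\<close>, where f' = "%x h. h * ((D' x + c * D x) * exp (c * x))"])
  fix x assume "p <= x" "x <= q"
  then have "(D has_real_derivative D' x) (at x within {p..q})"
   using sub[OF pq(1,2)] der DERIV_subset by (meson atLeastAtMost_iff subsetD)
  then have "((%x. D x * exp (c * x)) has_real_derivative (D' x + c * D x) * exp (c * x)) (at x within {p..q})"
   by (auto intro!: derivative_eq_intros simp: algebra_simps)
  then show "((%x. D x * exp (c * x)) has_derivative (%h. h * ((D' x + c * D x) * exp (c * x)))) (at x within {p..q})"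
   by (simp only: has_field_derivative_def mult_commute_abs)
 qed
 have decreasing: "D q * exp (- L * q) <= D p * exp (- L * p)" if pq: "p \<in> I" "q \<in> I" "p < q" for p q
 proof -
  obtain x where x: "x \<in> {p<..<q}"
   "D q * exp (- L * q) - D p * exp (- L * p) = (q - p) * ((D' x + - L * D x) * exp (- L * x))"
   using mvt[OF pq] by blast
  have "x \<in> I" using x(1) sub[OF pq(1,2)] by auto
  then have "D' x + - L * D x <= 0" using bound[of x] by auto
  then have "(q - p) * ((D' x + - L * D x) * exp (- L * x)) <= 0"
   using \<open>p < q\<close> by (intro mult_nonneg_nonpos mult_nonpos_nonneg) auto
  then show ?thesis using x(2) by linarith
 qed
 have increasing: "D p * exp (L * p) <= D q * exp (L * q)" if pq: "p \<in> I" "q \<in> I" "p < q" for p q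
 proof -
  obtain x where x: "x \<in> {p<..<q}"
   "D q * exp (L * q) - D p * exp (L * p) = (q - p) * ((D' x + L * D x) * exp (L * x))"
   using mvt[OF pq] by blast
  have "x \<in> I" using x(1) sub[OF pq(1,2)] by auto
  then have "D' x + L * D x \<ge> 0" using bound[of x] by auto
  then have "(q - p) * ((D' x + L * D x) * exp (L * x)) \<ge> 0"
   using \<open>p < q\<close> by (intro mult_nonneg_nonneg) auto
  then show ?thesis using x(2) by linarith
 qed
 consider "t = t0" | "t0 < t" | "t < t0" by linarith
 then show ?thesis
 proof cases
  case 1 then show ?thesis using D0 by simp
 next
  case 2
  from decreasing[OF I(2,3) 2] show ?thesis using D0 nonneg[OF I(3)]
   by (simp add: mult_le_0_iff)
 next
  case 3
  from increasing[OF I(3,2) 3] show ?thesis using D0 nonneg[OF I(3)]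
   by (simp add: mult_le_0_iff)
 qed
qed

lemma trajectory_unique:
 fixes \<gamma> \<delta> :: "real => complex"
 assumes lip: "L-lipschitz_on S X"
  and tr: "trajectory_on UNIV X \<gamma>" "trajectory_on UNIV X \<delta>"
  and S: "range \<gamma> \<subseteq> S" "range \<delta> \<subseteq> S" and eq: "\<gamma> t0 = \<delta> t0"
 shows "\<gamma> = \<delta>"
proof
 fix t
 define D where "D = (%t. (\<gamma> t - \<delta> t) \<bullet> (\<gamma> t - \<delta> t))"
 define D' where "D' = (%t. 2 * ((\<gamma> t - \<delta> t) \<bullet> (X (\<gamma> t) - X (\<delta> t))))"
 have "D t = 0"
 proof (rule gronwall_zero[of UNIV t0 t D D' "2 * L"])
  fix s
  have *: "(\<gamma> has_vector_derivative X (\<gamma> s)) (at s)" "(\<delta> has_vector_derivative X (\<delta> s)) (at s)"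
   using tr by (auto simp: trajectory_on_def)
  show "(D has_real_derivative D' s) (at s within UNIV)"
   unfolding D_def D'_def has_real_derivative_iff_has_vector_derivative
   using * unfolding has_vector_derivative_def
   by (auto intro!: derivative_eq_intros ext simp: inner_commute algebra_simps)
  have "norm (X (\<gamma> s) - X (\<delta> s)) <= L * norm (\<gamma> s - \<delta> s)"
   using lipschitz_onD[OF lip, of "\<gamma> s" "\<delta> s"] S by (auto simp: dist_norm)
  then have "norm (\<gamma> s - \<delta> s) * norm (X (\<gamma> s) - X (\<delta> s)) <= norm (\<gamma> s - \<delta> s) * (L * norm (\<gamma> s - \<delta> s))"
   by (intro mult_left_mono) auto
  moreover have "\<bar>(\<gamma> s - \<delta> s) \<bullet> (X (\<gamma> s) - X (\<delta> s))\<bar> <= norm (\<gamma> s - \<delta> s) * norm (X (\<gamma> s) - X (\<delta> s))"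
   by (rule Cauchy_Schwarz_ineq2)
  moreover have "D s = norm (\<gamma> s - \<delta> s) * norm (\<gamma> s - \<delta> s)"
   by (simp add: D_def dot_square_norm power2_eq_square)
  ultimately show "\<bar>D' s\<bar> <= 2 * L * D s"
   unfolding D'_def by (simp add: abs_mult algebra_simps)
  show "0 <= D s" by (simp add: D_def)
 qed (use eq in \<open>auto simp: D_def\<close>)
 then show "\<gamma> t = \<delta> t" by (simp add: D_def)
qed

text \<open>The equation is solved by inverting the travel time. The bounds by the distance to the ends make the travel time to either end infinite, so the solution exists
for all times and tends to the ends.\<close>

lemma autonomous_flow:
 fixes K :: "real => real"
 assumes ab: "a < b" and cont: "continuous_on {a<..<b} K"
  and pos: "!!x. a < x ==> x < b ==> 0 < K x"
  and left: "!!x. a < x ==> x < b ==> K x <= M * (x - a)"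
  and right: "!!x. a < x ==> x < b ==> K x <= M * (b - x)"
 obtains x where "bij_betw x UNIV {a<..<b}" "strict_mono x"
  "!!t. (x has_real_derivative K (x t)) (at t)"
  "(x \<longlongrightarrow> b) at_top" "(x \<longlongrightarrow> a) at_bot"
proof -
 have contK: "isCont K x" if "a < x" "x < b" for x
  using cont that by (simp add: continuous_on_eq_continuous_at)
 obtain T where T: "!!x. a < x ==> x < b ==> (T has_real_derivative inverse (K x)) (at x)"
 proof -
  have "\<exists>F. \<forall>x. ereal a < ereal x --> ereal x < ereal b --> (F has_vector_derivative inverse (K x)) (at x)"
   by (rule einterval_antiderivative) (use ab pos in \<open>auto intro!: continuous_intros contK simp: less_imp_neq[THEN not_sym]\<close>)
  then show ?thesis using that by (auto simp: has_real_derivative_iff_has_vector_derivative)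
 qed
 have Tmono: "T x < T y" if "a < x" "x < y" "y < b" for x y
 proof (rule DERIV_pos_imp_increasing[OF that(2)])
  fix z assume z: "x <= z" "z <= y"
  then have "a < z" "z < b" using that by auto
  then show "\<exists>d. (T has_real_derivative d) (at z) & 0 < d"
   using T[of z] pos[of z] by (intro exI[of _ "inverse (K z)"]) auto
 qed
 have Tcont: "isCont T x" if "a < x" "x < b" for x
  using T[OF that] DERIV_isCont by blast
 define m where "m = (a + b) / 2"
 have m: "a < m" "m < b" using ab by (auto simp: m_def field_simps)
 have M: "0 < M" using left[OF m] pos[OF m] m by (smt (verit) mult_nonneg_nonpos2 mult_le_0_iff)
 have grow: "T m + (ln (b - m) - ln (b - x)) / M <= T x" if x: "m <= x" "x < b" for x
 proof -
  have "T m + ln (b - m) / M <= T x + ln (b - x) / M"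
  proof (rule DERIV_nonneg_imp_nondecreasing[OF x(1)])
   fix z assume z: "m <= z" "z <= x"
   have "inverse (M * (b - z)) <= inverse (K z)"
    by (rule le_imp_inverse_le) (use right pos z x m in auto)
   then show "\<exists>y. ((%x. T x + ln (b - x) / M) has_real_derivative y) (at z) & 0 <= y"
    by (intro exI[of _ "inverse (K z) - inverse (M * (b - z))"])
     (use z x m M in \<open>auto intro!: derivative_eq_intros T simp: divide_inverse mult.commute\<close>)
  qed
  then show ?thesis by (simp add: diff_divide_distrib)
 qed
 have grow': "T x <= T m - (ln (m - a) - ln (x - a)) / M" if x: "a < x" "x <= m" for x
 proof -
  have "T x - ln (x - a) / M <= T m - ln (m - a) / M"
  proof (rule DERIV_nonneg_imp_nondecreasing[OF x(2)])
   fix z assume z: "x <= z" "z <= m"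
   have "inverse (M * (z - a)) <= inverse (K z)"
    by (rule le_imp_inverse_le) (use left pos z x m in auto)
   then show "\<exists>y. ((%x. T x - ln (x - a) / M) has_real_derivative y) (at z) & 0 <= y"
    by (intro exI[of _ "inverse (K z) - inverse (M * (z - a))"])
     (use z x m M in \<open>auto intro!: derivative_eq_intros T simp: divide_inverse mult.commute\<close>)
  qed
  then show ?thesis by (simp add: diff_divide_distrib)
 qed
 have up: "\<exists>x. m <= x & x < b & y <= T x" for y
 proof -
  define e where "e = min (ln (b - m)) (ln (b - m) - M * (y - T m))"
  have "T m + (ln (b - m) - ln (b - (b - exp e))) / M <= T (b - exp e)"
  proof (rule grow)
   have "exp e <= exp (ln (b - m))" by (simp add: e_def)
   then show "m <= b - exp e" using m by simp
  qed simp
  moreover have "M * (y - T m) <= ln (b - m) - e" by (simp add: e_def)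
  then have "y - T m <= (ln (b - m) - e) / M" using M by (simp add: field_simps)
  moreover have "exp e <= exp (ln (b - m))" by (simp add: e_def)
  ultimately show ?thesis using m by (intro exI[of _ "b - exp e"]) auto
 qed
 have dn: "\<exists>x. a < x & x <= m & T x <= y" for y
 proof -
  define e where "e = min (ln (m - a)) (ln (m - a) - M * (T m - y))"
  have le: "exp e <= exp (ln (m - a))" by (simp add: e_def)
  have "T (a + exp e) <= T m - (ln (m - a) - ln (a + exp e - a)) / M"
   by (rule grow') (use le m in auto)
  moreover have "M * (T m - y) <= ln (m - a) - e" by (simp add: e_def)
  then have "T m - y <= (ln (m - a) - e) / M" using M by (simp add: field_simps)
  ultimately show ?thesis using m le by (intro exI[of _ "a + exp e"]) auto
 qed
 have surj: "\<exists>x. a < x & x < b & T x = y" for y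
 proof -
  obtain p q where p: "a < p" "p <= m" "T p <= y" and q: "m <= q" "q < b" "y <= T q"
   using up[of y] dn[of y] by blast
  have "\<exists>x\<ge>p. x <= q & T x = y"
   by (rule IVT[of T]) (use p q m Tcont in auto)
  then obtain z where "p <= z" "z <= q" "T z = y" by blast
  then show ?thesis using p q by (intro exI[of _ z]) auto
 qed
 define x where "x = (%y. SOME x. a < x & x < b & T x = y)"
 have x: "a < x y" "x y < b" "T (x y) = y" for y
  using someI_ex[OF surj[of y]] by (auto simp: x_def)
 have xT: "x (T z) = z" if "a < z" "z < b" for z
  using Tmono[of z "x (T z)"] Tmono[of "x (T z)" z] x[of "T z"] that by force
 have xmono: "strict_mono x"
 proof (rule strict_monoI)
  fix s t :: real assume "s < t"
  then show "x s < x t" using Tmono[of "x t" "x s"] x by (metis not_less_iff_gr_or_eq)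
 qed
 have xcont: "isCont x y" for y
 proof -
  obtain p q where p: "a < p" "p < x y" and q: "x y < q" "q < b"
   using dense x by meson
  have "isCont x (T (x y))"
   by (rule isCont_inverse_function2[of p _ q]) (use p q x xT Tcont in auto)
  then show ?thesis by (simp add: x)
 qed
 have xder: "(x has_real_derivative K (x t)) (at t)" for t
 proof -
  have "(x has_real_derivative inverse (inverse (K (x t)))) (at t)"
   by (rule DERIV_inverse_function[of T _ _ _ "t - 1" "t + 1"])
    (use x pos[of "x t"] T xcont in \<open>auto simp: less_imp_neq\<close>)
  then show ?thesis by simp
 qed
 show thesis
 proof
  show "bij_betw x UNIV {a<..<b}"
   unfolding bij_betw_def
  proof
   show "inj x" using xmono strict_mono_imp_inj_on by blast
   show "range x = {a<..<b}" using x xT by (auto simp: image_iff) (metis)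
  qed
  show "(x \<longlongrightarrow> b) at_top"
  proof (rule order_tendstoI)
   fix l assume "l < b"
   define z where "z = max l m"
   have z: "a < z" "z < b" using m \<open>l < b\<close> by (auto simp: z_def)
   have *: "l < x t" if "T z < t" for t
    using xmono[THEN strict_monoD, OF that] xT[OF z] by (simp add: z_def)
   show "\<forall>\<^sub>F t in at_top. l < x t"
    by (rule eventually_mono[OF eventually_gt_at_top[of "T z"] *])
  qed (use x(2) in \<open>auto intro!: always_eventually intro: less_trans\<close>)
  show "(x \<longlongrightarrow> a) at_bot"
  proof (rule order_tendstoI)
   fix l assume "a < l"
   define z where "z = min l m"
   have z: "a < z" "z < b" using m \<open>a < l\<close> by (auto simp: z_def)
   have *: "x t < l" if "t < T z" for t
    using xmono[THEN strict_monoD, OF that] xT[OF z] by (simp add: z_def)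
   show "\<forall>\<^sub>F t in at_bot. x t < l"
    by (rule eventually_mono[OF eventually_gt_at_bot[of "T z"] *])
  qed (use x(1) in \<open>auto intro!: always_eventually intro: less_trans\<close>)
 qed (fact xmono xder)+
qed

text \<open>The curve \<open>c\<close> is an open orbit of \<open>X\<close> up to its parametrisation, \<open>K\<close> being the speed of the parameter; the
sign \<open>e\<close> tells the direction of travel. Describing orbits without their time law makes it possible to
match orbits of two fields with different speeds.\<close>

definition flow_arc :: "(complex => complex) => real => real => real => (real => complex) => bool" where
 "flow_arc X e a b c \<longleftrightarrow> a < b & (\<exists>K M. continuous_on {a<..<b} K &
   (\<forall>x\<in>{a<..<b}. 0 < K x & K x <= M * (x - a) & K x <= M * (b - x) &
    (\<exists>v. (c has_vector_derivative v) (at x) & X (c x) = (e * K x) *\<^sub>R v)))"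

lemma flow_arc_trajectory:
 assumes "flow_arc X e a b c"
 obtains y where "bij_betw y UNIV {a<..<b}" "strict_mono y"
  "(y \<longlongrightarrow> b) at_top" "(y \<longlongrightarrow> a) at_bot"
  "!!s. trajectory_on UNIV X (%t. c (y (e * t + s)))"
proof -
 obtain K M where ab: "a < b" and K: "continuous_on {a<..<b} K"
  and KM: "!!x. a < x ==> x < b ==> 0 < K x & K x <= M * (x - a) & K x <= M * (b - x)"
  and c: "!!x. a < x ==> x < b ==> \<exists>v. (c has_vector_derivative v) (at x) & X (c x) = (e * K x) *\<^sub>R v"
  using assms unfolding flow_arc_def by (metis greaterThanLessThan_iff)
 obtain y where y: "bij_betw y UNIV {a<..<b}" "strict_mono y"
  "!!t. (y has_real_derivative K (y t)) (at t)" "(y \<longlongrightarrow> b) at_top" "(y \<longlongrightarrow> a) at_bot"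
  by (rule autonomous_flow[OF ab K, of M]) (use KM in auto)
 have "((%t. c (y (e * t + s))) has_vector_derivative X (c (y (e * t + s)))) (at t)" for s t
 proof -
  have in_ab: "a < y (e * t + s)" "y (e * t + s) < b"
   using bij_betwE[OF y(1)] by auto
  from c[OF this] obtain v where v: "(c has_vector_derivative v) (at (y (e * t + s)))"
   "X (c (y (e * t + s))) = (e * K (y (e * t + s))) *\<^sub>R v" by auto
  have "((%t. y (e * t + s)) has_real_derivative K (y (e * t + s)) * e) (at t)"
   by (rule DERIV_chain2[OF y(3)]) (auto intro!: derivative_eq_intros)
  from vector_diff_chain_at[OF this[unfolded has_real_derivative_iff_has_vector_derivative] v(1)]
  show ?thesis using v(2) by (simp add: o_def mult.commute)
 qed
 then show thesis using y by (intro that[of y]) (auto simp: trajectory_on_def)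
qed

text \<open>If \<open>h\<close> maps one arc onto another one traversed in the same direction, then it carries the trajectory on
the first to a reparametrised trajectory on the second: both parameters are increasing functions of
time which exhaust the line.\<close>

lemma flow_arc_matching:
 assumes arcs: "flow_arc X e a b c" "flow_arc Y e a' b' c'" and e: "e = 1 | e = -1"
  and lip: "L-lipschitz_on S X"
  and S: "c ` {a<..<b} \<subseteq> S" "c' ` {a'<..<b'} \<subseteq> S"
  and phi: "strict_mono_on {a<..<b} \<phi>" "\<phi> ` {a<..<b} = {a'<..<b'}"
  and h: "!!x. a < x ==> x < b ==> h (c x) = c' (\<phi> x)"
  and tr: "trajectory_on UNIV X \<gamma>" "range \<gamma> \<subseteq> S" and \<gamma>0: "\<gamma> 0 \<in> c ` {a<..<b}"
 shows "\<exists>\<delta> \<tau>. trajectory_on UNIV Y \<delta> & range \<delta> \<subseteq> S & strict_mono \<tau> & surj \<tau> &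
  (\<forall>t. h (\<gamma> t) = \<delta> (\<tau> t))"
proof -
 obtain y where y: "bij_betw y UNIV {a<..<b}" "strict_mono y"
  "!!s. trajectory_on UNIV X (%t. c (y (e * t + s)))"
  using flow_arc_trajectory[OF arcs(1)] by metis
 obtain z where z: "bij_betw z UNIV {a'<..<b'}" "strict_mono z"
  "!!s. trajectory_on UNIV Y (%t. c' (z (e * t + s)))"
  using flow_arc_trajectory[OF arcs(2)] by metis
 obtain x0 where x0: "x0 \<in> {a<..<b}" "\<gamma> 0 = c x0" using \<gamma>0 by auto
 obtain s0 where s0: "y s0 = x0" using y(1) x0(1) unfolding bij_betw_def by (metis imageE)
 have \<gamma>: "\<gamma> = (%t. c (y (e * t + s0)))"
  by (rule trajectory_unique[OF lip tr(1) y(3) tr(2), of _ 0])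
   (use S(1) bij_betwE[OF y(1)] x0 s0 in auto)
 have ex: "\<exists>s. z s = \<phi> (y r)" for r
 proof -
  have "\<phi> (y r) \<in> {a'<..<b'}" using phi(2) bij_betwE[OF y(1)] by auto
  then show ?thesis using z(1) unfolding bij_betw_def by (metis imageE)
 qed
 define \<nu> where "\<nu> = (%r. SOME s. z s = \<phi> (y r))"
 have \<nu>: "z (\<nu> r) = \<phi> (y r)" for r
  unfolding \<nu>_def using someI_ex[OF ex] .
 have \<nu>_mono: "\<nu> r < \<nu> s" if "r < s" for r s
 proof -
  have "z (\<nu> r) < z (\<nu> s)" unfolding \<nu>
   using that y(2) phi(1) bij_betwE[OF y(1)] by (auto simp: strict_mono_on_def strict_mono_def)
  then show ?thesis using z(2) by (simp add: strict_mono_less)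
 qed
 have \<nu>_surj: "\<exists>r. \<nu> r = s" for s
 proof -
  have "z s \<in> {a'<..<b'}" using bij_betwE[OF z(1)] by auto
  then obtain x where x: "x \<in> {a<..<b}" "\<phi> x = z s" using phi(2) by (metis imageE)
  then obtain r where "y r = x" using y(1) unfolding bij_betw_def by (metis imageE)
  then have "z (\<nu> r) = z s" using x \<nu> by simp
  then show ?thesis using z(2) by (auto simp: strict_mono_eq)
 qed
 define \<tau> where "\<tau> = (%t. e * \<nu> (e * t + s0))"
 have ee: "e * (e * t) = t" for t using e by auto
 have \<tau>_mono: "strict_mono \<tau>"
  using e by (auto simp: \<tau>_def strict_mono_def intro!: \<nu>_mono)
 have "\<exists>t. \<tau> t = s" for s
 proof -
  obtain r where "\<nu> r = e * s" using \<nu>_surj by blast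
  then have "\<tau> (e * (r - s0)) = s" by (simp add: \<tau>_def ee)
  then show "\<exists>t. \<tau> t = s" by blast
 qed
 then have "surj \<tau>" by (metis surjI surj_def)
 moreover have "h (\<gamma> t) = c' (z (e * \<tau> t + 0))" for t
  using h[of "y (e * t + s0)"] bij_betwE[OF y(1)] by (simp add: \<gamma> \<tau>_def ee \<nu>)
 moreover have "range (%t. c' (z (e * t + 0))) \<subseteq> S"
  using S(2) bij_betwE[OF z(1)] by auto
 ultimately show ?thesis using z(3)[of 0] \<tau>_mono by blast
qed

section \<open>Quadratic fields in polar form\<close>

lemma exponents_2: "exponents 2 = {(2, 0), (1, 1), (0, 2)}"
proof -
 have "i + j = 2 \<longleftrightarrow> (i, j) \<in> {(2, 0), (1, 1), (0, 2)}" for i j :: nat by auto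
 then show ?thesis by (auto simp: exponents_def)
qed

lemma hom_poly_2:
 "hom_poly 2 a z = a (2, 0) * (Re z)^2 + a (1, 1) * Re z * Im z + a (0, 2) * (Im z)^2"
 by (simp add: hom_poly_def exponents_2 algebra_simps)

lemma hom_field_2:
 "hom_field 2 a b z = Complex (a (2, 0) * (Re z)^2 + a (1, 1) * Re z * Im z + a (0, 2) * (Im z)^2)
   (b (2, 0) * (Re z)^2 + b (1, 1) * Re z * Im z + b (0, 2) * (Im z)^2)"
 by (simp add: hom_field_def hom_poly_2)

text \<open>In polar coordinates the field is \<open>\<rho>' = \<rho>^2 radial\<close>, \<open>\<theta>' = \<rho> angular\<close>.\<close>

definition radial :: "(complex => complex) => real => real" where
 "radial F th = Re (F (cis th) * cis (- th))"

definition angular :: "(complex => complex) => real => real" where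
 "angular F th = Im (F (cis th) * cis (- th))"

lemma field_on_circle: "F (cis th) = cis th * Complex (radial F th) (angular F th)"
proof -
 have "Complex (radial F th) (angular F th) = F (cis th) * cis (- th)"
  by (simp add: radial_def angular_def complex_eq_iff)
 then have "cis th * Complex (radial F th) (angular F th) = (cis th * cis (- th)) * F (cis th)"
  by (simp add: mult_ac)
 then show ?thesis by (simp add: cis_mult)
qed

lemma hom_fields_scale: "F \<in> hom_fields n ==> F (of_real r * z) = of_real (r ^ n) * F z"
 using hom_field_scaleR by (auto simp: hom_fields_def scaleR_conv_of_real)

lemma hom_fields_2_zero: "F \<in> hom_fields 2 ==> F 0 = 0"
 using hom_fields_scale[of F 2 0 0] by simp

lemma field_polar:
 assumes "F \<in> hom_fields 2"
 shows "F (of_real r * cis th) = of_real (r^2) * (cis th * Complex (radial F th) (angular F th))"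
 using hom_fields_scale[OF assms] field_on_circle by metis

text \<open>The compactification multiplies the radial part by \<open>1 - \<rho>^2\<close> and keeps the angular part, so the boundary
circle carries the same angular dynamics as every smaller circle.\<close>

lemma poincare_field_polar:
 assumes "F \<in> hom_fields 2"
 shows "poincare_field F (of_real \<rho> * cis th) =
  cis th * Complex (\<rho>\<^sup>2 * (1 - \<rho>\<^sup>2) * radial F th) (\<rho>\<^sup>2 * angular F th)"
proof -
 have cs: "cos th * cos th = 1 - sin th * sin th"
  using sin_cos_squared_add3[of th] by linarith
 have cs': "cos th * (cos th * k) = k - sin th * (sin th * k)" for k
  unfolding mult.assoc[symmetric] cs by (simp add: algebra_simps)
 have i: "(of_real \<rho> * cis th) \<bullet> F (of_real \<rho> * cis th) = \<rho> ^ 3 * radial F th"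
  unfolding field_polar[OF assms] inner_complex_def
  by (simp add: power2_eq_square power3_eq_cube algebra_simps cs cs')
 show ?thesis
  unfolding poincare_field_def i unfolding field_polar[OF assms]
  by (simp add: complex_eq_iff power2_eq_square power3_eq_cube algebra_simps)
qed

lemma hom_fields_2_minus: "F \<in> hom_fields 2 ==> F (- z) = F z"
 using hom_fields_scale[of F 2 "-1" z] by simp

lemma radial_angular_add_pi:
 assumes "F \<in> hom_fields 2"
 shows "radial F (th + pi) = - radial F th" "angular F (th + pi) = - angular F th"
proof -
 have c: "cis (th + pi) = - cis th" "cis (- (th + pi)) = - cis (- th)"
  by (simp_all add: complex_eq_iff cos_diff sin_diff)
 show "radial F (th + pi) = - radial F th" "angular F (th + pi) = - angular F th"
  unfolding radial_def angular_def c by (simp_all add: hom_fields_2_minus[OF assms])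
qed

definition cubic_form :: "real => real => real => real => real => real => real" where
 "cubic_form p q r s x y = p * x ^ 3 + q * x^2 * y + r * x * y^2 + s * y ^ 3"

lemma angular_hom_field:
 "angular (hom_field 2 a b) th = cubic_form (b (2, 0)) (b (1, 1) - a (2, 0)) (b (0, 2) - a (1, 1)) (- a (0, 2)) (cos th) (sin th)"
 by (simp add: angular_def hom_field_2 cubic_form_def power2_eq_square power3_eq_cube algebra_simps)

lemma radial_hom_field:
 "radial (hom_field 2 a b) th = cubic_form (a (2, 0)) (a (1, 1) + b (2, 0)) (a (0, 2) + b (1, 1)) (b (0, 2)) (cos th) (sin th)"
 by (simp add: radial_def hom_field_2 cubic_form_def power2_eq_square power3_eq_cube algebra_simps)

lemma angular_cubic_form:
 assumes "F \<in> hom_fields 2"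
 obtains p q r s where "!!th. angular F th = cubic_form p q r s (cos th) (sin th)"
proof -
 obtain a b where F: "F = hom_field 2 a b" using assms by (auto simp: hom_fields_def)
 show thesis by (rule that, unfold F, rule angular_hom_field)
qed

lemma continuous_radial_angular:
 assumes "F \<in> hom_fields 2"
 shows "continuous_on A (radial F)" "continuous_on A (angular F)"
proof -
 obtain a b where F: "F = hom_field 2 a b" using assms by (auto simp: hom_fields_def)
 have "radial F = (%th. cubic_form (a (2, 0)) (a (1, 1) + b (2, 0)) (a (0, 2) + b (1, 1)) (b (0, 2)) (cos th) (sin th))"
  "angular F = (%th. cubic_form (b (2, 0)) (b (1, 1) - a (2, 0)) (b (0, 2) - a (1, 1)) (- a (0, 2)) (cos th) (sin th))"
  unfolding F by (auto simp: radial_hom_field angular_hom_field)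
 then show "continuous_on A (radial F)" "continuous_on A (angular F)"
  by (auto simp: cubic_form_def intro!: continuous_intros)
qed

lemma angular_lipschitz:
 assumes "F \<in> hom_fields 2"
 obtains M where "0 < M" "!!x y. \<bar>angular F x - angular F y\<bar> <= M * \<bar>x - y\<bar>"
proof -
 obtain p q r s where g: "!!th. angular F th = cubic_form p q r s (cos th) (sin th)"
  using angular_cubic_form[OF assms] by blast
 define g' where "g' = (%x. cubic_form (q) (2*r - 3*p) (3 * s - 2*q) (- r) (cos x) (sin x))"
 have D: "(angular F has_real_derivative g' x) (at x)" for x
 proof -
  have "((%x. cubic_form p q r s (cos x) (sin x)) has_real_derivative g' x) (at x)"
   unfolding cubic_form_def g'_def
   by (auto intro!: derivative_eq_intros simp: power2_eq_square power3_eq_cube algebra_simps)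
  then show ?thesis using g by presburger
 qed
 define M where "M = \<bar>q\<bar> + \<bar>2*r - 3*p\<bar> + \<bar>3 * s - 2*q\<bar> + \<bar>r\<bar> + 1"
 have bound: "\<bar>g' x\<bar> <= M" for x
 proof -
  have le_1: "\<bar>v * w\<bar> <= 1" if "\<bar>v\<bar> <= 1" "\<bar>w\<bar> <= 1" for v w :: real
   using that by (simp add: abs_mult mult_le_one)
  have c: "\<bar>cos x ^ 3\<bar> <= 1" "\<bar>(cos x)^2 * sin x\<bar> <= 1" "\<bar>cos x * (sin x)^2\<bar> <= 1" "\<bar>sin x ^ 3\<bar> <= 1"
   unfolding power2_eq_square power3_eq_cube by (intro le_1 abs_cos_le_one abs_sin_le_one)+
  have *: "\<bar>k * w\<bar> <= \<bar>k\<bar>" if "\<bar>w\<bar> <= 1" for k w :: real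
   using that by (simp add: abs_mult mult_left_le)
  have "g' x = q * cos x ^ 3 + (2*r - 3*p) * ((cos x)^2 * sin x) + (3 * s - 2*q) * (cos x * (sin x)^2) + (- r) * sin x ^ 3"
   by (simp add: g'_def cubic_form_def mult.assoc)
  moreover have sum: "\<bar>a + b + c + d\<bar> <= A + B + C + D + 1"
   if "\<bar>a\<bar> <= A" "\<bar>b\<bar> <= B" "\<bar>c\<bar> <= C" "\<bar>d\<bar> <= D" for a b c d A B C D :: real
   using that by linarith
  ultimately show ?thesis unfolding M_def
   using sum[OF *[OF c(1), of q] *[OF c(2), of "2*r - 3*p"] *[OF c(3), of "3 * s - 2*q"] *[OF c(4), of "-r"]]
   by (simp only: abs_minus_cancel)
 qed
 show thesis
 proof (rule that[of M])
  fix x y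
  have "norm (angular F x - angular F y) <= M * norm (x - y)"
   by (rule field_differentiable_bound[of UNIV "angular F" g']) (use D bound in auto)
  then show "\<bar>angular F x - angular F y\<bar> <= M * \<bar>x - y\<bar>" by simp
 qed (simp add: M_def add_nonneg_pos)
qed

lemma lipschitz_on_disk_mult:
 fixes f g :: "complex => complex"
 assumes "\<exists>L. L-lipschitz_on (cball 0 1) f" "\<exists>L. L-lipschitz_on (cball 0 1) g"
 shows "\<exists>L. L-lipschitz_on (cball 0 1) (%z. f z * g z)"
proof -
 obtain L N where L: "L-lipschitz_on (cball 0 1) f" and N: "N-lipschitz_on (cball 0 1) g"
  using assms by auto
 have bdd: "\<exists>B. 0 <= B & (\<forall>z\<in>cball 0 1. norm (k z) <= B)" if "J-lipschitz_on (cball 0 1) k"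
  for J and k :: "complex => complex"
 proof (intro exI[of _ "norm (k 0) + J"] conjI ballI)
  fix z :: complex assume z: "z \<in> cball 0 1"
  have "norm (k z - k 0) <= J * norm (z - 0)"
   using lipschitz_onD[OF that, of z 0] z by (simp add: dist_norm)
  also have "\<dots> <= J" using z lipschitz_on_nonneg[OF that] by (simp add: mult_left_le)
  finally show "norm (k z) <= norm (k 0) + J" using norm_triangle_sub[of "k z" "k 0"] by linarith
 qed (use lipschitz_on_nonneg[OF that] in simp)
 obtain B where B: "0 <= B" "!!z. z \<in> cball 0 1 ==> norm (f z) <= B" using bdd[OF L] by blast
 obtain C where C: "0 <= C" "!!z. z \<in> cball 0 1 ==> norm (g z) <= C" using bdd[OF N] by blast
 have "(B * N + C * L)-lipschitz_on (cball 0 1) (%z. f z * g z)"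
 proof (rule lipschitz_onI)
  fix z w :: complex assume z: "z \<in> cball 0 1" "w \<in> cball 0 1"
  have "f z * g z - f w * g w = f z * (g z - g w) + g w * (f z - f w)" by (simp add: algebra_simps)
  then have "dist (f z * g z) (f w * g w) <= norm (f z) * norm (g z - g w) + norm (g w) * norm (f z - f w)"
   by (metis dist_norm norm_mult norm_triangle_ineq)
  also have "\<dots> <= B * (N * dist z w) + C * (L * dist z w)"
   using B C z lipschitz_onD[OF L, of z w] lipschitz_onD[OF N, of z w]
   by (intro add_mono mult_mono) (auto simp: dist_norm)
  finally show "dist (f z * g z) (f w * g w) <= (B * N + C * L) * dist z w" by (simp add: algebra_simps)
 qed (use B C lipschitz_on_nonneg[OF L] lipschitz_on_nonneg[OF N] in simp)
 then show ?thesis by blast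
qed

definition lipschitz_disk :: "(complex => complex) => bool" where
 "lipschitz_disk f \<longleftrightarrow> (\<exists>L. L-lipschitz_on (cball 0 1) f)"

lemma lipschitz_disk_intros:
 "lipschitz_disk (%z. c)"
 "lipschitz_disk (%z. z)"
 "lipschitz_disk (%z. of_real (Re z))"
 "lipschitz_disk (%z. of_real (Im z))"
 "lipschitz_disk f ==> lipschitz_disk g ==> lipschitz_disk (%z. f z + g z)"
 "lipschitz_disk f ==> lipschitz_disk g ==> lipschitz_disk (%z. f z - g z)"
 "lipschitz_disk f ==> lipschitz_disk g ==> lipschitz_disk (%z. f z * g z)"
proof -
 show "lipschitz_disk (%z. c)" "lipschitz_disk (%z. z)"
  unfolding lipschitz_disk_def by (rule exI, rule lipschitz_on_constant, rule exI, rule lipschitz_on_id)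
 show "lipschitz_disk (%z. of_real (Re z))"
  unfolding lipschitz_disk_def
 proof (rule exI[of _ 1], rule lipschitz_onI)
  show "dist (of_real (Re x) :: complex) (of_real (Re y)) <= 1 * dist x y" for x y
   using abs_Re_le_cmod[of "x - y"] by (simp add: dist_norm flip: of_real_diff)
 qed simp
 show "lipschitz_disk (%z. of_real (Im z))"
  unfolding lipschitz_disk_def
 proof (rule exI[of _ 1], rule lipschitz_onI)
  show "dist (of_real (Im x) :: complex) (of_real (Im y)) <= 1 * dist x y" for x y
   using abs_Im_le_cmod[of "x - y"] by (simp add: dist_norm flip: of_real_diff)
 qed simp
 assume "lipschitz_disk f" "lipschitz_disk g"
 then obtain L M where *: "L-lipschitz_on (cball 0 1) f" "M-lipschitz_on (cball 0 1) g"
  unfolding lipschitz_disk_def by blast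
 show "lipschitz_disk (%z. f z + g z)"
  unfolding lipschitz_disk_def by (rule exI, rule lipschitz_on_add[OF *])
 show "lipschitz_disk (%z. f z - g z)"
  unfolding lipschitz_disk_def by (rule exI, rule lipschitz_on_diff[OF *])
 show "lipschitz_disk (%z. f z * g z)"
  unfolding lipschitz_disk_def by (rule lipschitz_on_disk_mult[OF exI exI]) (rule *)+
qed

lemma poincare_field_lipschitz:
 assumes "F \<in> hom_fields 2"
 obtains L where "L-lipschitz_on (cball 0 1) (poincare_field F)"
proof -
 obtain a b where F: "F = hom_field 2 a b" using assms by (auto simp: hom_fields_def)
 define P :: "(nat \<times> nat => real) => complex => complex" where
  "P = (%c z. of_real (c (2, 0)) * (of_real (Re z) * of_real (Re z))
   + of_real (c (1, 1)) * (of_real (Re z) * of_real (Im z))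
   + of_real (c (0, 2)) * (of_real (Im z) * of_real (Im z)))"
 have P: "lipschitz_disk (P c)" for c
  unfolding P_def by (intro lipschitz_disk_intros)
 have "poincare_field F z = (P a z + \<i> * P b z) - (of_real (Re z) * P a z + of_real (Im z) * P b z) * z" for z
  by (simp add: poincare_field_def F hom_field_2 P_def complex_eq_iff inner_complex_def power2_eq_square algebra_simps)
 then have "poincare_field F = (%z. (P a z + \<i> * P b z) - (of_real (Re z) * P a z + of_real (Im z) * P b z) * z)"
  by (rule ext)
 moreover have "lipschitz_disk (%z. (P a z + \<i> * P b z) - (of_real (Re z) * P a z + of_real (Im z) * P b z) * z)"
  by (intro lipschitz_disk_intros P)
 ultimately show thesis using that by (auto simp: lipschitz_disk_def)
qed

lemma cis_mult_Complex_eq_0: "cis th * Complex x y = 0 \<longleftrightarrow> x = 0 & y = 0"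
proof -
 have "cis th * Complex x y = 0 \<longleftrightarrow> Complex x y = 0" using cis_neq_zero[of th] mult_eq_0_iff by auto
 then show ?thesis by (auto simp: complex_eq_iff[of "Complex x y" 0])
qed

lemma poincare_field_zero_iff:
 assumes "F \<in> hom_fields 2" "0 < \<rho>" "\<rho> <= 1"
 shows "poincare_field F (of_real \<rho> * cis th) = 0 \<longleftrightarrow> angular F th = 0 & (\<rho> = 1 | radial F th = 0)"
proof -
 have "\<rho>\<^sup>2 = 1 \<longleftrightarrow> \<rho> = 1" using assms by (simp add: power2_eq_1_iff)
 moreover note cis_mult_Complex_eq_0
 ultimately show ?thesis unfolding poincare_field_polar[OF assms(1)] using assms by auto
qed

lemma field_zero_iff:
 assumes "F \<in> hom_fields 2" "r ~= 0"
 shows "F (of_real r * cis th) = 0 \<longleftrightarrow> angular F th = 0 & radial F th = 0"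
 unfolding field_polar[OF assms(1)] mult_eq_0_iff[of "of_real _"] cis_mult_Complex_eq_0 using assms by auto

text \<open>Rotating the zero direction \<open>(C, S)\<close> to the first axis makes the leading coefficient vanish; rotating
back gives the cofactor.\<close>

lemma cubic_form_factor:

 assumes "cubic_form p q r s C S = 0" "C^2 + S^2 = 1"
 obtains \<alpha> \<beta> \<gamma> where "!!x y. cubic_form p q r s x y = (C * y - S * x) * (\<alpha> * x^2 + \<beta> * x * y + \<gamma> * y^2)"
proof -
 define e1 where "e1 = - 3*p*C^2*S + q*(C^3 - 2*C*S^2) + r*(2*C^2*S - S^3) + 3 * s*S^2*C"
 define e2 where "e2 = 3*p*C*S^2 + q*(S^3 - 2*C^2*S) + r*(C^3 - 2*C*S^2) + 3 * s*C^2*S"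
 define e3 where "e3 = - p*S^3 + q*S^2*C - r*S*C^2 + s*C^3"
 show thesis
 proof (rule that[of "e1*C^2 - e2*C*S + e3*S^2" "2*e1*C*S + e2*(C^2 - S^2) - 2*e3*C*S" "e1*S^2 + e2*C*S + e3*C^2"])
  fix x y
  define u l where "u = C*x + S*y" and "l = C*y - S*x"
  have "C*u - S*l = (C^2 + S^2) * x" "S*u + C*l = (C^2 + S^2) * y"
   by (simp_all add: u_def l_def power2_eq_square algebra_simps)
  then have xy: "x = C*u - S*l" "y = S*u + C*l" using assms(2) by simp_all
  have "cubic_form p q r s (C*u - S*l) (S*u + C*l) = cubic_form p q r s C S * u^3 + l*(e1*u^2 + e2*u*l + e3*l^2)"
   unfolding cubic_form_def e1_def e2_def e3_def by algebra
  then have "cubic_form p q r s x y = l*(e1*u^2 + e2*u*l + e3*l^2)" using xy assms(1) by simp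
  also have "\<dots> = l * ((e1*C^2 - e2*C*S + e3*S^2) * x^2 + (2*e1*C*S + e2*(C^2 - S^2) - 2*e3*C*S) * x * y + (e1*S^2 + e2*C*S + e3*C^2) * y^2)"
   unfolding u_def l_def by algebra
  finally show "cubic_form p q r s x y = (C * y - S * x) * ((e1*C^2 - e2*C*S + e3*S^2) * x^2 +
   (2*e1*C*S + e2*(C^2 - S^2) - 2*e3*C*S) * x * y + (e1*S^2 + e2*C*S + e3*C^2) * y^2)" unfolding l_def .
 qed
qed

lemma quadratic_form_factor:
 assumes "p * C^2 + q * C * S + r * S^2 = 0" "C^2 + S^2 = (1::real)"
 obtains \<alpha> \<beta> where "!!x y. p * x^2 + q * x * y + r * y^2 = (C * y - S * x) * (\<alpha> * x + \<beta> * y)"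
proof -
 define e1 where "e1 = - 2*p*C*S + q*(C^2 - S^2) + 2*r*S*C"
 define e2 where "e2 = p*S^2 - q*C*S + r*C^2"
 show thesis
 proof (rule that[of "e1*C - e2*S" "e1*S + e2*C"])
  fix x y
  define u l where "u = C*x + S*y" and "l = C*y - S*x"
  have "C*u - S*l = (C^2 + S^2) * x" "S*u + C*l = (C^2 + S^2) * y"
   by (simp_all add: u_def l_def power2_eq_square algebra_simps)
  then have xy: "x = C*u - S*l" "y = S*u + C*l" using assms(2) by simp_all
  have "p * (C*u - S*l)^2 + q * (C*u - S*l) * (S*u + C*l) + r * (S*u + C*l)^2 = (p * C^2 + q * C * S + r * S^2) * u^2 + l*(e1*u + e2*l)"
   unfolding e1_def e2_def by algebra
  then have "p * x^2 + q * x * y + r * y^2 = l*(e1*u + e2*l)" using xy assms(1) by simp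
  also have "\<dots> = l * ((e1*C - e2*S) * x + (e1*S + e2*C) * y)"
   unfolding u_def l_def by algebra
  finally show "p * x^2 + q * x * y + r * y^2 = (C * y - S * x) * ((e1*C - e2*S) * x + (e1*S + e2*C) * y)" unfolding l_def .
 qed
qed

section \<open>Sectors between singular rays\<close>

text \<open>Inverse of \<open>\<rho> \<mapsto> log (\<rho> / sqrt (1 - \<rho>^2))\<close>. In the coordinate \<open>w\<close> with \<open>\<rho> = squash w\<close> the orbits in a sector
are the translates \<open>w = H(\<theta>) + const\<close> of a single graph.\<close>

definition squash :: "real => real" where "squash w = 1 / sqrt (1 + exp (- 2 * w))"

lemma squash_bounds: "0 < squash w" "squash w < 1"
 by (auto simp: squash_def add_pos_pos less_divide_eq)

lemma squash_square: "(squash w)^2 = 1 / (1 + exp (- 2 * w))"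
 by (simp add: squash_def power_divide add_nonneg_nonneg)

lemma DERIV_squash: "(squash has_real_derivative squash w * (1 - (squash w)\<^sup>2)) (at w)"
proof -
 define E where "E = exp (- 2 * w)"
 have E: "0 < E" by (simp add: E_def)
 have "((%w. 1 + exp (- 2 * w)) has_real_derivative E * - 2) (at w)"
  unfolding E_def by (auto intro!: derivative_eq_intros)
 then have "((%w. sqrt (1 + exp (- 2 * w))) has_real_derivative inverse (sqrt (1 + E)) / 2 * (E * - 2)) (at w)"
  using E unfolding E_def by (intro DERIV_chain2[OF DERIV_real_sqrt]) (auto simp: add_pos_pos)
 moreover have "sqrt (1 + exp (- 2 * w)) ~= 0"
  using add_pos_pos[OF zero_less_one exp_gt_zero[of "- 2 * w"]] by simp
 ultimately have "((%w. inverse (sqrt (1 + exp (- 2 * w)))) has_real_derivative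
   - (inverse (sqrt (1 + E)) * (inverse (sqrt (1 + E)) / 2 * (E * - 2)) * inverse (sqrt (1 + E)))) (at w)"
  unfolding E_def by (rule DERIV_inverse')
 moreover have "- (inverse (sqrt (1 + E)) * (inverse (sqrt (1 + E)) / 2 * (E * - 2)) * inverse (sqrt (1 + E)))
   = squash w * (1 - (squash w)\<^sup>2)"
 proof -
  have *: "inverse (sqrt (1 + E)) * inverse (sqrt (1 + E)) = 1 / (1 + E)"
   using E by (simp add: divide_inverse flip: inverse_mult_distrib)
  have "- (inverse (sqrt (1 + E)) * (inverse (sqrt (1 + E)) / 2 * (E * - 2)) * inverse (sqrt (1 + E)))
   = inverse (sqrt (1 + E)) * (E * (inverse (sqrt (1 + E)) * inverse (sqrt (1 + E))))" by simp
  also have "\<dots> = squash w * (1 - (squash w)\<^sup>2)"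
   unfolding * squash_square unfolding squash_def E_def[symmetric] using E by (simp add: field_simps)
  finally show ?thesis .
 qed
 moreover have "squash = (%w. inverse (sqrt (1 + exp (- 2 * w))))"
  by (rule ext) (simp add: squash_def divide_inverse)
 ultimately show ?thesis by simp
qed

lemma squash_limits: "(squash \<longlongrightarrow> 1) at_top" "(squash \<longlongrightarrow> 0) at_bot"
 unfolding squash_def by real_asymp+

lemma squash_surj:
 assumes "0 < \<rho>" "\<rho> < 1" obtains w where "\<rho> = squash w"
proof
 have "\<rho>\<^sup>2 < 1" using assms by (simp add: power_less_one_iff)
 then have "1 / \<rho>\<^sup>2 - 1 > 0" using assms by simp
 then have "exp (- 2 * (- ln (1 / \<rho>\<^sup>2 - 1) / 2)) = 1 / \<rho>\<^sup>2 - 1" by simp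
 then show "\<rho> = squash (- ln (1 / \<rho>\<^sup>2 - 1) / 2)"
  unfolding squash_def using assms by (simp add: real_sqrt_divide)
qed

lemma sector_arc:
 assumes F: "F \<in> hom_fields 2" and ab: "a < b" "angular F a = 0" "angular F b = 0"
  and e: "e = 1 | e = -1" and pos: "!!x. a < x ==> x < b ==> 0 < e * angular F x"
  and rho: "!!x. a < x ==> x < b ==> 0 < \<rho> x & \<rho> x <= 1"
  and rho': "!!x. a < x ==> x < b ==>
    (\<rho> has_real_derivative \<rho> x * (1 - (\<rho> x)\<^sup>2) * (radial F x / angular F x)) (at x)"
 shows "flow_arc (poincare_field F) e a b (%th. of_real (\<rho> th) * cis th)"
proof -
 obtain M where M: "0 < M" "!!x y. \<bar>angular F x - angular F y\<bar> <= M * \<bar>x - y\<bar>"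
  using angular_lipschitz[OF F] by blast
 have ang: "e * angular F x <= M * (x - a)" "e * angular F x <= M * (b - x)" if "a < x" "x < b" for x
  using M(2)[of x a] M(2)[of x b] ab that e by (auto simp: abs_le_iff)
 show ?thesis
  unfolding flow_arc_def
 proof (intro conjI exI[of _ "%x. \<rho> x * (e * angular F x)"] exI[of _ M] ballI)
  have "isCont \<rho> x" if "a < x" "x < b" for x using rho'[OF that] DERIV_isCont by blast
  then have "continuous_on {a<..<b} \<rho>" by (simp add: continuous_at_imp_continuous_on)
  then show "continuous_on {a<..<b} (%x. \<rho> x * (e * angular F x))"
   by (intro continuous_intros continuous_radial_angular[OF F])
  fix x assume "x \<in> {a<..<b}"
  then have x: "a < x" "x < b" by auto
  show "0 < \<rho> x * (e * angular F x)" using pos[OF x] rho[OF x] by simp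
  have le: "\<rho> x * (e * angular F x) <= e * angular F x"
   using pos[OF x] rho[OF x] by (metis less_eq_real_def mult_left_le_one_le)
  show "\<rho> x * (e * angular F x) <= M * (x - a)" "\<rho> x * (e * angular F x) <= M * (b - x)"
   using le ang[OF x] by linarith+
  define r where "r = \<rho> x * (1 - (\<rho> x)\<^sup>2) * (radial F x / angular F x)"
  have "((%th. of_real (\<rho> th) * cis th) has_vector_derivative cis x * Complex r (\<rho> x)) (at x)"
   using rho'[OF x] unfolding has_vector_derivative_complex_iff r_def[symmetric]
   by (auto intro!: derivative_eq_intros simp: algebra_simps)
  moreover have "poincare_field F (of_real (\<rho> x) * cis x) = (e * (\<rho> x * (e * angular F x))) *\<^sub>R (cis x * Complex r (\<rho> x))"
  proof -
   have "angular F x ~= 0" using pos[OF x] by auto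
   then have *: "(\<rho> x)^2 * (1 - (\<rho> x)\<^sup>2) * radial F x = \<rho> x * angular F x * r"
    by (simp add: r_def power2_eq_square)
   have k: "e * (\<rho> x * (e * angular F x)) = \<rho> x * angular F x" using e by auto
   have "Complex (\<rho> x * angular F x * r) ((\<rho> x)^2 * angular F x) = (\<rho> x * angular F x) *\<^sub>R Complex r (\<rho> x)"
    by (simp add: complex_eq_iff power2_eq_square)
   then show ?thesis
    unfolding poincare_field_polar[OF F] k * by (simp only: mult_scaleR_right)
  qed
  ultimately show "\<exists>v. ((%th. of_real (\<rho> th) * cis th) has_vector_derivative v) (at x) &
    poincare_field F (of_real (\<rho> x) * cis x) = (e * (\<rho> x * (e * angular F x))) *\<^sub>R v" by blast
 qed (use ab in simp)
qed

lemma ray_arc: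
 assumes F: "F \<in> hom_fields 2" and "angular F th = 0" and e: "e = 1 | e = -1" and pos: "0 < e * radial F th"
 shows "flow_arc (poincare_field F) e 0 1 (%\<rho>. of_real \<rho> * cis th)"
 unfolding flow_arc_def
proof (intro conjI exI[of _ "%\<rho>. \<rho>\<^sup>2 * (1 - \<rho>\<^sup>2) * (e * radial F th)"] exI[of _ "2 * (e * radial F th)"] ballI)
 show "continuous_on {0<..<1} (%\<rho>. \<rho>\<^sup>2 * (1 - \<rho>\<^sup>2) * (e * radial F th))"
  by (intro continuous_intros)
 fix x :: real assume "x \<in> {0<..<1}"
 then have x: "0 < x" "x < 1" by auto
 have x2: "x^2 < 1" "0 <= x^2" using x by (auto simp: power_less_one_iff)
 have "x^2 <= x" using x by (simp add: power2_eq_square mult_left_le)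
 note x2 = this x2
 show "0 < x^2 * (1 - x\<^sup>2) * (e * radial F th)" using x x2 pos by simp
 have "x^2 * (1 - x\<^sup>2) <= x^2 * 1" by (intro mult_left_mono) (use x2 in auto)
 then have a: "x^2 * (1 - x\<^sup>2) <= 2 * x" using x2 x by linarith
 have "x^2 * (1 - x\<^sup>2) <= 1 - x\<^sup>2" using x2 by (intro mult_left_le_one_le) auto
 also have "1 - x\<^sup>2 <= 2 * (1 - x)"
  using zero_le_power2[of "1 - x"] by (simp add: power2_eq_square algebra_simps)
 finally have b: "x^2 * (1 - x\<^sup>2) <= 2 * (1 - x)" .
 show "x^2 * (1 - x\<^sup>2) * (e * radial F th) <= 2 * (e * radial F th) * (x - 0)"
  using mult_right_mono[OF a, of "e * radial F th"] pos by (simp add: mult_ac)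
 show "x^2 * (1 - x\<^sup>2) * (e * radial F th) <= 2 * (e * radial F th) * (1 - x)"
  by (rule order_trans[OF mult_right_mono[OF b]]) (use pos in \<open>auto simp: algebra_simps\<close>)
 have "((%\<rho>. of_real \<rho> * cis th) has_vector_derivative cis th) (at x)"
  unfolding has_vector_derivative_complex_iff by (auto intro!: derivative_eq_intros)
 moreover have "poincare_field F (of_real x * cis th) = (e * (x^2 * (1 - x\<^sup>2) * (e * radial F th))) *\<^sub>R cis th"
  unfolding poincare_field_polar[OF F] using assms(2) e by (auto simp: complex_eq_iff)
 ultimately show "\<exists>v. ((%\<rho>. of_real \<rho> * cis th) has_vector_derivative v) (at x) &
  poincare_field F (of_real x * cis th) = (e * (x^2 * (1 - x\<^sup>2) * (e * radial F th))) *\<^sub>R v" by blast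
qed simp

text \<open>The denominator is at most linear at \<open>a\<close> and the numerator does not vanish there, so the quotient is at
least a multiple of \<open>1 / (x - a)\<close> in absolute value and its antiderivative diverges logarithmically, and monotonically, with a sign given by the numerator.\<close>

lemma antiderivative_left_end:
 fixes H f g :: "real => real"
 assumes ab: "a < b" and H: "!!x. a < x ==> x < b ==> (H has_real_derivative f x / g x) (at x)"
  and e: "e = 1 | e = -1" and g: "!!x. a < x ==> x < b ==> 0 < e * g x & e * g x <= M * (x - a)"
  and M: "0 < M" and f: "isCont f a" "f a ~= 0" and s: "s = e * sgn (f a)"
 obtains a1 where "a < a1" "a1 < b" "!!x y. a < x ==> x < y ==> y < a1 ==> s * H x < s * H y"
  "filterlim (%x. s * H x) at_bot (at_right a)"
proof -
 define k where "k = \<bar>f a\<bar> / (2 * M)"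
 have k: "0 < k" using M f by (simp add: k_def)
 have "((%x. sgn (f a) * f x) \<longlongrightarrow> sgn (f a) * f a) (at a)"
  using f by (intro tendsto_intros) (simp add: isCont_def)
 moreover have "sgn (f a) * f a = \<bar>f a\<bar>" by (simp add: sgn_if)
 ultimately have "\<forall>\<^sub>F x in at a. \<bar>f a\<bar> / 2 < sgn (f a) * f x"
  using f(2) by (intro order_tendstoD(1)) auto
 then obtain d where d: "0 < d" "!!x. x ~= a ==> \<bar>x - a\<bar> < d ==> \<bar>f a\<bar> / 2 < sgn (f a) * f x"
  unfolding eventually_at by (auto simp: dist_real_def)
 define a1 where "a1 = min (a + d) ((a + b) / 2)"
 have a1: "a < a1" "a1 < b" using d ab by (auto simp: a1_def min_def field_simps)
 have slope: "k / (x - a) <= s * (f x / g x)" "0 < s * (f x / g x)" if x: "a < x" "x < a1" for x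
 proof -
  have xb: "x < b" using x a1 by simp
  have "\<bar>f a\<bar> / 2 < sgn (f a) * f x" using d(2)[of x] x by (simp add: a1_def)
  then have n: "\<bar>f a\<bar> / 2 <= sgn (f a) * f x" "0 < sgn (f a) * f x" using f(2) by (auto intro: less_trans[rotated])
  have eq: "s * (f x / g x) = (sgn (f a) * f x) / (e * g x)" using e s by auto
  have "k / (x - a) = (\<bar>f a\<bar> / 2) / (M * (x - a))" by (simp add: k_def)
  also have "\<dots> <= (sgn (f a) * f x) / (e * g x)"
   using g[OF x(1) xb] n by (intro frac_le) auto
  finally show "k / (x - a) <= s * (f x / g x)" using eq by simp
  show "0 < s * (f x / g x)" unfolding eq using n g[OF x(1) xb] by simp
 qed
 have D: "((%x. s * H x) has_real_derivative s * (f x / g x)) (at x)" if "a < x" "x < a1" for x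
  using H[of x] a1 that by (auto intro!: derivative_eq_intros)
 have mono: "s * H x < s * H y" if "a < x" "x < y" "y < a1" for x y
 proof (rule DERIV_pos_imp_increasing[OF that(2)])
  fix z assume "x <= z" "z <= y"
  then have "a < z" "z < a1" using that by auto
  then show "\<exists>m. ((%x. s * H x) has_real_derivative m) (at z) & 0 < m" using D slope by blast
 qed
 define m where "m = (a + a1) / 2"
 have m: "a < m" "m < a1" using a1 by (auto simp: m_def)
 have bound: "s * H x <= s * H m - k * ln (m - a) + k * ln (x - a)" if x: "a < x" "x <= m" for x
 proof -
  have "s * H x - k * ln (x - a) <= s * H m - k * ln (m - a)"
  proof (rule DERIV_nonneg_imp_nondecreasing[OF x(2)])
   fix z assume "x <= z" "z <= m"
   then have z: "a < z" "z < a1" using x m by auto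
   have "((%x. s * H x - k * ln (x - a)) has_real_derivative s * (f z / g z) - k / (z - a)) (at z)"
    by (rule DERIV_diff[OF D[OF z]]) (use z in \<open>auto intro!: derivative_eq_intros\<close>)
   then show "\<exists>y. ((%x. s * H x - k * ln (x - a)) has_real_derivative y) (at z) & 0 <= y"
    using slope(1)[OF z] by (intro exI[of _ "s * (f z / g z) - k / (z - a)"]) auto
  qed
  then show ?thesis by linarith
 qed
 have "filterlim (%x. s * H m - k * ln (m - a) + k * ln x) at_bot (at_right 0)" using k by real_asymp
 then have "filterlim (%x. s * H m - k * ln (m - a) + k * ln (x - a)) at_bot (at_right a)"
  by (subst filterlim_at_right_to_0) simp
 moreover have "\<forall>\<^sub>F x in at_right a. s * H x <= s * H m - k * ln (m - a) + k * ln (x - a)"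
  using eventually_at_right_less[of a] eventually_at_right_real[OF m(1)]
  by eventually_elim (use bound in auto)
 ultimately have "filterlim (%x. s * H x) at_bot (at_right a)" by (rule filterlim_at_bot_mono)
 then show thesis using that[OF a1] mono by blast
qed

lemma antiderivative_right_end:
 fixes H f g :: "real => real"
 assumes ab: "a < b" and H: "!!x. a < x ==> x < b ==> (H has_real_derivative f x / g x) (at x)"
  and e: "e = 1 | e = -1" and g: "!!x. a < x ==> x < b ==> 0 < e * g x & e * g x <= M * (b - x)"
  and M: "0 < M" and f: "isCont f b" "f b ~= 0" and s: "s = e * sgn (f b)"
 obtains b1 where "a < b1" "b1 < b" "!!x y. b1 < x ==> x < y ==> y < b ==> s * H x < s * H y"
  "filterlim (%x. s * H x) at_top (at_left b)"
proof -
 have cont: "isCont (%x. - f (- x)) (- b)"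
  using isCont_o2[of "- b" uminus f] f(1) by (intro continuous_intros) auto
 have D: "((%x. H (- x)) has_real_derivative - f (- x) / g (- x)) (at x)" if "- b < x" "x < - a" for x
 proof -
  have "(H has_real_derivative f (- x) / g (- x)) (at (- x))" using H that by auto
  moreover have "(uminus has_real_derivative - 1) (at x)" by (auto intro!: derivative_eq_intros)
  ultimately have "((%x. H (- x)) has_real_derivative f (- x) / g (- x) * - 1) (at x)" by (rule DERIV_chain2)
  then show ?thesis by simp
 qed
 have sneg: "- s = e * sgn (- f (- (- b)))" by (simp add: s sgn_minus)
 have g': "0 < e * g (- x) & e * g (- x) <= M * (x - - b)" if "- b < x" "x < - a" for x
  using g[of "- x"] that by (simp add: add.commute)
 have "- b < - a" "- f (- (- b)) ~= 0" using ab f(2) by auto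
 note left = antiderivative_left_end[of "- b" "- a" "%x. H (- x)" "%x. - f (- x)" "%x. g (- x)" e M "- s",
  OF this(1) D e g' M cont this(2) sneg]
 show thesis
 proof (rule left)
  fix a1 assume a1: "- b < a1" "a1 < - a"
   "!!x y. - b < x ==> x < y ==> y < a1 ==> - s * H (- x) < - s * H (- y)"
   and lim: "filterlim (%x. - s * H (- x)) at_bot (at_right (- b))"
  show thesis
  proof (rule that[of "- a1"])
   show "s * H x < s * H y" if "- a1 < x" "x < y" "y < b" for x y
    using a1(3)[of "- y" "- x"] that by simp
   show "filterlim (%x. s * H x) at_top (at_left b)"
    unfolding at_left_minus[of b] filterlim_filtermap
    using lim by (simp add: filterlim_uminus_at_bot)
  qed (use a1 in auto)
 qed
qed

text \<open>Two functions that increase near the two ends are joined by an increasing function that agrees with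
them close to the ends; in the middle a linear interpolation is used.\<close>

lemma monotone_join:
 fixes p q :: "real => real"
 assumes a1: "a < a1" and b1: "b1 < b" and ab: "a < b"
  and p: "!!x y. a < x ==> x < y ==> y < a1 ==> p x < p y" "!!x. a < x ==> x < b ==> isCont p x"
   "filterlim p at_bot (at_right a)"
  and q: "!!x y. b1 < x ==> x < y ==> y < b ==> q x < q y" "!!x. a < x ==> x < b ==> isCont q x"
   "filterlim q at_top (at_left b)"
 obtains E a2 b2 where "a < a2" "a2 < b2" "b2 < b" "!!x. x <= a2 ==> E x = p x" "!!x. b2 <= x ==> E x = q x"
  "!!x y. a < x ==> x < y ==> y < b ==> E x < E y" "!!y. \<exists>x. a < x & x < b & E x = y"
proof -
 define m where "m = (a + b) / 2"
 define b2 where "b2 = (max b1 m + b) / 2"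
 have m: "a < m" "m < b" using ab by (auto simp: m_def)
 have b2: "b1 < b2" "m < b2" "b2 < b" using m b1 by (auto simp: b2_def max_def)
 have "\<forall>\<^sub>F x in at_right a. p x < q b2" using p(3) by (simp add: filterlim_at_bot_dense)
 moreover have "\<forall>\<^sub>F x in at_right a. x \<in> {a<..<min a1 m}"
  by (rule eventually_at_right_real) (use a1 m in auto)
 ultimately have "\<forall>\<^sub>F x in at_right a. p x < q b2 & x \<in> {a<..<min a1 m}" by eventually_elim auto
 from eventually_happens[OF this] obtain a2 where a2: "p a2 < q b2" "a < a2" "a2 < a1" "a2 < m" by auto
 define k where "k = (q b2 - p a2) / (b2 - a2)"
 have k: "0 < k" using a2 b2 by (simp add: k_def)
 define E where "E = (%x. if x <= a2 then p x else if b2 <= x then q x else p a2 + k * (x - a2))"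
 have ab2: "a2 < b2" using a2 b2 by simp
 have lin: "p a2 + k * (b2 - a2) = q b2" using ab2 by (simp add: k_def)
 have Ep: "E x = p x" if "x <= a2" for x using that by (simp add: E_def)
 have Eq: "E x = q x" if "b2 <= x" for x using that ab2 by (simp add: E_def)
 have El: "E x = p a2 + k * (x - a2)" if "a2 <= x" "x <= b2" for x
  using that lin by (auto simp: E_def)
 have mono_p: "E x < E y" if "a < x" "x < y" "y <= a2" for x y
  using that a2 p(1)[of x y] by (simp add: Ep)
 have mono_l: "E x < E y" if "a2 <= x" "x < y" "y <= b2" for x y
  using that k by (simp add: El)
 have mono_q: "E x < E y" if "b2 <= x" "x < y" "y < b" for x y
  using that b2 q(1)[of x y] by (simp add: Eq)
 have mono_lq: "E x < E y" if "a2 <= x" "x < y" "y < b" for x y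
 proof -
  consider "y <= b2" | "b2 <= x" | "x < b2" "b2 < y" by linarith
  then show ?thesis
  proof cases
   case 3
   then show ?thesis using mono_l[of x b2] mono_q[of b2 y] that by linarith
  qed (use mono_l[of x y] mono_q[of x y] that in auto)
 qed
 have mono: "E x < E y" if "a < x" "x < y" "y < b" for x y
 proof -
  consider "y <= a2" | "a2 <= x" | "x < a2" "a2 < y" by linarith
  then show ?thesis
  proof cases
   case 3
   then show ?thesis using mono_p[of x a2] mono_lq[of a2 y] that by linarith
  qed (use mono_p[of x y] mono_lq[of x y] that in auto)
 qed
 have surj: "\<exists>x. a < x & x < b & E x = y" for y
 proof -
  consider "y <= p a2" | "p a2 <= y" "y <= q b2" | "q b2 <= y" by linarith
  then show ?thesis
  proof cases
   case 1
   have "\<forall>\<^sub>F x in at_right a. p x < y" using p(3) by (simp add: filterlim_at_bot_dense)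
   moreover have "\<forall>\<^sub>F x in at_right a. x \<in> {a<..<a2}" by (rule eventually_at_right_real) (use a2 in auto)
   ultimately have "\<forall>\<^sub>F x in at_right a. p x < y & x \<in> {a<..<a2}" by eventually_elim auto
   from eventually_happens[OF this] obtain z where z: "p z < y" "a < z" "z < a2" by auto
   have "\<exists>x\<ge>z. x <= a2 & p x = y"
    by (rule IVT[of p]) (use 1 z p(2) ab2 b2 in auto)
   then obtain x where "z <= x" "x <= a2" "p x = y" by blast
   then show ?thesis using z Ep ab2 b2 by (intro exI[of _ x]) auto
  next
   case 2
   have x: "a2 <= a2 + (y - p a2) / k" "a2 + (y - p a2) / k <= b2"
    using 2 k lin by (auto simp: field_simps)
   show ?thesis using El[OF x] k x a2 b2 by (intro exI[of _ "a2 + (y - p a2) / k"]) auto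
  next
   case 3
   have "\<forall>\<^sub>F x in at_left b. y < q x" using q(3) by (simp add: filterlim_at_top_dense)
   moreover have "\<forall>\<^sub>F x in at_left b. x \<in> {b2<..<b}" by (rule eventually_at_left_real) (use b2 in auto)
   ultimately have "\<forall>\<^sub>F x in at_left b. y < q x & x \<in> {b2<..<b}" by eventually_elim auto
   from eventually_happens[OF this] obtain z where z: "y < q z" "b2 < z" "z < b" by auto
   have "\<exists>x\<ge>b2. x <= z & q x = y"
    by (rule IVT[of q]) (use 3 z q(2) ab2 a2 in auto)
   then obtain x where "b2 <= x" "x <= z" "q x = y" by blast
   then show ?thesis using z Eq ab2 a2 by (intro exI[of _ x]) auto
  qed
 qed
 show thesis by (rule that[OF a2(2) ab2 b2(3) Ep Eq mono surj])
qed

text \<open>The signs \<open>s\<close> and \<open>t\<close> tell in which direction \<open>H\<close> diverges at the left and at the right end.\<close>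

definition end_behaviour :: "real => real => real => real => (real => real) => bool" where
 "end_behaviour a b s t H \<longleftrightarrow> a < b & (\<forall>x. a < x & x < b --> isCont H x) &
   (\<exists>a1>a. \<forall>x y. a < x & x < y & y < a1 --> s * H x < s * H y) &
   (\<exists>b1<b. \<forall>x y. b1 < x & x < y & y < b --> t * H x < t * H y) &
   filterlim (%x. s * H x) at_bot (at_right a) & filterlim (%x. t * H x) at_top (at_left b)"

lemma end_behaviour_join:
 assumes "end_behaviour a b s t H"
 shows "\<exists>E a2 b2. a < a2 & a2 < b2 & b2 < b & (\<forall>x\<le>a2. E x = s * H x) & (\<forall>x\<ge>b2. E x = t * H x) &
  (\<forall>x y. a < x & x < y & y < b --> E x < E y) & (\<forall>y. \<exists>x. a < x & x < b & E x = y)"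
proof -
 obtain a1 b1 where *: "a < b" "!!x. a < x ==> x < b ==> isCont H x" "a < a1" "b1 < b"
  "!!x y. a < x ==> x < y ==> y < a1 ==> s * H x < s * H y"
  "!!x y. b1 < x ==> x < y ==> y < b ==> t * H x < t * H y"
  "filterlim (%x. s * H x) at_bot (at_right a)" "filterlim (%x. t * H x) at_top (at_left b)"
  using assms unfolding end_behaviour_def by blast
 have c: "isCont (%x. c * H x) x" if "a < x" "x < b" for c x
  using *(2)[OF that] by (intro continuous_intros)
 show ?thesis
 proof (rule monotone_join[OF *(3,4,1,5) c *(7,6) c *(8)])
  fix E a2 b2 assume E: "a < a2" "a2 < b2" "b2 < b" "!!x. x <= a2 ==> E x = s * H x" "!!x. b2 <= x ==> E x = t * H x"
   "!!x y. a < x ==> x < y ==> y < b ==> E x < E y" "!!y. \<exists>x. a < x & x < b & E x = y"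
  show ?thesis
   by (rule exI[of _ E], rule exI[of _ a2], rule exI[of _ b2]) (use E in simp)
 qed
qed

text \<open>The change of variable is \<open>D^{-1} E\<close> for the increasing functions \<open>E\<close>, \<open>D\<close> that agree with \<open>H\<close>, \<open>H'\<close> up to sign near the
ends. There it matches \<open>H\<close> with \<open>H'\<close> exactly, which gives continuity of the glued map at the rays.\<close>

lemma sector_homeomorphism:
 assumes F: "end_behaviour a b s t H" and G: "end_behaviour a' b' s t H'" and st: "s ~= 0" "t ~= 0"
 obtains \<phi> a2 b2 where "strict_mono_on {a<..<b} \<phi>" "\<phi> ` {a<..<b} = {a'<..<b'}" "a < a2" "b2 < b"
  "!!x. a < x ==> x < a2 ==> H' (\<phi> x) = H x" "!!x. b2 < x ==> x < b ==> H' (\<phi> x) = H x"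
proof -
 obtain E a2 b2 where E: "a < a2" "a2 < b2" "b2 < b" "!!x. x <= a2 ==> E x = s * H x" "!!x. b2 <= x ==> E x = t * H x"
  "!!x y. a < x ==> x < y ==> y < b ==> E x < E y" "!!y. \<exists>x. a < x & x < b & E x = y"
  using end_behaviour_join[OF F] by (elim exE conjE) metis
 obtain D a3 b3 where D: "a' < a3" "a3 < b3" "b3 < b'" "!!x. x <= a3 ==> D x = s * H' x" "!!x. b3 <= x ==> D x = t * H' x"
  "!!x y. a' < x ==> x < y ==> y < b' ==> D x < D y" "!!y. \<exists>x. a' < x & x < b' & D x = y"
  using end_behaviour_join[OF G] by (elim exE conjE) metis
 define \<phi> where "\<phi> = (%x. SOME y. a' < y & y < b' & D y = E x)"
 have \<phi>: "a' < \<phi> x" "\<phi> x < b'" "D (\<phi> x) = E x" for x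
  using someI_ex[OF D(7)[of "E x"]] unfolding \<phi>_def by blast+
 have D_le: "x <= y" if "D x <= D y" "a' < x" "x < b'" "a' < y" "y < b'" for x y
  using D(6)[of y x] that by linarith
 have D_less: "x < y" if "D x < D y" "a' < x" "x < b'" "a' < y" "y < b'" for x y
  using D(6)[of y x] that by (cases rule: linorder_cases[of x y]) auto
 obtain x3 where x3: "a < x3" "x3 < b" "E x3 = D a3" using E(7)[of "D a3"] by blast
 obtain x4 where x4: "a < x4" "x4 < b" "E x4 = D b3" using E(7)[of "D b3"] by blast
 show thesis
 proof (rule that[of \<phi> "min a2 x3" "max b2 x4"])
  show "strict_mono_on {a<..<b} \<phi>"
  proof (rule strict_mono_onI)
   fix x y assume "x \<in> {a<..<b}" "y \<in> {a<..<b}" "x < y"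
   then show "\<phi> x < \<phi> y" using E(6)[of x y] \<phi> by - (rule D_less, simp_all)
  qed
  show "\<phi> ` {a<..<b} = {a'<..<b'}"
  proof (intro equalityI subsetI)
   fix y assume y: "y \<in> {a'<..<b'}"
   obtain x where x: "a < x" "x < b" "E x = D y" using E(7)[of "D y"] by blast
   then have "\<phi> x = y" using D_le[of "\<phi> x" y] D_le[of y "\<phi> x"] \<phi>[of x] y by auto
   then show "y \<in> \<phi> ` {a<..<b}" using x by auto
  qed (use \<phi> in auto)
  show "H' (\<phi> x) = H x" if "a < x" "x < min a2 x3" for x
  proof -
   have "E x < E x3" using that E(6)[of x x3] x3 by auto
   then have "\<phi> x <= a3" using \<phi>[of x] x3 D(1-3) by - (rule D_le, auto)
   then have "s * H' (\<phi> x) = s * H x" using D(4)[of "\<phi> x"] E(4)[of x] \<phi>(3)[of x] that by auto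
   then show ?thesis using st by simp
  qed
  show "H' (\<phi> x) = H x" if "max b2 x4 < x" "x < b" for x
  proof -
   have "E x4 < E x" using that E(6)[of x4 x] x4 by auto
   then have "b3 <= \<phi> x" using \<phi>[of x] x4 D(1-3) by - (rule D_le, auto)
   then have "t * H' (\<phi> x) = t * H x" using D(5)[of "\<phi> x"] E(5)[of x] \<phi>(3)[of x] that by auto
   then show ?thesis using st by simp
  qed
 qed (use E(1-3) x3 x4 in auto)
qed

lemma strict_mono_surj_continuous:
 fixes \<phi> :: "real => real"
 assumes "strict_mono_on {a..b} \<phi>" "\<phi> ` {a..b} = {c..d}"
 shows "continuous_on {a..b} \<phi>"
proof (cases "a <= b")
 case True
 define \<psi> where "\<psi> = the_inv_into {a..b} \<phi>"
 have inj: "inj_on \<phi> {a..b}" using assms(1) by (rule strict_mono_on_imp_inj_on)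
 show ?thesis
  unfolding continuous_on_iff
 proof (intro ballI allI impI)
  fix x e :: real assume x: "x \<in> {a..b}" and e: "0 < e"
  have le: "\<phi> u <= \<phi> v" if "u \<in> {a..b}" "v \<in> {a..b}" "u <= v" for u v
   using assms(1) that by (cases "u = v") (auto simp: strict_mono_on_def intro: less_imp_le)
  have lt: "u < v" if "u \<in> {a..b}" "v \<in> {a..b}" "\<phi> u < \<phi> v" for u v
   using le[of v u] that by fastforce
  have left: "\<exists>d>0. \<forall>y\<in>{a..b}. x - d < y --> \<phi> x - e < \<phi> y"
  proof (cases "\<phi> x - e < \<phi> a")
   case True
   then show ?thesis using le[of a] by (intro exI[of _ 1]) (force)
  next
   case False
   have "\<phi> x <= d" using assms(2) x by auto
   have "\<phi> a \<in> {c..d}" using assms(2) \<open>a <= b\<close> by auto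
   then have "\<phi> x - e / 2 \<in> {c..d}" using False e \<open>\<phi> x <= d\<close> by auto
   then obtain z where z: "z \<in> {a..b}" "\<phi> z = \<phi> x - e / 2" using assms(2) by (metis imageE)
   have "z < x" using lt[of z x] z x e by auto
   have "\<phi> x - e < \<phi> y" if "y \<in> {a..b}" "z < y" for y
    using le[of z y] z that e by auto
   then show ?thesis using \<open>z < x\<close> by (intro exI[of _ "x - z"]) auto
  qed
  have right: "\<exists>d>0. \<forall>y\<in>{a..b}. y < x + d --> \<phi> y < \<phi> x + e"
  proof (cases "\<phi> b < \<phi> x + e")
   case True
   then show ?thesis using le[of _ b] by (intro exI[of _ 1]) (force)
  next
   case False
   have "c <= \<phi> x" using assms(2) x by auto
   have "\<phi> b \<in> {c..d}" using assms(2) \<open>a <= b\<close> by auto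
   then have "\<phi> x + e / 2 \<in> {c..d}" using False e \<open>c <= \<phi> x\<close> by auto
   then obtain z where z: "z \<in> {a..b}" "\<phi> z = \<phi> x + e / 2" using assms(2) by (metis imageE)
   have "x < z" using lt[of x z] z x e by auto
   have "\<phi> y < \<phi> x + e" if "y \<in> {a..b}" "y < z" for y
    using le[of y z] z that e by auto
   then show ?thesis using \<open>x < z\<close> by (intro exI[of _ "z - x"]) auto
  qed
  obtain d1 where d1: "0 < d1" "!!y. y \<in> {a..b} ==> x - d1 < y ==> \<phi> x - e < \<phi> y" using left by blast
  obtain d2 where d2: "0 < d2" "!!y. y \<in> {a..b} ==> y < x + d2 ==> \<phi> y < \<phi> x + e" using right by blast
  show "\<exists>d>0. \<forall>x'\<in>{a..b}. dist x' x < d --> dist (\<phi> x') (\<phi> x) < e"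
  proof (intro exI[of _ "min d1 d2"] conjI ballI impI)
   fix y assume y: "y \<in> {a..b}" "dist y x < min d1 d2"
   then have "x - d1 < y" "y < x + d2" by (auto simp: dist_real_def)
   with d1(2)[OF y(1)] d2(2)[OF y(1)] show "dist (\<phi> y) (\<phi> x) < e" by (auto simp: dist_real_def)
  qed (use d1 d2 in simp)
 qed
qed simp

section \<open>Gluing sectors to the disk\<close>

lemma closed_sector_homeomorphism:
 assumes F: "end_behaviour a b s t H" and G: "end_behaviour a' b' s t H'" and st: "s ~= 0" "t ~= 0"
 shows "\<exists>\<phi> d. strict_mono_on {a..b} \<phi> & \<phi> a = a' & \<phi> b = b' & \<phi> ` {a<..<b} = {a'<..<b'} &
  continuous_on {a..b} d & d a = 0 & d b = 0 & (\<forall>x\<in>{a<..<b}. d x = H' (\<phi> x) - H x)"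
proof (rule sector_homeomorphism[OF F G st])
 fix \<phi>0 a2 b2
 assume mono: "strict_mono_on {a<..<b} \<phi>0" and im: "\<phi>0 ` {a<..<b} = {a'<..<b'}" and ab2: "a < a2" "b2 < b"
  and near: "!!x. a < x ==> x < a2 ==> H' (\<phi>0 x) = H x" "!!x. b2 < x ==> x < b ==> H' (\<phi>0 x) = H x"
 have ab: "a < b" "a' < b'" and cH: "!!x. a < x ==> x < b ==> isCont H x"
  and cH': "!!x. a' < x ==> x < b' ==> isCont H' x"
  using F G by (auto simp: end_behaviour_def)
 define \<phi> where "\<phi> = (%x. if x <= a then a' else if b <= x then b' else \<phi>0 x)"
 define d where "d = (%x. if a < x & x < b then H' (\<phi> x) - H x else 0)"
 have in0: "a' < \<phi>0 x" "\<phi>0 x < b'" if "a < x" "x < b" for x using im that by auto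
 have mono_\<phi>: "strict_mono_on {a..b} \<phi>"
 proof (rule strict_mono_onI)
  fix x y assume "x \<in> {a..b}" "y \<in> {a..b}" "x < y"
  then show "\<phi> x < \<phi> y"
   using in0[of x] in0[of y] ab strict_mono_onD[OF mono, of x y] by (auto simp: \<phi>_def)
 qed
 have open_im: "\<phi> ` {a<..<b} = {a'<..<b'}"
  using im by (auto simp: \<phi>_def image_iff)
 have ends: "\<phi> a = a'" "\<phi> b = b'" using ab by (auto simp: \<phi>_def)
 have "\<phi> ` {a..b} = {a'..b'}"
 proof -
  have "{a..b} = insert a (insert b {a<..<b})" "{a'..b'} = insert a' (insert b' {a'<..<b'})" using ab by auto
  then show ?thesis using open_im ends by simp
 qed
 then have "continuous_on {a..b} \<phi>" by (rule strict_mono_surj_continuous[OF mono_\<phi>])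
 then have cont_\<phi>: "isCont \<phi> x" if "a < x" "x < b" for x
  using that by (metis atLeastAtMost_borel continuous_on_interior greaterThanLessThan_iff interior_atLeastAtMost_real)
 have "continuous (at x within {a..b}) d" if x: "x \<in> {a..b}" for x
 proof -
  consider "x = a" | "x = b" | "a < x" "x < b" using x by force
  then show ?thesis
  proof cases
   case 1
   have "\<forall>\<^sub>F y in at a within {a..b}. d y = 0"
    unfolding eventually_at using ab2 near(1)
    by (intro exI[of _ "a2 - a"]) (auto simp: d_def \<phi>_def dist_real_def)
   then show ?thesis
    using 1 by (auto simp: continuous_within d_def intro: tendsto_eventually)
  next
   case 2
   have "\<forall>\<^sub>F y in at b within {a..b}. d y = 0"
    unfolding eventually_at using ab2 near(2)
    by (intro exI[of _ "b - b2"]) (auto simp: d_def \<phi>_def dist_real_def)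
   then show ?thesis
    using 2 by (auto simp: continuous_within d_def intro: tendsto_eventually)
  next
   case 3
   have "\<phi> x \<in> {a'<..<b'}" using open_im 3 by auto
   then have "isCont (%x. H' (\<phi> x) - H x) x"
    using cont_\<phi>[OF 3] cH[OF 3] cH' by (intro continuous_intros isCont_o2[of x \<phi> H']) auto
   moreover have "\<forall>\<^sub>F y in nhds x. d y = H' (\<phi> y) - H y"
    using eventually_nhds_in_open[of "{a<..<b}" x] 3 by (auto elim!: eventually_mono simp: d_def)
   ultimately have "isCont d x" by (simp add: isCont_cong)
   then show ?thesis by (rule continuous_at_imp_continuous_at_within)
  qed
 qed
 then have "continuous_on {a..b} d" by (simp add: continuous_on_eq_continuous_within)
 then show ?thesis
  using mono_\<phi> ends open_im ab by (intro exI[of _ \<phi>] exI[of _ d]) (auto simp: d_def)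
qed

text \<open>The angular maps of consecutive sectors agree at the common ray, and the radial correction \<open>d\<close>
vanishes there, so both extend continuously across the ray.\<close>

lemma glued_sectors:
 fixes th \<psi> :: "nat => real"
 assumes F: "!!j. end_behaviour (th j) (th (Suc j)) (s j) (t j) (H j)"
  and G: "!!j. end_behaviour (\<psi> j) (\<psi> (Suc j)) (s j) (t j) (K j)"
  and st: "!!j. s j ~= 0" "!!j. t j ~= 0"
 shows "\<exists>\<phi> d. strict_mono_on {th 0..th k} \<phi> & \<phi> ` {th 0..th k} = {\<psi> 0..\<psi> k} &
  continuous_on {th 0..th k} d & (\<forall>j\<le>k. \<phi> (th j) = \<psi> j & d (th j) = 0) &
  (\<forall>j<k. \<phi> ` {th j<..<th (Suc j)} = {\<psi> j<..<\<psi> (Suc j)} &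
    (\<forall>x\<in>{th j<..<th (Suc j)}. d x = K j (\<phi> x) - H j x))"
proof (induction k)
 case 0
 show ?case by (intro exI[of _ "%_. \<psi> 0"] exI[of _ "%_. 0"]) (auto simp: strict_mono_on_def)
next
 case (Suc k)
 have inc: "th i <= th j" "\<psi> i <= \<psi> j" if "i <= j" for i j
 proof -
  have "th n <= th (Suc n)" "\<psi> n <= \<psi> (Suc n)" for n
   using F[of n] G[of n] by (auto simp: end_behaviour_def)
  then show "th i <= th j" "\<psi> i <= \<psi> j" using lift_Suc_mono_le[of th] lift_Suc_mono_le[of \<psi>] that by blast+
 qed
 have lt: "th k < th (Suc k)" "\<psi> k < \<psi> (Suc k)" using F G by (auto simp: end_behaviour_def)
 obtain \<phi> d where 1: "strict_mono_on {th 0..th k} \<phi>" "\<phi> ` {th 0..th k} = {\<psi> 0..\<psi> k}"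
  "continuous_on {th 0..th k} d" "!!j. j <= k ==> \<phi> (th j) = \<psi> j & d (th j) = 0"
  "!!j. j < k ==> \<phi> ` {th j<..<th (Suc j)} = {\<psi> j<..<\<psi> (Suc j)} &
    (\<forall>x\<in>{th j<..<th (Suc j)}. d x = K j (\<phi> x) - H j x)"
  using Suc.IH by blast
 obtain \<phi>' d' where 2: "strict_mono_on {th k..th (Suc k)} \<phi>'" "\<phi>' (th k) = \<psi> k" "\<phi>' (th (Suc k)) = \<psi> (Suc k)"
  "\<phi>' ` {th k<..<th (Suc k)} = {\<psi> k<..<\<psi> (Suc k)}" "continuous_on {th k..th (Suc k)} d'"
  "d' (th k) = 0" "d' (th (Suc k)) = 0" "!!x. x \<in> {th k<..<th (Suc k)} ==> d' x = K k (\<phi>' x) - H k x"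
  using closed_sector_homeomorphism[OF F[of k] G[of k] st(1)[of k] st(2)[of k]] by blast
 define \<phi>2 where "\<phi>2 = (%x. if x <= th k then \<phi> x else \<phi>' x)"
 define d2 where "d2 = (%x. if x <= th k then d x else d' x)"
 have union: "{th 0..th (Suc k)} = {th 0..th k} \<union> {th k..th (Suc k)}" "{\<psi> 0..\<psi> (Suc k)} = {\<psi> 0..\<psi> k} \<union> {\<psi> k..\<psi> (Suc k)}"
  using inc[of 0 k] lt by auto
 have eqk: "\<phi> (th k) = \<phi>' (th k)" "d (th k) = d' (th k)" using 1(4)[of k] 2 by auto
 have on1: "\<phi>2 x = \<phi> x" "d2 x = d x" if "x <= th k" for x using that by (auto simp: \<phi>2_def d2_def)
 have on2: "\<phi>2 x = \<phi>' x" "d2 x = d' x" if "th k <= x" for x using that eqk by (auto simp: \<phi>2_def d2_def)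
 have A: "strict_mono_on {th 0..th (Suc k)} \<phi>2"
 proof (rule strict_mono_onI)
  fix x y assume xy: "x \<in> {th 0..th (Suc k)}" "y \<in> {th 0..th (Suc k)}" "x < y"
  have m1: "\<phi>2 u < \<phi>2 v" if "u \<in> {th 0..th k}" "v \<in> {th 0..th k}" "u < v" for u v
   using strict_mono_onD[OF 1(1) that] that on1 by simp
  have m2: "\<phi>2 u < \<phi>2 v" if "u \<in> {th k..th (Suc k)}" "v \<in> {th k..th (Suc k)}" "u < v" for u v
   using strict_mono_onD[OF 2(1) that] that on2 by simp
  consider "y <= th k" | "th k <= x" | "x < th k" "th k < y" by linarith
  then show "\<phi>2 x < \<phi>2 y"
  proof cases
   case 3
   have "\<phi>2 x < \<phi>2 (th k)" by (rule m1) (use 3 xy in auto)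
   also have "\<phi>2 (th k) < \<phi>2 y" by (rule m2) (use 3 xy lt in auto)
   finally show ?thesis .
  qed (use xy m1[of x y] m2[of x y] in auto)
 qed
 have B: "\<phi>2 ` {th 0..th (Suc k)} = {\<psi> 0..\<psi> (Suc k)}"
 proof -
  have "\<phi>2 ` {th 0..th k} = {\<psi> 0..\<psi> k}" using 1(2) on1 by (auto simp: image_iff)
  moreover have "\<phi>2 ` {th k..th (Suc k)} = \<phi>' ` {th k..th (Suc k)}" using on2 by (intro image_cong) auto
  moreover have "{th k..th (Suc k)} = insert (th k) (insert (th (Suc k)) {th k<..<th (Suc k)})"
   "{\<psi> k..\<psi> (Suc k)} = insert (\<psi> k) (insert (\<psi> (Suc k)) {\<psi> k<..<\<psi> (Suc k)})" using lt by auto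
  ultimately show ?thesis unfolding union image_Un using 2 by simp
 qed
 have C: "continuous_on {th 0..th (Suc k)} d2"
  unfolding union d2_def by (rule continuous_on_cases) (use 1(3) 2(5) eqk in auto)
 have D: "\<phi>2 (th j) = \<psi> j & d2 (th j) = 0" if "j <= Suc k" for j
 proof (cases "j = Suc k")
  case True then show ?thesis using on2[of "th (Suc k)"] lt 2 by simp
 next
  case False then show ?thesis using that 1(4)[of j] on1[of "th j"] inc[of j k] by simp
 qed
 have E: "\<phi>2 ` {th j<..<th (Suc j)} = {\<psi> j<..<\<psi> (Suc j)} &
    (\<forall>x\<in>{th j<..<th (Suc j)}. d2 x = K j (\<phi>2 x) - H j x)" if "j < Suc k" for j
 proof (cases "j = k")
  case True
  have "\<phi>2 ` {th k<..<th (Suc k)} = \<phi>' ` {th k<..<th (Suc k)}" using on2 by (intro image_cong) auto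
  then show ?thesis using True 2(4,8) on2 by auto
 next
  case False
  then have "j < k" using that by simp
  then have le: "th (Suc j) <= th k" using inc[of "Suc j" k] by simp
  then have "\<phi>2 ` {th j<..<th (Suc j)} = \<phi> ` {th j<..<th (Suc j)}" using on1 by (intro image_cong) auto
  then show ?thesis using 1(5)[OF \<open>j < k\<close>] on1 le by auto
 qed
 have D': "\<forall>j\<le>Suc k. \<phi>2 (th j) = \<psi> j & d2 (th j) = 0" using D by simp
 have E': "\<forall>j<Suc k. \<phi>2 ` {th j<..<th (Suc j)} = {\<psi> j<..<\<psi> (Suc j)} &
    (\<forall>x\<in>{th j<..<th (Suc j)}. d2 x = K j (\<phi>2 x) - H j x)"
  by (intro allI impI E)
 show ?case by (rule exI[of _ \<phi>2], rule exI[of _ d2]) (intro conjI A B C D' E')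
qed

text \<open>The translation by \<open>d\<close> in the coordinate \<open>w\<close> (\<open>radial_push_squash\<close>), written so that it extends
continuously to \<open>\<rho> = 0\<close> and \<open>\<rho> = 1\<close>.\<close>

definition radial_push :: "real => real => real" where
 "radial_push \<rho> d = \<rho> / sqrt (\<rho>\<^sup>2 + (1 - \<rho>\<^sup>2) * exp (- 2 * d))"

lemma radial_push_denominator: "0 <= \<rho> ==> \<rho> <= 1 ==> 0 < \<rho>\<^sup>2 + (1 - \<rho>\<^sup>2) * exp (- 2 * d)" for \<rho> d :: real
 by (cases "\<rho> = 0") (auto intro!: add_pos_nonneg mult_nonneg_nonneg simp: power_le_one)

lemma radial_push_0 [simp]: "radial_push 0 d = 0" and radial_push_1 [simp]: "radial_push 1 d = 1"
 by (simp_all add: radial_push_def)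

lemma radial_push_squash: "radial_push (squash w) d = squash (w + d)"
proof -
 define E where "E = exp (- 2 * w)"
 have E: "0 < E" by (simp add: E_def)
 have sum: "(squash w)^2 + (1 - (squash w)\<^sup>2) * exp (- 2 * d) = (1 + E * exp (- 2 * d)) / (1 + E)"
  unfolding squash_square E_def[symmetric] using E by (simp add: field_simps)
 have w: "squash w = 1 / sqrt (1 + E)" by (simp add: squash_def E_def)
 have wd: "squash (w + d) = 1 / sqrt (1 + E * exp (- 2 * d))"
  by (simp add: squash_def E_def algebra_simps flip: exp_add)
 show ?thesis
  unfolding radial_push_def sum unfolding w wd using E by (simp add: real_sqrt_divide)
qed

lemma squash_inject: "squash v = squash w \<longleftrightarrow> v = w"
proof
 assume "squash v = squash w"
 then have "(squash v)^2 = (squash w)^2" by simp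
 moreover have "1 + exp (- 2 * v) > 0" "1 + exp (- 2 * w) > 0" by (auto simp: add_pos_pos)
 ultimately show "v = w" unfolding squash_square by (simp add: field_simps)
qed simp

lemma unit_interval_cases:
 fixes \<rho> :: real
 assumes "0 <= \<rho>" "\<rho> <= 1" obtains "\<rho> = 0" | "\<rho> = 1" | w where "\<rho> = squash w"
 using assms squash_surj[of \<rho>] by (metis less_eq_real_def)

lemma radial_push_inject:
 assumes "0 <= \<rho>" "\<rho> <= 1" "0 <= \<rho>'" "\<rho>' <= 1" "radial_push \<rho> d = radial_push \<rho>' d"
 shows "\<rho> = \<rho>'"
proof -
 have "squash w ~= 0" "squash w ~= 1" for w using squash_bounds[of w] by auto
 then show ?thesis
  using assms(5) by (cases rule: unit_interval_cases[OF assms(1,2)]; cases rule: unit_interval_cases[OF assms(3,4)])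
   (auto simp: radial_push_squash squash_inject dest: sym)
qed

lemma radial_push_range:
 assumes "0 <= \<rho>" "\<rho> <= 1"
 shows "0 <= radial_push \<rho> d" "radial_push \<rho> d <= 1" "radial_push \<rho> d = 0 \<longleftrightarrow> \<rho> = 0" "radial_push \<rho> d = 1 \<longleftrightarrow> \<rho> = 1"
proof -
 note sb = squash_bounds
 show "0 <= radial_push \<rho> d" "radial_push \<rho> d <= 1"
  using sb by (cases rule: unit_interval_cases[OF assms]; auto simp: radial_push_squash less_imp_le)+
 show "radial_push \<rho> d = 0 \<longleftrightarrow> \<rho> = 0" "radial_push \<rho> d = 1 \<longleftrightarrow> \<rho> = 1"
  using radial_push_inject[OF assms, of 0 d] radial_push_inject[OF assms, of 1 d] by auto
qed

lemma radial_push_surj: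
 assumes "0 <= r" "r <= 1" obtains \<rho> where "0 <= \<rho>" "\<rho> <= 1" "radial_push \<rho> d = r"
proof (cases rule: unit_interval_cases[OF assms])
 case (3 w)
 then show thesis using that[of "squash (w - d)"] squash_bounds[of "w - d"] by (simp add: radial_push_squash)
qed (use that[of 0] that[of 1] in auto)

lemma polar_eq_iff:
 assumes "0 <= \<rho>" "0 <= \<rho>'" and t: "t \<in> {\<alpha>..\<alpha> + 2 * pi}" "t' \<in> {\<alpha>..\<alpha> + 2 * pi}"
 shows "of_real \<rho> * cis t = of_real \<rho>' * cis t' \<longleftrightarrow>
  \<rho> = \<rho>' & (\<rho> = 0 | t = t' | t = \<alpha> & t' = \<alpha> + 2 * pi | t' = \<alpha> & t = \<alpha> + 2 * pi)"
proof
 assume eq: "of_real \<rho> * cis t = of_real \<rho>' * cis t'"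
 then have "norm (of_real \<rho> * cis t) = norm (of_real \<rho>' * cis t')" by simp
 then have "\<rho> = \<rho>'" using assms by (simp add: norm_mult)
 moreover have "t = t' | t = \<alpha> & t' = \<alpha> + 2 * pi | t' = \<alpha> & t = \<alpha> + 2 * pi" if "\<rho> ~= 0"
 proof -
  have "cis t = cis t'" using eq \<open>\<rho> = \<rho>'\<close> that by simp
  then have "sin t = sin t' & cos t = cos t'" by (simp add: complex_eq_iff)
  then obtain n :: int where n: "t = t' + 2 * pi * n" using sin_cos_eq_iff by blast
  have "\<bar>2 * pi * n\<bar> <= 2 * pi" using n t by auto
  then have "\<bar>real_of_int n\<bar> <= 1" by (simp add: abs_mult)
  then have "n = -1 | n = 0 | n = 1" by linarith
  then show ?thesis using n t by auto
 qed
 ultimately show "\<rho> = \<rho>' & (\<rho> = 0 | t = t' | t = \<alpha> & t' = \<alpha> + 2 * pi | t' = \<alpha> & t = \<alpha> + 2 * pi)" by blast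
next
 have "cis (\<alpha> + 2 * pi) = cis \<alpha>" by (simp flip: cis_mult)
 then show "of_real \<rho> * cis t = of_real \<rho>' * cis t'"
  if "\<rho> = \<rho>' & (\<rho> = 0 | t = t' | t = \<alpha> & t' = \<alpha> + 2 * pi | t' = \<alpha> & t = \<alpha> + 2 * pi)"
  using that by auto
qed

lemma polar_coordinates:
 obtains t where "\<alpha> <= t" "t < \<alpha> + 2 * pi" "u = of_real (norm u) * cis t"
proof -
 define z where "z = u * cis (- \<alpha>)"
 have "u = z * cis \<alpha>" by (simp add: z_def mult.assoc cis_mult)
 also have "z = of_real (norm z) * cis (Arg2pi z)" using Arg2pi[of z] by (simp add: is_Arg_def cis_conv_exp)
 finally have "u = of_real (norm u) * cis (Arg2pi z + \<alpha>)"
  by (simp add: z_def norm_mult mult.assoc cis_mult)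
 then show thesis using that[of "Arg2pi z + \<alpha>"] Arg2pi[of z] by simp
qed

lemma polar_coordinates_image:
 "(%(\<rho>, t). of_real \<rho> * cis t) ` ({0..1} \<times> {\<alpha>..\<alpha> + 2 * pi}) = cball 0 1"
proof (intro equalityI subsetI)
 fix u :: complex assume "u \<in> cball 0 1"
 moreover obtain t where "\<alpha> <= t" "t < \<alpha> + 2 * pi" "u = of_real (norm u) * cis t" by (rule polar_coordinates)
 ultimately show "u \<in> (%(\<rho>, t). of_real \<rho> * cis t) ` ({0..1} \<times> {\<alpha>..\<alpha> + 2 * pi})"
  by (intro image_eqI[of _ _ "(norm u, t)"]) auto
qed (auto simp: norm_mult)

text \<open>A map on the image of a compact set is continuous if its pull-back is, because a continuous surjection
of a compact set onto a Hausdorff space is a quotient map.\<close>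

lemma continuous_factor_compact:
 fixes \<Phi> :: "'a :: t2_space => 'b :: t2_space" and k :: "'a => 'c :: t2_space"
 assumes B: "compact B" and \<Phi>: "continuous_on B \<Phi>" and k: "continuous_on B k"
  and compat: "!!p q. p \<in> B ==> q \<in> B ==> \<Phi> p = \<Phi> q ==> k p = k q"
 obtains h where "continuous_on (\<Phi> ` B) h" "!!p. p \<in> B ==> h (\<Phi> p) = k p"
proof -
 define h where "h = (%u. k (SOME p. p \<in> B & \<Phi> p = u))"
 have h: "h (\<Phi> p) = k p" if "p \<in> B" for p
 proof -
  have "(SOME q. q \<in> B & \<Phi> q = \<Phi> p) \<in> B & \<Phi> (SOME q. q \<in> B & \<Phi> q = \<Phi> p) = \<Phi> p"
   by (rule someI[of _ p]) (use that in simp)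
  then show ?thesis using compat[of "SOME q. q \<in> B & \<Phi> q = \<Phi> p" p] that by (simp add: h_def)
 qed
 have cl: "closed (\<Phi> ` B)" using compact_continuous_image[OF \<Phi> B] compact_imp_closed by blast
 have "continuous_on (\<Phi> ` B) h"
  unfolding continuous_on_closed_vimage[OF cl]
 proof (intro allI impI)
  fix C :: "'c set" assume "closed C"
  then have "closed (k -` C \<inter> B)"
   using k continuous_on_closed_vimage[OF compact_imp_closed[OF B]] by blast
  then have "compact (k -` C \<inter> B)" using B by (metis compact_Int_closed inf.commute inf.left_idem)
  then have "compact (\<Phi> ` (k -` C \<inter> B))"
   using compact_continuous_image continuous_on_subset[OF \<Phi>] by (metis inf_le2)
  moreover have "\<Phi> ` (k -` C \<inter> B) = h -` C \<inter> \<Phi> ` B" using h by auto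
  ultimately show "closed (h -` C \<inter> \<Phi> ` B)" using compact_imp_closed by metis
 qed
 then show thesis using h that by blast
qed

section \<open>Portraits from sequences of nodes\<close>

text \<open>\<open>th\<close> lists the singular rays in order, repeating after \<open>l\<close> steps by the half turn; the numbering starts
so that the angular part is positive after even rays. The sign alternates because all zeros of the
angular part are sign changes, and \<open>l\<close> is odd because the angular part is odd under the half turn.\<close>

definition sectored :: "(complex => complex) => nat => (nat => real) => bool" where
 "sectored F l th \<longleftrightarrow> F \<in> hom_fields 2 & odd l & (\<forall>j. th j < th (Suc j)) & (\<forall>j. th (j + l) = th j + pi) &
   (\<forall>j. angular F (th j) = 0 & radial F (th j) ~= 0) &
   (\<forall>j x. th j < x & x < th (Suc j) --> 0 < (- 1) ^ j * angular F x)"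

text \<open>The factor \<open>(- 1) ^ j\<close> is the sign of the angular part just after the ray, so this says that the polar
blow-up of the origin has, topologically, a node there rather than a saddle.\<close>

definition node :: "(complex => complex) => (nat => real) => nat => bool" where
 "node F th j \<longleftrightarrow> 0 < (- 1) ^ j * radial F (th j)"

lemma sectoredD:
 assumes "sectored F l th"
 shows "F \<in> hom_fields 2" "odd l" "th j < th (Suc j)" "th (j + l) = th j + pi"
  "angular F (th j) = 0" "radial F (th j) ~= 0"
  "th j < x ==> x < th (Suc j) ==> 0 < (- 1) ^ j * angular F x"
  "th (2 * l) = th 0 + 2 * pi"
proof -
 note * = assms[unfolded sectored_def]
 have **: "\<forall>j. th j < th (Suc j)" "\<forall>j. th (j + l) = th j + pi" "\<forall>j. angular F (th j) = 0 & radial F (th j) ~= 0"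
  "\<forall>j x. th j < x & x < th (Suc j) --> 0 < (- 1) ^ j * angular F x"
  using * by blast+
 show "F \<in> hom_fields 2" "odd l" using * by blast+
 show "th j < th (Suc j)" by (rule spec[OF **(1)])
 show "th (j + l) = th j + pi" by (rule spec[OF **(2)])
 show "angular F (th j) = 0" by (rule conjunct1[OF spec[OF **(3)]])
 show "radial F (th j) ~= 0" by (rule conjunct2[OF spec[OF **(3)]])
 show "0 < (- 1) ^ j * angular F x" if "th j < x" "x < th (Suc j)"
  by (rule mp[OF spec[OF spec[OF **(4)]] conjI[OF that]])
 show "th (2 * l) = th 0 + 2 * pi"
  using spec[OF **(2), of l] spec[OF **(2), of 0] unfolding mult_2 add_0 by linarith
qed

lemma sign_power: "(- 1 :: real) ^ j = 1 | (- 1 :: real) ^ j = - 1"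
 by (cases "even j") auto

text \<open>At a node \<open>H\<close> diverges so that the orbits approach the origin, at a saddle they approach the boundary.\<close>

lemma sectored_antiderivative:
 assumes S: "sectored F l th"
 shows "\<exists>H. (\<forall>x. th j < x & x < th (Suc j) --> (H has_real_derivative radial F x / angular F x) (at x)) &
  end_behaviour (th j) (th (Suc j)) (if node F th j then 1 else -1) (if node F th (Suc j) then -1 else 1) H"
proof -
 define a b e where "a = th j" and "b = th (Suc j)" and "e = (- 1 :: real) ^ j"
 have e: "e = 1 | e = -1" unfolding e_def by (rule sign_power)
 note F = sectoredD(1)[OF S]
 have ab: "a < b" using sectoredD(3)[OF S] by (simp add: a_def b_def)
 have zero: "angular F a = 0" "angular F b = 0" "radial F a ~= 0" "radial F b ~= 0"
  using sectoredD(5,6)[OF S] by (auto simp: a_def b_def)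
 have pos: "0 < e * angular F x" if "a < x" "x < b" for x
  using sectoredD(7)[OF S] that by (simp add: a_def b_def e_def)
 obtain M where M: "0 < M" "!!x y. \<bar>angular F x - angular F y\<bar> <= M * \<bar>x - y\<bar>"
  using angular_lipschitz[OF F] by blast
 have bound: "0 < e * angular F x & e * angular F x <= M * (x - a)"
  "0 < e * angular F x & e * angular F x <= M * (b - x)" if "a < x" "x < b" for x
  using M(2)[of x a] M(2)[of x b] zero that e pos[OF that] by (auto simp: abs_le_iff)
 have cont: "isCont (radial F) x" "isCont (angular F) x" for x
  using continuous_radial_angular[OF F, of UNIV] by (auto simp: continuous_on_eq_continuous_at)
 have nz: "angular F x ~= 0" if "a < x" "x < b" for x using pos[OF that] by auto
 have "\<exists>H. \<forall>x. ereal a < ereal x --> ereal x < ereal b --> (H has_vector_derivative radial F x / angular F x) (at x)"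
  by (rule einterval_antiderivative) (use ab nz cont in \<open>auto intro!: continuous_divide\<close>)
 then obtain H where H: "!!x. a < x ==> x < b ==> (H has_real_derivative radial F x / angular F x) (at x)"
  by (auto simp: has_real_derivative_iff_has_vector_derivative)
 define s t where "s = e * sgn (radial F a)" and "t = e * sgn (radial F b)"
 have s: "s = (if node F th j then 1 else -1)"
  using e zero(3) unfolding s_def node_def a_def[symmetric] e_def[symmetric] by (auto simp: sgn_if)
 have t: "t = (if node F th (Suc j) then -1 else 1)"
  using e zero(4) unfolding t_def node_def b_def[symmetric] power_Suc e_def[symmetric] by (auto simp: sgn_if)
 have left: "(\<exists>a1>a. \<forall>x y. a < x & x < y & y < a1 --> s * H x < s * H y) & filterlim (%x. s * H x) at_bot (at_right a)"
  by (rule antiderivative_left_end[OF ab H e bound(1) M(1) cont(1) zero(3) s_def]) auto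
 have right: "(\<exists>b1<b. \<forall>x y. b1 < x & x < y & y < b --> t * H x < t * H y) & filterlim (%x. t * H x) at_top (at_left b)"
  by (rule antiderivative_right_end[OF ab H e bound(2) M(1) cont(1) zero(4) t_def]) auto
 have "isCont H x" if "a < x" "x < b" for x using H[OF that] by (rule DERIV_isCont)
 then have "end_behaviour a b s t H" using left right ab unfolding end_behaviour_def by blast
 then show ?thesis using H unfolding s t a_def b_def by blast
qed

lemma enclosing_index:
 fixes th :: "nat => real"
 assumes "th 0 <= x" "x < th n" obtains j where "j < n" "th j <= x" "x < th (Suc j)"
proof -
 have "\<exists>j<n. th j <= x & x < th (Suc j)" using assms
 proof (induction n)
  case (Suc n)
  then show ?case by (cases "x < th n") (auto intro: less_SucI simp: not_less)
 qed simp
 then show thesis using that by blast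
qed

lemma disk_trajectory_unique:
 assumes "F \<in> hom_fields 2" "disk_trajectory F \<gamma>" "disk_trajectory F \<delta>" "\<gamma> t = \<delta> t"
 shows "\<gamma> = \<delta>"
proof -
 obtain L where "L-lipschitz_on (cball 0 1) (poincare_field F)" using poincare_field_lipschitz[OF assms(1)] .
 then show ?thesis using assms trajectory_unique unfolding disk_trajectory_def by blast
qed

lemma disk_trajectory_const:
 assumes "poincare_field F u = 0" "u \<in> cball 0 1"
 shows "disk_trajectory F (%_. u)"
 using assms by (auto simp: disk_trajectory_def trajectory_on_def)

lemma singular_trajectory:
 assumes "F \<in> hom_fields 2" "disk_trajectory F \<gamma>" "poincare_field F (\<gamma> 0) = 0"
 shows "\<gamma> = (%_. \<gamma> 0)"
proof -
 have "\<gamma> 0 \<in> cball 0 1" using assms(2) unfolding disk_trajectory_def by blast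
 from disk_trajectory_unique[OF assms(1,2) disk_trajectory_const[OF assms(3) this], of 0] show ?thesis by simp
qed

lemma poincare_field_0: "F \<in> hom_fields 2 ==> poincare_field F 0 = 0"
 by (simp add: poincare_field_def hom_fields_2_zero)

lemma sectored_sector_arc:
 assumes S: "sectored F l th"
  and H: "!!x. th j < x ==> x < th (Suc j) ==> (H has_real_derivative radial F x / angular F x) (at x)"
 shows "flow_arc (poincare_field F) ((- 1) ^ j) (th j) (th (Suc j)) (%x. of_real (squash (w + H x)) * cis x)"
  "flow_arc (poincare_field F) ((- 1) ^ j) (th j) (th (Suc j)) (%x. of_real 1 * cis x)"
proof -
 note arc = sector_arc[OF sectoredD(1)[OF S] sectoredD(3)[OF S] sectoredD(5)[OF S] sectoredD(5)[OF S] sign_power sectoredD(7)[OF S]]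
 show "flow_arc (poincare_field F) ((- 1) ^ j) (th j) (th (Suc j)) (%x. of_real 1 * cis x)"
  by (rule arc) auto
 show "flow_arc (poincare_field F) ((- 1) ^ j) (th j) (th (Suc j)) (%x. of_real (squash (w + H x)) * cis x)"
 proof (rule arc)
  fix x assume x: "th j < x" "x < th (Suc j)"
  show "0 < squash (w + H x) & squash (w + H x) <= 1" using squash_bounds[of "w + H x"] by simp
  have "((%x. w + H x) has_real_derivative radial F x / angular F x) (at x)"
   using H[OF x] by (auto intro!: derivative_eq_intros)
  from DERIV_chain2[OF DERIV_squash this]
  show "((%x. squash (w + H x)) has_real_derivative
   squash (w + H x) * (1 - (squash (w + H x))\<^sup>2) * (radial F x / angular F x)) (at x)" .
 qed
qed

lemma sectored_ray_arc:
 assumes S: "sectored F l th"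
 shows "flow_arc (poincare_field F) (sgn (radial F (th j))) 0 1 (%\<rho>. of_real \<rho> * cis (th j))"
 using sectoredD(6)[OF S, of j] by (intro ray_arc[OF sectoredD(1,5)[OF S]]) (auto simp: sgn_if)

lemma arcs_in_disk:
 "(%x. of_real (squash (K x)) * cis x) ` A \<subseteq> cball 0 1" "(%x. of_real 1 * cis x) ` A \<subseteq> cball 0 1"
 "(%\<rho>. of_real \<rho> * cis th) ` {0<..<1} \<subseteq> cball 0 1"
 using squash_bounds(2) by (auto simp: norm_mult less_imp_le abs_of_pos[OF squash_bounds(1)])

lemma node_radial_sign:
 assumes "sectored F l th" "sectored G l' \<psi>" "node F th j \<longleftrightarrow> node G \<psi> j"
 shows "sgn (radial F (th j)) = sgn (radial G (\<psi> j))"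
 using assms(3) sectoredD(6)[OF assms(1), of j] sectoredD(6)[OF assms(2), of j] sign_power[of j]
 unfolding node_def by (auto simp: sgn_if)

text \<open>The homeomorphism maps angles by a change of variable \<open>\<phi>\<close> and radii by \<open>radial_push\<close> with the
correction \<open>d(\<theta>) = K(\<phi>(\<theta>)) - H(\<theta>)\<close>, which turns the orbit equation of one field into that of the
other. Equality of the node sequences makes the antiderivatives diverge in the same directions, so the
pieces fit together; rays and boundary arcs are mapped to rays and boundary arcs.\<close>

theorem sectored_equivalent:
 assumes S: "sectored F l th" and T: "sectored G l \<psi>" and nodes: "!!j. node F th j \<longleftrightarrow> node G \<psi> j"
 shows "same_phase_portrait F G"
proof -
 note F = sectoredD(1)[OF S] and G = sectoredD(1)[OF T]
 define s t where "s = (%j. if node F th j then 1 else -1 :: real)" and "t = (%j. if node F th (Suc j) then -1 else 1 :: real)"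
 have "\<exists>H. (\<forall>x. th j < x & x < th (Suc j) --> (H has_real_derivative radial F x / angular F x) (at x)) &
  end_behaviour (th j) (th (Suc j)) (s j) (t j) H" for j
  using sectored_antiderivative[OF S, of j] by (simp add: s_def t_def)
 then obtain H where H: "!!j x. th j < x ==> x < th (Suc j) ==> (H j has_real_derivative radial F x / angular F x) (at x)"
  "!!j. end_behaviour (th j) (th (Suc j)) (s j) (t j) (H j)" by metis
 have "\<exists>K. (\<forall>x. \<psi> j < x & x < \<psi> (Suc j) --> (K has_real_derivative radial G x / angular G x) (at x)) &
  end_behaviour (\<psi> j) (\<psi> (Suc j)) (s j) (t j) K" for j
  using sectored_antiderivative[OF T, of j] by (simp add: s_def t_def nodes)
 then obtain K where K: "!!j x. \<psi> j < x ==> x < \<psi> (Suc j) ==> (K j has_real_derivative radial G x / angular G x) (at x)"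
  "!!j. end_behaviour (\<psi> j) (\<psi> (Suc j)) (s j) (t j) (K j)" by metis
 have nz: "s j ~= 0" "t j ~= 0" for j by (auto simp: s_def t_def)
 obtain \<phi> d where mono: "strict_mono_on {th 0..th (2 * l)} \<phi>" and im: "\<phi> ` {th 0..th (2 * l)} = {\<psi> 0..\<psi> (2 * l)}"
  and contd: "continuous_on {th 0..th (2 * l)} d" and at': "\<forall>j\<le>2 * l. \<phi> (th j) = \<psi> j & d (th j) = 0"
  and sec': "\<forall>j<2 * l. \<phi> ` {th j<..<th (Suc j)} = {\<psi> j<..<\<psi> (Suc j)} &
    (\<forall>x\<in>{th j<..<th (Suc j)}. d x = K j (\<phi> x) - H j x)"
  using glued_sectors[where th = th and \<psi> = \<psi> and s = s and t = t and H = H and K = K and k = "2 * l", OF H(2) K(2) nz]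
  by (elim exE conjE)
 note at = at'[rule_format] and sec = sec'[rule_format]
 define \<alpha> \<beta> where "\<alpha> = th 0" and "\<beta> = \<psi> 0"
 have period: "th (2 * l) = \<alpha> + 2 * pi" "\<psi> (2 * l) = \<beta> + 2 * pi"
  using sectoredD(8)[OF S] sectoredD(8)[OF T] by (auto simp: \<alpha>_def \<beta>_def)
 define I J where "I = {\<alpha>..\<alpha> + 2 * pi}" and "J = {\<beta>..\<beta> + 2 * pi}"
 have I: "{th 0..th (2 * l)} = I" "{\<psi> 0..\<psi> (2 * l)} = J" by (auto simp: I_def J_def \<alpha>_def \<beta>_def period)
 note mono = mono[unfolded I] and im = im[unfolded I] and contd = contd[unfolded I]
 have ends: "\<phi> \<alpha> = \<beta>" "\<phi> (\<alpha> + 2 * pi) = \<beta> + 2 * pi" "d \<alpha> = 0" "d (\<alpha> + 2 * pi) = 0"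
  using at[of 0] at[of "2 * l"] period by (auto simp: \<alpha>_def \<beta>_def)
 have ab: "\<alpha> \<in> I" "\<alpha> + 2 * pi \<in> I" by (auto simp: I_def)
 have \<phi>_inj: "\<phi> x = \<phi> y \<longleftrightarrow> x = y" if "x \<in> I" "y \<in> I" for x y
  using strict_mono_on_imp_inj_on[OF mono] that by (auto simp: inj_on_def)
 define \<Phi> :: "real \<times> real => complex" where "\<Phi> = (%(\<rho>, t). of_real \<rho> * cis t)"
 define k where "k = (%(\<rho>, t). \<Phi> (radial_push \<rho> (d t), \<phi> t))"
 define B where "B = {0..1::real} \<times> I"
 have \<Phi>_image: "\<Phi> ` B = cball 0 1" unfolding \<Phi>_def B_def I_def by (rule polar_coordinates_image)
 have \<phi>_J: "\<phi> x \<in> J" if "x \<in> I" for x using im that by blast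
 have k_iff: "k p = k q \<longleftrightarrow> \<Phi> p = \<Phi> q" if "p \<in> B" "q \<in> B" for p q
 proof -
  obtain \<rho> x \<rho>' y where pq: "p = (\<rho>, x)" "q = (\<rho>', y)" by (metis surj_pair)
  then have r: "0 <= \<rho>" "\<rho> <= 1" "0 <= \<rho>'" "\<rho>' <= 1" and xy: "x \<in> I" "y \<in> I" using that by (auto simp: B_def)
  have "k p = k q \<longleftrightarrow> radial_push \<rho> (d x) = radial_push \<rho>' (d y) &
    (\<rho> = 0 | \<phi> x = \<phi> y | \<phi> x = \<beta> & \<phi> y = \<beta> + 2 * pi | \<phi> y = \<beta> & \<phi> x = \<beta> + 2 * pi)"
   using polar_eq_iff[of "radial_push \<rho> (d x)" "radial_push \<rho>' (d y)" "\<phi> x" \<beta> "\<phi> y"]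
    radial_push_range[OF r(1,2), of "d x"] radial_push_range[OF r(3,4), of "d y"] \<phi>_J xy
   by (simp add: k_def \<Phi>_def pq J_def)
  also have "\<dots> \<longleftrightarrow> radial_push \<rho> (d x) = radial_push \<rho>' (d y) & (\<rho> = 0 | x = y | x = \<alpha> & y = \<alpha> + 2 * pi | y = \<alpha> & x = \<alpha> + 2 * pi)"
   using \<phi>_inj xy ab ends by metis
  also have "\<dots> \<longleftrightarrow> \<rho> = \<rho>' & (\<rho> = 0 | x = y | x = \<alpha> & y = \<alpha> + 2 * pi | y = \<alpha> & x = \<alpha> + 2 * pi)"
   using radial_push_range(3)[OF r(3,4), of "d y"] radial_push_inject[OF r, of "d x"] ends by auto
  also have "\<dots> \<longleftrightarrow> \<Phi> p = \<Phi> q"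
   using polar_eq_iff[OF r(1,3), of x \<alpha> y] xy by (simp add: \<Phi>_def pq I_def)
  finally show ?thesis .
 qed
 have k_image: "k ` B = cball 0 1"
 proof (intro equalityI subsetI)
  fix v :: complex assume "v \<in> cball 0 1"
  also have "cball 0 1 = (%(\<rho>, t). of_real \<rho> * cis t) ` ({0..1} \<times> J)"
   unfolding J_def by (rule polar_coordinates_image[symmetric])
  finally obtain r y where v: "v = of_real r * cis y" "0 <= r" "r <= 1" "y \<in> J" by auto
  obtain x where x: "x \<in> I" "\<phi> x = y" using v(4) im by (metis imageE)
  obtain \<rho> where "0 <= \<rho>" "\<rho> <= 1" "radial_push \<rho> (d x) = r" using radial_push_surj[OF v(2,3)] .
  then show "v \<in> k ` B" using x v by (intro image_eqI[of _ _ "(\<rho>, x)"]) (auto simp: k_def \<Phi>_def B_def)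
 next
  fix v assume "v \<in> k ` B"
  then show "v \<in> cball 0 1" using radial_push_range by (auto simp: k_def \<Phi>_def B_def norm_mult)
 qed
 have cont_\<phi>: "continuous_on I \<phi>" using strict_mono_surj_continuous[of \<alpha> "\<alpha> + 2 * pi" \<phi>] mono im unfolding I_def J_def by blast
 have cont_k: "continuous_on B k"
 proof -
  have c: "continuous_on B (%p. d (snd p))" "continuous_on B (%p. \<phi> (snd p))"
   by (auto intro!: continuous_on_compose2[OF contd] continuous_on_compose2[OF cont_\<phi>] continuous_intros simp: B_def)
  have "(fst p)^2 + (1 - (fst p)\<^sup>2) * exp (- 2 * d (snd p)) > 0" if "p \<in> B" for p
   using radial_push_denominator[of "fst p"] that by (auto simp: B_def)
  then have "continuous_on B (%p. of_real (radial_push (fst p) (d (snd p))) * cis (\<phi> (snd p)))"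
   unfolding radial_push_def by (intro continuous_intros c) (auto simp: less_imp_neq[THEN not_sym])
  then show ?thesis by (simp add: k_def \<Phi>_def case_prod_beta')
 qed
 have comp: "compact B" by (auto simp: B_def I_def compact_Times)
 have cont_\<Phi>: "continuous_on B \<Phi>" unfolding \<Phi>_def case_prod_beta' by (intro continuous_intros)
 obtain h where h: "continuous_on (\<Phi> ` B) h" "!!p. p \<in> B ==> h (\<Phi> p) = k p"
  using continuous_factor_compact[OF comp cont_\<Phi> cont_k] k_iff by metis
 have "h ` cball 0 1 = k ` B" unfolding \<Phi>_image[symmetric] image_image using h(2) by (intro image_cong) auto
 then have him: "h ` cball 0 1 = cball 0 1" using k_image by simp
 have "inj_on h (cball 0 1)"
  unfolding \<Phi>_image[symmetric] inj_on_def using h(2) k_iff by auto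
 then obtain h' where homeo: "homeomorphism (cball 0 1) (cball 0 1) h h'"
  using homeomorphism_compact[OF compact_cball _ him] h(1) \<Phi>_image by metis
 have h_polar: "h (of_real \<rho> * cis x) = of_real (radial_push \<rho> (d x)) * cis (\<phi> x)" if "0 <= \<rho>" "\<rho> <= 1" "x \<in> I" for \<rho> x
  using h(2)[of "(\<rho>, x)"] that by (simp add: k_def \<Phi>_def B_def)
 have polar: "\<exists>\<rho> x. 0 <= \<rho> & \<rho> <= 1 & \<alpha> <= x & x < \<alpha> + 2 * pi & u = of_real \<rho> * cis x" if "u \<in> cball 0 1" for u :: complex
 proof -
  obtain x where "\<alpha> <= x" "x < \<alpha> + 2 * pi" "u = of_real (norm u) * cis x" by (rule polar_coordinates)
  then show ?thesis using that by (intro exI[of _ "norm u"] exI[of _ x]) auto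
 qed
 have norm_h: "norm (h u) = 1 \<longleftrightarrow> norm u = 1" if uin: "u \<in> cball 0 1" for u
 proof -
  obtain \<rho> x where u: "0 <= \<rho>" "\<rho> <= 1" "x \<in> I" "u = of_real \<rho> * cis x"
   using polar[OF uin] by (force simp: I_def)
  have "norm (h u) = radial_push \<rho> (d x)" unfolding u(4) h_polar[OF u(1-3)]
   using radial_push_range[OF u(1,2)] by (simp add: norm_mult)
  then show ?thesis using radial_push_range(4)[OF u(1,2)] u by (simp add: norm_mult)
 qed
 have "h ` sphere 0 1 = sphere 0 1"
 proof (intro equalityI subsetI)
  fix v :: complex assume v: "v \<in> sphere 0 1"
  then have "v \<in> h ` cball 0 1" unfolding him by simp
  then obtain u where "u \<in> cball 0 1" "v = h u" by blast
  then show "v \<in> h ` sphere 0 1" using norm_h[of u] v by auto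
 qed (use norm_h in auto)
 moreover have "\<exists>\<delta> \<tau>. disk_trajectory G \<delta> & strict_mono \<tau> & surj \<tau> & (\<forall>t. h (\<gamma> t) = \<delta> (1 * \<tau> t))"
  if tr: "disk_trajectory F \<gamma>" for \<gamma>
 proof -
  have tr': "trajectory_on UNIV (poincare_field F) \<gamma>" "range \<gamma> \<subseteq> cball 0 1" using tr by (auto simp: disk_trajectory_def)
  obtain L where L: "L-lipschitz_on (cball 0 1) (poincare_field F)" using poincare_field_lipschitz[OF F] .
  have "\<gamma> 0 \<in> cball 0 1" using tr'(2) by blast
  then obtain \<rho> x where u: "0 <= \<rho>" "\<rho> <= 1" "\<alpha> <= x" "x < \<alpha> + 2 * pi" "\<gamma> 0 = of_real \<rho> * cis x"
   using polar by blast
  have sing: ?thesis if "poincare_field F (\<gamma> 0) = 0" "poincare_field G (h (\<gamma> 0)) = 0"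
  proof -
   have "h (\<gamma> 0) \<in> cball 0 1" using him \<open>\<gamma> 0 \<in> cball 0 1\<close> by blast
   note \<delta> = disk_trajectory_const[OF that(2) this]
   have "h (\<gamma> t) = h (\<gamma> 0)" for t
    using fun_cong[OF singular_trajectory[OF F tr that(1)], of t] by (rule arg_cong)
   then have "\<forall>t. h (\<gamma> t) = (%_. h (\<gamma> 0)) (1 * id t)" by blast
   moreover have "strict_mono (id :: real => real)" by (simp add: strict_mono_def)
   ultimately show ?thesis using \<delta> surj_id by blast
  qed
  have match: ?thesis
   if "flow_arc (poincare_field F) e a b c" "flow_arc (poincare_field G) e a' b' c'" "e = 1 | e = -1"
    "c ` {a<..<b} \<subseteq> cball 0 1" "c' ` {a'<..<b'} \<subseteq> cball 0 1" "strict_mono_on {a<..<b} f" "f ` {a<..<b} = {a'<..<b'}"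
    "!!x. a < x ==> x < b ==> h (c x) = c' (f x)" "\<gamma> 0 \<in> c ` {a<..<b}" for e a b c a' b' c' f
   using flow_arc_matching[OF that(1-3) L that(4-8) tr' that(9)]
   unfolding disk_trajectory_def by simp
  obtain j where j: "j < 2 * l" "th j <= x" "x < th (Suc j)"
   using enclosing_index[of th x "2 * l"] u period by (auto simp: \<alpha>_def)
  have xI: "x \<in> I" using u by (simp add: I_def)
  have inc: "th i <= th j" if "i <= j" for i j
   using lift_Suc_mono_le[of th, OF less_imp_le[OF sectoredD(3)[OF S]] that] .
  consider "\<rho> = 0" | "\<rho> = 1" "x = th j" | "0 < \<rho>" "\<rho> < 1" "x = th j" | "\<rho> = 1" "th j < x" | "0 < \<rho>" "\<rho> < 1" "th j < x"
   using u j by linarith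
  then show ?thesis
  proof cases
   case 1
   have "h 0 = 0" using h_polar[of 0 \<alpha>] ab by simp
   then show ?thesis using 1 u(5) by (intro sing) (auto simp: poincare_field_0 F G)
  next
   case 2
   have "h (\<gamma> 0) = of_real 1 * cis (\<psi> j)" using h_polar[OF u(1,2) xI] 2 at[of j] j by (simp add: u(5))
   moreover have "\<gamma> 0 = of_real 1 * cis (th j)" using 2 u(5) by simp
   ultimately show ?thesis
    by (intro sing; simp only:; intro poincare_field_zero_iff[THEN iffD2] F G)
     (auto simp: sectoredD(5)[OF S] sectoredD(5)[OF T])
  next
   case 3
   have hray: "h (of_real r * cis (th j)) = of_real r * cis (\<psi> j)" if "0 < r" "r < 1" for r
    using h_polar[of r "th j"] that at[of j] j xI 3 radial_push_squash[of _ 0] squash_surj[OF that]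
    by (metis add.right_neutral less_imp_le)
   show ?thesis
    by (rule match[OF sectored_ray_arc[OF S, of j] sectored_ray_arc[OF T, of j, folded node_radial_sign[OF S T nodes]], of id])
     (use arcs_in_disk 3 u(5) hray sectoredD(6)[OF S, of j] in \<open>auto simp: strict_mono_on_def sgn_if\<close>)
  next
   case 4
   have in_I: "y \<in> I" if "th j < y" "y < th (Suc j)" for y
    using that inc[of 0 j] inc[of "Suc j" "2 * l"] j period by (auto simp: I_def \<alpha>_def)
   have mono_j: "strict_mono_on {th j<..<th (Suc j)} \<phi>"
    using mono in_I by (auto simp: strict_mono_on_def)
   show ?thesis
    by (rule match[OF sectored_sector_arc(2)[OF S H(1)] sectored_sector_arc(2)[OF T K(1)] sign_power _ _ mono_j conjunct1[OF sec[OF j(1)]]])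
     (use arcs_in_disk 4 j u(5) in_I h_polar[of 1] in auto)
  next
   case 5
   have in_I: "y \<in> I" if "th j < y" "y < th (Suc j)" for y
    using that inc[of 0 j] inc[of "Suc j" "2 * l"] j period by (auto simp: I_def \<alpha>_def)
   have mono_j: "strict_mono_on {th j<..<th (Suc j)} \<phi>"
    using mono in_I by (auto simp: strict_mono_on_def)
   obtain v where "\<rho> = squash v" using squash_surj[OF 5(1,2)] .
   define w where "w = v - H j x"
   have w: "\<rho> = squash (w + H j x)" using \<open>\<rho> = squash v\<close> by (simp add: w_def)
   show ?thesis
   proof (rule match[OF sectored_sector_arc(1)[where w = w and j = j, OF S H(1)] sectored_sector_arc(1)[where w = w and j = j, OF T K(1)] sign_power _ _ mono_j conjunct1[OF sec[OF j(1)]]])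
    show "\<gamma> 0 \<in> (%x. of_real (squash (w + H j x)) * cis x) ` {th j<..<th (Suc j)}"
     using u(5) w 5 j by auto
    fix y assume y: "th j < y" "y < th (Suc j)"
    have dy: "d y = K j (\<phi> y) - H j y" using sec[OF j(1)] y by auto
    show "h (of_real (squash (w + H j y)) * cis y) = of_real (squash (w + K j (\<phi> y))) * cis (\<phi> y)"
     using h_polar[of "squash (w + H j y)" y] in_I[OF y] squash_bounds[of "w + H j y"] by (simp add: radial_push_squash dy)
   qed (use arcs_in_disk in auto)
  qed
 qed
 ultimately show ?thesis
  unfolding same_phase_portrait_def using homeo by (intro exI[of _ h] exI[of _ h'] conjI bexI[of _ 1]) auto
qed

section \<open>Limits of orbits\<close>

lemma flow_arc_limits:
 assumes arc: "flow_arc X e a b c" and e: "e = 1 | e = -1" and lip: "L-lipschitz_on S X"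
  and S: "c ` {a<..<b} \<subseteq> S" and tr: "trajectory_on UNIV X \<gamma>" "range \<gamma> \<subseteq> S" and \<gamma>0: "\<gamma> 0 \<in> c ` {a<..<b}"
  and lims: "(c \<longlongrightarrow> p) (at_right a)" "(c \<longlongrightarrow> q) (at_left b)"
 shows "((%t. \<gamma> (e * t)) \<longlongrightarrow> q) at_top" "((%t. \<gamma> (e * t)) \<longlongrightarrow> p) at_bot" "range \<gamma> = c ` {a<..<b}"
proof -
 have ee: "e * (e * t) = t" for t using e by auto
 obtain y where y: "bij_betw y UNIV {a<..<b}" "strict_mono y" "(y \<longlongrightarrow> b) at_top" "(y \<longlongrightarrow> a) at_bot"
  "!!s. trajectory_on UNIV X (%t. c (y (e * t + s)))"
  using flow_arc_trajectory[OF arc] by metis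
 have y_in: "a < y t" "y t < b" for t using bij_betwE[OF y(1)] by auto
 obtain x0 where x0: "x0 \<in> {a<..<b}" "\<gamma> 0 = c x0" using \<gamma>0 by auto
 obtain s0 where s0: "y s0 = x0" using y(1) x0(1) unfolding bij_betw_def by (metis imageE)
 have \<gamma>: "\<gamma> = (%t. c (y (e * t + s0)))"
  by (rule trajectory_unique[OF lip tr(1) y(5) tr(2), of _ 0])
   (use S bij_betwE[OF y(1)] x0 s0 in auto)
 have \<gamma>e: "(%t. \<gamma> (e * t)) = (%t. c (y (t + s0)))" by (simp add: \<gamma> ee)
 have "filterlim y (at_left b) at_top" using y(3) y_in by (auto simp: filterlim_at less_imp_neq)
 then have "((%t. c (y t)) \<longlongrightarrow> q) at_top" by (rule filterlim_compose[OF lims(2)])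
 moreover have "filterlim (%t. t + s0) at_top at_top" by real_asymp
 ultimately show "((%t. \<gamma> (e * t)) \<longlongrightarrow> q) at_top" unfolding \<gamma>e by (rule filterlim_compose)
 have "filterlim y (at_right a) at_bot" using y(4) y_in by (auto simp: filterlim_at less_imp_neq[THEN not_sym])
 then have "((%t. c (y t)) \<longlongrightarrow> p) at_bot" by (rule filterlim_compose[OF lims(1)])
 moreover have "filterlim (%t. t + s0) at_bot at_bot" by real_asymp
 ultimately show "((%t. \<gamma> (e * t)) \<longlongrightarrow> p) at_bot" unfolding \<gamma>e by (rule filterlim_compose)
 have "range (%t. y (e * t + s0)) = range y"
 proof (intro equalityI subsetI)
  fix z assume "z \<in> range y"
  then obtain t where "z = y t" by auto
  then have "z = y (e * (e * (t - s0)) + s0)" by (simp add: ee)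
  then show "z \<in> range (%t. y (e * t + s0))" by blast
 qed auto
 then show "range \<gamma> = c ` {a<..<b}" using y(1) unfolding \<gamma> bij_betw_def by (metis image_image)
qed

definition end_point :: "(complex => complex) => (nat => real) => nat => complex" where
 "end_point F th j = (if node F th j then 0 else cis (th j))"

lemma cis_tendsto: "(cis \<longlongrightarrow> cis x) (at x within A)"
 using isCont_tendsto_compose continuous_on_cis[of UNIV "%x. x"]
 by (metis continuous_at_imp_continuous_at_within continuous_on_eq_continuous_at continuous_on_id continuous_within open_UNIV UNIV_I)

lemma sector_arc_limits:
 assumes S: "sectored F l th"
  and eb: "end_behaviour (th j) (th (Suc j)) (if node F th j then 1 else -1) (if node F th (Suc j) then -1 else 1) H"
 shows "((%x. of_real (squash (w + H x)) * cis x) \<longlongrightarrow> end_point F th j) (at_right (th j))"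
  "((%x. of_real (squash (w + H x)) * cis x) \<longlongrightarrow> end_point F th (Suc j)) (at_left (th (Suc j)))"
proof -
 have up: "((%x. of_real (squash (w + H x)) * cis x) \<longlongrightarrow> cis z) F'"
  if "filterlim H at_top F'" "(cis \<longlongrightarrow> cis z) F'" for F' z
 proof -
  have "filterlim (%x. w + H x) at_top F'"
   by (rule filterlim_compose[OF _ that(1)]) real_asymp
  from filterlim_compose[OF squash_limits(1) this]
  have "((%x. of_real (squash (w + H x)) * cis x) \<longlongrightarrow> of_real 1 * cis z) F'"
   by (intro tendsto_intros that(2))
  then show ?thesis by simp
 qed
 have down: "((%x. of_real (squash (w + H x)) * cis x) \<longlongrightarrow> 0) F'"
  if "filterlim H at_bot F'" "(cis \<longlongrightarrow> cis z) F'" for F' z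
 proof -
  have "filterlim (%x. w + H x) at_bot F'"
   by (rule filterlim_compose[OF _ that(1)]) real_asymp
  from filterlim_compose[OF squash_limits(2) this]
  have "((%x. of_real (squash (w + H x)) * cis x) \<longlongrightarrow> of_real 0 * cis z) F'"
   by (intro tendsto_intros that(2))
  then show ?thesis by simp
 qed
 note lim = eb[unfolded end_behaviour_def]
 show "((%x. of_real (squash (w + H x)) * cis x) \<longlongrightarrow> end_point F th j) (at_right (th j))"
 proof (cases "node F th j")
  case True
  then show ?thesis using lim down[OF _ cis_tendsto] by (simp add: end_point_def)
 next
  case False
  then have "filterlim H at_top (at_right (th j))" using lim by (simp add: filterlim_uminus_at_top)
  then show ?thesis using False up[OF _ cis_tendsto] by (simp add: end_point_def)
 qed
 show "((%x. of_real (squash (w + H x)) * cis x) \<longlongrightarrow> end_point F th (Suc j)) (at_left (th (Suc j)))"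
 proof (cases "node F th (Suc j)")
  case True
  then have "filterlim H at_bot (at_left (th (Suc j)))" using lim by (simp add: filterlim_uminus_at_bot)
  then show ?thesis using True down[OF _ cis_tendsto] by (simp add: end_point_def)
 next
  case False
  then show ?thesis using lim up[OF _ cis_tendsto] by (simp add: end_point_def)
 qed
qed

lemma ray_arc_limits:
 "((%\<rho>. of_real \<rho> * cis th) \<longlongrightarrow> 0) (at_right 0)" "((%\<rho>. of_real \<rho> * cis th) \<longlongrightarrow> cis th) (at_left 1)"
proof -
 have "((%\<rho>. of_real \<rho> * cis th) \<longlongrightarrow> of_real 0 * cis th) (at_right 0)"
  "((%\<rho>. of_real \<rho> * cis th) \<longlongrightarrow> of_real 1 * cis th) (at_left 1)" by (intro tendsto_intros)+
 then show "((%\<rho>. of_real \<rho> * cis th) \<longlongrightarrow> 0) (at_right 0)" "((%\<rho>. of_real \<rho> * cis th) \<longlongrightarrow> cis th) (at_left 1)"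
  by simp_all
qed

lemma disk_trajectory_on_arc:
 assumes F: "F \<in> hom_fields 2" and arc: "flow_arc (poincare_field F) e a b c" and e: "e = 1 | e = -1"
  and S: "c ` {a<..<b} \<subseteq> cball 0 1" and lims: "(c \<longlongrightarrow> p) (at_right a)" "(c \<longlongrightarrow> q) (at_left b)"
 shows "disk_trajectory F \<gamma> ==> \<gamma> 0 \<in> c ` {a<..<b} ==>
   ((%t. \<gamma> (e * t)) \<longlongrightarrow> q) at_top & ((%t. \<gamma> (e * t)) \<longlongrightarrow> p) at_bot & range \<gamma> = c ` {a<..<b}"
  and "\<exists>\<gamma>. disk_trajectory F \<gamma> & \<gamma> 0 \<in> c ` {a<..<b}"
proof -
 obtain L where L: "L-lipschitz_on (cball 0 1) (poincare_field F)" using poincare_field_lipschitz[OF F] .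
 show "((%t. \<gamma> (e * t)) \<longlongrightarrow> q) at_top & ((%t. \<gamma> (e * t)) \<longlongrightarrow> p) at_bot & range \<gamma> = c ` {a<..<b}"
  if "disk_trajectory F \<gamma>" "\<gamma> 0 \<in> c ` {a<..<b}"
 proof -
  have "trajectory_on UNIV (poincare_field F) \<gamma>" "range \<gamma> \<subseteq> cball 0 1"
   using that(1) by (auto simp: disk_trajectory_def)
  from flow_arc_limits[OF arc e L S this that(2) lims] show ?thesis by blast
 qed
 obtain y where y: "bij_betw y UNIV {a<..<b}" "!!s. trajectory_on UNIV (poincare_field F) (%t. c (y (e * t + s)))"
  using flow_arc_trajectory[OF arc] by metis
 have in_ab: "y t \<in> {a<..<b}" for t using bij_betwE[OF y(1)] by auto
 then have "disk_trajectory F (%t. c (y (e * t + 0)))" using y(2)[of 0] S by (auto simp: disk_trajectory_def)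
 then show "\<exists>\<gamma>. disk_trajectory F \<gamma> & \<gamma> 0 \<in> c ` {a<..<b}"
  using in_ab by (intro exI[of _ "%t. c (y (e * t + 0))"]) auto
qed

text \<open>Every point of the disk is the origin, on a singular ray, inside a sector or on the boundary circle,
and uniqueness keeps the whole trajectory there.\<close>

lemma disk_trajectory_cases:
 assumes S: "sectored F l th" and tr: "disk_trajectory F \<gamma>"
 obtains (const) "\<gamma> = (%_. \<gamma> 0)"
 | (ray) j where "j < 2 * l" "((%t. \<gamma> (sgn (radial F (th j)) * t)) \<longlongrightarrow> cis (th j)) at_top"
   "((%t. \<gamma> (sgn (radial F (th j)) * t)) \<longlongrightarrow> 0) at_bot" "range \<gamma> = (%\<rho>. of_real \<rho> * cis (th j)) ` {0<..<1}"
 | (sector) j where "((%t. \<gamma> ((- 1) ^ j * t)) \<longlongrightarrow> end_point F th (Suc j)) at_top"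
   "((%t. \<gamma> ((- 1) ^ j * t)) \<longlongrightarrow> end_point F th j) at_bot"
 | (circle) j where "((%t. \<gamma> ((- 1) ^ j * t)) \<longlongrightarrow> cis (th (Suc j))) at_top"
   "((%t. \<gamma> ((- 1) ^ j * t)) \<longlongrightarrow> cis (th j)) at_bot"
proof -
 note F = sectoredD(1)[OF S]
 obtain x where x: "th 0 <= x" "x < th 0 + 2 * pi" "\<gamma> 0 = of_real (norm (\<gamma> 0)) * cis x" by (rule polar_coordinates)
 define \<rho> where "\<rho> = norm (\<gamma> 0)"
 have "\<gamma> 0 \<in> cball 0 1" using tr unfolding disk_trajectory_def by blast
 then have \<rho>: "0 <= \<rho>" "\<rho> <= 1" by (auto simp: \<rho>_def)
 have \<gamma>0: "\<gamma> 0 = of_real \<rho> * cis x" using x(3) unfolding \<rho>_def .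
 obtain j where j: "j < 2 * l" "th j <= x" "x < th (Suc j)"
  using enclosing_index[of th x "2 * l"] x sectoredD(8)[OF S] by auto
 consider "\<rho> = 0" | "\<rho> = 1" "x = th j" | "0 < \<rho>" "\<rho> < 1" "x = th j" | "\<rho> = 1" "th j < x" | "0 < \<rho>" "\<rho> < 1" "th j < x"
  using \<rho> j by linarith
 then show thesis
 proof cases
  case 1
  then show thesis using const singular_trajectory[OF F tr] \<gamma>0 by (simp add: poincare_field_0[OF F])
 next
  case 2
  have "poincare_field F (of_real 1 * cis x) = 0"
   using poincare_field_zero_iff[OF F, of 1 x] 2 sectoredD(5)[OF S] by simp
  then show thesis using const singular_trajectory[OF F tr] \<gamma>0 2 by simp
 next
  case 3
  have "\<gamma> 0 \<in> (%\<rho>. of_real \<rho> * cis (th j)) ` {0<..<1}" using 3 \<gamma>0 by auto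
  from disk_trajectory_on_arc(1)[OF F sectored_ray_arc[OF S] _ arcs_in_disk(3) ray_arc_limits tr this] sectoredD(6)[OF S, of j]
  show thesis using ray[OF j(1)] by (auto simp: sgn_if)
 next
  case 4
  obtain H where H: "!!x. th j < x ==> x < th (Suc j) ==> (H has_real_derivative radial F x / angular F x) (at x)"
   using sectored_antiderivative[OF S, of j] by blast
  have m: "\<gamma> 0 \<in> (%x. of_real 1 * cis x) ` {th j<..<th (Suc j)}" using 4 j \<gamma>0 by auto
  have lim: "((%x. of_real 1 * cis x) \<longlongrightarrow> cis z) (at z within A)" for z A using cis_tendsto by simp
  have arc0: "flow_arc (poincare_field F) ((- 1) ^ j) (th j) (th (Suc j)) (%x. of_real 1 * cis x)"
   by (rule sectored_sector_arc(2)[OF S]) (rule H)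
  from disk_trajectory_on_arc(1)[OF F arc0 sign_power arcs_in_disk(2) lim lim tr m]
  show thesis using circle by blast
 next
  case 5
  obtain H where H: "!!x. th j < x ==> x < th (Suc j) ==> (H has_real_derivative radial F x / angular F x) (at x)"
   and eb: "end_behaviour (th j) (th (Suc j)) (if node F th j then 1 else -1) (if node F th (Suc j) then -1 else 1) H"
   using sectored_antiderivative[OF S, of j] by blast
  obtain v where v: "\<rho> = squash v" using squash_surj[OF 5(1,2)] .
  have m: "\<gamma> 0 \<in> (%y. of_real (squash (v - H x + H y)) * cis y) ` {th j<..<th (Suc j)}"
   using 5 j \<gamma>0 v by (intro image_eqI[of _ _ x]) auto
  have arc0: "flow_arc (poincare_field F) ((- 1) ^ j) (th j) (th (Suc j)) (%y. of_real (squash (v - H x + H y)) * cis y)"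
   by (rule sectored_sector_arc(1)[OF S]) (rule H)
  from disk_trajectory_on_arc(1)[OF F arc0 sign_power arcs_in_disk(1) sector_arc_limits[OF S eb] tr m]
  show thesis using sector by blast
 qed
qed

text \<open>An orbit that leaves the origin and returns to it.\<close>

definition homoclinic_orbit :: "(complex => complex) => bool" where
 "homoclinic_orbit F \<longleftrightarrow> (\<exists>\<gamma>. disk_trajectory F \<gamma> & \<gamma> 0 ~= 0 & (\<gamma> \<longlongrightarrow> 0) at_top & (\<gamma> \<longlongrightarrow> 0) at_bot)"

text \<open>Two different orbits that join the origin to the same point at infinity, in the same direction.\<close>

definition twin_orbits :: "(complex => complex) => bool" where
 "twin_orbits F \<longleftrightarrow> (\<exists>\<gamma> \<delta> p e. disk_trajectory F \<gamma> & disk_trajectory F \<delta> & \<gamma> 0 \<notin> range \<delta> & norm p = 1 & (e = 1 | e = -1) &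
   ((%t. \<gamma> (e * t)) \<longlongrightarrow> p) at_top & ((%t. \<gamma> (e * t)) \<longlongrightarrow> 0) at_bot &
   ((%t. \<delta> (e * t)) \<longlongrightarrow> p) at_top & ((%t. \<delta> (e * t)) \<longlongrightarrow> 0) at_bot)"

lemma sign_flip_limits:
 fixes \<gamma> :: "real => complex"
 assumes "e = 1 | e = - 1" "((%t. \<gamma> (e * t)) \<longlongrightarrow> q) at_top" "((%t. \<gamma> (e * t)) \<longlongrightarrow> p) at_bot"
 shows "e = 1 ==> (\<gamma> \<longlongrightarrow> q) at_top & (\<gamma> \<longlongrightarrow> p) at_bot"
  and "e = - 1 ==> (\<gamma> \<longlongrightarrow> p) at_top & (\<gamma> \<longlongrightarrow> q) at_bot"
proof -
 show "(\<gamma> \<longlongrightarrow> q) at_top & (\<gamma> \<longlongrightarrow> p) at_bot" if "e = 1"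
  using assms(2,3) unfolding that mult_1 by blast
 show "(\<gamma> \<longlongrightarrow> p) at_top & (\<gamma> \<longlongrightarrow> q) at_bot" if "e = - 1"
  using assms(2)[unfolded at_top_mirror filterlim_filtermap] assms(3)[unfolded at_bot_mirror filterlim_filtermap]
  unfolding that mult_minus1 minus_minus by blast
qed

lemma sign_match:
 fixes \<gamma> :: "real => complex"
 assumes e: "e = 1 | e = (- 1 :: real)" "e' = 1 | e' = (- 1 :: real)"
  and l1: "((%t. \<gamma> (e * t)) \<longlongrightarrow> q) at_top" "((%t. \<gamma> (e * t)) \<longlongrightarrow> p) at_bot"
  and l2: "((%t. \<gamma> (e' * t)) \<longlongrightarrow> q') at_top" "((%t. \<gamma> (e' * t)) \<longlongrightarrow> p') at_bot"
 shows "q' = q & p' = p & e = e' | q' = p & p' = q & e = - e'"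
proof -
 have top: "u = v" if "(\<gamma> \<longlongrightarrow> u) at_top" "(\<gamma> \<longlongrightarrow> v) at_top" for u v
  by (rule tendsto_unique[OF trivial_limit_at_top_linorder that])
 have bot: "u = v" if "(\<gamma> \<longlongrightarrow> u) at_bot" "(\<gamma> \<longlongrightarrow> v) at_bot" for u v
  by (rule tendsto_unique[OF trivial_limit_at_bot_linorder that])
 note f = sign_flip_limits[OF e(1) l1] and f' = sign_flip_limits[OF e(2) l2]
 consider "e = 1" "e' = 1" | "e = 1" "e' = -1" | "e = -1" "e' = 1" | "e = -1" "e' = -1" using e by blast
 then show ?thesis
 proof cases
  case 1
  from f(1)[OF 1(1)] f'(1)[OF 1(2)] show ?thesis using 1 top[of q' q] bot[of p' p] by simp
 next
  case 2
  from f(1)[OF 2(1)] f'(2)[OF 2(2)] show ?thesis using 2 top[of p' q] bot[of q' p] by simp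
 next
  case 3
  from f(2)[OF 3(1)] f'(1)[OF 3(2)] show ?thesis using 3 top[of q' p] bot[of p' q] by simp
 next
  case 4
  from f(2)[OF 4(1)] f'(2)[OF 4(2)] show ?thesis using 4 top[of p' p] bot[of q' q] by simp
 qed
qed

text \<open>An orbit in a sector starts and ends at the origin exactly if both bounding rays are nodes; all other
orbits have an end on the boundary.\<close>

lemma homoclinic_orbit_iff:
 assumes S: "sectored F l th"
 shows "homoclinic_orbit F \<longleftrightarrow> (\<exists>j. node F th j & node F th (Suc j))"
proof
 note F = sectoredD(1)[OF S]
 assume "\<exists>j. node F th j & node F th (Suc j)"
 then obtain j where j: "node F th j" "node F th (Suc j)" by blast
 obtain H where H: "!!x. th j < x ==> x < th (Suc j) ==> (H has_real_derivative radial F x / angular F x) (at x)"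
  and eb: "end_behaviour (th j) (th (Suc j)) (if node F th j then 1 else -1) (if node F th (Suc j) then -1 else 1) H"
  using sectored_antiderivative[OF S, of j] by blast
 have arc0: "flow_arc (poincare_field F) ((- 1) ^ j) (th j) (th (Suc j)) (%x. of_real (squash (0 + H x)) * cis x)"
  by (rule sectored_sector_arc(1)[OF S]) (rule H)
 note arc = disk_trajectory_on_arc[OF F arc0 sign_power arcs_in_disk(1) sector_arc_limits[OF S eb]]
 obtain \<gamma> where \<gamma>: "disk_trajectory F \<gamma>" "\<gamma> 0 \<in> (%x. of_real (squash (0 + H x)) * cis x) ` {th j<..<th (Suc j)}"
  using arc(2) by blast
 have "\<gamma> 0 ~= 0" using \<gamma>(2) squash_bounds(1) by (auto simp: less_imp_neq[THEN not_sym])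
 moreover have "((%t. \<gamma> ((- 1) ^ j * t)) \<longlongrightarrow> 0) at_top" "((%t. \<gamma> ((- 1) ^ j * t)) \<longlongrightarrow> 0) at_bot"
  using arc(1)[OF \<gamma>] j by (auto simp: end_point_def)
 from sign_flip_limits[OF sign_power this] have "(\<gamma> \<longlongrightarrow> 0) at_top & (\<gamma> \<longlongrightarrow> 0) at_bot"
  using sign_power[of j] by blast
 ultimately show "homoclinic_orbit F" using \<gamma>(1) unfolding homoclinic_orbit_def by blast
next
 assume "homoclinic_orbit F"
 then obtain \<gamma> where \<gamma>: "disk_trajectory F \<gamma>" "\<gamma> 0 ~= 0" "((%t. \<gamma> (1 * t)) \<longlongrightarrow> 0) at_top" "((%t. \<gamma> (1 * t)) \<longlongrightarrow> 0) at_bot"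
  unfolding homoclinic_orbit_def by auto
 have e1: "(1 :: real) = 1 | (1 :: real) = -1" by simp
 show "\<exists>j. node F th j & node F th (Suc j)"
 proof (cases rule: disk_trajectory_cases[OF S \<gamma>(1), case_names const ray sector circle])
  case const
  have "((%t. \<gamma> 0) \<longlongrightarrow> 0) (at_top :: real filter)" using \<gamma>(3) by (subst (asm) const) simp
  then show ?thesis using \<gamma>(2) by (simp add: tendsto_const_iff)
 next
  case (ray j)
  have "sgn (radial F (th j)) = 1 | sgn (radial F (th j)) = -1" using sectoredD(6)[OF S, of j] by (auto simp: sgn_if)
  from sign_match[OF e1 this \<gamma>(3,4) ray(2,3)] show ?thesis by auto
 next
  case (sector j)
  from sign_match[OF e1 sign_power \<gamma>(3,4) sector] show ?thesis by (auto simp: end_point_def split: if_splits)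
 next
  case (circle j)
  from sign_match[OF e1 sign_power \<gamma>(3,4) circle] show ?thesis by auto
 qed
qed

lemma sectored_strict_mono:
 assumes "sectored F l th" shows "strict_mono th"
 using sectoredD(3)[OF assms] by (simp add: strict_mono_Suc_iff)

lemma sectored_cis_inject:
 assumes S: "sectored F l th" and "i < 2 * l" "j < 2 * l" "cis (th i) = cis (th j)"
 shows "i = j"
proof -
 note mono = sectored_strict_mono[OF S]
 have "th 0 <= th k" "th k < th 0 + 2 * pi" if "k < 2 * l" for k
  using that mono sectoredD(8)[OF S] by (metis le0 strict_mono_less_eq, metis strict_mono_less)
 then have "th i = th j"
  using polar_eq_iff[of 1 1 "th i" "th 0" "th j"] assms(2-4) by (force simp: less_imp_le)
 then show ?thesis using mono by (simp add: strict_mono_eq)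
qed

text \<open>A saddle ray next to a node is accompanied by the orbits of the sector between them, which join the
origin to the same boundary point as the orbit on the saddle ray.\<close>

lemma twin_orbits_if:
 assumes S: "sectored F l th" and j: "node F th j" "\<not> node F th (Suc j)"
 shows "twin_orbits F"
proof -
 note F = sectoredD(1)[OF S]
 obtain H where H: "!!x. th j < x ==> x < th (Suc j) ==> (H has_real_derivative radial F x / angular F x) (at x)"
  and eb: "end_behaviour (th j) (th (Suc j)) (if node F th j then 1 else -1) (if node F th (Suc j) then -1 else 1) H"
  using sectored_antiderivative[OF S, of j] by blast
 have arc0: "flow_arc (poincare_field F) ((- 1) ^ j) (th j) (th (Suc j)) (%x. of_real (squash (0 + H x)) * cis x)"
  by (rule sectored_sector_arc(1)[OF S]) (rule H)
 note arc = disk_trajectory_on_arc[OF F arc0 sign_power arcs_in_disk(1) sector_arc_limits[OF S eb]]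
 obtain \<gamma> where \<gamma>: "disk_trajectory F \<gamma>" "\<gamma> 0 \<in> (%x. of_real (squash (0 + H x)) * cis x) ` {th j<..<th (Suc j)}"
  using arc(2) by blast
 have e: "sgn (radial F (th (Suc j))) = (- 1) ^ j"
  using j(2) sectoredD(6)[OF S, of "Suc j"] sign_power[of j] unfolding node_def by (auto simp: sgn_if)
 note ray = sectored_ray_arc[OF S, of "Suc j", unfolded e]
 note arc' = disk_trajectory_on_arc[OF F ray sign_power arcs_in_disk(3) ray_arc_limits]
 obtain \<delta> where \<delta>: "disk_trajectory F \<delta>" "\<delta> 0 \<in> (%\<rho>. of_real \<rho> * cis (th (Suc j))) ` {0<..<1}"
  using arc'(2) by blast
 have "\<gamma> 0 \<notin> range \<delta>"
 proof
  assume "\<gamma> 0 \<in> range \<delta>"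
  then obtain \<rho> where \<rho>: "0 < \<rho>" "\<gamma> 0 = of_real \<rho> * cis (th (Suc j))" using arc'(1)[OF \<delta>] by auto
  obtain x where x: "th j < x" "x < th (Suc j)" "\<gamma> 0 = of_real (squash (H x)) * cis x" using \<gamma>(2) by auto
  have "of_real (squash (H x)) * (cis x * cis (- x)) = of_real \<rho> * (cis (th (Suc j)) * cis (- x))"
   using x(3) \<rho>(2) by (metis mult.assoc)
  then have eq: "of_real (squash (H x)) = of_real \<rho> * cis (th (Suc j) - x)" by (simp add: cis_mult)
  have "Suc j <= j + l" using sectoredD(2)[OF S] by (cases l) auto
  then have "th (Suc j) <= th (j + l)" by (rule strict_mono_leD[OF sectored_strict_mono[OF S]])
  then have "0 < sin (th (Suc j) - x)" using x sectoredD(4)[OF S, of j] by (intro sin_gt_zero) auto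
  moreover have "\<rho> * sin (th (Suc j) - x) = 0" using arg_cong[OF eq, of Im] by simp
  ultimately show False using \<rho>(1) by simp
 qed
 note off = this
 show ?thesis
  unfolding twin_orbits_def
  using off arc(1)[OF \<gamma>] arc'(1)[OF \<delta>] j \<gamma>(1) \<delta>(1) sign_power[of j]
  by - (rule exI[of _ \<gamma>], rule exI[of _ \<delta>], rule exI[of _ "cis (th (Suc j))"], rule exI[of _ "(- 1) ^ j"],
   simp add: end_point_def)
qed

text \<open>Without nodes the sectors contain no orbit ending at the origin, so only the rays remain, and different
rays end at different points.\<close>

lemma no_twin_orbits:
 assumes S: "sectored F l th" and no: "!!j. \<not> node F th j"
 shows "\<not> twin_orbits F"
proof
 assume "twin_orbits F"
 then obtain \<gamma> \<delta> p e where *: "disk_trajectory F \<gamma>" "disk_trajectory F \<delta>" "\<gamma> 0 \<notin> range \<delta>" "norm p = 1" "e = 1 | e = -1"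
  "((%t. \<gamma> (e * t)) \<longlongrightarrow> p) at_top" "((%t. \<gamma> (e * t)) \<longlongrightarrow> 0) at_bot"
  "((%t. \<delta> (e * t)) \<longlongrightarrow> p) at_top" "((%t. \<delta> (e * t)) \<longlongrightarrow> 0) at_bot"
  unfolding twin_orbits_def by blast
 have p: "p ~= 0" using *(4) by auto
 have ray: "\<exists>j<2 * l. p = cis (th j) & range \<alpha> = (%\<rho>. of_real \<rho> * cis (th j)) ` {0<..<1}"
  if \<alpha>: "disk_trajectory F \<alpha>" "((%t. \<alpha> (e * t)) \<longlongrightarrow> p) at_top" "((%t. \<alpha> (e * t)) \<longlongrightarrow> 0) at_bot" for \<alpha>
 proof (cases rule: disk_trajectory_cases[OF S \<alpha>(1), case_names const ray sector circle])
  case const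
  have "(%t. \<alpha> (e * t)) = (%_. \<alpha> 0)" by (rule ext) (rule fun_cong[OF const])
  from \<alpha>(2,3)[unfolded this] show ?thesis using p by (simp add: tendsto_const_iff)
 next
  case (ray j)
  have "sgn (radial F (th j)) = 1 | sgn (radial F (th j)) = -1" using sectoredD(6)[OF S, of j] by (auto simp: sgn_if)
  from sign_match[OF *(5) this \<alpha>(2,3) ray(2,3)] show ?thesis using p ray(1,4) by auto
 next
  case (sector j)
  from sign_match[OF *(5) sign_power \<alpha>(2,3) sector] show ?thesis using no by (auto simp: end_point_def)
 next
  case (circle j)
  from sign_match[OF *(5) sign_power \<alpha>(2,3) circle] show ?thesis by auto
 qed
 obtain i where i: "i < 2 * l" "p = cis (th i)" "range \<gamma> = (%\<rho>. of_real \<rho> * cis (th i)) ` {0<..<1}" using ray[OF *(1,6,7)] by blast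
 obtain j where j: "j < 2 * l" "p = cis (th j)" "range \<delta> = (%\<rho>. of_real \<rho> * cis (th j)) ` {0<..<1}" using ray[OF *(2,8,9)] by blast
 have "i = j" using sectored_cis_inject[OF S i(1) j(1)] i(2) j(2) by simp
 then show False using i(3) j(3) *(3) by blast
qed

section \<open>The index of a sectored field\<close>

lemma exp_lift_constant:
 fixes D :: "real => complex"
 assumes S: "connected S" "continuous_on S D" "!!x. x \<in> S ==> exp (D x) = 1" and xy: "x \<in> S" "y \<in> S"
 shows "D x = D y"
proof -
 have "D constant_on S"
 proof (rule continuous_discrete_range_constant[OF S(1,2)])
  fix x assume x: "x \<in> S"
  have "2 * pi <= norm (D y - D x)" if y: "y \<in> S" "D y ~= D x" for y
  proof -
   have "exp (D y - D x) = 1" using S(3)[OF x] S(3)[OF y(1)] by (simp add: exp_diff)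
   then obtain n :: int where n: "Re (D y - D x) = 0" "Im (D y - D x) = of_int (2 * n) * pi"
    unfolding exp_eq_1 by blast
   have eq: "D y - D x = of_real (of_int (2 * n) * pi) * \<i>" using n by (simp add: complex_eq_iff)
   then have "n ~= 0" using y by auto
   then have "1 <= \<bar>real_of_int n\<bar>" by linarith
   then show ?thesis unfolding eq by (simp add: norm_mult abs_mult)
  qed
  then show "\<exists>e>0. \<forall>y. y \<in> S & D y ~= D x --> e <= norm (D y - D x)"
   by (intro exI[of _ "2 * pi"]) auto
 qed
 then show ?thesis using xy by (auto simp: constant_on_def)
qed

lemma winding_number_exp_path:
 fixes a :: "real => real"
 assumes a: "continuous_on {0..1} a" and n: "a 1 - a 0 = 2 * pi * of_int n"
 shows "winding_number (%t. exp (\<i> * of_real (a t))) 0 = of_int n"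
proof -
 define q where "q = (%t. \<i> * of_real (a t))"
 define l where "l = linepath (\<i> * of_real (a 0)) (\<i> * of_real (a 1))"
 have "path q" unfolding path_def q_def by (intro continuous_intros a)
 have "homotopic_paths UNIV q l"
 proof (rule homotopic_paths_linear[OF \<open>path q\<close>])
  show "path l" by (simp add: l_def)
  show "pathstart l = pathstart q" unfolding l_def pathstart_linepath by (simp add: q_def pathstart_def)
  show "pathfinish l = pathfinish q" unfolding l_def pathfinish_linepath by (simp add: q_def pathfinish_def)
 qed simp
 then have hom: "homotopic_paths (- {0}) (exp \<circ> q) (exp \<circ> l)"
  by (rule homotopic_paths_continuous_image) (auto intro: continuous_intros)
 have l: "l t = \<i> * of_real (a 0 + t * (2 * pi * of_int n))" for t
 proof -
  have "a 1 = a 0 + 2 * pi * of_int n" using n by simp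
  then show ?thesis by (simp add: l_def linepath_def complex_eq_iff algebra_simps)
 qed
 have der: "((exp \<circ> l) has_vector_derivative (\<i> * of_real (2 * pi * of_int n)) * exp (l t)) (at t)" for t
 proof -
  have "(l has_vector_derivative \<i> * of_real (2 * pi * of_int n)) (at t)"
   unfolding l by (auto intro!: derivative_eq_intros simp: has_vector_derivative_complex_iff)
  then show ?thesis
   by (rule field_vector_diff_chain_at) (rule DERIV_exp)
 qed
 have valid: "valid_path (exp \<circ> l)"
  unfolding l_def by (rule valid_path_compose_holomorphic[of _ _ UNIV]) (auto intro!: holomorphic_on_exp)
 have "winding_number (exp \<circ> l) 0 = 1 / (2 * pi * \<i>) * contour_integral (exp \<circ> l) (%w. 1 / (w - 0))"
  by (rule winding_number_valid_path[OF valid]) (auto simp: path_image_def)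
 also have "contour_integral (exp \<circ> l) (%w. 1 / (w - 0)) = integral {0..1} (%t::real. \<i> * of_real (2 * pi * of_int n))"
  unfolding contour_integral_integral
  by (rule integral_cong) (simp add: vector_derivative_at[OF der])
 also have "1 / (2 * pi * \<i>) * \<dots> = of_int n" by simp
 finally have "winding_number (exp \<circ> l) 0 = of_int n" .
 moreover have "winding_number (exp \<circ> q) 0 = winding_number (exp \<circ> l) 0"
  by (rule winding_number_homotopic_paths[OF hom])
 ultimately show ?thesis by (simp add: q_def o_def)
qed

definition node_count :: "(complex => complex) => nat => (nat => real) => nat" where
 "node_count F l th = card {j. j < l & node F th j}"

lemma node_periodic:
 assumes S: "sectored F l th" shows "node F th (j + l) \<longleftrightarrow> node F th j"
proof -
 have "(- 1 :: real) ^ (j + l) = - ((- 1) ^ j)" using sectoredD(2)[OF S] by (simp add: power_add)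
 then show ?thesis unfolding node_def sectoredD(4)[OF S] radial_angular_add_pi[OF sectoredD(1)[OF S]] by simp
qed

lemma sectored_angular_zero:
 assumes S: "sectored F l th" and x: "th 0 <= x" "x < th n"
 shows "angular F x = 0 \<longleftrightarrow> (\<exists>j<n. x = th j)"
proof
 assume z: "angular F x = 0"
 obtain j where j: "j < n" "th j <= x" "x < th (Suc j)" using enclosing_index[of th x n] x by blast
 have "x = th j" using sectoredD(7)[OF S, of j x] j z by fastforce
 then show "\<exists>j<n. x = th j" using j by blast
qed (use sectoredD(5)[OF S] in auto)

lemma sectored_nonzero:
 assumes S: "sectored F l th" and z: "z ~= 0" shows "F z ~= 0"
proof -
 obtain x where x: "th 0 <= x" "x < th 0 + 2 * pi" "z = of_real (norm z) * cis x" by (rule polar_coordinates)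
 have "angular F x = 0 ==> radial F x ~= 0"
  using sectored_angular_zero[OF S, of x "2 * l"] x sectoredD(6,8)[OF S] by auto
 then show ?thesis using field_zero_iff[OF sectoredD(1)[OF S], of "norm z" x] z x(3) by auto
qed

text \<open>Across a sector the vector \<open>(radial, angular)\<close> moves inside a half plane from one end of its boundary line
to either end, so its argument changes by \<open>\<pi>\<close>, \<open>0\<close> or \<open>-\<pi>\<close> according to the types of the two rays.\<close>

lemma winding_on_sector:
 assumes S: "sectored F l th" and Q: "continuous_on UNIV Q" "!!x. Complex (radial F x) (angular F x) = exp (Q x)"
 shows "Im (Q (th (Suc j)) - Q (th j)) = pi * (of_bool (node F th j) + of_bool (node F th (Suc j)) - 1)"
proof -
 define e where "e = (- 1 :: real) ^ j"
 have e: "e = 1 | e = -1" unfolding e_def by (rule sign_power)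
 note F = sectoredD(1)[OF S]
 define a b where "a = th j" and "b = th (Suc j)"
 have ab: "a < b" using sectoredD(3)[OF S] by (simp add: a_def b_def)
 have zero: "angular F a = 0" "angular F b = 0" "radial F a ~= 0" "radial F b ~= 0"
  using sectoredD(5,6)[OF S] by (auto simp: a_def b_def)
 have pos: "0 < e * angular F x" if "a < x" "x < b" for x
  using sectoredD(7)[OF S] that by (simp add: a_def b_def e_def)
 define k where "k = (%x. Complex (e * angular F x) (- e * radial F x))"
 have off: "k x \<notin> \<real>\<^sub>\<le>\<^sub>0" if "x \<in> {a..b}" for x
 proof -
  consider "x = a" | "x = b" | "a < x" "x < b" using \<open>x \<in> {a..b}\<close> by force
  then show ?thesis using zero pos[of x] e by cases (auto simp: k_def complex_nonpos_Reals_iff)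
 qed
 have cont_k: "continuous_on A k" for A
  unfolding k_def complex_eq_iff Complex_eq
  by (intro continuous_intros continuous_radial_angular[OF F])
 define D where "D = (%x. Q x - (Ln (k x) + \<i> * of_real (e * pi / 2)))"
 have "continuous_on {a..b} D"
  unfolding D_def by (intro continuous_intros continuous_on_Ln cont_k continuous_on_subset[OF Q(1)] off) auto
 moreover have "exp (D x) = 1" if "x \<in> {a..b}" for x
 proof -
  have "k x ~= 0" using off[OF that] by auto
  have "exp (\<i> * of_real (e * pi / 2)) = cis (e * pi / 2)" by (simp add: cis_conv_exp)
  also have "\<dots> = of_real e * \<i>" using e by (auto simp: complex_eq_iff)
  finally have "exp (Ln (k x) + \<i> * of_real (e * pi / 2)) = k x * (of_real e * \<i>)"
   using \<open>k x ~= 0\<close> by (simp add: exp_add)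
  also have "\<dots> = Complex (radial F x) (angular F x)" using e by (auto simp: k_def complex_eq_iff)
  finally show ?thesis by (simp add: D_def exp_diff Q(2)[symmetric]) (metis Q(2) exp_not_eq_zero divide_self)
 qed
 ultimately have "D a = D b" using ab by (intro exp_lift_constant[of "{a..b}" D]) auto
 then have "Im (Q b - Q a) = Im (Ln (k b)) - Im (Ln (k a))" by (simp add: D_def complex_eq_iff)
 moreover have Im_Ln: "Im (Ln (k x)) = - sgn (e * radial F x) * pi / 2" if "angular F x = 0" "radial F x ~= 0" for x
 proof -
  have kx: "k x = of_real \<bar>radial F x\<bar> * (if 0 < e * radial F x then - \<i> else \<i>)"
   using that e by (auto simp: k_def complex_eq_iff abs_if)
  show ?thesis using e that unfolding kx
   by (auto simp: Ln_times_of_real sgn_if zero_less_mult_iff mult_less_0_iff)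
 qed
 moreover have "sgn (e * radial F a) = 2 * of_bool (node F th j) - 1"
  using zero(3) e unfolding node_def a_def[symmetric] e_def[symmetric] by (auto simp: sgn_if)
 moreover have "sgn (e * radial F b) = 1 - 2 * of_bool (node F th (Suc j))"
  using zero(4) e unfolding node_def b_def[symmetric] power_Suc e_def[symmetric] by (auto simp: sgn_if)
 ultimately show ?thesis
  unfolding a_def[symmetric] b_def[symmetric] using zero by (simp add: field_simps)
qed

lemma sum_telescope_nodes:
 fixes Q :: "nat => real"
 shows "(\<Sum>j<n. Q (Suc j) - Q j) = Q n - Q 0"
 by (induction n) auto

text \<open>Summing the changes of argument over the \<open>2 l\<close> sectors gives the turns of the field relative to the
radial direction, which itself contributes one turn.\<close>

theorem sectored_index:
 assumes S: "sectored F l th"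
 shows "has_index F 0 (1 - int l + 2 * int (node_count F l th))"
proof -
 note F = sectoredD(1)[OF S]
 define N where "N = node_count F l th"
 have cont: "continuous_on UNIV (%x. Complex (radial F x) (angular F x))"
  unfolding Complex_eq by (intro continuous_intros continuous_radial_angular[OF F])
 have nz: "Complex (radial F x) (angular F x) ~= 0" for x
  using sectored_nonzero[OF S, of "cis x"] field_on_circle[of F x] by auto
 obtain Q where Q: "continuous_on UNIV Q" "!!x. Complex (radial F x) (angular F x) = exp (Q x)"
  using continuous_logarithm_on_contractible[OF cont convex_imp_contractible[OF convex_UNIV] nz] by auto
 define m where "m = (%j. of_bool (node F th j) :: real)"
 have m_period: "m (j + l) = m j" for j using node_periodic[OF S] by (simp add: m_def)
 have m_sum: "(\<Sum>j<l. m j) = N"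
 proof -
  have "(\<Sum>j<l. m j) = (\<Sum>j\<in>{j. j < l & node F th j}. 1)"
   unfolding m_def by (rule sum.mono_neutral_cong_right) auto
  then show ?thesis by (simp add: N_def node_count_def)
 qed
 have m_sum2: "(\<Sum>j<2 * l. m j) = 2 * real N"
 proof -
  have "(\<Sum>j<l + k. m j) = (\<Sum>j<l. m j) + (\<Sum>j<k. m (j + l))" for k
   by (induction k) (simp_all add: add.commute)
  from this[of l] have "(\<Sum>j<l + l. m j) = real N + real N" unfolding m_period m_sum .
  then show ?thesis by (simp only: mult_2)
 qed
 have m_shift: "(\<Sum>j<2 * l. m (Suc j)) = (\<Sum>j<2 * l. m j)"
 proof -
  have "m (2 * l) = m 0" using m_period[of l] m_period[of 0] unfolding mult_2 add_0 by (rule trans)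
  then show ?thesis using sum_telescope_nodes[of m "2 * l"] by (simp add: sum_subtractf)
 qed
 have "Im (Q (th (2 * l))) - Im (Q (th 0)) = (\<Sum>j<2 * l. Im (Q (th (Suc j))) - Im (Q (th j)))"
  by (rule sum_telescope_nodes[symmetric])
 also have "\<dots> = (\<Sum>j<2 * l. pi * (m j + m (Suc j) - 1))"
  using winding_on_sector[OF S Q] by (simp add: m_def)
 also have "\<dots> = pi * (\<Sum>j<2 * l. m j + m (Suc j) - 1)" by (simp add: sum_distrib_left)
 also have "\<dots> = pi * (4 * real N - 2 * real l)"
  using m_sum2 m_shift by (simp add: sum.distrib sum_subtractf)
 finally have inc: "Im (Q (th 0 + 2 * pi)) - Im (Q (th 0)) = pi * (4 * real N - 2 * real l)" using sectoredD(8)[OF S] by simp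
 have "Q (x + 2 * pi) - Q x - (Q (th 0 + 2 * pi) - Q (th 0)) = 0" for x
 proof -
  define D where "D = (%x. Q (x + 2 * pi) - Q x)"
  have "continuous_on UNIV D"
   unfolding D_def by (intro continuous_intros continuous_on_compose2[OF Q(1)] Q(1)) auto
  moreover have "exp (D x) = 1" for x
  proof -
   have two: "x + 2 * pi = (x + pi) + pi" by simp
   have "exp (Q (x + 2 * pi)) = exp (Q x)"
    unfolding Q(2)[symmetric] two radial_angular_add_pi[OF F] minus_minus ..
   then show ?thesis by (simp add: D_def exp_diff)
  qed
  ultimately have "D x = D (th 0)" by (intro exp_lift_constant[of UNIV D]) auto
  then show ?thesis by (simp add: D_def)
 qed
 from this[of 0] have incQ: "Im (Q (2 * pi)) - Im (Q 0) = pi * (4 * real N - 2 * real l)"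
  using inc by (simp add: complex_eq_iff)
 define i where "i = 1 - int l + 2 * int N"
 define A where "A = (%t. Im (Q (2 * pi * t)) + 2 * pi * t)"
 have A: "continuous_on {0..1} A"
  unfolding A_def by (intro continuous_intros continuous_on_compose2[OF Q(1)]) auto
 have "A 1 - A 0 = 2 * pi * of_int i" using incQ by (simp add: A_def i_def algebra_simps)
 note W = winding_number_exp_path[OF A this]
 have "(%t. sgn (F (circlepath 0 r t))) = (%t. exp (\<i> * of_real (A t)))" if "0 < r" for r
 proof
  fix t
  have c: "circlepath 0 r t = of_real r * cis (2 * pi * t)" by (simp add: circlepath cis_conv_exp mult_ac)
  have "F (circlepath 0 r t) = of_real (r^2) * (cis (2 * pi * t) * exp (Q (2 * pi * t)))"
   unfolding c field_polar[OF F] Q(2) ..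
  also have "exp (Q (2 * pi * t)) = of_real (exp (Re (Q (2 * pi * t)))) * cis (Im (Q (2 * pi * t)))"
   by (simp add: exp_eq_polar)
  finally have F_eq: "F (circlepath 0 r t) = of_real (r^2 * exp (Re (Q (2 * pi * t)))) * cis (A t)"
   by (simp add: A_def mult_ac flip: cis_mult)
  define k where "k = r^2 * exp (Re (Q (2 * pi * t)))"
  have "0 < k" using that by (simp add: k_def)
  then have "sgn (F (circlepath 0 r t)) = cis (A t)"
   unfolding F_eq k_def[symmetric] by (simp only: sgn_mult sgn_of_real sgn_cis sgn_pos of_real_1 mult_1)
  then show "sgn (F (circlepath 0 r t)) = exp (\<i> * of_real (A t))" by (simp add: cis_conv_exp)
 qed
 then have "\<forall>\<^sub>F r in at_right 0. winding_number (%t. sgn (F (circlepath 0 r t))) 0 = of_int i"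
  using W by (intro eventually_mono[OF eventually_at_right_less[of 0]]) simp
 moreover have "\<forall>\<^sub>F w in at 0. F w ~= 0"
  using eventually_neq_at_within[of 0 0 UNIV] by eventually_elim (rule sectored_nonzero[OF S])
 ultimately show ?thesis using hom_fields_2_zero[OF F] by (simp add: has_index_def i_def N_def)
qed

lemma has_index_unique: "has_index F z i ==> has_index F z j ==> i = j"
proof -
 assume "has_index F z i" "has_index F z j"
 then have a: "\<forall>\<^sub>F r in at_right 0. winding_number (%t. sgn (F (circlepath z r t))) 0 = of_int i"
  and b: "\<forall>\<^sub>F r in at_right 0. winding_number (%t. sgn (F (circlepath z r t))) 0 = of_int j"
  unfolding has_index_def by blast+
 have "\<forall>\<^sub>F r in at_right (0::real). of_int i = (of_int j :: complex)"
  using eventually_conj[OF a b] by (rule eventually_mono) (elim conjE, simp)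
 then show "i = j" by simp
qed

section \<open>Invariant lines\<close>

definition zero_angles :: "(complex => complex) => real set" where
 "zero_angles F = {x. 0 <= x & x < pi & angular F x = 0}"

lemma line_membership: "z \<in> span {cis x} \<longleftrightarrow> Im (z * cis (- x)) = 0"
proof
 assume "z \<in> span {cis x}"
 then obtain k where "z = k *\<^sub>R cis x" by (auto simp: span_singleton)
 then have "z * cis (- x) = of_real k" by (simp add: scaleR_conv_of_real mult.assoc cis_mult)
 then show "Im (z * cis (- x)) = 0" by simp
next
 assume "Im (z * cis (- x)) = 0"
 then have "z * cis (- x) = of_real (Re (z * cis (- x)))" by (simp add: complex_eq_iff)
 then have "(z * cis (- x)) * cis x = Re (z * cis (- x)) *\<^sub>R cis x" by (metis scaleR_conv_of_real)
 then have "z = Re (z * cis (- x)) *\<^sub>R cis x" by (simp add: mult.assoc cis_mult)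
 then show "z \<in> span {cis x}" by (metis singletonI span_base span_scale)
qed

text \<open>A linear form vanishing on the line satisfies a linear differential inequality along each trajectory,
so it stays zero by Gronwall's lemma.\<close>

lemma flow_invariant_line:
 assumes F: "F \<in> hom_fields 2" and x: "angular F x = 0"
 shows "flow_invariant F (span {cis x})"
 unfolding flow_invariant_def
proof (intro allI impI, elim conjE)
 fix I \<gamma> assume I: "is_interval I" and tr: "trajectory_on I F \<gamma>" and meet: "\<gamma> ` I \<inter> span {cis x} ~= {}"
 define lf where "lf = (%z. cos x * Im z - sin x * Re z)"
 have line: "z \<in> span {cis x} \<longleftrightarrow> lf z = 0" for z by (simp add: line_membership lf_def algebra_simps)
 obtain a b where Fab: "F = hom_field 2 a b" using F by (auto simp: hom_fields_def)
 have quad: "lf (F (Complex u v)) = (cos x * b (2,0) - sin x * a (2,0)) * u^2 + (cos x * b (1,1) - sin x * a (1,1)) * u * v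
   + (cos x * b (0,2) - sin x * a (0,2)) * v^2" for u v
  by (simp add: lf_def Fab hom_field_2 algebra_simps)
 have "lf (F (cis x)) = 0" using x by (simp add: angular_def lf_def algebra_simps)
 then have "lf (F (Complex (cos x) (sin x))) = 0" by (simp add: cis.code complex_eq_iff flip: cis.ctr)
 from quadratic_form_factor[OF this[unfolded quad]] obtain \<alpha> \<beta>
  where fac: "!!u v. lf (F (Complex u v)) = (cos x * v - sin x * u) * (\<alpha> * u + \<beta> * v)"
  unfolding quad by (metis sin_cos_squared_add2)
 define m where "m = (%z. \<alpha> * Re z + \<beta> * Im z)"
 have lfF: "lf (F z) = lf z * m z" for z using fac[of "Re z" "Im z"] by (simp add: lf_def m_def)
 obtain t0 where t0: "t0 \<in> I" "lf (\<gamma> t0) = 0" using meet line by auto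
 show "\<gamma> ` I \<subseteq> span {cis x}"
 proof
  fix z assume "z \<in> \<gamma> ` I"
  then obtain t where t: "t \<in> I" "z = \<gamma> t" by auto
  define J where "J = closed_segment t0 t"
  have JI: "J \<subseteq> I" unfolding J_def using I t0 t by (simp add: closed_segment_subset is_interval_convex)
  have der: "(\<gamma> has_vector_derivative F (\<gamma> s)) (at s within J)" if "s \<in> J" for s
   using tr JI that unfolding trajectory_on_def by (meson has_vector_derivative_within_subset subsetD)
  have cont: "continuous_on J \<gamma>"
   using der by (meson continuous_on_eq_continuous_within has_vector_derivative_continuous)
  have "continuous_on J (%s. m (\<gamma> s))" unfolding m_def by (intro continuous_intros cont)
  then have "compact ((%s. m (\<gamma> s)) ` J)" by (rule compact_continuous_image) (simp add: J_def)
  then obtain B where B: "!!s. s \<in> J ==> \<bar>m (\<gamma> s)\<bar> <= B"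
   using compact_imp_bounded[of "(%s. m (\<gamma> s)) ` J"] by (auto simp: bounded_iff)
  have "(%s. (lf (\<gamma> s))^2) t = 0"
  proof (rule gronwall_zero[of J t0 t _ "%s. 2 * (lf (\<gamma> s))^2 * m (\<gamma> s)" "2 * B"])
   show "is_interval J" by (simp add: J_def is_interval_convex_1)
   fix s assume s: "s \<in> J"
   have "((%s. lf (\<gamma> s)) has_real_derivative lf (F (\<gamma> s))) (at s within J)"
    unfolding lf_def using der[OF s] by (auto intro!: derivative_eq_intros)
   then show "((%s. (lf (\<gamma> s))^2) has_real_derivative 2 * (lf (\<gamma> s))^2 * m (\<gamma> s)) (at s within J)"
    unfolding lfF by (auto intro!: derivative_eq_intros simp: power2_eq_square)
   have "(lf (\<gamma> s))^2 * \<bar>m (\<gamma> s)\<bar> <= (lf (\<gamma> s))^2 * B" using B[OF s] by (intro mult_left_mono) auto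
   then show "\<bar>2 * (lf (\<gamma> s))^2 * m (\<gamma> s)\<bar> <= 2 * B * (lf (\<gamma> s))^2" by (simp add: abs_mult mult_ac)
  qed (use t0 in \<open>auto simp: J_def\<close>)
  then show "z \<in> span {cis x}" using line t by simp
 qed
qed

text \<open>Cutting the speed off linearly near the ends of the interval gives a field to which the complete flow
applies; near the initial point it agrees with the given one.\<close>

lemma local_flow:
 fixes K :: "real => real"
 assumes \<eta>: "0 < \<eta>" and cont: "continuous_on {x - 2 * \<eta>..x + 2 * \<eta>} K"
  and pos: "!!u. u \<in> {x - 2 * \<eta>..x + 2 * \<eta>} ==> 0 < K u"
 obtains y I where "is_interval I" "0 \<in> I" "y 0 = x" "\<exists>t\<in>I. y t = x + \<eta> / 2" "!!t. t \<in> I ==> \<bar>y t - x\<bar> < \<eta>"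
  "!!t. t \<in> I ==> (y has_real_derivative K (y t)) (at t)"
proof -
 define a b where "a = x - 2 * \<eta>" and "b = x + 2 * \<eta>"
 define cut where "cut = (%u. min 1 (min ((u - a) / \<eta>) ((b - u) / \<eta>)))"
 have "bounded (K ` {a..b})"
  unfolding a_def b_def by (rule compact_imp_bounded[OF compact_continuous_image[OF cont compact_Icc]])
 then obtain B where "\<forall>z\<in>K ` {a..b}. norm z <= B" unfolding bounded_iff by blast
 then have B: "K u <= B" if "u \<in> {a..b}" for u using that by (auto simp: abs_le_iff)
 have B0: "0 < B" using pos[of x] B[of x] \<eta> by (force simp: a_def b_def)
 have cut: "0 < cut u" "cut u <= (u - a) / \<eta>" "cut u <= (b - u) / \<eta>" if "a < u" "u < b" for u
  using that \<eta> by (auto simp: cut_def)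
 have ab: "a < b" using \<eta> by (simp add: a_def b_def)
 have cont': "continuous_on {a<..<b} (%u. K u * cut u)"
  unfolding cut_def using \<eta> by (intro continuous_intros continuous_on_subset[OF cont]) (auto simp: a_def b_def)
 have posK: "0 < K u * cut u" if "a < u" "u < b" for u
  using pos[of u] cut(1)[OF that] that by (simp add: a_def b_def)
 have le: "K u * cut u <= B / \<eta> * (u - a)" "K u * cut u <= B / \<eta> * (b - u)" if "a < u" "u < b" for u
 proof -
  have "K u * cut u <= B * ((u - a) / \<eta>)" "K u * cut u <= B * ((b - u) / \<eta>)"
   by (intro mult_mono; use B[of u] cut[OF that] that B0 in force)+
  then show "K u * cut u <= B / \<eta> * (u - a)" "K u * cut u <= B / \<eta> * (b - u)" by simp_all
 qed
 obtain y0 where y0: "bij_betw y0 UNIV {a<..<b}" "strict_mono y0" "!!t. (y0 has_real_derivative K (y0 t) * cut (y0 t)) (at t)"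
  "(y0 \<longlongrightarrow> b) at_top" "(y0 \<longlongrightarrow> a) at_bot"
  using autonomous_flow[OF ab cont' posK le] by metis
 have "\<exists>t. y0 t = z" if "a < z" "z < b" for z
  using y0(1) that unfolding bij_betw_def by (metis greaterThanLessThan_iff imageE)
 note ex = this
 have "a < x" "x < b" "a < x + \<eta> / 2" "x + \<eta> / 2 < b" using \<eta> by (auto simp: a_def b_def)
 then obtain t0 t1 where t0: "y0 t0 = x" and t1: "y0 t1 = x + \<eta> / 2" using ex[of x] ex[of "x + \<eta> / 2"] by blast
 define y where "y = (%t. y0 (t + t0))"
 define I where "I = {t. \<bar>y t - x\<bar> < \<eta>}"
 have ymono: "y s < y t" if "s < t" for s t using y0(2) that by (simp add: y_def strict_mono_def)
 show thesis
 proof (rule that[of I y])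
  show "is_interval I" unfolding is_interval_1
  proof (intro ballI allI impI)
   fix s t u assume st: "s \<in> I" "t \<in> I" "s <= u & u <= t"
   then have "y s <= y u" "y u <= y t" using ymono by (metis less_eq_real_def)+
   then show "u \<in> I" using st by (auto simp: I_def)
  qed
  show "0 \<in> I" "y 0 = x" using t0 \<eta> by (auto simp: I_def y_def)
  show "\<exists>t\<in>I. y t = x + \<eta> / 2" using t1 \<eta> by (intro bexI[of _ "t1 - t0"]) (auto simp: I_def y_def)
  fix t assume t: "t \<in> I"
  then show near: "\<bar>y t - x\<bar> < \<eta>" by (simp add: I_def)
  have "cut (y t) = 1" using near \<eta> by (auto simp: cut_def a_def b_def min_def field_simps)
  moreover have "(y has_real_derivative K (y0 (t + t0)) * cut (y0 (t + t0))) (at t)"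
   unfolding y_def using DERIV_shift[of y0 _ t t0] y0(3) by blast
  ultimately show "(y has_real_derivative K (y t)) (at t)" by (simp add: y_def)
 qed
qed

text \<open>Off the zeros of the angular part a short trajectory crosses the line, its angle being a strictly
monotone function of time.\<close>

lemma line_leaves:
 assumes F: "F \<in> hom_fields 2" and x: "angular F x ~= 0"
 shows "\<not> flow_invariant F (span {cis x})"
proof
 assume inv: "flow_invariant F (span {cis x})"
 define e where "e = sgn (angular F x)"
 have e: "e = 1 | e = -1" using x by (auto simp: e_def sgn_if)
 have cont: "isCont (radial F) u" "isCont (angular F) u" for u
  using continuous_radial_angular[OF F, of UNIV] by (auto simp: continuous_on_eq_continuous_at)
 have "isCont (%u. e * angular F u) x" by (intro continuous_intros cont)
 moreover have "0 < e * angular F x" using x by (simp add: e_def sgn_mult_self_eq abs_sgn_eq mult_sgn_abs) (simp add: sgn_if)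
 ultimately have "\<forall>\<^sub>F u in at x. 0 < e * angular F u" by (intro order_tendstoD) (simp add: isCont_def)
 then obtain d where d: "0 < d" "!!u. u ~= x ==> \<bar>u - x\<bar> < d ==> 0 < e * angular F u"
  unfolding eventually_at by (auto simp: dist_real_def)
 then have pos: "0 < e * angular F u" if "\<bar>u - x\<bar> < d" for u
  using that \<open>0 < e * angular F x\<close> by (cases "u = x") auto
 define \<eta> where "\<eta> = min (d / 3) (1 / 2)"
 have \<eta>: "0 < \<eta>" "2 * \<eta> < d" "\<eta> < 1" using d(1) by (auto simp: \<eta>_def)
 have nz: "angular F u ~= 0" if "\<bar>u - x\<bar> < d" for u using pos[OF that] by auto
 have "\<exists>H. \<forall>u. ereal (x - d) < ereal u --> ereal u < ereal (x + d) --> (H has_vector_derivative radial F u / angular F u) (at u)"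
 proof (rule einterval_antiderivative)
  show "isCont (%u. radial F u / angular F u) u" if "ereal (x - d) < ereal u" "ereal u < ereal (x + d)" for u
   using nz[of u] that by (intro continuous_divide cont) (auto simp: abs_less_iff)
 qed (use d in simp)
 then obtain H where "\<forall>u. ereal (x - d) < ereal u --> ereal u < ereal (x + d) --> (H has_vector_derivative radial F u / angular F u) (at u)"
  by blast
 then have H: "(H has_real_derivative radial F u / angular F u) (at u)" if "\<bar>u - x\<bar> < d" for u
  using that by (auto simp: has_real_derivative_iff_has_vector_derivative abs_less_iff)
 have Hcont: "continuous_on {x - 2 * \<eta>..x + 2 * \<eta>} H"
  using \<eta> by (intro continuous_at_imp_continuous_on ballI DERIV_isCont[OF H]) auto
 obtain y I where y: "is_interval I" "0 \<in> I" "y 0 = x" "\<exists>t\<in>I. y t = x + \<eta> / 2" "!!t. t \<in> I ==> \<bar>y t - x\<bar> < \<eta>"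
  "!!t. t \<in> I ==> (y has_real_derivative exp (H (y t)) * (e * angular F (y t))) (at t)"
 proof (rule local_flow[OF \<eta>(1), of x "%u. exp (H u) * (e * angular F u)"])
  show "continuous_on {x - 2 * \<eta>..x + 2 * \<eta>} (%u. exp (H u) * (e * angular F u))"
   by (intro continuous_intros Hcont continuous_radial_angular[OF F])
  show "0 < exp (H u) * (e * angular F u)" if "u \<in> {x - 2 * \<eta>..x + 2 * \<eta>}" for u
   using pos[of u] that \<eta> by (auto simp: abs_less_iff)
 qed blast
 define \<gamma> where "\<gamma> = (%t. of_real (exp (H (y (e * t)))) * cis (y (e * t)))"
 define J where "J = {t. e * t \<in> I}"
 have ee: "e * (e * t) = t" for t using e by auto
 have "is_interval J"
 proof -
  have "J = (%t. e * t) ` I"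
  proof (intro equalityI subsetI)
   show "t \<in> (%t. e * t) ` I" if "t \<in> J" for t
    using that by (intro image_eqI[of _ _ "e * t"]) (simp_all only: J_def ee mem_Collect_eq)
   show "t \<in> J" if "t \<in> (%t. e * t) ` I" for t
    using that by (elim imageE) (simp only: J_def ee mem_Collect_eq)
  qed
  then show ?thesis using y(1) e by (auto simp: is_interval_convex_1 convex_scaling[of I e, unfolded real_scaleR_def])
 qed
 moreover have "trajectory_on J F \<gamma>"
  unfolding trajectory_on_def
 proof
  fix t assume "t \<in> J"
  then have t: "e * t \<in> I" by (simp add: J_def)
  define u where "u = y (e * t)"
  have u: "\<bar>u - x\<bar> < d" using y(5)[OF t] \<eta> by (simp add: u_def)
  have dy: "((%t. y (e * t)) has_real_derivative exp (H u) * (e * angular F u) * e) (at t)"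
   unfolding u_def by (rule DERIV_chain2[where g = "%t. e * t" and x = t, OF y(6)[OF t]]) (auto intro!: derivative_eq_intros)
  have k: "exp (H u) * (e * angular F u) * e = exp (H u) * angular F u" using e by auto
  have dr: "((%t. exp (H (y (e * t)))) has_real_derivative exp (H u) * (radial F u / angular F u * (exp (H u) * angular F u))) (at t)"
   unfolding u_def
   by (rule DERIV_chain2[OF DERIV_exp], rule DERIV_chain2[where g = "%t. y (e * t)" and x = t, OF H[OF u, unfolded u_def]]) (use dy[unfolded k] in \<open>simp add: u_def\<close>)
  have dr': "exp (H u) * (radial F u / angular F u * (exp (H u) * angular F u)) = exp (H u) * exp (H u) * radial F u"
   using nz[OF u] by simp
  define R Y where "R = (%t. exp (H (y (e * t))))" and "Y = (%t. y (e * t))"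
  have \<gamma>_eq: "\<gamma> = (%t. of_real (R t) * cis (Y t))" by (simp add: \<gamma>_def R_def Y_def)
  have Rt: "R t = exp (H u)" and Yt: "Y t = u" by (simp_all add: R_def Y_def u_def)
  have dR: "(R has_real_derivative exp (H u) * exp (H u) * radial F u) (at t)"
   using dr[unfolded dr'] by (simp only: R_def)
  have dY: "(Y has_real_derivative exp (H u) * angular F u) (at t)"
   using dy[unfolded k] by (simp only: Y_def)
  have F\<gamma>: "F (\<gamma> t) = of_real ((exp (H u))^2) * (cis u * Complex (radial F u) (angular F u))"
   unfolding \<gamma>_eq Rt Yt by (rule field_polar[OF F])
  have "(\<gamma> has_vector_derivative F (\<gamma> t)) (at t)"
   unfolding has_vector_derivative_complex_iff F\<gamma> unfolding \<gamma>_eq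
   using dR dY by (auto intro!: derivative_eq_intros simp: Rt Yt power2_eq_square algebra_simps simp flip: of_real_mult)
  then show "(\<gamma> has_vector_derivative F (\<gamma> t)) (at t within J)" by (rule has_vector_derivative_at_within)
 qed
 moreover have "\<gamma> 0 \<in> span {cis x}"
  using y(3) by (simp add: \<gamma>_def line_membership mult.assoc cis_mult)
 then have "\<gamma> ` J \<inter> span {cis x} ~= {}" using y(2) by (auto simp: J_def intro!: exI[of _ "\<gamma> 0"] image_eqI[of _ _ 0])
 ultimately have sub: "\<gamma> ` J \<subseteq> span {cis x}" using inv unfolding flow_invariant_def by blast
 obtain s where s: "s \<in> I" "y s = x + \<eta> / 2" using y(4) by blast
 have "e * s \<in> J" unfolding J_def mem_Collect_eq ee by (rule s(1))
 then have "\<gamma> (e * s) \<in> span {cis x}" using sub by blast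
 moreover have "\<gamma> (e * s) = of_real (exp (H (y s))) * cis (y s)" unfolding \<gamma>_def ee ..
 ultimately have "Im (of_real (exp (H (y s))) * (cis (y s) * cis (- x))) = 0"
  by (simp only: line_membership mult.assoc)
 then have "sin (\<eta> / 2) = 0" using s(2) by (simp add: cis_mult)
 moreover have "0 < sin (\<eta> / 2)" using \<eta> pi_gt3 by (intro sin_gt_zero) auto
 ultimately show False by simp
qed

lemma zero_angle_lines_inj: "inj_on (%x. span {cis x}) {0..<pi}"
proof (rule inj_onI)
 fix x y assume xy: "x \<in> {0..<pi}" "y \<in> {0..<pi}" "span {cis x} = span {cis y}"
 have "cis y \<in> span {cis x}" unfolding xy(3) by (simp add: span_base)
 then have "sin (y - x) = 0" by (simp add: line_membership cis_mult)
 moreover have "\<bar>y - x\<bar> < pi" using xy by auto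
 ultimately show "x = y" by (metis abs_zero diff_self eq_iff_diff_eq_0 sin_eq_0_pi abs_less_iff minus_less_iff)
qed

lemma line_direction:
 assumes "v ~= 0" obtains x where "0 <= x" "x < pi" "span {v} = span {cis x}"
proof -
 obtain t where t: "0 <= t" "t < 0 + 2 * pi" "v = of_real (norm v) * cis t" by (rule polar_coordinates)
 define x where "x = (if t < pi then t else t - pi)"
 have "cis t = cis x | cis t = - cis x" by (auto simp: x_def complex_eq_iff sin_diff cos_diff)
 moreover have v: "v = norm v *\<^sub>R cis t" unfolding scaleR_conv_of_real by (rule t(3))
 ultimately have "\<exists>k. k ~= 0 & v = k *\<^sub>R cis x"
 proof (elim disjE)
  assume c: "cis t = cis x"
  have "norm v ~= 0" using assms by simp
  then show ?thesis using v[unfolded c] by blast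
 next
  assume c: "cis t = - cis x"
  have "v = (- norm v) *\<^sub>R cis x" using v[unfolded c] unfolding scaleR_minus_right scaleR_minus_left .
  moreover have "- norm v ~= 0" using assms by simp
  ultimately show ?thesis by blast
 qed
 then obtain k where "k ~= 0" "v = k *\<^sub>R cis x" by blast
 then have "span {v} = span {cis x}" by (simp add: span_image_scale[of "{cis x}" "%_. k", simplified])
 then show thesis using t by (intro that[of x]) (auto simp: x_def)
qed

lemma invariant_lines_eq:
 assumes F: "F \<in> hom_fields 2"
 shows "invariant_lines F = (%x. span {cis x}) ` zero_angles F"
proof (intro equalityI subsetI)
 fix L assume "L \<in> invariant_lines F"
 then obtain v where v: "v ~= 0" "L = span {v}" "flow_invariant F L" by (auto simp: invariant_lines_def)
 obtain x where x: "0 <= x" "x < pi" "span {v} = span {cis x}" using line_direction[OF v(1)] .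
 have "angular F x = 0" using line_leaves[OF F, of x] v x by auto
 then show "L \<in> (%x. span {cis x}) ` zero_angles F" using v x by (auto simp: zero_angles_def)
next
 fix L assume "L \<in> (%x. span {cis x}) ` zero_angles F"
 then obtain x where "L = span {cis x}" "angular F x = 0" by (auto simp: zero_angles_def)
 then show "L \<in> invariant_lines F"
  using flow_invariant_line[OF F] cis_neq_zero[of x] unfolding invariant_lines_def by blast
qed

lemma card_invariant_lines:
 assumes "F \<in> hom_fields 2"
 shows "finite (invariant_lines F) \<longleftrightarrow> finite (zero_angles F)" "card (invariant_lines F) = card (zero_angles F)"
proof -
 have "inj_on (%x. span {cis x}) (zero_angles F)"
  by (rule inj_on_subset[OF zero_angle_lines_inj]) (auto simp: zero_angles_def)
 then show "finite (invariant_lines F) \<longleftrightarrow> finite (zero_angles F)" "card (invariant_lines F) = card (zero_angles F)"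
  unfolding invariant_lines_eq[OF assms] by (simp_all add: finite_image_iff card_image)
qed

text \<open>The origin is the only zero of the field.\<close>

definition nondegenerate :: "(complex => complex) => bool" where
 "nondegenerate F \<longleftrightarrow> F \<in> hom_fields 2 & (\<forall>x. angular F x = 0 --> radial F x ~= 0)"

lemma has_index_nondegenerate:
 assumes F: "F \<in> hom_fields 2" and i: "has_index F 0 i"
 shows "nondegenerate F"
proof (rule ccontr)
 assume "\<not> nondegenerate F"
 then obtain x where x: "angular F x = 0" "radial F x = 0" using F by (auto simp: nondegenerate_def)
 have z: "F (of_real r * cis x) = 0" for r by (simp add: field_polar[OF F] x complex_eq_iff)
 have "\<forall>\<^sub>F w in at 0. F w ~= 0" using i by (simp add: has_index_def)
 then obtain d where d: "0 < d" "!!w. w ~= 0 ==> norm w < d ==> F w ~= 0"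
  unfolding eventually_at by (auto simp: dist_norm)
 show False using d(2)[of "of_real (d / 2) * cis x"] d(1) z[of "d / 2"] by (auto simp: norm_mult)
qed

lemma sectored_from_signs:
 assumes F: "nondegenerate F" and l: "odd l"
  and \<tau>: "!!j. \<tau> j < \<tau> (Suc j)" "!!j. \<tau> (j + l) = \<tau> j + pi" "!!j. angular F (\<tau> j) = 0"
  and sign: "!!j x. \<tau> j < x ==> x < \<tau> (Suc j) ==> 0 < k * (- 1) ^ j * angular F x"
 obtains th where "sectored F l th"
proof -
 have F': "F \<in> hom_fields 2" "!!x. angular F x = 0 ==> radial F x ~= 0" using F by (auto simp: nondegenerate_def)
 define x0 where "x0 = (\<tau> 0 + \<tau> 1) / 2"
 have "0 < k * (- 1) ^ 0 * angular F x0" by (rule sign) (use \<tau>(1)[of 0] in \<open>auto simp: x0_def\<close>)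
 then have "k ~= 0" by auto
 then consider "0 < k" | "k < 0" by linarith
 then show thesis
 proof cases
  case 1
  have "sectored F l \<tau>"
   unfolding sectored_def
  proof (intro conjI allI impI; (elim conjE)?)
   fix j x assume "\<tau> j < x" "x < \<tau> (Suc j)"
   then have "0 < k * ((- 1) ^ j * angular F x)" using sign[of j x] by (simp add: mult.assoc)
   then show "0 < (- 1) ^ j * angular F x" using 1 by (rule zero_less_mult_pos)
  qed (use F' \<tau> l in auto)
  then show thesis by (rule that)
 next
  case 2
  have "sectored F l (%j. \<tau> (Suc j))"
   unfolding sectored_def
  proof (intro conjI allI impI; (elim conjE)?)
   fix j x assume "\<tau> (Suc j) < x" "x < \<tau> (Suc (Suc j))"
   then have "0 < (- k) * ((- 1) ^ j * angular F x)" using sign[of "Suc j" x] by (simp add: mult.assoc)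
   moreover have "0 < - k" using 2 by simp
   ultimately show "0 < (- 1) ^ j * angular F x" by (rule zero_less_mult_pos)
  next
   show "\<tau> (Suc (j + l)) = \<tau> (Suc j) + pi" for j using \<tau>(2)[of "Suc j"] by simp
  qed (use F' \<tau> l in auto)
  then show thesis by (rule that)
 qed
qed

lemma angular_add_multiple_pi:
 assumes "F \<in> hom_fields 2" shows "angular F (x + real n * pi) = (- 1) ^ n * angular F x"
proof (induction n)
 case (Suc n)
 have "x + real (Suc n) * pi = (x + real n * pi) + pi" by (simp add: algebra_simps)
 then show ?case using Suc radial_angular_add_pi(2)[OF assms, of "x + real n * pi"] by (simp only:) simp
qed simp

lemma zero_angles_complete:
 assumes F: "F \<in> hom_fields 2" and x: "angular F x = 0" "0 <= x" "x < 2 * pi"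
 shows "x \<in> zero_angles F | x - pi \<in> zero_angles F"
 using x radial_angular_add_pi(2)[OF F, of "x - pi"] by (auto simp: zero_angles_def)

lemma sectored_exists_1:
 assumes F: "nondegenerate F" and card: "card (zero_angles F) = 1"
 obtains th where "sectored F 1 th"
proof -
 have F': "F \<in> hom_fields 2" using F by (simp add: nondegenerate_def)
 obtain a where a: "zero_angles F = {a}" using card by (metis card_1_singletonE)
 then have "a \<in> zero_angles F" by simp
 then have a': "0 <= a" "a < pi" "angular F a = 0" by (auto simp: zero_angles_def)
 have nz: "angular F x ~= 0" if "a < x" "x < a + pi" for x
  using zero_angles_complete[OF F', of x] a a' that by auto
 define m where "m = a + pi / 2"
 define k where "k = angular F m"
 have k0: "k ~= 0" unfolding k_def by (rule nz) (auto simp: m_def)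
 have pos: "0 < k * angular F x" if x: "a < x" "x < a + pi" for x
 proof (rule ccontr)
  assume "\<not> 0 < k * angular F x"
  then have neg: "k * angular F x < 0" using nz[OF x] k0 by (simp add: not_less order_less_le)
  have kk: "0 < k * angular F m" using k0 unfolding k_def[symmetric] by (metis not_real_square_gt_zero)
  have cont: "continuous_on A (%u. k * angular F u)" for A by (intro continuous_intros continuous_radial_angular[OF F'])
  have "\<exists>z. a < z & z < a + pi & k * angular F z = 0"
  proof (cases "x <= m")
   case True
   obtain z where "x <= z" "z <= m" "k * angular F z = 0"
    using IVT'[of "%u. k * angular F u" x 0 m] neg kk True cont by force
   then show ?thesis using x by (intro exI[of _ z]) (auto simp: m_def)
  next
   case False
   obtain z where "m <= z" "z <= x" "k * angular F z = 0"
    using IVT2'[of "%u. k * angular F u" x 0 m] neg kk False cont by force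
   then show ?thesis using x by (intro exI[of _ z]) (auto simp: m_def)
  qed
  then show False using nz k0 by auto
 qed
 show thesis
 proof (rule sectored_from_signs[OF F, of 1 "%j. a + real j * pi" k])
  fix j x assume x: "a + real j * pi < x" "x < a + real (Suc j) * pi"
  have "0 < k * angular F (x - real j * pi)" by (rule pos) (use x in \<open>auto simp: algebra_simps\<close>)
  moreover have "angular F x = (- 1) ^ j * angular F (x - real j * pi)"
   using angular_add_multiple_pi[OF F', of "x - real j * pi" j] by simp
  ultimately show "0 < k * (- 1) ^ j * angular F x" by (simp add: mult.assoc flip: power_mult_distrib mult.assoc[of "(- 1) ^ j"])
 qed (use that a' angular_add_multiple_pi[OF F'] in \<open>auto simp: algebra_simps\<close>)
qed

lemma angular_factor:
 assumes F: "F \<in> hom_fields 2" and z: "angular F a = 0" "angular F b = 0" "angular F c = 0"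
  and ne: "sin (b - a) ~= 0" "sin (c - a) ~= 0" "sin (c - b) ~= 0"
 obtains k where "!!x. angular F x = k * (sin (x - a) * sin (x - b) * sin (x - c))"
proof -
 obtain p q r s where g: "!!x. angular F x = cubic_form p q r s (cos x) (sin x)" using angular_cubic_form[OF F] by blast
 have sd: "cos v * sin u - sin v * cos u = sin (u - v)" for u v :: real by (simp add: sin_diff)
 have cs: "(cos u)^2 + (sin u)^2 = 1" for u :: real by simp
 obtain \<alpha> \<beta> \<gamma> where 1: "!!x y. cubic_form p q r s x y = (cos a * y - sin a * x) * (\<alpha> * x^2 + \<beta> * x * y + \<gamma> * y^2)"
  using cubic_form_factor[OF z(1)[unfolded g] cs] by blast
 have "\<alpha> * (cos b)^2 + \<beta> * cos b * sin b + \<gamma> * (sin b)^2 = 0"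
  using z(2) ne(1) unfolding g 1 sd by simp
 from quadratic_form_factor[OF this cs] obtain \<delta> \<epsilon>
  where 2: "!!x y. \<alpha> * x^2 + \<beta> * x * y + \<gamma> * y^2 = (cos b * y - sin b * x) * (\<delta> * x + \<epsilon> * y)" by blast
 have lin: "\<delta> * cos c + \<epsilon> * sin c = 0" using z(3) ne(2,3) unfolding g 1 2 sd by simp
 have "\<delta> * cos x + \<epsilon> * sin x = (\<epsilon> * cos c - \<delta> * sin c) * sin (x - c)" for x
 proof -
  have "(\<epsilon> * cos c - \<delta> * sin c) * (sin x * cos c - cos x * sin c) =
    (\<delta> * cos x + \<epsilon> * sin x) * ((cos c)^2 + (sin c)^2) - (\<delta> * cos c + \<epsilon> * sin c) * (cos x * cos c + sin x * sin c)"
   by algebra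
  then show ?thesis unfolding lin cs by (simp add: sin_diff)
 qed
 then show thesis by (intro that[of "\<epsilon> * cos c - \<delta> * sin c"]) (simp add: g 1 2 sd)
qed

text \<open>The three zeros give a factorisation of the angular part into three sines, hence simple zeros and
alternating signs between them.\<close>

lemma sectored_exists_3:
 assumes F: "nondegenerate F" and card: "card (zero_angles F) = 3"
 obtains th where "sectored F 3 th"
proof -
 have F': "F \<in> hom_fields 2" using F by (simp add: nondegenerate_def)
 have fin: "finite (zero_angles F)" using card by (metis card.infinite zero_neq_numeral)
 obtain a b c where abc: "zero_angles F = {a, b, c}" "a < b" "b < c"
 proof -
  define xs where "xs = sorted_list_of_set (zero_angles F)"
  have xs: "length xs = 3" "sorted_wrt (<) xs" "set xs = zero_angles F"
   using card fin by (auto simp: xs_def strict_sorted_list_of_set)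
  then obtain a b c where "xs = [a, b, c]" by (auto simp: eval_nat_numeral length_Suc_conv)
  then show thesis using xs that[of a b c] by auto
 qed
 then have "{a, b, c} \<subseteq> zero_angles F" by simp
 then have z: "0 <= a" "c < pi" "angular F a = 0" "angular F b = 0" "angular F c = 0" by (auto simp: zero_angles_def)
 obtain k where k: "!!x. angular F x = k * (sin (x - a) * sin (x - b) * sin (x - c))"
  using angular_factor[OF F' z(3-5)] abc z sin_gt_zero[of "b - a"] sin_gt_zero[of "c - a"] sin_gt_zero[of "c - b"] by force
 have k0: "k ~= 0"
 proof
  assume "k = 0"
  then have "{0..<pi} \<subseteq> zero_angles F" using k by (auto simp: zero_angles_def)
  then show False using fin by (meson finite_subset infinite_Ico pi_gt_zero)
 qed
 then have kk: "0 < k * k" by (metis not_real_square_gt_zero)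
 define \<tau> where "\<tau> = (%j::nat. (if j mod 3 = 0 then a else if j mod 3 = 1 then b else c) + real (j div 3) * pi)"
 have cases3: "\<exists>m. j = 3 * m | j = 3 * m + 1 | j = 3 * m + 2" for j :: nat
 proof -
  have "j = 3 * (j div 3) + j mod 3" by simp
  moreover have "j mod 3 < 3" by simp
  ultimately show ?thesis by (intro exI[of _ "j div 3"]) linarith
 qed
 have vals: "\<tau> (3 * m) = a + real m * pi" "\<tau> (3 * m + 1) = b + real m * pi" "\<tau> (3 * m + 2) = c + real m * pi"
  "\<tau> (Suc (3 * m)) = b + real m * pi" "\<tau> (Suc (3 * m + 1)) = c + real m * pi" "\<tau> (Suc (3 * m + 2)) = a + pi + real m * pi" for m
 proof -
  have mods: "(3 * m) mod 3 = 0" "(3 * m + 1) mod 3 = 1" "(3 * m + 2) mod 3 = 2" "(3 * m) div 3 = m" "(3 * m + 1) div 3 = m" "(3 * m + 2) div 3 = m"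
   "Suc (3 * m + 2) mod 3 = 0" "Suc (3 * m + 2) div 3 = m + 1" by presburger+
  show "\<tau> (3 * m) = a + real m * pi" "\<tau> (3 * m + 1) = b + real m * pi" "\<tau> (3 * m + 2) = c + real m * pi"
   by (simp_all only: \<tau>_def mods if_True if_False refl simp_thms; simp)+
  then show "\<tau> (Suc (3 * m)) = b + real m * pi" "\<tau> (Suc (3 * m + 1)) = c + real m * pi" by simp_all
  show "\<tau> (Suc (3 * m + 2)) = a + pi + real m * pi" by (simp only: \<tau>_def mods) (simp add: algebra_simps)
 qed
 have base: "0 < k * angular F x" if "a < x & x < b | c < x & x < a + pi" for x
 proof -
  have "0 < sin (x - a) * sin (x - b) * sin (x - c)"
  proof (cases "x < b")
   case True
   then have "0 < sin (x - a)" "0 < sin (b - x)" "0 < sin (c - x)" using that abc z by (auto intro!: sin_gt_zero)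
   then have "0 < sin (x - a) * (sin (b - x) * sin (c - x))" by simp
   then show ?thesis using sin_minus[of "b - x"] sin_minus[of "c - x"] by (simp add: mult.assoc)
  next
   case False
   then have "0 < sin (x - a)" "0 < sin (x - b)" "0 < sin (x - c)" using that abc z by (auto intro!: sin_gt_zero)
   then show ?thesis by simp
  qed
  then show ?thesis unfolding k mult.assoc[of k k, symmetric] using kk by simp
 qed
 have base': "0 < - (k * angular F x)" if "b < x" "x < c" for x
 proof -
  have "0 < sin (x - a)" "0 < sin (x - b)" "0 < sin (c - x)" using that abc z by (auto intro!: sin_gt_zero)
  then have "0 < sin (x - a) * sin (x - b) * sin (c - x)" by simp
  then have "0 < - (sin (x - a) * sin (x - b) * sin (x - c))" using sin_minus[of "c - x"] by simp
  from mult_pos_pos[OF kk this] show ?thesis unfolding k by (simp add: mult.assoc)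
 qed
 have shift: "angular F x = (- 1) ^ m * angular F (x - real m * pi)" for x m
  using angular_add_multiple_pi[OF F', of "x - real m * pi" m] by simp
 have sq: "((- 1) ^ m * (- 1) ^ m :: real) = 1" for m by (simp flip: power_mult_distrib)
 show thesis
 proof (rule sectored_from_signs[OF F, of 3 \<tau> k])
  fix j x assume x: "\<tau> j < x" "x < \<tau> (Suc j)"
  obtain m where m: "j = 3 * m | j = 3 * m + 1 | j = 3 * m + 2" using cases3 by blast
  define u where "u = x - real m * pi"
  have pw: "(- 1 :: real) ^ (3 * m) = (- 1) ^ m" by (simp add: power_mult)
  from m have "0 < (- 1) ^ (j + m) * (k * angular F u)"
  proof (elim disjE)
   assume j: "j = 3 * m"
   then have "0 < k * angular F u" using x unfolding j vals by (intro base) (auto simp: u_def)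
   then show ?thesis by (simp add: j power_add pw sq)
  next
   assume j: "j = 3 * m + 1"
   then have "0 < - (k * angular F u)" using x unfolding j vals by (intro base') (auto simp: u_def)
   then show ?thesis by (simp add: j power_add pw sq)
  next
   assume j: "j = 3 * m + 2"
   then have "0 < k * angular F u" using x unfolding j vals by (intro base) (auto simp: u_def)
   then show ?thesis by (simp add: j power_add pw sq)
  qed
  then show "0 < k * (- 1) ^ j * angular F x" unfolding shift[of x m] u_def by (simp add: power_add mult_ac)
 next
  show "\<tau> j < \<tau> (Suc j)" for j
  proof -
   obtain m where "j = 3 * m | j = 3 * m + 1 | j = 3 * m + 2" using cases3 by blast
   then show ?thesis using vals[of m] abc z by (elim disjE) auto
  qed
  show "\<tau> (j + 3) = \<tau> j + pi" for j by (simp add: \<tau>_def algebra_simps)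
  show "angular F (\<tau> j) = 0" for j
  proof -
   obtain m where "j = 3 * m | j = 3 * m + 1 | j = 3 * m + 2" using cases3 by blast
   then show ?thesis using vals[of m] z angular_add_multiple_pi[OF F'] by (elim disjE) auto
  qed
 qed (use that in auto)
qed

section \<open>Possible arrangements of nodes\<close>

lemma sectored_nondegenerate: "sectored F l th ==> nondegenerate F"
 unfolding nondegenerate_def
proof (intro conjI allI impI notI)
 assume S: "sectored F l th"
 show F: "F \<in> hom_fields 2" by (rule sectoredD(1)[OF S])
 fix x assume "angular F x = 0" "radial F x = 0"
 then have "F (of_real 1 * cis x) = 0" using field_zero_iff[OF F, of 1 x] by simp
 moreover have "F (of_real 1 * cis x) ~= 0" by (rule sectored_nonzero[OF S]) simp
 ultimately show False by contradiction
qed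

lemma hom_fields_2_pencil:
 assumes "F \<in> hom_fields 2"
 shows "F (of_real x * u + of_real y * v) = of_real (x^2) * F u + of_real (x * y) * (F (u + v) - F u - F v) + of_real (y^2) * F v"
proof -
 obtain a b where F: "F = hom_field 2 a b" using assms by (auto simp: hom_fields_def)
 show ?thesis unfolding F hom_field_2 by (simp add: complex_eq_iff power2_eq_square algebra_simps)
qed

text \<open>Three nodes would make the field point outwards on the two outer rays and inwards on the middle one.
In the basis of the outer directions \<open>u\<close> and \<open>v\<close> only one mixed term \<open>B\<close> is left. Invariance of the middle ray
makes its component across \<open>u\<close> negative, whereas the sign of the angular part in the first sector makes
it positive.\<close>

lemma not_three_nodes:
 assumes S: "sectored F 3 th"
 shows "\<not> (node F th 0 & node F th 1 & node F th 2)"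
proof
 assume nodes: "node F th 0 & node F th 1 & node F th 2"
 note F = sectoredD(1)[OF S]
 define f where "f = (%j. radial F (th j))"
 have f: "0 < f 0" "f 1 < 0" "0 < f 2" using nodes by (auto simp: node_def f_def)
 have Fz: "F (cis (th j)) = of_real (f j) * cis (th j)" for j
  using field_on_circle[of F "th j"] sectoredD(5)[OF S, of j] by (simp add: f_def complex_eq_iff)
 have order: "th 0 < th 1" "th 1 < th 2" "th 2 < th 0 + pi"
  using sectoredD(3)[OF S, of 0] sectoredD(3)[OF S, of 1] sectoredD(3)[OF S, of 2] sectoredD(4)[OF S, of 0]
  by (auto simp: numeral_2_eq_2 numeral_3_eq_3)
 define cr where "cr = (%u w. Im (cnj u * w))"
 have cr_add: "cr u (w + w') = cr u w + cr u w'" "cr (u + w) w' = cr u w' + cr w w'"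
  "cr u (of_real k * w) = k * cr u w" "cr (of_real k * u) w = k * cr u w" "cr u u = 0" for u w w' k
  by (simp_all add: cr_def algebra_simps)
 have cr_swap: "cr w u = - cr u w" for u w by (simp add: cr_def algebra_simps)
 define D where "D = sin (th 2 - th 0)"
 have D: "0 < D" unfolding D_def using order by (intro sin_gt_zero) auto
 define \<alpha> \<beta> where "\<alpha> = sin (th 2 - th 1) / D" and "\<beta> = sin (th 1 - th 0) / D"
 have ab: "0 < \<alpha>" "0 < \<beta>" unfolding \<alpha>_def \<beta>_def using order D by (auto intro!: divide_pos_pos sin_gt_zero)
 define u v where "u = cis (th 0)" and "v = cis (th 2)"
 have uv: "cr u v = D" by (simp add: u_def v_def cr_def D_def sin_diff mult.commute)
 have D_cis: "of_real D * cis (th 1) = of_real (sin (th 2 - th 1)) * u + of_real (sin (th 1 - th 0)) * v"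
 proof -
  have "D * cos (th 1) = sin (th 2 - th 1) * cos (th 0) + sin (th 1 - th 0) * cos (th 2)"
   "D * sin (th 1) = sin (th 2 - th 1) * sin (th 0) + sin (th 1 - th 0) * sin (th 2)"
   unfolding D_def sin_diff by algebra+
  then show ?thesis by (simp add: complex_eq_iff u_def v_def)
 qed
 have w: "cis (th 1) = of_real \<alpha> * u + of_real \<beta> * v"
 proof -
  have "cis (th 1) = of_real (1 / D) * (of_real D * cis (th 1))" using D by simp
  then show ?thesis unfolding D_cis by (simp add: \<alpha>_def \<beta>_def algebra_simps)
 qed
 define B where "B = F (u + v) - F u - F v"
 have Fu: "F u = of_real (f 0) * u" and Fv: "F v = of_real (f 2) * v" using Fz by (auto simp: u_def v_def)
 have pencil: "F (of_real x * u + of_real y * v) = of_real (x^2 * f 0) * u + of_real (x * y) * B + of_real (y^2 * f 2) * v" for x y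
  unfolding hom_fields_2_pencil[OF F] B_def[symmetric] unfolding Fu Fv by simp
 have "cr u (F (cis (th 1))) = cr u (of_real (f 1) * cis (th 1))" using Fz by simp
 then have "\<alpha> * \<beta> * cr u B + \<beta>\<^sup>2 * f 2 * D = f 1 * (\<beta> * D)"
  unfolding w pencil cr_add uv by simp
 then have "\<beta> * (\<alpha> * cr u B) = \<beta> * (f 1 * D - \<beta> * f 2 * D)" by (simp add: algebra_simps power2_eq_square)
 then have "\<alpha> * cr u B = f 1 * D - \<beta> * f 2 * D" using ab by simp
 moreover have "f 1 * D < 0" "0 < \<beta> * f 2 * D" using f D ab by (auto simp: mult_neg_pos)
 ultimately have "\<alpha> * cr u B < 0" by linarith
 then have B: "cr u B < 0" using ab by (simp add: mult_less_0_iff)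
 have angular: "cr (of_real x * u + of_real y * v) (F (of_real x * u + of_real y * v)) =
   x * y * (x * (cr u B - f 0 * D) + y * (f 2 * D - cr B v))" for x y
  unfolding pencil cr_add uv by (simp add: cr_swap[of v u] cr_swap[of v B] uv algebra_simps power2_eq_square)
 have "cr (cis (th 1)) (F (cis (th 1))) = 0" unfolding Fz cr_add by simp
 then have zero: "\<alpha> * (cr u B - f 0 * D) + \<beta> * (f 2 * D - cr B v) = 0"
  unfolding w angular using ab by simp
 define m where "m = (th 0 + th 1) / 2"
 define h where "h = (th 1 - th 0) / 2"
 define r where "r = 2 * cos h"
 have "u + cis (th 1) = of_real r * cis m"
 proof -
  have t: "th 0 = m - h" "th 1 = m + h" by (simp_all add: m_def h_def field_simps)
  have "cos (th 0) + cos (th 1) = r * cos m" "sin (th 0) + sin (th 1) = r * sin m"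
   unfolding t cos_diff cos_add sin_diff sin_add r_def by simp_all
  then show ?thesis by (simp add: u_def complex_eq_iff)
 qed
 then have um: "of_real (1 + \<alpha>) * u + of_real \<beta> * v = of_real r * cis m" unfolding w by (simp add: algebra_simps)
 have "cnj (cis m) * (cis m * z) = z" for z by (simp add: cis_cnj cis_mult flip: mult.assoc)
 then have cr_m: "cr (cis m) (cis m * z) = Im z" for z by (simp only: cr_def)
 have "cr (of_real r * cis m) (F (of_real r * cis m)) = r ^ 3 * angular F m"
  unfolding field_polar[OF F] cr_add cr_m by (simp add: power3_eq_cube power2_eq_square)
 moreover have "0 < r" unfolding r_def h_def using order by (intro mult_pos_pos cos_gt_zero_pi) auto
 moreover have "0 < angular F m" using sectoredD(7)[OF S, of 0 m] order by (simp add: m_def)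
 ultimately have "0 < (1 + \<alpha>) * \<beta> * ((1 + \<alpha>) * (cr u B - f 0 * D) + \<beta> * (f 2 * D - cr B v))"
  unfolding um[symmetric] angular by simp
 then have "0 < (1 + \<alpha>) * (cr u B - f 0 * D) + \<beta> * (f 2 * D - cr B v)"
  using ab by (metis add_pos_pos mult_pos_pos zero_less_mult_pos zero_less_one)
 then have "0 < cr u B - f 0 * D" using zero by (simp add: algebra_simps)
 moreover have "0 < f 0 * D" using f D by simp
 ultimately show False using B by linarith
qed

lemma sectored_shift:
 assumes S: "sectored F l th" and k: "even k"
 shows "sectored F l (%j. th (j + k))" "node F (%j. th (j + k)) j \<longleftrightarrow> node F th (j + k)"
proof -
 have p: "(- 1 :: real) ^ (j + k) = (- 1) ^ j" for j using k by (simp add: power_add)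
 have "th (j + l + k) = th (j + k) + pi" for j using sectoredD(4)[OF S, of "j + k"] by (simp add: ac_simps)
 then show "sectored F l (%j. th (j + k))"
  using S sectoredD(7)[OF S, of "_ + k"] unfolding sectored_def p by simp
 show "node F (%j. th (j + k)) j \<longleftrightarrow> node F th (j + k)" unfolding node_def p ..
qed

lemma node_mod_3:
 assumes S: "sectored F 3 th" shows "node F th j \<longleftrightarrow> node F th (j mod 3)"
proof (induction j rule: less_induct)
 case (less j)
 show ?case
 proof (cases "j < 3")
  case False
  then have "node F th j \<longleftrightarrow> node F th (j - 3)" using node_periodic[OF S, of "j - 3"] by simp
  then show ?thesis using less[of "j - 3"] False by (simp add: mod_if[of j])
 qed simp
qed

lemma node_count_3: "node_count F 3 th = of_bool (node F th 0) + of_bool (node F th 1) + of_bool (node F th 2)"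
proof -
 have "node_count F 3 th = (\<Sum>j\<in>{0,1,2::nat}. of_bool (node F th j))"
 proof -
  have "{j. j < 3 & node F th j} = {j \<in> {0,1,2}. node F th j}" by auto
  then show ?thesis by (simp add: node_count_def sum.If_cases Int_def of_bool_def)
 qed
 then show ?thesis by simp
qed

lemma node_count_le_2: "sectored F 3 th ==> node_count F 3 th <= 2"
 using not_three_nodes[of F th] unfolding node_count_3
 by (cases "node F th 0"; cases "node F th 1"; cases "node F th 2") simp_all

text \<open>Shifting the starting ray by an even number preserves the sign convention; since the number of rays is
odd, this reaches every rotation of the node sequence.\<close>

lemma sectored_normal_form:
 assumes S: "sectored F 3 th"
 obtains th' where "sectored F 3 th'" "node_count F 3 th' = node_count F 3 th"
  "!!j. node F th' j \<longleftrightarrow> (if node_count F 3 th = 0 then False else if node_count F 3 th = 1 then j mod 3 = 0 else j mod 3 ~= 0)"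
proof -
 define N where "N = node_count F 3 th"
 have N: "N <= 2" unfolding N_def by (rule node_count_le_2[OF S])
 define P where "P = (%j. node F th j = (N = 1))"
 have "\<exists>k. even k & (N = 0 | node F th k = (N = 1))"
 proof -
  consider "N = 0" | "N = 1" | "N = 2" using N by linarith
  then show ?thesis
  proof cases
   case 2
   then have "node F th 0 | node F th 1 | node F th 2" unfolding N_def node_count_3
    by (cases "node F th 0"; cases "node F th 1"; cases "node F th 2") simp_all
   then have "node F th 0 | node F th 4 | node F th 2" using node_mod_3[OF S, of 4] by simp
   then have "\<exists>k. even k & node F th k"
    by (elim disjE) (rule exI[of _ 0], simp, rule exI[of _ 4], simp, rule exI[of _ 2], simp)
   then show ?thesis using 2 by simp
  next
   case 3
   have "\<not> node F th 0 | \<not> node F th 1 | \<not> node F th 2" using not_three_nodes[OF S] by blast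
   then have "\<not> node F th 0 | \<not> node F th 4 | \<not> node F th 2" using node_mod_3[OF S, of 4] by simp
   then have "\<exists>k. even k & \<not> node F th k"
    by (elim disjE) (rule exI[of _ 0], simp, rule exI[of _ 4], simp, rule exI[of _ 2], simp)
   then show ?thesis using 3 by simp
  qed auto
 qed
 then obtain k where k: "even k" "N = 0 | node F th k = (N = 1)" by blast
 note S' = sectored_shift(1)[OF S k(1)] and n' = sectored_shift(2)[OF S k(1)]
 have *: "node F (%j. th (j + k)) j \<longleftrightarrow> node F th ((j + k) mod 3)" for j
  unfolding n' using node_mod_3[OF S] by blast
 have count: "node_count F 3 (%j. th (j + k)) = N"
 proof -
  have "k mod 3 = 0 | k mod 3 = 1 | k mod 3 = 2" by linarith
  then show ?thesis unfolding N_def node_count_3 *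
  proof (elim disjE)
   assume "k mod 3 = 0"
   then have "(0 + k) mod 3 = 0" "(1 + k) mod 3 = 1" "(2 + k) mod 3 = 2" by presburger+
   then show "of_bool (node F th ((0 + k) mod 3)) + of_bool (node F th ((1 + k) mod 3)) + of_bool (node F th ((2 + k) mod 3)) =
    (of_bool (node F th 0) + of_bool (node F th 1) + of_bool (node F th 2) :: nat)" by simp
  next
   assume "k mod 3 = 1"
   then have "(0 + k) mod 3 = 1" "(1 + k) mod 3 = 2" "(2 + k) mod 3 = 0" by presburger+
   then show "of_bool (node F th ((0 + k) mod 3)) + of_bool (node F th ((1 + k) mod 3)) + of_bool (node F th ((2 + k) mod 3)) =
    (of_bool (node F th 0) + of_bool (node F th 1) + of_bool (node F th 2) :: nat)" by simp
  next
   assume "k mod 3 = 2"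
   then have "(0 + k) mod 3 = 2" "(1 + k) mod 3 = 0" "(2 + k) mod 3 = 1" by presburger+
   then show "of_bool (node F th ((0 + k) mod 3)) + of_bool (node F th ((1 + k) mod 3)) + of_bool (node F th ((2 + k) mod 3)) =
    (of_bool (node F th 0) + of_bool (node F th 1) + of_bool (node F th 2) :: nat)" by simp
  qed
 qed
 define \<psi> where "\<psi> = (%j. th (j + k))"
 have S\<psi>: "sectored F 3 \<psi>" and c\<psi>: "node_count F 3 \<psi> = N" unfolding \<psi>_def by (rule S', rule count)
 have first: "N = 0 | node F \<psi> 0 = (N = 1)" using k(2) n'[of 0] unfolding \<psi>_def by simp
 show thesis
 proof (rule that[OF S\<psi>])
  show "node_count F 3 \<psi> = node_count F 3 th" using c\<psi> by (simp add: N_def)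
  fix j :: nat
  have "j mod 3 = 0 | j mod 3 = 1 | j mod 3 = 2" by linarith
  then show "node F \<psi> j \<longleftrightarrow> (if node_count F 3 th = 0 then False else if node_count F 3 th = 1 then j mod 3 = 0 else j mod 3 ~= 0)"
   unfolding N_def[symmetric] using node_mod_3[OF S\<psi>, of j] c\<psi> first N unfolding node_count_3
   by (elim disjE; cases "node F \<psi> 0"; cases "node F \<psi> 1"; cases "node F \<psi> 2"; simp)
 qed
qed

text \<open>The complete invariant: the number of lines and the number of nodes among them.\<close>

definition portrait_data :: "(complex => complex) => nat => nat => bool" where
 "portrait_data F l N \<longleftrightarrow> (\<exists>th. sectored F l th & node_count F l th = N)"

lemma portrait_data_index: "portrait_data F l N ==> has_index F 0 (1 - int l + 2 * int N)"
 unfolding portrait_data_def using sectored_index by blast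

lemma portrait_data_exists:
 assumes F: "nondegenerate F" and l: "card (zero_angles F) = l" "l = 1 | l = 3"
 obtains N where "portrait_data F l N" "N <= (l + 1) div 2"
proof -
 from l(2) show thesis
 proof
  assume l1: "l = 1"
  then obtain th where S: "sectored F 1 th" using sectored_exists_1[OF F] l(1) by blast
  have "node_count F 1 th <= 1"
   unfolding node_count_def using card_mono[of "{0::nat}" "{j. j < 1 & node F th j}"] by auto
  then show thesis using that[of "node_count F 1 th"] S l1 unfolding portrait_data_def by auto
 next
  assume l3: "l = 3"
  then obtain th where S: "sectored F 3 th" using sectored_exists_3[OF F] l(1) by blast
  then show thesis using that[of "node_count F 3 th"] node_count_le_2[OF S] l3 unfolding portrait_data_def by auto
 qed
qed

lemma node_1_const:
 assumes "sectored F 1 th" shows "node F th j \<longleftrightarrow> node_count F 1 th = 1"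
proof -
 have "node F th j \<longleftrightarrow> node F th 0"
  by (induction j) (use node_periodic[OF assms] in auto)
 moreover have "{j. j < 1 & node F th j} = (if node F th 0 then {0::nat} else {})" by auto
 ultimately show ?thesis by (simp add: node_count_def)
qed

lemma portrait_data_equivalent:
 assumes "portrait_data F l N" "portrait_data G l N" "l = 1 | l = 3"
 shows "same_phase_portrait F G"
proof -
 obtain th \<psi> where S: "sectored F l th" "node_count F l th = N" and T: "sectored G l \<psi>" "node_count G l \<psi> = N"
  using assms(1,2) unfolding portrait_data_def by blast
 from assms(3) show ?thesis
 proof
  assume l: "l = 1"
  have "node F th j \<longleftrightarrow> node G \<psi> j" for j
   using node_1_const[of F th j] node_1_const[of G \<psi> j] S T l by simp
  then show ?thesis by (rule sectored_equivalent[OF S(1) T(1)])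
 next
  assume l: "l = 3"
  obtain th' where S': "sectored F 3 th'" "!!j. node F th' j \<longleftrightarrow> (if N = 0 then False else if N = 1 then j mod 3 = 0 else j mod 3 ~= 0)"
   using sectored_normal_form[of F th] S l by metis
  obtain \<psi>' where T': "sectored G 3 \<psi>'" "!!j. node G \<psi>' j \<longleftrightarrow> (if N = 0 then False else if N = 1 then j mod 3 = 0 else j mod 3 ~= 0)"
   using sectored_normal_form[of G \<psi>] T l by metis
  have "node F th' j \<longleftrightarrow> node G \<psi>' j" for j unfolding S'(2) T'(2) ..
  then show ?thesis by (rule sectored_equivalent[OF S'(1) T'(1)])
 qed
qed

text \<open>For \<open>l = 1\<close> consecutive rays have the same type, and for \<open>l = 3\<close> two nodes are always adjacent; so
homoclinic orbits exist exactly for the largest possible number of nodes.\<close>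

lemma portrait_data_homoclinic:
 assumes D: "portrait_data F l N" and l: "l = 1 | l = 3"
 shows "homoclinic_orbit F \<longleftrightarrow> 2 * N = l + 1"
proof -
 obtain th where S: "sectored F l th" "node_count F l th = N" using D unfolding portrait_data_def by blast
 from l show ?thesis
 proof
  assume "l = 1"
  then show ?thesis using homoclinic_orbit_iff[OF S(1)] node_1_const[of F th] S by auto
 next
  assume l: "l = 3"
  obtain th' where S': "sectored F 3 th'" "!!j. node F th' j \<longleftrightarrow> (if N = 0 then False else if N = 1 then j mod 3 = 0 else j mod 3 ~= 0)"
   using sectored_normal_form[of F th] S l by metis
  have N2: "N <= 2" using node_count_le_2[of F th] S l by simp
  have "homoclinic_orbit F \<longleftrightarrow> (\<exists>j. node F th' j & node F th' (Suc j))" by (rule homoclinic_orbit_iff[OF S'(1)])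
  also have "\<dots> \<longleftrightarrow> N = 2"
  proof
   assume "\<exists>j. node F th' j & node F th' (Suc j)"
   then obtain j where j: "node F th' j" "node F th' (Suc j)" by blast
   show "N = 2"
   proof (rule ccontr)
    assume "N ~= 2"
    then have "N = 0 | N = 1" using N2 by linarith
    then show False using j unfolding S'(2) by (elim disjE) (simp, simp, presburger)
   qed
  next
   assume "N = 2"
   then have "node F th' 1 & node F th' (Suc 1)" unfolding S'(2) by simp
   then show "\<exists>j. node F th' j & node F th' (Suc j)" by blast
  qed
  finally show ?thesis using l by auto
 qed
qed

lemma portrait_data_twin:
 assumes D: "portrait_data F 3 N"
 shows "N = 0 ==> \<not> twin_orbits F" "N = 1 ==> twin_orbits F"
proof -
 obtain th where S: "sectored F 3 th" "node_count F 3 th = N" using D unfolding portrait_data_def by blast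
 obtain th' where S': "sectored F 3 th'" "!!j. node F th' j \<longleftrightarrow> (if N = 0 then False else if N = 1 then j mod 3 = 0 else j mod 3 ~= 0)"
  using sectored_normal_form[of F th] S by metis
 show "\<not> twin_orbits F" if "N = 0" using no_twin_orbits[OF S'(1)] that unfolding S'(2) by simp
 show "twin_orbits F" if "N = 1"
  by (rule twin_orbits_if[OF S'(1), of 0]) (simp_all add: S'(2) that)
qed

section \<open>Topological invariants of the portrait\<close>

lemma limit_reparametrized:
 fixes f :: "real => complex" and \<tau> :: "real => real"
 assumes \<tau>: "strict_mono \<tau>" "surj \<tau>"
 shows "((%t. f (\<tau> t)) \<longlongrightarrow> p) at_top ==> (f \<longlongrightarrow> p) at_top"
  and "((%t. f (\<tau> t)) \<longlongrightarrow> p) at_bot ==> (f \<longlongrightarrow> p) at_bot"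
proof -
 define \<rho> where "\<rho> = inv \<tau>"
 have \<tau>\<rho>: "\<tau> (\<rho> s) = s" for s unfolding \<rho>_def by (rule surj_f_inv_f[OF \<tau>(2)])
 have le: "Z <= \<rho> s \<longleftrightarrow> \<tau> Z <= s" "\<rho> s <= Z \<longleftrightarrow> s <= \<tau> Z" for Z s
  using strict_mono_less_eq[OF \<tau>(1), of Z "\<rho> s"] strict_mono_less_eq[OF \<tau>(1), of "\<rho> s" Z] unfolding \<tau>\<rho> by simp_all
 have "filterlim \<rho> at_top at_top" unfolding filterlim_at_top le by (intro allI eventually_ge_at_top)
 then show "((%t. f (\<tau> t)) \<longlongrightarrow> p) at_top ==> (f \<longlongrightarrow> p) at_top"
  using filterlim_compose[of "%t. f (\<tau> t)" "nhds p" at_top \<rho> at_top] unfolding \<tau>\<rho> by blast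
 have "filterlim \<rho> at_bot at_bot" unfolding filterlim_at_bot le by (intro allI eventually_le_at_bot)
 then show "((%t. f (\<tau> t)) \<longlongrightarrow> p) at_bot ==> (f \<longlongrightarrow> p) at_bot"
  using filterlim_compose[of "%t. f (\<tau> t)" "nhds p" at_bot \<rho> at_bot] unfolding \<tau>\<rho> by blast
qed

definition portrait_map :: "(complex => complex) => (complex => complex) => (complex => complex) => real => bool" where
 "portrait_map F G h \<sigma> \<longleftrightarrow> inj_on h (cball 0 1) & continuous_on (cball 0 1) h & h ` cball 0 1 = cball 0 1 &
   h ` sphere 0 1 = sphere 0 1 & (\<sigma> = 1 | \<sigma> = -1) &
   (\<forall>\<gamma>. disk_trajectory F \<gamma> --> (\<exists>\<delta> \<tau>. disk_trajectory G \<delta> & strict_mono \<tau> & surj \<tau> & (\<forall>t. h (\<gamma> t) = \<delta> (\<sigma> * \<tau> t))))"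

lemma same_phase_portrait_map:
 assumes "same_phase_portrait F G" obtains h \<sigma> where "portrait_map F G h \<sigma>"
proof -
 obtain h h' \<sigma> where h: "homeomorphism (cball 0 1) (cball 0 1) h h'" "h ` sphere 0 1 = sphere 0 1" and s: "\<sigma> \<in> {1, -1}"
  and tr: "\<forall>\<gamma>. disk_trajectory F \<gamma> --> (\<exists>\<delta> \<tau>. disk_trajectory G \<delta> & strict_mono \<tau> & surj \<tau> & (\<forall>t. h (\<gamma> t) = \<delta> (\<sigma> * \<tau> t)))"
  using assms unfolding same_phase_portrait_def by (elim exE conjE bexE)
 have s': "\<sigma> = 1 | \<sigma> = -1" using s by simp
 have "inj_on h (cball 0 1)" using h(1) unfolding homeomorphism_def by (metis inj_on_def)
 then have "portrait_map F G h \<sigma>" using h(2) homeomorphism_cont1[OF h(1)] homeomorphism_image1[OF h(1)] s' tr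
  unfolding portrait_map_def by (intro conjI)
 then show thesis by (rule that)
qed

lemma portrait_mapD:
 assumes "portrait_map F G h \<sigma>"
 shows "inj_on h (cball 0 1)" "continuous_on (cball 0 1) h" "h ` cball 0 1 = cball 0 1" "h ` sphere 0 1 = sphere 0 1"
  "\<sigma> = 1 | \<sigma> = -1"
  "disk_trajectory F \<gamma> ==> \<exists>\<delta> \<tau>. disk_trajectory G \<delta> & strict_mono \<tau> & surj \<tau> & (\<forall>t. h (\<gamma> t) = \<delta> (\<sigma> * \<tau> t))"
 using assms[unfolded portrait_map_def] by (elim conjE, simp)+

lemma disk_trajectory_in: "disk_trajectory F \<gamma> ==> \<gamma> t \<in> cball 0 1"
 unfolding disk_trajectory_def by blast

lemma portrait_map_singular:
 assumes h: "portrait_map F G h \<sigma>" and u: "u \<in> cball 0 1" "poincare_field F u = 0"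
 shows "poincare_field G (h u) = 0"
proof -
 obtain \<delta> and \<tau> :: "real => real" where d: "disk_trajectory G \<delta>" "surj \<tau>" "!!t. h u = \<delta> (\<sigma> * \<tau> t)"
  using portrait_mapD(6)[OF h disk_trajectory_const[OF u(2,1)]] by blast
 have "\<delta> s = h u" for s
 proof -
  obtain t where "\<tau> t = \<sigma> * s" using d(2) by (metis surjD)
  then show ?thesis using d(3)[of t] portrait_mapD(5)[OF h] by auto
 qed
 then have "\<delta> = (%_. h u)" by blast
 then have "((%_. h u) has_vector_derivative poincare_field G (h u)) (at (0::real))"
  using d(1) unfolding disk_trajectory_def trajectory_on_def by simp
 then show ?thesis using vector_derivative_unique_at[OF _ has_vector_derivative_const] by blast
qed

lemma interior_singular_point:
 assumes G: "nondegenerate G" and v: "v \<in> ball 0 1" "poincare_field G v = 0" shows "v = 0"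
proof (rule ccontr)
 assume "v ~= 0"
 obtain x where x: "v = of_real (norm v) * cis x" using polar_coordinates[of 0 v] by blast
 have "poincare_field G (of_real (norm v) * cis x) = 0" using v(2) x by metis
 then show False
  using poincare_field_zero_iff[of G "norm v" x] G v(1) \<open>v ~= 0\<close> by (auto simp: nondegenerate_def)
qed

lemma portrait_map_ball:
 assumes h: "portrait_map F G h \<sigma>" and u: "u \<in> ball 0 1" shows "h u \<in> ball 0 1"
proof -
 have "h u \<in> cball 0 1" using portrait_mapD(3)[OF h] u by auto
 moreover have "h u \<notin> sphere 0 1"
 proof
  assume "h u \<in> sphere 0 1"
  then obtain v where "v \<in> sphere 0 1" "h v = h u" using portrait_mapD(4)[OF h] by (metis imageE)
  then have "v = u" using inj_onD[OF portrait_mapD(1)[OF h], of v u] u by auto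
  then show False using u \<open>v \<in> sphere 0 1\<close> by auto
 qed
 ultimately show ?thesis by (auto simp: less_le)
qed

text \<open>The origin is the only singular point inside the disk of a nondegenerate field, so it is fixed; a
degenerate field would have further interior singular points.\<close>

lemma portrait_map_origin:
 assumes F: "F \<in> hom_fields 2" and G: "nondegenerate G" and h: "portrait_map F G h \<sigma>"
 shows "h 0 = 0" "nondegenerate F"
proof -
 have G0: "h u = 0" if "u \<in> ball 0 1" "poincare_field F u = 0" for u
  using interior_singular_point[OF G portrait_map_ball[OF h that(1)]] portrait_map_singular[OF h _ that(2)] that(1) by auto
 show h0: "h 0 = 0" by (rule G0) (auto simp: poincare_field_0[OF F])
 show "nondegenerate F"
 proof (rule ccontr)
  assume "\<not> nondegenerate F"
  then obtain x where x: "angular F x = 0" "radial F x = 0" using F by (auto simp: nondegenerate_def)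
  define u where "u = of_real (1 / 2) * cis x"
  have u: "u \<in> ball 0 1" "u ~= 0" by (auto simp: u_def norm_mult)
  have "poincare_field F u = 0" unfolding u_def using poincare_field_zero_iff[OF F, of "1/2" x] x by simp
  then have "h u = h 0" using G0[OF u(1)] h0 by simp
  then show False using inj_onD[OF portrait_mapD(1)[OF h], of u 0] u by auto
 qed
qed

lemma transfer_limits:
 assumes h: "portrait_map F G h \<sigma>" and \<gamma>: "disk_trajectory F \<gamma>" and e: "e = 1 | e = (-1 :: real)"
  and d: "strict_mono \<tau>" "surj \<tau>" "!!t. h (\<gamma> t) = \<delta> (\<sigma> * \<tau> t)"
  and p: "((%t. \<gamma> (e * t)) \<longlongrightarrow> p) at_top" "((%t. \<gamma> (e * t)) \<longlongrightarrow> q) at_bot" "p \<in> cball 0 1" "q \<in> cball 0 1"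
 shows "((%t. \<delta> ((\<sigma> * e) * t)) \<longlongrightarrow> h p) at_top & ((%t. \<delta> ((\<sigma> * e) * t)) \<longlongrightarrow> h q) at_bot"
proof -
 define \<rho> where "\<rho> = (%t. e * \<tau> (e * t))"
 have ee: "e * (e * t) = t" for t using e by auto
 have \<rho>: "strict_mono \<rho>" using d(1) e by (auto simp: \<rho>_def strict_mono_def)
 have "\<exists>t. \<rho> t = s" for s
 proof -
  obtain t where "\<tau> t = e * s" using d(2) by (metis surjD)
  then have "\<rho> (e * t) = s" by (simp add: \<rho>_def ee)
  then show ?thesis by blast
 qed
 then have \<rho>s: "surj \<rho>" by (metis surjI surj_def)
 have eq: "h (\<gamma> (e * t)) = \<delta> ((\<sigma> * e) * \<rho> t)" for t by (simp add: d(3) \<rho>_def mult.assoc ee)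
 have "((%t. h (\<gamma> (e * t))) \<longlongrightarrow> h p) at_top" "((%t. h (\<gamma> (e * t))) \<longlongrightarrow> h q) at_bot"
  using disk_trajectory_in[OF \<gamma>]
  by (auto intro!: continuous_on_tendsto_compose[OF portrait_mapD(2)[OF h]] p always_eventually simp del: mem_cball)
 then show ?thesis unfolding eq
  using limit_reparametrized[OF \<rho> \<rho>s, of "%t. \<delta> ((\<sigma> * e) * t)"] by blast
qed

lemma disk_trajectory_shift:
 assumes "disk_trajectory F \<gamma>" shows "disk_trajectory F (%t. \<gamma> (t + c))"
proof -
 have "((%t. \<gamma> (t + c)) has_vector_derivative poincare_field F (\<gamma> (t + c))) (at t)" for t
 proof -
  have "((%t. t + c) has_vector_derivative 1) (at t)" by (auto intro!: derivative_eq_intros)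
  moreover have "(\<gamma> has_vector_derivative poincare_field F (\<gamma> (t + c))) (at (t + c))"
   using assms by (simp add: disk_trajectory_def trajectory_on_def)
  ultimately show ?thesis using vector_diff_chain_at[of "%t. t + c" 1 t \<gamma>] by (simp add: o_def)
 qed
 then show ?thesis using disk_trajectory_in[OF assms] by (auto simp: disk_trajectory_def trajectory_on_def)
qed

lemma homoclinic_orbit_transfer:
 assumes F: "F \<in> hom_fields 2" and h: "portrait_map F G h \<sigma>" and h0: "h 0 = 0" and "homoclinic_orbit F"
 shows "homoclinic_orbit G"
proof -
 obtain \<gamma> where \<gamma>: "disk_trajectory F \<gamma>" "\<gamma> 0 ~= 0" "((%t. \<gamma> (1 * t)) \<longlongrightarrow> 0) at_top" "((%t. \<gamma> (1 * t)) \<longlongrightarrow> 0) at_bot"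
  using assms(4) unfolding homoclinic_orbit_def by auto
 obtain \<delta> \<tau> where d: "disk_trajectory G \<delta>" "strict_mono \<tau>" "surj \<tau>" "!!t. h (\<gamma> t) = \<delta> (\<sigma> * \<tau> t)"
  using portrait_mapD(6)[OF h \<gamma>(1)] by blast
 have "((%t. \<delta> ((\<sigma> * 1) * t)) \<longlongrightarrow> h 0) at_top & ((%t. \<delta> ((\<sigma> * 1) * t)) \<longlongrightarrow> h 0) at_bot"
  by (rule transfer_limits[OF h \<gamma>(1) _ d(2-4) \<gamma>(3,4)]) auto
 then have lim: "((%t. \<delta> (\<sigma> * t)) \<longlongrightarrow> 0) at_top" "((%t. \<delta> (\<sigma> * t)) \<longlongrightarrow> 0) at_bot" by (simp_all add: h0)
 note s = portrait_mapD(5)[OF h]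
 have l: "(\<delta> \<longlongrightarrow> 0) at_top & (\<delta> \<longlongrightarrow> 0) at_bot" using sign_flip_limits[OF s lim] s by blast
 obtain t1 where t1: "\<tau> t1 = 0" using d(3) by (metis surjD)
 have "\<delta> 0 ~= 0"
 proof
  assume "\<delta> 0 = 0"
  then have "h (\<gamma> t1) = h 0" using d(4)[of t1] t1 h0 by simp
  then have "\<gamma> t1 = 0" using inj_onD[OF portrait_mapD(1)[OF h], of "\<gamma> t1" 0] disk_trajectory_in[OF \<gamma>(1), of t1] by auto
  then have "\<gamma> = (%_. 0)"
   using disk_trajectory_unique[OF F \<gamma>(1) disk_trajectory_const[OF poincare_field_0[OF F]], of t1] by simp
  then show False using \<gamma>(2) by simp
 qed
 then show ?thesis using d(1) l unfolding homoclinic_orbit_def by blast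
qed

lemma twin_orbits_transfer:
 assumes F: "F \<in> hom_fields 2" and h: "portrait_map F G h \<sigma>" and h0: "h 0 = 0" and "twin_orbits F"
 shows "twin_orbits G"
proof -
 obtain \<gamma> \<delta> p e where *: "disk_trajectory F \<gamma>" "disk_trajectory F \<delta>" "\<gamma> 0 \<notin> range \<delta>" "norm p = 1" "e = 1 | e = -1"
  "((%t. \<gamma> (e * t)) \<longlongrightarrow> p) at_top" "((%t. \<gamma> (e * t)) \<longlongrightarrow> 0) at_bot"
  "((%t. \<delta> (e * t)) \<longlongrightarrow> p) at_top" "((%t. \<delta> (e * t)) \<longlongrightarrow> 0) at_bot"
  using assms(4) unfolding twin_orbits_def by blast
 obtain \<gamma>' \<tau> where c: "disk_trajectory G \<gamma>'" "strict_mono \<tau>" "surj \<tau>" "!!t. h (\<gamma> t) = \<gamma>' (\<sigma> * \<tau> t)"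
  using portrait_mapD(6)[OF h *(1)] by blast
 obtain \<delta>' \<tau>' where d: "disk_trajectory G \<delta>'" "strict_mono \<tau>'" "surj \<tau>'" "!!t. h (\<delta> t) = \<delta>' (\<sigma> * \<tau>' t)"
  using portrait_mapD(6)[OF h *(2)] by blast
 have in_disk: "p \<in> cball 0 1" "0 \<in> cball 0 (1::real)" using *(4) by auto
 have lc: "((%t. \<gamma>' ((\<sigma> * e) * t)) \<longlongrightarrow> h p) at_top & ((%t. \<gamma>' ((\<sigma> * e) * t)) \<longlongrightarrow> h 0) at_bot"
  by (rule transfer_limits[OF h *(1,5) c(2-4) *(6,7)]) (use *(4) in auto)
 have ld: "((%t. \<delta>' ((\<sigma> * e) * t)) \<longlongrightarrow> h p) at_top & ((%t. \<delta>' ((\<sigma> * e) * t)) \<longlongrightarrow> h 0) at_bot"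
  by (rule transfer_limits[OF h *(2,5) d(2-4) *(8,9)]) (use *(4) in auto)
 have s: "\<sigma> * e = 1 | \<sigma> * e = -1" using portrait_mapD(5)[OF h] *(5) by auto
 have hp: "norm (h p) = 1" using portrait_mapD(4)[OF h] *(4) by (metis imageI mem_sphere_0)
 have "\<gamma>' 0 \<notin> range \<delta>'"
 proof
  assume "\<gamma>' 0 \<in> range \<delta>'"
  then obtain r where r: "\<gamma>' 0 = \<delta>' r" by auto
  obtain t1 where t1: "\<tau> t1 = 0" using c(3) by (metis surjD)
  obtain t2 where t2: "\<tau>' t2 = \<sigma> * r" using d(3) by (metis surjD)
  have "\<sigma> * (\<sigma> * r) = r" using portrait_mapD(5)[OF h] by auto
  then have "h (\<gamma> t1) = h (\<delta> t2)" by (simp only: c(4)[of t1] d(4)[of t2] t1 t2 r mult_zero_right)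
  then have "\<gamma> t1 = \<delta> t2"
   using inj_onD[OF portrait_mapD(1)[OF h] _ disk_trajectory_in[OF *(1)] disk_trajectory_in[OF *(2)]] by blast
  then have "\<gamma> = (%t. \<delta> (t + (t2 - t1)))"
   using disk_trajectory_unique[OF F *(1) disk_trajectory_shift[OF *(2)], of t1] by simp
  then show False using *(3) by auto
 qed
 then show ?thesis unfolding twin_orbits_def using c(1) d(1) hp s lc[unfolded h0] ld[unfolded h0] by blast
qed

definition circle_singularities :: "(complex => complex) => complex set" where
 "circle_singularities F = {u \<in> sphere 0 1. poincare_field F u = 0}"

lemma cis_inj_on: "inj_on cis {0..<2 * pi}"
proof (rule inj_onI)
 fix x y assume xy: "x \<in> {0..<2 * pi}" "y \<in> {0..<2 * pi}" "cis x = cis y"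
 then show "x = y" using polar_eq_iff[of 1 1 x 0 y] by auto
qed

lemma circle_singularities_eq:
 assumes F: "F \<in> hom_fields 2"
 shows "circle_singularities F = cis ` (zero_angles F \<union> (%x. x + pi) ` zero_angles F)"
proof (intro equalityI subsetI)
 fix u assume u: "u \<in> circle_singularities F"
 obtain x where x: "0 <= x" "x < 0 + 2 * pi" "u = of_real (norm u) * cis x" by (rule polar_coordinates)
 then have ux: "u = of_real 1 * cis x" using u by (simp add: circle_singularities_def)
 then have "angular F x = 0" using u poincare_field_zero_iff[OF F, of 1 x] by (simp add: circle_singularities_def)
 then have "x \<in> zero_angles F | x - pi \<in> zero_angles F" using zero_angles_complete[OF F] x by simp
 then have "x \<in> zero_angles F \<union> (%x. x + pi) ` zero_angles F" by force
 then show "u \<in> cis ` (zero_angles F \<union> (%x. x + pi) ` zero_angles F)" using ux by simp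
next
 fix u assume "u \<in> cis ` (zero_angles F \<union> (%x. x + pi) ` zero_angles F)"
 then obtain x where x: "u = cis x" "angular F x = 0"
  using radial_angular_add_pi(2)[OF F] by (auto simp: zero_angles_def)
 then show "u \<in> circle_singularities F"
  using poincare_field_zero_iff[OF F, of 1 x] by (simp add: circle_singularities_def)
qed

lemma card_circle_singularities:
 assumes F: "F \<in> hom_fields 2"
 shows "finite (circle_singularities F) \<longleftrightarrow> finite (zero_angles F)"
  "finite (zero_angles F) ==> card (circle_singularities F) = 2 * card (zero_angles F)"
proof -
 let ?Z = "zero_angles F" and ?Z' = "(%x. x + pi) ` zero_angles F"
 have inj: "inj_on cis (?Z \<union> ?Z')" by (rule inj_on_subset[OF cis_inj_on]) (auto simp: zero_angles_def)
 have "inj_on (%x. x + pi) ?Z" by (auto simp: inj_on_def)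
 then have Z': "card ?Z' = card ?Z" "finite ?Z' \<longleftrightarrow> finite ?Z" by (simp_all add: card_image finite_image_iff)
 show "finite (circle_singularities F) \<longleftrightarrow> finite ?Z"
  unfolding circle_singularities_eq[OF F] finite_image_iff[OF inj] using Z' by simp
 assume fin: "finite ?Z"
 have "?Z \<inter> ?Z' = {}" by (auto simp: zero_angles_def)
 then have "card (?Z \<union> ?Z') = card ?Z + card ?Z'" using fin by (intro card_Un_disjoint) auto
 then show "card (circle_singularities F) = 2 * card ?Z"
  unfolding circle_singularities_eq[OF F] card_image[OF inj] using Z' by simp
qed

lemma portrait_map_circle:
 assumes h: "portrait_map F G h \<sigma>"
 shows "h ` circle_singularities F \<subseteq> circle_singularities G" "inj_on h (circle_singularities F)"
proof -
 show "h ` circle_singularities F \<subseteq> circle_singularities G"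
  using portrait_map_singular[OF h] portrait_mapD(4)[OF h] by (auto simp: circle_singularities_def)
 show "inj_on h (circle_singularities F)"
  by (rule inj_on_subset[OF portrait_mapD(1)[OF h]]) (auto simp: circle_singularities_def)
qed

text \<open>Each invariant line ends in two singular points on the boundary, and singular points are mapped to
singular points in both directions.\<close>

lemma same_line_count:
 assumes F: "F \<in> hom_fields 2" "G \<in> hom_fields 2" and FG: "same_phase_portrait F G" "same_phase_portrait G F"
  and fin: "finite (zero_angles G)"
 shows "finite (zero_angles F) & card (zero_angles F) = card (zero_angles G)"
proof -
 obtain h \<sigma> where h: "portrait_map F G h \<sigma>" using same_phase_portrait_map[OF FG(1)] .
 obtain k \<rho> where k: "portrait_map G F k \<rho>" using same_phase_portrait_map[OF FG(2)] .
 have finG: "finite (circle_singularities G)" using fin card_circle_singularities[OF F(2)] by simp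
 then have finF: "finite (circle_singularities F)"
  using portrait_map_circle[OF h] by (meson finite_imageD finite_subset)
 have "card (circle_singularities F) = card (circle_singularities G)"
  using card_inj_on_le[OF portrait_map_circle(2,1)[OF h] finG] card_inj_on_le[OF portrait_map_circle(2,1)[OF k] finF] by simp
 then show ?thesis using card_circle_singularities[OF F(1)] card_circle_singularities[OF F(2)] finF fin by simp
qed

lemma same_phase_portrait_refl: "same_phase_portrait F F"
proof -
 have "\<forall>\<gamma>. disk_trajectory F \<gamma> --> (\<exists>\<delta> \<tau>. disk_trajectory F \<delta> & strict_mono \<tau> & surj \<tau> & (\<forall>t. id (\<gamma> t) = \<delta> (1 * \<tau> t)))"
 proof (intro allI impI)
  fix \<gamma> assume "disk_trajectory F \<gamma>"
  moreover have "strict_mono (id :: real => real)" by (simp add: strict_mono_def)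
  moreover have "\<forall>t. id (\<gamma> t) = \<gamma> (1 * id t)" by simp
  ultimately show "\<exists>\<delta> \<tau>. disk_trajectory F \<delta> & strict_mono \<tau> & surj \<tau> & (\<forall>t. id (\<gamma> t) = \<delta> (1 * \<tau> t))"
   using surj_id by blast
 qed
 moreover have "homeomorphism (cball 0 1) (cball 0 1) id (id :: complex => complex)" by (auto simp: homeomorphism_def)
 ultimately show ?thesis unfolding same_phase_portrait_def by (metis image_id id_apply insertI1)
qed

lemma same_phase_portrait_trans:
 assumes "same_phase_portrait F G" "same_phase_portrait G H"
 shows "same_phase_portrait F H"
proof -
 obtain h h' \<sigma> where h: "homeomorphism (cball 0 1) (cball 0 1) h h'" "h ` sphere 0 1 = sphere 0 1" "\<sigma> \<in> {1, -1}"
  and tr: "!!\<gamma>. disk_trajectory F \<gamma> ==> (\<exists>\<delta> \<tau>. disk_trajectory G \<delta> & strict_mono \<tau> & surj \<tau> & (\<forall>t. h (\<gamma> t) = \<delta> (\<sigma> * \<tau> t)))"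
  using assms(1) unfolding same_phase_portrait_def by (elim exE conjE bexE) blast
 obtain k k' \<rho> where k: "homeomorphism (cball 0 1) (cball 0 1) k k'" "k ` sphere 0 1 = sphere 0 1" "\<rho> \<in> {1, -1}"
  and tr': "!!\<gamma>. disk_trajectory G \<gamma> ==> (\<exists>\<delta> \<tau>. disk_trajectory H \<delta> & strict_mono \<tau> & surj \<tau> & (\<forall>t. k (\<gamma> t) = \<delta> (\<rho> * \<tau> t)))"
  using assms(2) unfolding same_phase_portrait_def by (elim exE conjE bexE) blast
 have traj: "\<exists>\<delta> \<tau>. disk_trajectory H \<delta> & strict_mono \<tau> & surj \<tau> & (\<forall>t. (k \<circ> h) (\<gamma> t) = \<delta> ((\<sigma> * \<rho>) * \<tau> t))"
  if \<gamma>: "disk_trajectory F \<gamma>" for \<gamma>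
 proof -
  obtain \<delta> \<tau> where d: "disk_trajectory G \<delta>" "strict_mono \<tau>" "surj \<tau>" "!!t. h (\<gamma> t) = \<delta> (\<sigma> * \<tau> t)" using tr[OF \<gamma>] by blast
  obtain \<epsilon> \<tau>' where e: "disk_trajectory H \<epsilon>" "strict_mono \<tau>'" "surj \<tau>'" "!!t. k (\<delta> t) = \<epsilon> (\<rho> * \<tau>' t)" using tr'[OF d(1)] by blast
  define \<nu> where "\<nu> = (%t. \<sigma> * \<tau>' (\<sigma> * \<tau> t))"
  have sg: "\<sigma> = 1 | \<sigma> = -1" using h(3) by simp
  then have ss: "\<sigma> * (\<sigma> * s) = s" for s by auto
  have "strict_mono \<nu>" using sg d(2) e(2) by (auto simp: \<nu>_def strict_mono_def)
  moreover have "\<exists>t. \<nu> t = s" for s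
  proof -
   obtain a where "\<tau>' a = \<sigma> * s" using e(3) by (metis surjD)
   moreover obtain b where "\<tau> b = \<sigma> * a" using d(3) by (metis surjD)
   ultimately have "\<nu> b = s" by (simp add: \<nu>_def ss)
   then show ?thesis by blast
  qed
  then have "surj \<nu>" by (metis surjI surj_def)
  moreover have "(k \<circ> h) (\<gamma> t) = \<epsilon> ((\<sigma> * \<rho>) * \<nu> t)" for t
  proof -
   have "(\<sigma> * \<rho>) * \<nu> t = \<rho> * (\<sigma> * (\<sigma> * \<tau>' (\<sigma> * \<tau> t)))" by (simp add: \<nu>_def mult_ac)
   then show ?thesis by (simp only: ss o_apply d(4) e(4))
  qed
  ultimately show ?thesis using e(1) by blast
 qed
 have "(k \<circ> h) ` sphere 0 1 = sphere 0 1" unfolding image_comp[symmetric] h(2) k(2) ..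
 moreover have "\<sigma> * \<rho> \<in> {1, -1}" using h(3) k(3) by auto
 ultimately show ?thesis
  unfolding same_phase_portrait_def using homeomorphism_compose[OF h(1) k(1)] traj by blast
qed

text \<open>The portrait determines the number of lines and, through homoclinic orbits and twin orbits, the
number of nodes; these numbers determine the index, and conversely the index and the number of lines
determine the number of nodes.\<close>

theorem portrait_determined:
 assumes G: "portrait_data G l N" "card (zero_angles G) = l" "l = 1 | l = 3" "N <= (l + 1) div 2"
 shows "determined_by (phase_portrait 2 G) (1 - int l + 2 * int N) l"
 unfolding determined_by_def
proof (intro ballI iffI)
 obtain \<psi> where S: "sectored G l \<psi>" using G(1) unfolding portrait_data_def by blast
 have Gh: "G \<in> hom_fields 2" and Gn: "nondegenerate G" using sectoredD(1)[OF S] sectored_nondegenerate[OF S] by auto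
 fix F assume F: "F \<in> hom_fields 2"
 {
  assume eq: "phase_portrait 2 F = phase_portrait 2 G"
  have "F \<in> phase_portrait 2 F" "G \<in> phase_portrait 2 G"
   using F Gh same_phase_portrait_refl by (auto simp: phase_portrait_def)
  then have FG: "same_phase_portrait F G" "same_phase_portrait G F" using eq by (auto simp: phase_portrait_def)
  have finG: "finite (zero_angles G)" using G(2,3) by (metis card.infinite zero_neq_numeral zero_neq_one)
  have Z: "finite (zero_angles F)" "card (zero_angles F) = l" using same_line_count[OF F Gh FG finG] G(2) by auto
  obtain h \<sigma> where h: "portrait_map F G h \<sigma>" using same_phase_portrait_map[OF FG(1)] .
  obtain k \<rho> where k: "portrait_map G F k \<rho>" using same_phase_portrait_map[OF FG(2)] .
  note h0 = portrait_map_origin[OF F Gn h]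
  note k0 = portrait_map_origin(1)[OF Gh h0(2) k]
  obtain N' where N': "portrait_data F l N'" "N' <= (l + 1) div 2" using portrait_data_exists[OF h0(2) Z(2) G(3)] .
  have hom: "homoclinic_orbit F \<longleftrightarrow> homoclinic_orbit G"
   using homoclinic_orbit_transfer[OF F h h0(1)] homoclinic_orbit_transfer[OF Gh k k0] by blast
  have twin: "twin_orbits F \<longleftrightarrow> twin_orbits G"
   using twin_orbits_transfer[OF F h h0(1)] twin_orbits_transfer[OF Gh k k0] by blast
  have top: "2 * N' = l + 1 \<longleftrightarrow> 2 * N = l + 1"
   using hom portrait_data_homoclinic[OF N'(1) G(3)] portrait_data_homoclinic[OF G(1,3)] by simp
  have "N' = N"
  proof (cases "l = 1")
   case True
   then have "N <= 1" "N' <= 1" using G(4) N'(2) by auto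
   then show ?thesis using top True by presburger
  next
   case False
   then have l3: "l = 3" using G(3) by simp
   then have "N <= 2" "N' <= 2" using G(4) N'(2) by auto
   moreover have "N = 2 \<longleftrightarrow> N' = 2" using top l3 by presburger
   moreover have "\<not> (N = 0 & N' = 1)" "\<not> (N = 1 & N' = 0)"
    using portrait_data_twin[of F N'] portrait_data_twin[of G N] N'(1) G(1) twin unfolding l3 by blast+
   ultimately show ?thesis by linarith
  qed
  then show "has_index F 0 (1 - int l + 2 * int N) & finite (invariant_lines F) & card (invariant_lines F) = l"
   using portrait_data_index[OF N'(1)] card_invariant_lines[OF F] Z by simp
 }
 {
  assume *: "has_index F 0 (1 - int l + 2 * int N) & finite (invariant_lines F) & card (invariant_lines F) = l"
  have Fn: "nondegenerate F" using has_index_nondegenerate[OF F] * by blast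
  have Z: "card (zero_angles F) = l" using card_invariant_lines[OF F] * by simp
  obtain N' where N': "portrait_data F l N'" using portrait_data_exists[OF Fn Z G(3)] by blast
  have "N' = N" using has_index_unique[OF portrait_data_index[OF N']] * by fastforce
  then have "same_phase_portrait F G" "same_phase_portrait G F"
   using portrait_data_equivalent[OF _ _ G(3)] N' G(1) by blast+
  then show "phase_portrait 2 F = phase_portrait 2 G"
   unfolding phase_portrait_def using same_phase_portrait_trans by blast
 }
qed

section \<open>Discriminant, winding number and examples\<close>

definition cubic_disc :: "real => real => real => real => real" where
 "cubic_disc p q r s = q^2 * r^2 - 4 * p * r ^ 3 - 4 * q ^ 3 * s + 18 * p * q * r * s - 27 * p^2 * s^2"

lemma cubic_disc_factor:
 assumes "!!x y. cubic_form p q r s x y = (C * y - S * x) * (\<alpha> * x^2 + \<beta> * x * y + \<gamma> * y^2)"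
 shows "cubic_disc p q r s = (\<beta>\<^sup>2 - 4 * \<alpha> * \<gamma>) * (\<alpha> * C^2 + \<beta> * C * S + \<gamma> * S^2)^2"
proof -
 have p: "p = - S * \<alpha>" using assms[of 1 0] by (simp add: cubic_form_def)
 have s: "s = C * \<gamma>" using assms[of 0 1] by (simp add: cubic_form_def)
 have 1: "p + q + r + s = (C - S) * (\<alpha> + \<beta> + \<gamma>)" using assms[of 1 1] by (simp add: cubic_form_def)
 have 2: "p - q + r - s = (- C - S) * (\<alpha> - \<beta> + \<gamma>)" using assms[of 1 "-1"] by (simp add: cubic_form_def)
 have q: "q = C * \<alpha> - S * \<beta>" and r: "r = C * \<beta> - S * \<gamma>" using 1 2 p s by (simp_all add: algebra_simps)
 show ?thesis unfolding cubic_disc_def p s q r by algebra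
qed

lemma reduce_mod_pi:
 obtains r where "0 <= r" "r < pi" "!!x. sin (x - c) = 0 \<longleftrightarrow> sin (x - r) = 0"
proof -
 define k where "k = \<lfloor>c / pi\<rfloor>"
 define r where "r = c - of_int k * pi"
 have k: "of_int k <= c / pi" "c / pi < of_int k + 1" unfolding k_def by linarith+
 have "of_int k * pi <= c" "c < (of_int k + 1) * pi" using k pi_gt_zero by (simp_all add: field_simps)
 then have "0 <= r" "r < pi" by (simp_all add: r_def algebra_simps)
 moreover have "sin (x - c) = 0 \<longleftrightarrow> sin (x - r) = 0" for x
 proof -
  have "x - r = (x - c) + of_int k * pi" by (simp add: r_def)
  moreover have k0: "sin (of_int k * pi) = 0" by (simp add: sin_times_pi_eq_0)
  ultimately have "sin (x - r) = sin (x - c) * cos (of_int k * pi)" by (simp only: sin_add k0 mult_zero_right add_0_right)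
  moreover have "cos (of_int k * pi) ~= 0" using sin_zero_abs_cos_one[OF k0] by linarith
  ultimately show ?thesis by simp
 qed
 ultimately show thesis by (rule that)
qed

lemma sin_zero_small: "sin x = 0 ==> \<bar>x\<bar> < pi ==> x = (0::real)"
proof -
 assume x: "sin x = 0" "\<bar>x\<bar> < pi"
 then have "- pi < x" "x < pi" by linarith+
 then show "x = 0" using sin_eq_0_pi x(1) by blast
qed

lemma card_three_sines:
 fixes c :: "nat => real"
 assumes d: "sin (c 0 - c 1) ~= 0" "sin (c 0 - c 2) ~= 0" "sin (c 1 - c 2) ~= 0"
 shows "card {x. 0 <= x & x < pi & (sin (x - c 0) = 0 | sin (x - c 1) = 0 | sin (x - c 2) = 0)} = 3"
proof -
 have "\<exists>r. 0 <= r & r < pi & (\<forall>x. sin (x - c j) = 0 \<longleftrightarrow> sin (x - r) = 0)" for j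
  using reduce_mod_pi[of "c j"] by metis
 then obtain r where r: "!!j. 0 <= r j & r j < pi & (\<forall>x. sin (x - c j) = 0 \<longleftrightarrow> sin (x - r j) = 0)" by metis
 have iff: "0 <= x & x < pi & sin (x - c j) = 0 \<longleftrightarrow> x = r j" for x j
 proof
  assume x: "0 <= x & x < pi & sin (x - c j) = 0"
  then have "sin (x - r j) = 0" using r by blast
  moreover have "\<bar>x - r j\<bar> < pi" using x r[of j] by linarith
  ultimately show "x = r j" using sin_zero_small by fastforce
 next
  assume x: "x = r j"
  have "sin (r j - r j) = 0" by simp
  then have "sin (r j - c j) = 0" using r by blast
  then show "0 <= x & x < pi & sin (x - c j) = 0" using x r by blast
 qed
 have "{x. 0 <= x & x < pi & (sin (x - c 0) = 0 | sin (x - c 1) = 0 | sin (x - c 2) = 0)} = {r 0, r 1, r 2}"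
  using iff by blast
 moreover have "r i ~= r j" if "sin (c i - c j) ~= 0" for i j
 proof
  assume "r i = r j"
  then have "sin (c i - c i) = 0 \<longleftrightarrow> sin (c i - c j) = 0" using r by metis
  then show False using that by simp
 qed
 ultimately show ?thesis using d by simp
qed

lemma quadratic_form_sines:
 assumes "0 < \<beta>\<^sup>2 - 4 * \<alpha> * \<gamma>"
 obtains K c1 c2 where "K ~= 0" "sin (c1 - c2) ~= (0 :: real)"
  "!!x::real. \<alpha> * (cos x)^2 + \<beta> * cos x * sin x + \<gamma> * (sin x)^2 = K * (sin (x - c1) * sin (x - c2))"
proof -
 define m u v where "m = (\<alpha> + \<gamma>) / 2" and "u = (\<alpha> - \<gamma>) / 2" and "v = \<beta> / 2"
 define R where "R = sqrt (u^2 + v^2)"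
 have mR: "m^2 < u^2 + v^2" using assms by (simp add: m_def u_def v_def power2_eq_square field_simps)
 have "0 < u^2 + v^2" using mR zero_le_power2[of m] by linarith
 then have R: "0 < R" "R^2 = u^2 + v^2" by (simp_all add: R_def)
 have m: "\<bar>m\<bar> < R" using mR R by (metis abs_le_square_iff abs_of_pos not_le)
 have "(u / R)^2 + (v / R)^2 = 1" using R(1) unfolding power_divide add_divide_distrib[symmetric] R(2)[symmetric] by simp
 then obtain \<phi> where \<phi>: "u / R = cos \<phi>" "v / R = sin \<phi>" using sincos_total_2pi by metis
 have uv: "u = R * cos \<phi>" "v = R * sin \<phi>" using \<phi> R by (simp_all add: field_simps)
 define \<psi> where "\<psi> = arccos (- m / R)"
 have mr: "- 1 < - m / R" "- m / R < 1" using m R by (simp_all add: field_simps abs_less_iff)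
 have \<psi>: "0 < \<psi>" "\<psi> < pi" "cos \<psi> = - m / R" using mr arccos_lt_bounded[of "- m / R"] by (auto simp: \<psi>_def)
 show thesis
 proof (rule that[of "- 2 * R" "(\<phi> + \<psi>) / 2" "(\<phi> - \<psi>) / 2"])
  have "(\<phi> + \<psi>) / 2 - (\<phi> - \<psi>) / 2 = \<psi>" by (simp add: field_simps)
  then show "sin ((\<phi> + \<psi>) / 2 - (\<phi> - \<psi>) / 2) ~= 0" using sin_gt_zero \<psi> by fastforce
  fix x :: real
  have c: "(cos x)^2 = 1 / 2 + cos (2 * x) / 2" "(sin x)^2 = 1 / 2 - cos (2 * x) / 2" "cos x * sin x = sin (2 * x) / 2"
   using cos_double_cos[of x] cos_double_sin[of x] sin_double[of x] by (linarith, linarith, simp)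
  have "\<alpha> * (cos x)^2 + \<beta> * cos x * sin x + \<gamma> * (sin x)^2 = m + u * cos (2 * x) + v * sin (2 * x)"
   unfolding mult.assoc[of \<beta>] c m_def u_def v_def by (simp add: field_simps)
  also have "\<dots> = R * (cos (2 * x - \<phi>) - cos \<psi>)" using R unfolding uv \<psi>(3) by (simp add: cos_diff algebra_simps)
  also have "\<dots> = - 2 * R * (sin (x - (\<phi> + \<psi>) / 2) * sin (x - (\<phi> - \<psi>) / 2))"
  proof -
   have "cos (2 * x - \<phi>) - cos \<psi> = 2 * sin ((2 * x - \<phi> + \<psi>) / 2) * sin ((\<psi> - (2 * x - \<phi>)) / 2)" by (rule cos_diff_cos)
   moreover have "(2 * x - \<phi> + \<psi>) / 2 = x - (\<phi> - \<psi>) / 2" "(\<psi> - (2 * x - \<phi>)) / 2 = - (x - (\<phi> + \<psi>) / 2)"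
    by (simp_all add: field_simps)
   ultimately show ?thesis by (simp only: sin_minus) simp
  qed
  finally show "\<alpha> * (cos x)^2 + \<beta> * cos x * sin x + \<gamma> * (sin x)^2 = - 2 * R * (sin (x - (\<phi> + \<psi>) / 2) * sin (x - (\<phi> - \<psi>) / 2))" .
 qed (use R in simp)
qed

lemma angular_zero_exists:
 assumes "F \<in> hom_fields 2" obtains x where "0 <= x" "x < pi" "angular F x = 0"
proof -
 have pi: "angular F pi = - angular F 0" using radial_angular_add_pi(2)[OF assms, of 0] by simp
 have c: "continuous_on {0..pi} (angular F)" by (rule continuous_radial_angular[OF assms])
 have "\<exists>x. 0 <= x & x <= pi & angular F x = 0"
 proof (cases "angular F 0 <= 0")
  case True
  then show ?thesis using IVT'[of "angular F" 0 0 pi] pi c by auto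
 next
  case False
  then show ?thesis using IVT2'[of "angular F" pi 0 0] pi c by auto
 qed
 then obtain x where x: "0 <= x" "x <= pi" "angular F x = 0" by blast
 show thesis
 proof (cases "x = pi")
  case True
  then show ?thesis using that[of 0] pi x by simp
 qed (use x that[of x] in auto)
qed

text \<open>Dividing by one zero, which exists by antiperiodicity, leaves a quadratic form. Up to a square its
discriminant is that of the cubic.\<close>

lemma card_zero_angles_disc:
 assumes F: "F \<in> hom_fields 2" and g: "!!x. angular F x = cubic_form p q r s (cos x) (sin x)"
 shows "cubic_disc p q r s > 0 ==> card (zero_angles F) = 3" "cubic_disc p q r s < 0 ==> card (zero_angles F) = 1"
proof -
 obtain x0 where x0: "0 <= x0" "x0 < pi" "angular F x0 = 0" using angular_zero_exists[OF F] .
 obtain \<alpha> \<beta> \<gamma> where fac: "!!x y. cubic_form p q r s x y = (cos x0 * y - sin x0 * x) * (\<alpha> * x^2 + \<beta> * x * y + \<gamma> * y^2)"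
  using cubic_form_factor[of p q r s "cos x0" "sin x0"] x0(3) g[of x0] by auto
 define Q where "Q = (%x. \<alpha> * (cos x)^2 + \<beta> * cos x * sin x + \<gamma> * (sin x)^2)"
 have disc: "cubic_disc p q r s = (\<beta>\<^sup>2 - 4 * \<alpha> * \<gamma>) * (Q x0)^2" unfolding Q_def by (rule cubic_disc_factor[OF fac])
 have ang: "angular F x = sin (x - x0) * Q x" for x by (simp add: g fac Q_def sin_diff algebra_simps)
 {
  assume "cubic_disc p q r s > 0"
  then have pos: "\<beta>\<^sup>2 - 4 * \<alpha> * \<gamma> > 0" and Q0: "Q x0 ~= 0"
   unfolding disc by (auto simp: zero_less_mult_iff not_less[symmetric])
  obtain K c1 c2 where K: "K ~= 0" "sin (c1 - c2) ~= 0" "!!x. Q x = K * (sin (x - c1) * sin (x - c2))"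
   using quadratic_form_sines[OF pos] unfolding Q_def by metis
  define c where "c = (%j::nat. if j = 0 then x0 else if j = 1 then c1 else c2)"
  have "zero_angles F = {x. 0 <= x & x < pi & (sin (x - c 0) = 0 | sin (x - c 1) = 0 | sin (x - c 2) = 0)}"
   using K(1) by (auto simp: zero_angles_def ang K(3) c_def)
  moreover have "sin (x0 - c1) ~= 0" "sin (x0 - c2) ~= 0" using Q0 unfolding K(3) by auto
  ultimately show "card (zero_angles F) = 3" using card_three_sines[of c] K(2) by (simp add: c_def)
 }
 {
  assume "cubic_disc p q r s < 0"
  then have neg: "\<beta>\<^sup>2 - 4 * \<alpha> * \<gamma> < 0"
   unfolding disc by (auto simp: mult_less_0_iff not_less[symmetric])
  have "Q x ~= 0" for x
  proof
   assume Q: "Q x = 0"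
   have "4 * \<alpha> * Q x = (2 * \<alpha> * cos x + \<beta> * sin x)^2 + (4 * \<alpha> * \<gamma> - \<beta>\<^sup>2) * (sin x)^2"
    by (simp add: Q_def power2_eq_square algebra_simps)
   then have 0: "(2 * \<alpha> * cos x + \<beta> * sin x)^2 + (4 * \<alpha> * \<gamma> - \<beta>\<^sup>2) * (sin x)^2 = 0" using Q by simp
   have "0 <= (4 * \<alpha> * \<gamma> - \<beta>\<^sup>2) * (sin x)^2" using neg by (intro mult_nonneg_nonneg) auto
   then have "(4 * \<alpha> * \<gamma> - \<beta>\<^sup>2) * (sin x)^2 = 0" "(2 * \<alpha> * cos x + \<beta> * sin x)^2 = 0"
    using 0 zero_le_power2[of "2 * \<alpha> * cos x + \<beta> * sin x"] by linarith+
   then have s: "sin x = 0" and "2 * \<alpha> * cos x + \<beta> * sin x = 0" using neg by auto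
   moreover have "cos x ~= 0" using s sin_zero_abs_cos_one[of x] by auto
   ultimately have "\<alpha> = 0" by simp
   then show False using neg zero_le_power2[of \<beta>] by simp
  qed
  then have "zero_angles F = {x. 0 <= x & x < pi & sin (x - x0) = 0}" by (auto simp: zero_angles_def ang)
  also have "\<dots> = {x0}" using x0 sin_zero_small[of "_ - x0"] by force
  finally show "card (zero_angles F) = 1" by simp
 }
qed

definition wind :: "(complex => complex) => complex" where
 "wind F = winding_number (%t. F (circlepath 0 1 t)) 0"

lemma nondegenerate_nonzero: "nondegenerate F ==> z ~= 0 ==> F z ~= 0"
proof -
 assume F: "nondegenerate F" and z: "z ~= 0"
 obtain x where x: "z = of_real (norm z) * cis x" using polar_coordinates[of 0 z] by blast
 have "F (of_real (norm z) * cis x) ~= 0" using field_zero_iff[of F "norm z" x] F z by (auto simp: nondegenerate_def)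
 then show "F z ~= 0" using x by metis
qed

lemma nondegenerateI: "F \<in> hom_fields 2 ==> (!!u. norm u = 1 ==> F u ~= 0) ==> nondegenerate F"
 unfolding nondegenerate_def
proof (intro conjI allI impI notI)
 fix x assume F: "F \<in> hom_fields 2" "!!u. norm u = 1 ==> F u ~= 0" and "angular F x = 0" "radial F x = 0"
 then show False using field_zero_iff[of F 1 x] F(2)[of "cis x"] by simp
qed

lemma continuous_hom_field: "F \<in> hom_fields 2 ==> continuous_on A F"
proof -
 assume "F \<in> hom_fields 2"
 then obtain a b where F: "F = hom_field 2 a b" by (auto simp: hom_fields_def)
 have eq: "F = (%z. Complex (a (2, 0) * (Re z)^2 + a (1, 1) * Re z * Im z + a (0, 2) * (Im z)^2)
   (b (2, 0) * (Re z)^2 + b (1, 1) * Re z * Im z + b (0, 2) * (Im z)^2))"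
  unfolding F by (rule ext) (rule hom_field_2)
 show "continuous_on A F" unfolding eq by (intro continuous_intros)
qed

lemma circlepath_unit: "circlepath 0 1 t = cis (2 * pi * t)" "circlepath 0 r t = of_real r * cis (2 * pi * t)"
 by (simp_all add: circlepath cis_conv_exp mult.commute mult.left_commute)

lemma field_loop:
 assumes "F \<in> hom_fields 2"
 shows "path (%t. F (circlepath 0 1 t))" "pathfinish (%t. F (circlepath 0 1 t)) = pathstart (%t. F (circlepath 0 1 t))"
proof -
 show "path (%t. F (circlepath 0 1 t))" unfolding path_def circlepath_unit
  by (rule continuous_on_compose2[OF continuous_hom_field[OF assms, of UNIV]]) (auto intro!: continuous_intros)
 show "pathfinish (%t. F (circlepath 0 1 t)) = pathstart (%t. F (circlepath 0 1 t))"
  by (simp add: pathfinish_def pathstart_def circlepath_unit)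
qed

lemma segment_near: "norm (w - z) < norm (z :: complex) ==> 0 \<notin> closed_segment z w"
proof
 assume "norm (w - z) < norm z" "0 \<in> closed_segment z w"
 then show False using segment_bound1[of 0 z w] by simp
qed

lemma segment_positive_multiple: "0 < k ==> z ~= 0 ==> 0 \<notin> closed_segment (z :: complex) (k *\<^sub>R z)"
proof
 assume k: "0 < k" and z: "z ~= 0" and "0 \<in> closed_segment z (k *\<^sub>R z)"
 then obtain u where u: "0 <= u" "u <= 1" "0 = (1 - u) *\<^sub>R z + u *\<^sub>R (k *\<^sub>R z)" by (auto simp: in_segment)
 then have "((1 - u) + u * k) *\<^sub>R z = 0" by (simp add: algebra_simps)
 then have "(1 - u) + u * k = 0" using z by simp
 moreover have "0 < (1 - u) + u * k"
 proof (cases "u = 1")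
  case False
  then show ?thesis using u k by (intro add_pos_nonneg) auto
 qed (use k in simp)
 ultimately show False by simp
qed

lemma has_index_wind:
 assumes F: "F \<in> hom_fields 2"
 shows "has_index F 0 i \<longleftrightarrow> nondegenerate F & wind F = of_int i"
proof -
 have w: "winding_number (%t. sgn (F (circlepath 0 r t))) 0 = wind F" if n: "nondegenerate F" and r: "0 < r" for r
 proof -
  define \<rho> where "\<rho> = (%t. F (circlepath 0 1 t))"
  have nz: "\<rho> t ~= 0" for t unfolding \<rho>_def circlepath_unit by (rule nondegenerate_nonzero[OF n]) simp
  have "F (circlepath 0 r t) = of_real (r^2) * F (circlepath 0 1 t)" for t
   unfolding circlepath_unit(2)[of r] circlepath_unit(1) by (rule hom_fields_scale[OF F])
  moreover have "sgn (of_real (r^2) :: complex) = 1" using r by (simp only: sgn_of_real) simp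
  ultimately have eq: "sgn (F (circlepath 0 r t)) = sgn (\<rho> t)" for t by (simp only: \<rho>_def sgn_mult mult_1)
  have p: "path (%t. sgn (\<rho> t))"
   using field_loop(1)[OF F] nz unfolding path_def \<rho>_def sgn_div_norm by (auto intro!: continuous_intros)
  have "winding_number (%t. sgn (\<rho> t)) 0 = winding_number \<rho> 0"
  proof (rule winding_number_loops_linear_eq)
   fix t :: real
   have "sgn (\<rho> t) = inverse (norm (\<rho> t)) *\<^sub>R \<rho> t" by (simp add: sgn_div_norm)
   then show "0 \<notin> closed_segment (\<rho> t) (sgn (\<rho> t))" using segment_positive_multiple[of "inverse (norm (\<rho> t))" "\<rho> t"] nz by simp
  qed (use field_loop[OF F] p in \<open>simp_all add: \<rho>_def[symmetric] pathfinish_def pathstart_def\<close>)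
  then show ?thesis by (simp add: eq wind_def \<rho>_def)
 qed
 show ?thesis
 proof
  assume i: "has_index F 0 i"
  have n: "nondegenerate F" by (rule has_index_nondegenerate[OF F i])
  have ev: "\<forall>\<^sub>F r in at_right 0. winding_number (%t. sgn (F (circlepath 0 r t))) 0 = of_int i" using i by (simp add: has_index_def)
  have "\<forall>\<^sub>F r in at_right (0::real). wind F = of_int i"
   by (rule eventually_mono[OF eventually_conj[OF ev eventually_at_right_less[of "0::real"]]]) (use w[OF n] in metis)
  then show "nondegenerate F & wind F = of_int i" using n by simp
 next
  assume a: "nondegenerate F & wind F = of_int i"
  then have "\<forall>\<^sub>F r in at_right 0. winding_number (%t. sgn (F (circlepath 0 r t))) 0 = of_int i"
   by - (rule eventually_mono[OF eventually_at_right_less[of "0::real"]], use w in metis)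
  moreover have "\<forall>\<^sub>F w in at 0. F w ~= 0"
   using a nondegenerate_nonzero by (auto simp: eventually_at intro: exI[of _ 1])
  ultimately show "has_index F 0 i" using hom_fields_2_zero[OF F] by (simp add: has_index_def)
 qed
qed

text \<open>Rouche's theorem: the segment between the two values avoids the origin.\<close>

lemma wind_perturbation:
 assumes F: "nondegenerate F" and G: "G \<in> hom_fields 2" and near: "!!u. norm u = 1 ==> norm (G u - F u) < norm (F u)"
 shows "nondegenerate G" "wind G = wind F"
proof -
 have Fh: "F \<in> hom_fields 2" using F by (simp add: nondegenerate_def)
 show "nondegenerate G" by (rule nondegenerateI[OF G]) (use near in fastforce)
 show "wind G = wind F" unfolding wind_def
  by (rule winding_number_loops_linear_eq)
   (use field_loop[OF Fh] field_loop[OF G] segment_near near in \<open>simp_all add: circlepath_unit\<close>)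
qed

lemma wind_cnj:
 assumes F: "nondegenerate F" and G: "G = (%z. cnj (F z))" "G \<in> hom_fields 2" and i: "has_index F 0 i"
 shows "has_index G 0 (- i)"
proof -
 have Fh: "F \<in> hom_fields 2" using F by (simp add: nondegenerate_def)
 have nz: "0 \<notin> path_image (%t. F (circlepath 0 1 t))"
 proof
  assume "0 \<in> path_image (%t. F (circlepath 0 1 t))"
  then obtain t where "F (cis (2 * pi * t)) = 0" unfolding path_image_def circlepath_unit by auto
  then show False using nondegenerate_nonzero[OF F, of "cis (2 * pi * t)"] by simp
 qed
 have "(%t. G (circlepath 0 1 t)) = cnj \<circ> (%t. F (circlepath 0 1 t))" unfolding G(1) o_def ..
 then have "wind G = - cnj (wind F)"
  using winding_number_cnj[OF field_loop(1)[OF Fh] nz] by (simp only: wind_def complex_cnj_zero)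
 moreover have "nondegenerate G"
 proof (rule nondegenerateI[OF G(2)])
  fix u :: complex assume "norm u = 1"
  then have "u ~= 0" by auto
  then have "cnj (F u) ~= 0" using nondegenerate_nonzero[OF F] by simp
  then show "G u ~= 0" unfolding G(1) .
 qed
 ultimately show ?thesis using i unfolding has_index_wind[OF Fh] has_index_wind[OF G(2)] by simp
qed

definition quad_field :: "(real \<times> real \<times> real) \<times> (real \<times> real \<times> real) => complex => complex" where
 "quad_field = (%((a, a', a''), (b, b', b'')) z.
   Complex (a * (Re z)^2 + a' * Re z * Im z + a'' * (Im z)^2) (b * (Re z)^2 + b' * Re z * Im z + b'' * (Im z)^2))"

lemma quad_field_hom: "hom_field 2 a b = quad_field ((a (2,0), a (1,1), a (0,2)), (b (2,0), b (1,1), b (0,2)))"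
 unfolding quad_field_def split_conv by (rule ext) (rule hom_field_2)

lemma hom_fields_2_eq: "hom_fields 2 = range quad_field"
proof -
 have "quad_field c \<in> hom_fields 2" for c
 proof -
  obtain a a' a'' b b' b'' where c: "c = ((a, a', a''), (b, b', b''))" by (metis prod.exhaust)
  define f where "f = (%u v w :: real. %k :: nat \<times> nat. if k = (2,0) then u else if k = (1,1) then v else w)"
  have "quad_field c = hom_field 2 (f a a' a'') (f b b' b'')" unfolding quad_field_hom c by (simp add: f_def)
  then show ?thesis by (auto simp: hom_fields_def)
 qed
 then show ?thesis by (auto simp: hom_fields_def quad_field_hom)
qed

lemma quad_field_in [simp]: "quad_field c \<in> hom_fields 2" by (simp add: hom_fields_2_eq)

fun field_disc :: "(real \<times> real \<times> real) \<times> (real \<times> real \<times> real) => real" where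
 "field_disc ((a, a', a''), (b, b', b'')) = cubic_disc b (b' - a) (b'' - a') (- a'')"

lemma card_lines_disc:
 "field_disc c > 0 ==> card (zero_angles (quad_field c)) = 3" "field_disc c < 0 ==> card (zero_angles (quad_field c)) = 1"
proof -
 obtain a a' a'' b b' b'' where c: "c = ((a, a', a''), (b, b', b''))" by (metis prod.exhaust)
 have "angular (quad_field c) x = cubic_form b (b' - a) (b'' - a') (- a'') (cos x) (sin x)" for x
  by (simp add: c angular_def quad_field_def cubic_form_def power2_eq_square power3_eq_cube algebra_simps)
 from card_zero_angles_disc[OF quad_field_in this]
 show "field_disc c > 0 ==> card (zero_angles (quad_field c)) = 3" "field_disc c < 0 ==> card (zero_angles (quad_field c)) = 1"
  by (simp_all add: c)
qed

lemma quad_field_diff: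
 assumes u: "norm u = 1" shows "norm (quad_field c u - quad_field d u) <= 6 * norm (c - d)"
proof -
 obtain a a' a'' b b' b'' where c: "c = ((a, a', a''), (b, b', b''))" by (metis prod.exhaust)
 obtain e e' e'' f f' f'' where d: "d = ((e, e', e''), (f, f', f''))" by (metis prod.exhaust)
 define n where "n = norm (c - d)"
 have l: "norm x <= norm (x, y)" "norm y <= norm (x, y)" for x :: "'x::real_normed_vector" and y :: "'y::real_normed_vector"
  using norm_fst_le[of x y] norm_snd_le[of y x] by simp_all
 have n1: "norm (a - e, a' - e', a'' - e'') <= n" "norm (b - f, b' - f', b'' - f'') <= n" unfolding n_def c d using l by auto
 have n2: "norm (a' - e', a'' - e'') <= n" "norm (b' - f', b'' - f'') <= n" using n1 l order_trans by blast+
 have n3: "\<bar>a - e\<bar> <= n" "\<bar>a' - e'\<bar> <= n" "\<bar>a'' - e''\<bar> <= n" "\<bar>b - f\<bar> <= n" "\<bar>b' - f'\<bar> <= n" "\<bar>b'' - f''\<bar> <= n"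
  using n1 n2 l unfolding real_norm_def[symmetric] using order_trans by blast+
 have Re1: "\<bar>Re u\<bar> <= 1" "\<bar>Im u\<bar> <= 1" using abs_Re_le_cmod[of u] abs_Im_le_cmod[of u] u by auto
 have q: "\<bar>x * (Re u)^2 + y * Re u * Im u + z * (Im u)^2\<bar> <= 3 * n" if "\<bar>x\<bar> <= n" "\<bar>y\<bar> <= n" "\<bar>z\<bar> <= n" for x y z
 proof -
  have m: "\<bar>x * (v * w)\<bar> <= n" if "\<bar>x\<bar> <= n" "\<bar>v\<bar> <= 1" "\<bar>w\<bar> <= 1" for x v w
   unfolding abs_mult using mult_mono[of "\<bar>x\<bar>" n "\<bar>v\<bar> * \<bar>w\<bar>" 1] mult_le_one[of "\<bar>v\<bar>" "\<bar>w\<bar>"] that by auto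
  show ?thesis
   using m[OF that(1) Re1(1) Re1(1)] m[OF that(2) Re1(1) Re1(2)] m[OF that(3) Re1(2) Re1(2)]
   unfolding power2_eq_square mult.assoc by linarith
 qed
 have "norm (quad_field c u - quad_field d u) <= \<bar>Re (quad_field c u - quad_field d u)\<bar> + \<bar>Im (quad_field c u - quad_field d u)\<bar>"
  by (rule cmod_le)
 also have "\<dots> = \<bar>(a - e) * (Re u)^2 + (a' - e') * Re u * Im u + (a'' - e'') * (Im u)^2\<bar>
   + \<bar>(b - f) * (Re u)^2 + (b' - f') * Re u * Im u + (b'' - f'') * (Im u)^2\<bar>"
  by (simp add: c d quad_field_def algebra_simps)
 also have "\<dots> <= 6 * n" using q[OF n3(1-3)] q[OF n3(4-6)] by linarith
 finally show ?thesis unfolding n_def .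
qed

lemma open_index: "open {c. has_index (quad_field c) 0 i}"
 unfolding open_contains_ball
proof
 fix c assume "c \<in> {c. has_index (quad_field c) 0 i}"
 then have c: "nondegenerate (quad_field c)" "wind (quad_field c) = of_int i" by (auto simp: has_index_wind)
 have "continuous_on (sphere 0 1) (%u. norm (quad_field c u))" by (intro continuous_intros continuous_hom_field) simp
 moreover have "sphere 0 (1::real) ~= ({} :: complex set)" by simp
 ultimately obtain u0 where u0: "norm u0 = 1" "!!u. norm u = 1 ==> norm (quad_field c u0) <= norm (quad_field c u)"
  using continuous_attains_inf[of "sphere 0 (1::real) :: complex set"] by (metis compact_sphere mem_sphere_0)
 define m where "m = norm (quad_field c u0)"
 have "u0 ~= 0" using u0(1) by auto
 then have m: "0 < m" using nondegenerate_nonzero[OF c(1), of u0] by (simp add: m_def)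
 have "has_index (quad_field d) 0 i" if "d \<in> ball c (m / 6)" for d
 proof -
  have "6 * norm (d - c) < m" using that by (simp add: dist_norm norm_minus_commute)
  then have "norm (quad_field d u - quad_field c u) < norm (quad_field c u)" if "norm u = 1" for u
   using quad_field_diff[OF that, of d c] u0(2)[OF that] by (simp add: m_def)
  then show ?thesis using wind_perturbation[OF c(1) quad_field_in] c(2) by (simp add: has_index_wind)
 qed
 then show "\<exists>e>0. ball c e \<subseteq> {c. has_index (quad_field c) 0 i}" using m by (intro exI[of _ "m / 6"]) auto
qed

lemma continuous_field_disc: "continuous_on A field_disc"
proof -
 have eq: "field_disc = (%c. cubic_disc (fst (snd c)) (fst (snd (snd c)) - fst (fst c)) (snd (snd (snd c)) - fst (snd (fst c))) (- snd (snd (fst c))))"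
  by (auto simp: fun_eq_iff)
 show ?thesis unfolding eq cubic_disc_def by (intro continuous_intros)
qed

lemma open_disc: "open {c. field_disc c > 0}" "open {c. field_disc c < 0}"
 using open_Collect_less[OF continuous_on_const[of UNIV 0] continuous_field_disc]
  open_Collect_less[OF continuous_field_disc continuous_on_const[of UNIV 0]] by blast+

lemma index_exp:
 assumes F: "F \<in> hom_fields 2" and k: "0 < k" and e: "!!x. F (cis x) = of_real k * exp (\<i> * of_real (of_int m * x + c))"
 shows "nondegenerate F" "wind F = of_int m"
proof -
 show "nondegenerate F"
 proof (rule nondegenerateI[OF F])
  fix u :: complex assume "norm u = 1"
  then obtain x where "u = cis x" using polar_coordinates[of 0 u] by (metis mult_1 of_real_1)
  then show "F u ~= 0" using e k by simp
 qed
 define a where "a = (%t. of_int m * (2 * pi * t) + c)"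
 define \<rho> where "\<rho> = (%t. exp (\<i> * of_real (a t)))"
 have a: "continuous_on {0..1} a" unfolding a_def by (intro continuous_intros)
 have "path \<rho>" unfolding path_def \<rho>_def by (intro continuous_intros a)
 moreover have Fr: "F (circlepath 0 1 t) = k *\<^sub>R \<rho> t" for t by (simp add: circlepath_unit e \<rho>_def a_def scaleR_conv_of_real)
 moreover have "pathfinish \<rho> = pathstart \<rho>"
  using field_loop(2)[OF F] k unfolding Fr by (simp add: pathfinish_def pathstart_def)
 ultimately have "wind F = winding_number \<rho> 0" unfolding wind_def Fr
  using field_loop[OF F, unfolded Fr] segment_positive_multiple[OF k]
  by (intro winding_number_loops_linear_eq) (auto simp: \<rho>_def)
 also have "\<dots> = of_int m" unfolding \<rho>_def by (rule winding_number_exp_path[OF a]) (simp add: a_def)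
 finally show "wind F = of_int m" .
qed

lemma quad_field_cis:
 "quad_field ((1,0,-1),(0,-2,0)) (cis x) = of_real 1 * exp (\<i> * of_real (of_int (-2) * x + 0))"
 "quad_field ((-2,0,-2),(0,0,0)) (cis x) = of_real 2 * exp (\<i> * of_real (of_int 0 * x + pi))"
 "quad_field ((1,0,1),(0,0,0)) (cis x) = of_real 1 * exp (\<i> * of_real (of_int 0 * x + 0))"
 "quad_field ((1,0,-1),(0,2,0)) (cis x) = of_real 1 * exp (\<i> * of_real (of_int 2 * x + 0))"
 "quad_field ((2,0,-2),(0,4,0)) (cis x) = of_real 2 * exp (\<i> * of_real (of_int 2 * x + 0))"
proof -
 have e: "exp (\<i> * of_real y) = cis y" for y by (simp add: cis_conv_exp)
 have sq: "(cos x)^2 = 1 - (sin x)\<^sup>2" by (simp add: cos_squared_eq)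
 note d = quad_field_def cos_double sin_double sq
 show "quad_field ((1,0,-1),(0,-2,0)) (cis x) = of_real 1 * exp (\<i> * of_real (of_int (-2) * x + 0))"
  unfolding e by (rule complex_eqI) (simp_all add: d)
 show "quad_field ((-2,0,-2),(0,0,0)) (cis x) = of_real 2 * exp (\<i> * of_real (of_int 0 * x + pi))"
  unfolding e by (rule complex_eqI) (simp_all add: d)
 show "quad_field ((1,0,1),(0,0,0)) (cis x) = of_real 1 * exp (\<i> * of_real (of_int 0 * x + 0))"
  unfolding e by (rule complex_eqI) (simp_all add: d)
 show "quad_field ((1,0,-1),(0,2,0)) (cis x) = of_real 1 * exp (\<i> * of_real (of_int 2 * x + 0))"
  unfolding e by (rule complex_eqI) (simp_all add: d)
 show "quad_field ((2,0,-2),(0,4,0)) (cis x) = of_real 2 * exp (\<i> * of_real (of_int 2 * x + 0))"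
  unfolding e by (rule complex_eqI) (simp_all add: d)
qed

lemmas examples_wind = index_exp[OF quad_field_in _ quad_field_cis(1)] index_exp[OF quad_field_in _ quad_field_cis(2)]
 index_exp[OF quad_field_in _ quad_field_cis(3)] index_exp[OF quad_field_in _ quad_field_cis(4)] index_exp[OF quad_field_in _ quad_field_cis(5)]

text \<open>The fields \<open>z \<mapsto> c |z|^2 + cnj z ^ 2\<close> and \<open>z \<mapsto> 2 z^2 + cnj z ^ 2\<close> have the index of their
dominant first terms.\<close>

lemma example_perturbed:
 assumes "nondegenerate (quad_field c)" "wind (quad_field c) = of_int i" "!!u. norm u = 1 ==> norm (quad_field c u) = 2"
  "!!u. quad_field d u - quad_field c u = quad_field ((1,0,-1),(0,-2,0)) u"
 shows "has_index (quad_field d) 0 i"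
proof -
 have "norm (quad_field ((1,0,-1),(0,-2,0)) u) = 1" if u: "norm u = 1" for u
 proof -
  obtain x where "u = cis x" using polar_coordinates[of 0 u] u by (metis mult_1 of_real_1)
  then show ?thesis using quad_field_cis(1)[of x] by (simp add: norm_mult)
 qed
 then show ?thesis using wind_perturbation[OF assms(1) quad_field_in, of d] assms by (simp add: has_index_wind)
qed

lemma example_fields:
 "has_index (quad_field ((1,0,-1),(0,-2,0))) 0 (-2)" "field_disc ((1,0,-1),(0,-2,0)) > 0"
 "has_index (quad_field ((-1,0,-3),(0,-2,0))) 0 0" "field_disc ((-1,0,-3),(0,-2,0)) > 0"
 "has_index (quad_field ((3,0,-3),(0,2,0))) 0 2" "field_disc ((3,0,-3),(0,2,0)) > 0"
 "has_index (quad_field ((1,0,1),(0,0,0))) 0 0" "field_disc ((1,0,1),(0,0,0)) < 0"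
 "has_index (quad_field ((1,0,-1),(0,2,0))) 0 2" "field_disc ((1,0,-1),(0,2,0)) < 0"
proof -
 show "has_index (quad_field ((1,0,-1),(0,-2,0))) 0 (-2)" "has_index (quad_field ((1,0,1),(0,0,0))) 0 0"
  "has_index (quad_field ((1,0,-1),(0,2,0))) 0 2"
  using examples_wind by (simp_all add: has_index_wind)
 have two: "norm (quad_field c u) = 2" if u: "norm u = 1" and c: "c = ((-2,0,-2),(0,0,0)) | c = ((2,0,-2),(0,4,0))" for c u
 proof -
  obtain x where "u = cis x" using polar_coordinates[of 0 u] u by (metis mult_1 of_real_1)
  then show ?thesis using quad_field_cis(2,5)[of x] c by (auto simp: norm_mult)
 qed
 show "has_index (quad_field ((-1,0,-3),(0,-2,0))) 0 0"
 proof (rule example_perturbed)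
  show "nondegenerate (quad_field ((-2,0,-2),(0,0,0)))" "wind (quad_field ((-2,0,-2),(0,0,0))) = of_int 0"
   using examples_wind(3,4) by simp_all
  show "norm (quad_field ((-2,0,-2),(0,0,0)) u) = 2" if "norm u = 1" for u by (rule two[OF that]) simp
  show "quad_field ((-1,0,-3),(0,-2,0)) u - quad_field ((-2,0,-2),(0,0,0)) u = quad_field ((1,0,-1),(0,-2,0)) u" for u
   by (simp add: quad_field_def complex_eq_iff algebra_simps)
 qed
 show "has_index (quad_field ((3,0,-3),(0,2,0))) 0 2"
 proof (rule example_perturbed)
  show "nondegenerate (quad_field ((2,0,-2),(0,4,0)))" "wind (quad_field ((2,0,-2),(0,4,0))) = of_int 2"
   using examples_wind(9,10) by simp_all
  show "norm (quad_field ((2,0,-2),(0,4,0)) u) = 2" if "norm u = 1" for u by (rule two[OF that]) simp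
  show "quad_field ((3,0,-3),(0,2,0)) u - quad_field ((2,0,-2),(0,4,0)) u = quad_field ((1,0,-1),(0,-2,0)) u" for u
   by (simp add: quad_field_def complex_eq_iff algebra_simps)
 qed
qed (simp_all add: cubic_disc_def)

theorem portrait_of_example:
 assumes c: "has_index (quad_field c) 0 i" and l: "card (zero_angles (quad_field c)) = l" "l = 1 | l = 3"
 shows "determined_by (phase_portrait 2 (quad_field c)) i l" "i \<in> {-2, 0, 2}" "l = 1 ==> i ~= -2"
proof -
 have n: "nondegenerate (quad_field c)" by (rule has_index_nondegenerate[OF quad_field_in c])
 obtain N where N: "portrait_data (quad_field c) l N" "N <= (l + 1) div 2" using portrait_data_exists[OF n l] .
 have i: "i = 1 - int l + 2 * int N" using has_index_unique[OF c portrait_data_index[OF N(1)]] .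
 show "determined_by (phase_portrait 2 (quad_field c)) i l" unfolding i by (rule portrait_determined[OF N(1) l N(2)])
 show "i \<in> {-2, 0, 2}" "l = 1 ==> i ~= -2" proof -
  have "N <= 2" "l = 1 ==> N <= 1" using N(2) l(2) by auto
  then have "N = 0 | N = 1 | N = 2" "l = 1 ==> N ~= 2" by linarith+
  moreover have "i = (if l = 1 then 0 else -2) + 2 * int N" using i l(2) by auto
  moreover have "l = 3 ==> N = 2 | N = 1 | N = 0" using calculation(1) by blast
  ultimately show "i \<in> {-2, 0, 2}" "l = 1 ==> i ~= -2" using l(2) by auto
 qed
qed

section \<open>Sign agreement of Gaussian linear forms\<close>

definition gauss :: "real measure" where
 "gauss = density lborel (%x. ennreal (std_normal_density x))"

lemma sets_gauss [simp, measurable_cong]: "sets gauss = sets borel" and space_gauss [simp]: "space gauss = UNIV"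
 by (simp_all add: gauss_def)

lemma prob_space_gauss: "prob_space gauss"
 unfolding gauss_def by (rule prob_space_normal_density) simp

lemma gauss_total [simp]: "emeasure gauss UNIV = 1"
 using prob_space.emeasure_space_1[OF prob_space_gauss] by simp

interpretation gauss: prob_space gauss by (rule prob_space_gauss)
interpretation gauss_pair: pair_sigma_finite gauss gauss ..

lemma nn_integral_gauss:
 "f \<in> borel_measurable borel ==> (\<integral>\<^sup>+x. f x \<partial>gauss) = (\<integral>\<^sup>+x. ennreal (std_normal_density x) * f x \<partial>lborel)"
 unfolding gauss_def by (rule nn_integral_density) auto

lemma gauss_reflect:
 assumes f [measurable]: "f \<in> borel_measurable borel" and e: "e = 1 | e = (-1 :: real)"
 shows "(\<integral>\<^sup>+x. f (e * x) \<partial>gauss) = (\<integral>\<^sup>+x. f x \<partial>gauss)"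
proof -
 have "(\<integral>\<^sup>+x. f x \<partial>gauss) = (\<integral>\<^sup>+x. ennreal (std_normal_density x) * f x \<partial>lborel)"
  by (rule nn_integral_gauss[OF f])
 also have "\<dots> = ennreal \<bar>e\<bar> * (\<integral>\<^sup>+x. ennreal (std_normal_density (0 + e * x)) * f (0 + e * x) \<partial>lborel)"
  by (rule nn_integral_real_affine) (use e in auto)
 also have "\<dots> = (\<integral>\<^sup>+x. ennreal (std_normal_density x) * f (e * x) \<partial>lborel)"
  using e by (auto simp: std_normal_density_def)
 also have "\<dots> = (\<integral>\<^sup>+x. f (e * x) \<partial>gauss)"
  by (rule nn_integral_gauss[symmetric]) measurable
 finally show ?thesis ..
qed

lemma gauss_singleton: "emeasure gauss {x} = 0"
proof -
 have "emeasure gauss {x} = (\<integral>\<^sup>+y. ennreal (std_normal_density y) * indicator {x} y \<partial>lborel)"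
  unfolding gauss_def by (rule emeasure_density) auto
 also have "\<dots> = 0"
  by (subst nn_integral_0_iff_AE) (auto intro!: AE_I'[of "{x}"] simp: null_sets_def)
 finally show ?thesis .
qed

lemma gauss_finite: "finite S ==> emeasure gauss S = 0"
proof (induction S rule: finite_induct)
 case (insert x S)
 then have "emeasure gauss (insert x S) <= emeasure gauss {x} + emeasure gauss S"
  using emeasure_subadditive[of "{x}" gauss S] by (simp add: borel_closed finite_imp_closed)
 then show ?case using gauss_singleton insert by simp
qed simp

lemma gauss_interval_positive: "a < b ==> 0 < emeasure gauss {a<..<b}"
proof (rule ccontr)
 assume ab: "a < b" and "\<not> 0 < emeasure gauss {a<..<b}"
 then have "emeasure gauss {a<..<b} = 0" by (simp add: not_less)
 moreover have "emeasure gauss {a<..<b} = (\<integral>\<^sup>+y. ennreal (std_normal_density y) * indicator {a<..<b} y \<partial>lborel)"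
  unfolding gauss_def by (rule emeasure_density) auto
 ultimately have "(\<integral>\<^sup>+y. ennreal (std_normal_density y) * indicator {a<..<b} y \<partial>lborel) = 0" by simp
 then have "AE y in lborel. ennreal (std_normal_density y) * indicator {a<..<b} y = 0"
  by (subst (asm) nn_integral_0_iff_AE) auto
 moreover have "ennreal (std_normal_density y) ~= 0" for y using normal_density_pos[of 1 0 y] by (simp add: ennreal_eq_0_iff)
 ultimately have "AE y in lborel. y \<notin> {a<..<b}"
  by (auto simp: indicator_def)
 then have "emeasure lborel {y \<in> space lborel. \<not> y \<notin> {a<..<b}} = 0" by (subst (asm) AE_iff_measurable[OF _ refl]) auto
 moreover have "{y \<in> space lborel. \<not> y \<notin> {a<..<b}} = {a<..<b}" by auto
 ultimately have "emeasure lborel {a<..<b} = 0" by simp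
 then show False using ab by simp
qed

text \<open>The rotation is a product of two triangular maps, each of which is handled by the substitution rule
in one variable.\<close>

lemma lborel_rotate:
 fixes h :: "real \<times> real => ennreal"
 assumes h [measurable]: "h \<in> borel_measurable (borel \<Otimes>\<^sub>M borel)" and cs: "cs^2 + sn^2 = 1" "cs ~= 0"
 shows "(\<integral>\<^sup>+x. \<integral>\<^sup>+y. h (cs * x + sn * y, cs * y - sn * x) \<partial>lborel \<partial>lborel) = (\<integral>\<^sup>+x. \<integral>\<^sup>+y. h (x, y) \<partial>lborel \<partial>lborel)"
proof -
 define k where "k = - sn / cs"
 have inner_x: "ennreal \<bar>cs\<bar> * (\<integral>\<^sup>+x. h (cs * x + sn * y, cs * y - sn * x) \<partial>lborel) = (\<integral>\<^sup>+x. h (x, k * x + (1 / cs) * y) \<partial>lborel)" for y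
 proof -
  have e: "k * (sn * y + cs * x) + (1 / cs) * y = cs * y - sn * x" for x
  proof -
   have "cs * (k * A + (1 / cs) * y) = y - sn * A" for A using cs(2) by (simp add: k_def field_simps)
   then have "cs * (k * (sn * y + cs * x) + (1 / cs) * y) = (cs^2 + sn^2) * y - sn * (sn * y + cs * x)" using cs(1) by simp
   also have "\<dots> = cs * (cs * y - sn * x)" by (simp add: power2_eq_square algebra_simps)
   finally have "cs * (k * (sn * y + cs * x) + (1 / cs) * y) = cs * (cs * y - sn * x)" .
   then show ?thesis using cs(2) by simp
  qed
  have "(\<integral>\<^sup>+x. h (x, k * x + (1 / cs) * y) \<partial>lborel) = ennreal \<bar>cs\<bar> * (\<integral>\<^sup>+x. h (sn * y + cs * x, k * (sn * y + cs * x) + (1 / cs) * y) \<partial>lborel)"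
   by (rule nn_integral_real_affine) (use cs in auto)
  then show ?thesis unfolding e by (simp only: add.commute)
 qed
 have inner_y: "(\<integral>\<^sup>+y. h (x, k * x + (1 / cs) * y) \<partial>lborel) = ennreal \<bar>cs\<bar> * (\<integral>\<^sup>+y. h (x, y) \<partial>lborel)" for x
 proof -
  have "(\<integral>\<^sup>+y. h (x, y) \<partial>lborel) = ennreal \<bar>1 / cs\<bar> * (\<integral>\<^sup>+y. h (x, k * x + (1 / cs) * y) \<partial>lborel)"
   by (rule nn_integral_real_affine) (use cs in auto)
  then have "ennreal \<bar>cs\<bar> * (\<integral>\<^sup>+y. h (x, y) \<partial>lborel) = (ennreal \<bar>cs\<bar> * ennreal \<bar>1 / cs\<bar>) * (\<integral>\<^sup>+y. h (x, k * x + (1 / cs) * y) \<partial>lborel)"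
   by (simp only: mult.assoc)
  moreover have "ennreal \<bar>cs\<bar> * ennreal \<bar>1 / cs\<bar> = 1" using cs(2) by (simp add: ennreal_mult[symmetric])
  ultimately show ?thesis by simp
 qed
 have "ennreal \<bar>cs\<bar> * (\<integral>\<^sup>+x. \<integral>\<^sup>+y. h (cs * x + sn * y, cs * y - sn * x) \<partial>lborel \<partial>lborel)
   = ennreal \<bar>cs\<bar> * (\<integral>\<^sup>+y. \<integral>\<^sup>+x. h (cs * x + sn * y, cs * y - sn * x) \<partial>lborel \<partial>lborel)"
  by (subst lborel_pair.Fubini') auto
 also have "\<dots> = (\<integral>\<^sup>+y. \<integral>\<^sup>+x. h (x, k * x + (1 / cs) * y) \<partial>lborel \<partial>lborel)"
  unfolding inner_x[symmetric] by (rule nn_integral_cmult[symmetric]) measurable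
 also have "\<dots> = (\<integral>\<^sup>+x. \<integral>\<^sup>+y. h (x, k * x + (1 / cs) * y) \<partial>lborel \<partial>lborel)"
  by (subst lborel_pair.Fubini') auto
 also have "\<dots> = ennreal \<bar>cs\<bar> * (\<integral>\<^sup>+x. \<integral>\<^sup>+y. h (x, y) \<partial>lborel \<partial>lborel)"
  unfolding inner_y by (rule nn_integral_cmult) measurable
 finally show ?thesis using cs(2) by (auto simp: ennreal_mult_cancel_left)
qed

lemma gauss_gauss:
 fixes h :: "real \<times> real => ennreal"
 assumes h [measurable]: "h \<in> borel_measurable (borel \<Otimes>\<^sub>M borel)"
 shows "(\<integral>\<^sup>+x. \<integral>\<^sup>+y. h (x, y) \<partial>gauss \<partial>gauss)
  = (\<integral>\<^sup>+x. \<integral>\<^sup>+y. ennreal (exp (- (x^2 + y^2) / 2) / (2 * pi)) * h (x, y) \<partial>lborel \<partial>lborel)"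
proof -
 have d: "std_normal_density x * std_normal_density y = exp (- (x^2 + y^2) / 2) / (2 * pi)" for x y :: real
 proof -
  have "std_normal_density x * std_normal_density y = (exp (- x\<^sup>2 / 2) * exp (- y\<^sup>2 / 2)) / (sqrt (2 * pi) * sqrt (2 * pi))"
   by (simp add: std_normal_density_def)
  also have "sqrt (2 * pi) * sqrt (2 * pi) = 2 * pi" by (rule real_sqrt_mult_self[THEN trans]) simp
  also have "exp (- x\<^sup>2 / 2) * exp (- y\<^sup>2 / 2) = exp (- (x^2 + y^2) / 2)"
   unfolding exp_add[symmetric] by (simp add: add_divide_distrib[symmetric] diff_divide_distrib[symmetric])
  finally show ?thesis .
 qed
 have "(\<integral>\<^sup>+x. \<integral>\<^sup>+y. h (x, y) \<partial>gauss \<partial>gauss) = (\<integral>\<^sup>+x. ennreal (std_normal_density x) * (\<integral>\<^sup>+y. h (x, y) \<partial>gauss) \<partial>lborel)"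
  by (rule nn_integral_gauss) measurable
 also have "\<dots> = (\<integral>\<^sup>+x. \<integral>\<^sup>+y. ennreal (std_normal_density x) * (ennreal (std_normal_density y) * h (x, y)) \<partial>lborel \<partial>lborel)"
 proof (rule nn_integral_cong)
  fix x :: real
  have "(\<integral>\<^sup>+y. h (x, y) \<partial>gauss) = (\<integral>\<^sup>+y. ennreal (std_normal_density y) * h (x, y) \<partial>lborel)"
   by (rule nn_integral_gauss) measurable
  then show "ennreal (std_normal_density x) * (\<integral>\<^sup>+y. h (x, y) \<partial>gauss)
    = (\<integral>\<^sup>+y. ennreal (std_normal_density x) * (ennreal (std_normal_density y) * h (x, y)) \<partial>lborel)"
   by (simp add: nn_integral_cmult)
 qed
 also have "\<dots> = (\<integral>\<^sup>+x. \<integral>\<^sup>+y. ennreal (exp (- (x^2 + y^2) / 2) / (2 * pi)) * h (x, y) \<partial>lborel \<partial>lborel)"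
  by (simp only: mult.assoc[symmetric] ennreal_mult[symmetric, OF normal_density_nonneg normal_density_nonneg] d)
 finally show ?thesis .
qed

lemma gauss_swap:
 fixes h :: "real \<times> real => ennreal"
 assumes h [measurable]: "h \<in> borel_measurable (borel \<Otimes>\<^sub>M borel)"
 shows "(\<integral>\<^sup>+x. \<integral>\<^sup>+y. h (x, y) \<partial>gauss \<partial>gauss) = (\<integral>\<^sup>+y. \<integral>\<^sup>+x. h (x, y) \<partial>gauss \<partial>gauss)"
 by (subst gauss_pair.Fubini') auto

lemma gauss_rotate:
 fixes h :: "real \<times> real => ennreal"
 assumes h [measurable]: "h \<in> borel_measurable (borel \<Otimes>\<^sub>M borel)" and cs: "cs^2 + sn^2 = 1"
 shows "(\<integral>\<^sup>+x. \<integral>\<^sup>+y. h (cs * x + sn * y, cs * y - sn * x) \<partial>gauss \<partial>gauss) = (\<integral>\<^sup>+x. \<integral>\<^sup>+y. h (x, y) \<partial>gauss \<partial>gauss)"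
proof (cases "cs = 0")
 case True
 then have "sn^2 = 1" using cs by simp
 then have sn: "sn = 1 | sn = -1" "- sn = 1 | - sn = -1" by (auto simp: power2_eq_1_iff)
 have "(\<integral>\<^sup>+x. \<integral>\<^sup>+y. h (sn * y, (- sn) * x) \<partial>gauss \<partial>gauss) = (\<integral>\<^sup>+x. \<integral>\<^sup>+y. h (y, (- sn) * x) \<partial>gauss \<partial>gauss)"
 proof (rule nn_integral_cong)
  fix x :: real
  show "(\<integral>\<^sup>+y. h (sn * y, (- sn) * x) \<partial>gauss) = (\<integral>\<^sup>+y. h (y, (- sn) * x) \<partial>gauss)"
   by (rule gauss_reflect[of "%y. h (y, (- sn) * x)", OF _ sn(1)]) measurable
 qed
 also have "\<dots> = (\<integral>\<^sup>+x. \<integral>\<^sup>+y. h (y, x) \<partial>gauss \<partial>gauss)"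
  by (rule gauss_reflect[of "%x. \<integral>\<^sup>+y. h (y, x) \<partial>gauss", OF _ sn(2)]) measurable
 also have "\<dots> = (\<integral>\<^sup>+x. \<integral>\<^sup>+y. h (x, y) \<partial>gauss \<partial>gauss)" by (rule gauss_swap[symmetric, OF h])
 finally show ?thesis using True by simp
next
 case False
 define H where "H = (%p. ennreal (exp (- ((fst p)^2 + (snd p)^2) / 2) / (2 * pi)) * h p)"
 have [measurable]: "H \<in> borel_measurable (borel \<Otimes>\<^sub>M borel)" unfolding H_def by measurable
 have r: "(cs * x + sn * y)^2 + (cs * y - sn * x)^2 = x^2 + y^2" for x y
 proof -
  have "(cs * x + sn * y)^2 + (cs * y - sn * x)^2 = (cs^2 + sn^2) * (x^2 + y^2)"
   by (simp add: power2_eq_square algebra_simps)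
  then show ?thesis using cs by simp
 qed
 have "(\<integral>\<^sup>+x. \<integral>\<^sup>+y. h (cs * x + sn * y, cs * y - sn * x) \<partial>gauss \<partial>gauss)
   = (\<integral>\<^sup>+x. \<integral>\<^sup>+y. H (cs * x + sn * y, cs * y - sn * x) \<partial>lborel \<partial>lborel)"
  unfolding H_def fst_conv snd_conv r
  by (rule gauss_gauss[of "%p. h (cs * fst p + sn * snd p, cs * snd p - sn * fst p)", unfolded fst_conv snd_conv]) measurable
 also have "\<dots> = (\<integral>\<^sup>+x. \<integral>\<^sup>+y. H (x, y) \<partial>lborel \<partial>lborel)" by (rule lborel_rotate[OF _ cs False]) measurable
 also have "\<dots> = (\<integral>\<^sup>+x. \<integral>\<^sup>+y. h (x, y) \<partial>gauss \<partial>gauss)" unfolding gauss_gauss[OF h] by (simp add: H_def)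
 finally show ?thesis .
qed

lemma rotation_to_axis:
 fixes a u :: real
 obtains cs sn where "cs^2 + sn^2 = 1" "a * cs + u * sn = sqrt (a^2 + u^2)" "u * cs - a * sn = 0"
proof (cases "a^2 + u^2 = 0")
 case True
 then have "a = 0" "u = 0" by (simp_all add: sum_power2_eq_zero_iff)
 then show ?thesis using that[of 1 0] by simp
next
 case False
 define r where "r = sqrt (a^2 + u^2)"
 have "0 < a^2 + u^2" using False by (metis sum_power2_gt_zero_iff sum_power2_eq_zero_iff)
 then have r: "0 < r" "r * r = a * a + u * u" by (simp_all add: r_def power2_eq_square)
 show ?thesis
 proof (rule that[of "a / r" "u / r"])
  show "(a / r)^2 + (u / r)^2 = 1" unfolding power_divide add_divide_distrib[symmetric] unfolding power2_eq_square r(2)[symmetric] using r(1) by simp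
  show "a * (a / r) + u * (u / r) = sqrt (a^2 + u^2)" using r by (simp add: r_def[symmetric] field_simps)
  show "u * (a / r) - a * (u / r) = 0" by simp
 qed
qed

text \<open>The joint law of two linear forms depends on their Gram matrix only. This is proved by adding one
variable at a time and using two plane rotations to absorb it into a triangular form.\<close>

lemma gaussian_pair:
 fixes u v :: "'i => real"
 assumes "finite J"
 shows "\<exists>a b c. 0 <= a & 0 <= c & a^2 = (\<Sum>i\<in>J. (u i)^2) & a * b = (\<Sum>i\<in>J. u i * v i) & b^2 + c^2 = (\<Sum>i\<in>J. (v i)^2) &
  (\<forall>h :: real \<times> real => ennreal. h \<in> borel_measurable (borel \<Otimes>\<^sub>M borel) -->
   (\<integral>\<^sup>+x. h (\<Sum>i\<in>J. u i * x i, \<Sum>i\<in>J. v i * x i) \<partial>PiM J (%_. gauss)) = (\<integral>\<^sup>+s. \<integral>\<^sup>+t. h (a * s, b * s + c * t) \<partial>gauss \<partial>gauss))"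
 using assms
proof (induction J rule: finite_induct)
 case empty
 interpret product_sigma_finite "%_ :: 'i. gauss" ..
 show ?case by (rule exI[of _ 0], rule exI[of _ 0], rule exI[of _ 0]) (simp add: nn_integral_empty PiM_empty)
next
 case (insert i J)
 interpret product_sigma_finite "%_ :: 'i. gauss" ..
 obtain a b c where ac: "0 <= a" "0 <= c" and sums: "a^2 = (\<Sum>i\<in>J. (u i)^2)" "a * b = (\<Sum>i\<in>J. u i * v i)" "b^2 + c^2 = (\<Sum>i\<in>J. (v i)^2)"
  and IH: "!!h :: real \<times> real => ennreal. h \<in> borel_measurable (borel \<Otimes>\<^sub>M borel) ==>
   (\<integral>\<^sup>+x. h (\<Sum>i\<in>J. u i * x i, \<Sum>i\<in>J. v i * x i) \<partial>PiM J (%_. gauss)) = (\<integral>\<^sup>+s. \<integral>\<^sup>+t. h (a * s, b * s + c * t) \<partial>gauss \<partial>gauss)"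
  using insert.IH by blast
 obtain cs sn where r1: "cs^2 + sn^2 = 1" "a * cs + u i * sn = sqrt (a^2 + (u i)^2)" "u i * cs - a * sn = 0" by (rule rotation_to_axis)
 define a' b' d where "a' = sqrt (a^2 + (u i)^2)" and "b' = b * cs + v i * sn" and "d = v i * cs - b * sn"
 obtain cs' sn' where r2: "cs'^2 + sn'^2 = 1" "c * cs' + d * sn' = sqrt (c^2 + d^2)" "d * cs' - c * sn' = 0" by (rule rotation_to_axis)
 define c' where "c' = sqrt (c^2 + d^2)"
 have a'2: "a'^2 = a^2 + (u i)^2" and c'2: "c'^2 = c^2 + d^2" by (simp_all add: a'_def c'_def)
 have au: "a = a' * cs" "u i = a' * sn"
 proof -
  have "a = a * (cs^2 + sn^2)" using r1(1) by simp
  also have "\<dots> = (a * cs + u i * sn) * cs - (u i * cs - a * sn) * sn" by (simp add: power2_eq_square algebra_simps)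
  finally show "a = a' * cs" using r1 by (simp add: a'_def)
  have "u i = u i * (cs^2 + sn^2)" using r1(1) by simp
  also have "\<dots> = (a * cs + u i * sn) * sn + (u i * cs - a * sn) * cs" by (simp add: power2_eq_square algebra_simps)
  finally show "u i = a' * sn" using r1 by (simp add: a'_def)
 qed
 have bd: "b'^2 + d^2 = b^2 + (v i)^2"
 proof -
  have "b'^2 + d^2 = (b^2 + (v i)^2) * (cs^2 + sn^2)" unfolding b'_def d_def by (simp add: power2_eq_square algebra_simps)
  then show ?thesis using r1(1) by simp
 qed
 show ?case
 proof (rule exI[of _ a'], rule exI[of _ b'], rule exI[of _ c'], intro conjI allI impI)
  show "0 <= a'" "0 <= c'" by (simp_all add: a'_def c'_def)
  show "a'^2 = (\<Sum>i\<in>insert i J. (u i)^2)" using insert.hyps sums(1) by (simp add: a'2)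
  have "a' * b' = (a' * cs) * b + (a' * sn) * v i" by (simp add: b'_def algebra_simps)
  also have "\<dots> = a * b + u i * v i" unfolding au[symmetric] ..
  finally show "a' * b' = (\<Sum>i\<in>insert i J. u i * v i)" using insert.hyps sums(2) by simp
  show "b'^2 + c'^2 = (\<Sum>i\<in>insert i J. (v i)^2)" using insert.hyps sums(3) bd c'2 by simp
  fix h :: "real \<times> real => ennreal" assume h [measurable]: "h \<in> borel_measurable (borel \<Otimes>\<^sub>M borel)"
  have "(\<integral>\<^sup>+x. h (\<Sum>j\<in>insert i J. u j * x j, \<Sum>j\<in>insert i J. v j * x j) \<partial>PiM (insert i J) (%_. gauss))
    = (\<integral>\<^sup>+x. \<integral>\<^sup>+y. h (\<Sum>j\<in>insert i J. u j * (x(i := y)) j, \<Sum>j\<in>insert i J. v j * (x(i := y)) j) \<partial>gauss \<partial>PiM J (%_. gauss))"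
   by (rule product_nn_integral_insert[OF insert.hyps]) measurable
  also have "\<dots> = (\<integral>\<^sup>+x. \<integral>\<^sup>+y. h ((\<Sum>j\<in>J. u j * x j) + u i * y, (\<Sum>j\<in>J. v j * x j) + v i * y) \<partial>gauss \<partial>PiM J (%_. gauss))"
  proof -
   have "(\<Sum>j\<in>insert i J. w j * (x(i := y)) j) = (\<Sum>j\<in>J. w j * x j) + w i * y" for w x :: "'i => real" and y
   proof -
    have "(\<Sum>j\<in>J. w j * (x(i := y)) j) = (\<Sum>j\<in>J. w j * x j)" using insert.hyps by (intro sum.cong) auto
    then show ?thesis using insert.hyps by (simp add: add.commute)
   qed
   then show ?thesis by (simp only:)
  qed
  also have "\<dots> = (\<integral>\<^sup>+s. \<integral>\<^sup>+t. \<integral>\<^sup>+y. h (a * s + u i * y, b * s + c * t + v i * y) \<partial>gauss \<partial>gauss \<partial>gauss)"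
   using IH[of "%p. \<integral>\<^sup>+y. h (fst p + u i * y, snd p + v i * y) \<partial>gauss"] by simp
  also have "\<dots> = (\<integral>\<^sup>+t. \<integral>\<^sup>+s. \<integral>\<^sup>+y. h (a * s + u i * y, b * s + c * t + v i * y) \<partial>gauss \<partial>gauss \<partial>gauss)"
   using gauss_swap[of "%p. \<integral>\<^sup>+y. h (a * fst p + u i * y, b * fst p + c * snd p + v i * y) \<partial>gauss"] by simp
  also have "\<dots> = (\<integral>\<^sup>+t. \<integral>\<^sup>+s. \<integral>\<^sup>+y. h (a' * s, b' * s + (c * t + d * y)) \<partial>gauss \<partial>gauss \<partial>gauss)"
  proof (rule nn_integral_cong)
   fix t :: real
   have e: "a * (cs * s - sn * y) + u i * (cs * y + sn * s) = a' * s"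
    "b * (cs * s - sn * y) + c * t + v i * (cs * y + sn * s) = b' * s + (c * t + d * y)" for s y
   proof -
    have "a * (cs * s - sn * y) + u i * (cs * y + sn * s) = (a * cs + u i * sn) * s + (u i * cs - a * sn) * y" by (simp add: algebra_simps)
    then show "a * (cs * s - sn * y) + u i * (cs * y + sn * s) = a' * s" using r1 by (simp add: a'_def)
   qed (simp add: b'_def d_def algebra_simps)
   have "(\<integral>\<^sup>+s. \<integral>\<^sup>+y. h (a * (cs * s - sn * y) + u i * (cs * y + sn * s), b * (cs * s - sn * y) + c * t + v i * (cs * y + sn * s)) \<partial>gauss \<partial>gauss)
    = (\<integral>\<^sup>+s. \<integral>\<^sup>+y. h (a * s + u i * y, b * s + c * t + v i * y) \<partial>gauss \<partial>gauss)"
    using gauss_rotate[of "%p. h (a * fst p + u i * snd p, b * fst p + c * t + v i * snd p)" cs "- sn"] r1(1) by simp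
   then show "(\<integral>\<^sup>+s. \<integral>\<^sup>+y. h (a * s + u i * y, b * s + c * t + v i * y) \<partial>gauss \<partial>gauss)
    = (\<integral>\<^sup>+s. \<integral>\<^sup>+y. h (a' * s, b' * s + (c * t + d * y)) \<partial>gauss \<partial>gauss)" unfolding e ..
  qed
  also have "\<dots> = (\<integral>\<^sup>+s. \<integral>\<^sup>+t. \<integral>\<^sup>+y. h (a' * s, b' * s + (c * t + d * y)) \<partial>gauss \<partial>gauss \<partial>gauss)"
   using gauss_swap[of "%p. \<integral>\<^sup>+y. h (a' * fst p, b' * fst p + (c * snd p + d * y)) \<partial>gauss"] by simp
  also have "\<dots> = (\<integral>\<^sup>+s. \<integral>\<^sup>+t. \<integral>\<^sup>+y. h (a' * s, b' * s + c' * t) \<partial>gauss \<partial>gauss \<partial>gauss)"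
  proof (rule nn_integral_cong)
   fix s :: real
   have e: "c * (cs' * t - sn' * y) + d * (cs' * y + sn' * t) = c' * t" for t y
   proof -
    have "c * (cs' * t - sn' * y) + d * (cs' * y + sn' * t) = (c * cs' + d * sn') * t + (d * cs' - c * sn') * y" by (simp add: algebra_simps)
    then show ?thesis using r2 by (simp add: c'_def)
   qed
   have "(\<integral>\<^sup>+t. \<integral>\<^sup>+y. h (a' * s, b' * s + (c * (cs' * t - sn' * y) + d * (cs' * y + sn' * t))) \<partial>gauss \<partial>gauss)
    = (\<integral>\<^sup>+t. \<integral>\<^sup>+y. h (a' * s, b' * s + (c * t + d * y)) \<partial>gauss \<partial>gauss)"
    using gauss_rotate[of "%p. h (a' * s, b' * s + (c * fst p + d * snd p))" cs' "- sn'"] r2(1) by simp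
   then show "(\<integral>\<^sup>+t. \<integral>\<^sup>+y. h (a' * s, b' * s + (c * t + d * y)) \<partial>gauss \<partial>gauss)
    = (\<integral>\<^sup>+t. \<integral>\<^sup>+y. h (a' * s, b' * s + c' * t) \<partial>gauss \<partial>gauss)" unfolding e ..
  qed
  also have "\<dots> = (\<integral>\<^sup>+s. \<integral>\<^sup>+t. h (a' * s, b' * s + c' * t) \<partial>gauss \<partial>gauss)" by simp
  finally show "(\<integral>\<^sup>+x. h (\<Sum>i\<in>insert i J. u i * x i, \<Sum>i\<in>insert i J. v i * x i) \<partial>PiM (insert i J) (%_. gauss))
    = (\<integral>\<^sup>+s. \<integral>\<^sup>+t. h (a' * s, b' * s + c' * t) \<partial>gauss \<partial>gauss)" .
 qed
qed

lemma gaussian_primitive: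
 "0 < C ==> ((%s. - exp (- (C * s^2) / 2) / (2 * pi * C)) has_real_derivative s * (exp (- (C * s^2) / 2) / (2 * pi))) (at s)"
 by (auto intro!: derivative_eq_intros simp: field_simps)

text \<open>In the coordinates \<open>(s, k)\<close> with \<open>t = - k s\<close> the inner integral is elementary and leaves the Cauchy
density, whose antiderivative is the arctangent.\<close>

lemma half_wedge:
 "(\<integral>\<^sup>+s. indicator {0<..} s * (\<integral>\<^sup>+t. indicator {..- \<kappa> * s} t \<partial>gauss) \<partial>gauss) = ennreal (1 / 4 - arctan \<kappa> / (2 * pi))"
proof -
 let ?e = "%s k. exp (- ((1 + k^2) * s^2) / 2) / (2 * pi) :: real"
 have "(\<integral>\<^sup>+s. indicator {0<..} s * (\<integral>\<^sup>+t. indicator {..- \<kappa> * s} t \<partial>gauss) \<partial>gauss)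
  = (\<integral>\<^sup>+s. \<integral>\<^sup>+t. indicator {0<..} s * (indicator {0..} (- \<kappa> * s - t)) \<partial>gauss \<partial>gauss)"
  by (subst nn_integral_cmult[symmetric]) (auto intro!: nn_integral_cong simp: indicator_def)
 also have "\<dots> = (\<integral>\<^sup>+s. \<integral>\<^sup>+t. ennreal (exp (- (s^2 + t^2) / 2) / (2 * pi)) * (indicator {0<..} s * indicator {0..} (- \<kappa> * s - t)) \<partial>lborel \<partial>lborel)"
  using gauss_gauss[of "%p. indicator {0<..} (fst p) * indicator {0..} (- \<kappa> * fst p - snd p)"] by simp
 also have "\<dots> = (\<integral>\<^sup>+s. \<integral>\<^sup>+k. ennreal (s * ?e s k) * indicator {0..} s * indicator {\<kappa>..} k \<partial>lborel \<partial>lborel)"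
 proof (rule nn_integral_cong)
  fix s :: real
  show "(\<integral>\<^sup>+t. ennreal (exp (- (s^2 + t^2) / 2) / (2 * pi)) * (indicator {0<..} s * indicator {0..} (- \<kappa> * s - t)) \<partial>lborel)
   = (\<integral>\<^sup>+k. ennreal (s * ?e s k) * indicator {0..} s * indicator {\<kappa>..} k \<partial>lborel)"
  proof (cases "0 < s")
   case True
   have "(\<integral>\<^sup>+t. ennreal (exp (- (s^2 + t^2) / 2) / (2 * pi)) * (indicator {0<..} s * indicator {0..} (- \<kappa> * s - t)) \<partial>lborel)
    = ennreal \<bar>- s\<bar> * (\<integral>\<^sup>+k. ennreal (exp (- (s^2 + (0 + (- s) * k)^2) / 2) / (2 * pi)) * (indicator {0<..} s * indicator {0..} (- \<kappa> * s - (0 + (- s) * k))) \<partial>lborel)"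
    by (rule nn_integral_real_affine) (use True in auto)
   also have "\<dots> = (\<integral>\<^sup>+k. ennreal \<bar>- s\<bar> * (ennreal (exp (- (s^2 + (0 + (- s) * k)^2) / 2) / (2 * pi)) * (indicator {0<..} s * indicator {0..} (- \<kappa> * s - (0 + (- s) * k)))) \<partial>lborel)"
    by (rule nn_integral_cmult[symmetric]) measurable
   also have "\<dots> = (\<integral>\<^sup>+k. ennreal (s * ?e s k) * indicator {0..} s * indicator {\<kappa>..} k \<partial>lborel)"
   proof (rule nn_integral_cong)
    fix k :: real
    have "s^2 + (0 + (- s) * k)^2 = (1 + k^2) * s^2" by (simp add: power2_eq_square algebra_simps)
    moreover have "0 <= - \<kappa> * s - (0 + (- s) * k) \<longleftrightarrow> \<kappa> <= k"
    proof -
     have "- \<kappa> * s - (0 + (- s) * k) = s * (k - \<kappa>)" by (simp add: algebra_simps)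
     then show ?thesis using True by (simp add: zero_le_mult_iff)
    qed
    ultimately show "ennreal \<bar>- s\<bar> * (ennreal (exp (- (s^2 + (0 + (- s) * k)^2) / 2) / (2 * pi)) * (indicator {0<..} s * indicator {0..} (- \<kappa> * s - (0 + (- s) * k))))
     = ennreal (s * ?e s k) * indicator {0..} s * indicator {\<kappa>..} k"
     using True by (simp add: indicator_def ennreal_mult[symmetric] del: ennreal_mult_eq_top_iff)
   qed
   finally show ?thesis .
  next
   case False
   then show ?thesis by (cases "s = 0") auto
  qed
 qed
 also have "\<dots> = (\<integral>\<^sup>+k. \<integral>\<^sup>+s. ennreal (s * ?e s k) * indicator {0..} s * indicator {\<kappa>..} k \<partial>lborel \<partial>lborel)"
  by (subst lborel_pair.Fubini') auto
 also have "\<dots> = (\<integral>\<^sup>+k. ennreal (1 / (2 * pi * (1 + k^2))) * indicator {\<kappa>..} k \<partial>lborel)"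
 proof (rule nn_integral_cong)
  fix k :: real
  have p: "0 < 1 + k^2" by (rule add_pos_nonneg) auto
  have "(\<integral>\<^sup>+s. ennreal (s * ?e s k) * indicator {0..} s \<partial>lborel) = ennreal (0 - (- exp (- ((1 + k^2) * 0^2) / 2) / (2 * pi * (1 + k^2))))"
  proof (rule nn_integral_FTC_atLeast)
   fix s :: real assume "0 <= s"
   then show "0 <= s * ?e s k" by simp
   show "((%s. - exp (- ((1 + k^2) * s^2) / 2) / (2 * pi * (1 + k^2))) has_real_derivative s * ?e s k) (at s)"
    by (rule gaussian_primitive[OF p])
  next
   have "filterlim (%s. (1 + k^2) * s^2 / 2) at_top at_top"
   proof (rule filterlim_at_top_mono[OF filterlim_ident])
    show "\<forall>\<^sub>F s in at_top. s <= (1 + k^2) * s^2 / 2"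
     using eventually_ge_at_top[of 2]
    proof eventually_elim
     case (elim s)
     have "2 * s <= s * s" using elim by (intro mult_right_mono) auto
     also have "\<dots> <= (1 + k^2) * (s * s)" using mult_right_mono[of 1 "1 + k^2" "s * s"] by simp
     finally show ?case by (simp add: power2_eq_square)
    qed
   qed
   then have "((%s. exp (- ((1 + k^2) * s^2 / 2))) \<longlongrightarrow> 0) at_top"
    by (rule filterlim_compose[OF exp_at_bot filterlim_compose[OF filterlim_uminus_at_bot_at_top]])
   then have "((%s. - exp (- ((1 + k^2) * s^2 / 2)) / (2 * pi * (1 + k^2))) \<longlongrightarrow> - 0 / (2 * pi * (1 + k^2))) at_top"
    by (intro tendsto_intros) (use p in auto)
   then show "((%s. - exp (- ((1 + k^2) * s^2) / 2) / (2 * pi * (1 + k^2))) \<longlongrightarrow> 0) at_top" by simp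
  qed measurable
  then show "(\<integral>\<^sup>+s. ennreal (s * ?e s k) * indicator {0..} s * indicator {\<kappa>..} k \<partial>lborel) = ennreal (1 / (2 * pi * (1 + k^2))) * indicator {\<kappa>..} k"
   by (simp add: nn_integral_multc)
 qed
 also have "\<dots> = ennreal (1 / 4 - arctan \<kappa> / (2 * pi))"
 proof (rule nn_integral_FTC_atLeast)
  fix k :: real
  have p: "0 < 1 + k^2" by (rule add_pos_nonneg) auto
  show "((%k. arctan k / (2 * pi)) has_real_derivative 1 / (2 * pi * (1 + k^2))) (at k)"
   by (rule DERIV_cdivide[OF DERIV_arctan, THEN DERIV_cong]) (simp only: inverse_eq_divide divide_divide_eq_left mult.commute)
  show "0 <= 1 / (2 * pi * (1 + k^2))" using p by simp
  have "((%k. arctan k / (2 * pi)) \<longlongrightarrow> (pi / 2) / (2 * pi)) at_top"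
   by (intro tendsto_intros tendsto_arctan_at_top) simp
  then show "((%k. arctan k / (2 * pi)) \<longlongrightarrow> 1 / 4) at_top" by simp
 qed measurable
 finally show ?thesis .
qed

lemma wedge:
 assumes "0 < a" "0 < c"
 shows "(\<integral>\<^sup>+s. \<integral>\<^sup>+t. indicator {p :: real \<times> real. (0 < fst p) ~= (0 < snd p)} (a * s, b * s + c * t) \<partial>gauss \<partial>gauss)
  = ennreal (1 / 2 - arctan (b / c) / pi)"
proof -
 define \<kappa> where "\<kappa> = b / c"
 have iff: "0 < a * s \<longleftrightarrow> 0 < s" "0 < b * s + c * t \<longleftrightarrow> - \<kappa> * s < t" for s t
 proof -
  show "0 < a * s \<longleftrightarrow> 0 < s" using assms by (simp add: zero_less_mult_iff)
  have "b * s + c * t = c * (\<kappa> * s + t)" using assms by (simp add: \<kappa>_def distrib_left)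
  then show "0 < b * s + c * t \<longleftrightarrow> - \<kappa> * s < t" using assms by (simp add: zero_less_mult_iff) linarith
 qed
 let ?m = "%s. \<integral>\<^sup>+t. indicator {..- \<kappa> * s} t \<partial>gauss"
 have m: "?m s = emeasure gauss {..- \<kappa> * s}" for s by simp
 have m': "?m s = (\<integral>\<^sup>+t. indicator {..<- \<kappa> * s} t \<partial>gauss)" for s
 proof -
  have "{..- \<kappa> * s} = insert (- \<kappa> * s) {..<- \<kappa> * s}" by auto
  then have "emeasure gauss {..- \<kappa> * s} <= emeasure gauss {- \<kappa> * s} + emeasure gauss {..<- \<kappa> * s}"
   using emeasure_subadditive[of "{- \<kappa> * s}" gauss "{..<- \<kappa> * s}"] by simp
  moreover have "emeasure gauss {..<- \<kappa> * s} <= emeasure gauss {..- \<kappa> * s}" by (rule emeasure_mono) auto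
  ultimately show ?thesis by (simp add: gauss_singleton)
 qed
 have [measurable]: "?m \<in> borel_measurable borel"
 proof -
  have "(%s. \<integral>\<^sup>+t. indicator {0..} (- \<kappa> * s - t) \<partial>gauss) \<in> borel_measurable borel" by measurable
  moreover have e: "indicator {0..} (- \<kappa> * s - t) = (indicator {..- \<kappa> * s} t :: ennreal)" for s t by (auto simp: indicator_def)
  ultimately show ?thesis unfolding e by -
 qed
 have "AE s in gauss. s ~= 0" by (rule AE_I[of _ _ "{0}"]) (auto simp: gauss_singleton)
 then have "(\<integral>\<^sup>+s. \<integral>\<^sup>+t. indicator {p :: real \<times> real. (0 < fst p) ~= (0 < snd p)} (a * s, b * s + c * t) \<partial>gauss \<partial>gauss)
  = (\<integral>\<^sup>+s. indicator {0<..} s * ?m s + indicator {0<..} (- 1 * s) * ?m (- 1 * s) \<partial>gauss)"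
 proof (intro nn_integral_cong_AE, eventually_elim)
  fix s :: real assume "s ~= 0"
  then consider "0 < s" | "s < 0" by linarith
  then show "(\<integral>\<^sup>+t. indicator {p :: real \<times> real. (0 < fst p) ~= (0 < snd p)} (a * s, b * s + c * t) \<partial>gauss)
   = indicator {0<..} s * ?m s + indicator {0<..} (- 1 * s) * ?m (- 1 * s)"
  proof cases
   case 1
   have "indicator {p :: real \<times> real. (0 < fst p) ~= (0 < snd p)} (a * s, b * s + c * t) = (indicator {..- \<kappa> * s} t :: ennreal)" for t
    using 1 by (auto simp: indicator_def iff)
   then show ?thesis using 1 by simp
  next
   case 2
   have "indicator {p :: real \<times> real. (0 < fst p) ~= (0 < snd p)} (a * s, b * s + c * t) = (indicator {..<- \<kappa> * (- 1 * s)} (- 1 * t) :: ennreal)" for t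
    using 2 by (auto simp: indicator_def iff)
   then have "(\<integral>\<^sup>+t. indicator {p :: real \<times> real. (0 < fst p) ~= (0 < snd p)} (a * s, b * s + c * t) \<partial>gauss)
    = (\<integral>\<^sup>+t. indicator {..<- \<kappa> * (- 1 * s)} (- 1 * t) \<partial>gauss)" by (simp only:)
   also have "\<dots> = (\<integral>\<^sup>+t. indicator {..<- \<kappa> * (- 1 * s)} t \<partial>gauss)" by (rule gauss_reflect) auto
   also have "\<dots> = ?m (- 1 * s)" by (rule m'[symmetric])
   finally show ?thesis using 2 by (simp only:) simp
  qed
 qed
 also have "\<dots> = (\<integral>\<^sup>+s. indicator {0<..} s * ?m s \<partial>gauss) + (\<integral>\<^sup>+s. indicator {0<..} (- 1 * s) * ?m (- 1 * s) \<partial>gauss)"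
  by (rule nn_integral_add) measurable
 also have "(\<integral>\<^sup>+s. indicator {0<..} (- 1 * s) * ?m (- 1 * s) \<partial>gauss) = (\<integral>\<^sup>+s. indicator {0<..} s * ?m s \<partial>gauss)"
  by (rule gauss_reflect[of "%s. indicator {0<..} s * ?m s", OF _ disjI2[OF refl]]) measurable
 also have "(\<integral>\<^sup>+s. indicator {0<..} s * ?m s \<partial>gauss) = ennreal (1 / 4 - arctan \<kappa> / (2 * pi))" by (rule half_wedge)
 also have "ennreal (1 / 4 - arctan \<kappa> / (2 * pi)) + ennreal (1 / 4 - arctan \<kappa> / (2 * pi)) = ennreal (1 / 2 - arctan \<kappa> / pi)"
 proof -
  have "arctan \<kappa> / (2 * pi) <= 1 / 4" using arctan_ubound[of \<kappa>] pi_gt_zero by (simp add: field_simps)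
  then show ?thesis by (simp add: ennreal_plus[symmetric] field_simps del: ennreal_plus)
 qed
 finally show ?thesis unfolding \<kappa>_def .
qed

text \<open>Sheppard's formula: the probability is the angle between the vectors \<open>u\<close> and \<open>v\<close> divided by \<open>\<pi>\<close>.\<close>

theorem sign_disagreement:
 fixes u v :: "'i => real"
 assumes J: "finite J" and pq: "p = (\<Sum>i\<in>J. (u i)^2)" "q = (\<Sum>i\<in>J. u i * v i)" "r = (\<Sum>i\<in>J. (v i)^2)" and pos: "0 < p * r - q\<^sup>2"
 shows "emeasure (PiM J (%_. gauss)) {x \<in> space (PiM J (%_. gauss)). (0 < (\<Sum>i\<in>J. u i * x i)) ~= (0 < (\<Sum>i\<in>J. v i * x i))}
  = ennreal (1 / 2 - arctan (q / sqrt (p * r - q\<^sup>2)) / pi)"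
proof -
 obtain a b c where ac: "0 <= a" "0 <= c" and s: "a^2 = p" "a * b = q" "b^2 + c^2 = r"
  and h: "!!h :: real \<times> real => ennreal. h \<in> borel_measurable (borel \<Otimes>\<^sub>M borel) ==>
   (\<integral>\<^sup>+x. h (\<Sum>i\<in>J. u i * x i, \<Sum>i\<in>J. v i * x i) \<partial>PiM J (%_. gauss)) = (\<integral>\<^sup>+s. \<integral>\<^sup>+t. h (a * s, b * s + c * t) \<partial>gauss \<partial>gauss)"
  using gaussian_pair[OF J, of u v] unfolding pq by blast
 have d: "p * r - q\<^sup>2 = (a * c)^2" unfolding s[symmetric] by (simp add: power2_eq_square algebra_simps)
 then have "a * c ~= 0" using pos by auto
 then have ac': "0 < a" "0 < c" using ac by auto
 have "sqrt (p * r - q\<^sup>2) = a * c" unfolding d using ac by simp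
 then have "q / sqrt (p * r - q\<^sup>2) = b / c" using ac' s(2) by (simp add: field_simps)
 moreover have "emeasure (PiM J (%_. gauss)) {x \<in> space (PiM J (%_. gauss)). (0 < (\<Sum>i\<in>J. u i * x i)) ~= (0 < (\<Sum>i\<in>J. v i * x i))}
  = (\<integral>\<^sup>+x. indicator {x \<in> space (PiM J (%_. gauss)). (0 < (\<Sum>i\<in>J. u i * x i)) ~= (0 < (\<Sum>i\<in>J. v i * x i))} x \<partial>PiM J (%_. gauss))"
  by (rule nn_integral_indicator[symmetric]) measurable
 moreover have "\<dots> = (\<integral>\<^sup>+x. indicator {p :: real \<times> real. (0 < fst p) ~= (0 < snd p)} (\<Sum>i\<in>J. u i * x i, \<Sum>i\<in>J. v i * x i) \<partial>PiM J (%_. gauss))"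
  by (rule nn_integral_cong) (auto simp: indicator_def)
 moreover have "\<dots> = ennreal (1 / 2 - arctan (b / c) / pi)"
 proof (rule trans[OF h wedge[OF ac']])
  have "{p :: real \<times> real. (0 < fst p) ~= (0 < snd p)} = {0<..} \<times> {..0} \<union> {..0} \<times> {0<..}" by auto
  moreover have "{0<..} \<times> {..0} \<union> {..0} \<times> {0<..} \<in> sets (borel \<Otimes>\<^sub>M (borel :: real measure) :: (real \<times> real) measure)"
   by (intro sets.Un pair_measureI) auto
  ultimately show "indicator {p :: real \<times> real. (0 < fst p) ~= (0 < snd p)} \<in> borel_measurable (borel \<Otimes>\<^sub>M borel)"
   by simp
 qed
 ultimately show ?thesis by simp
qed

section \<open>The space of coefficients and their law\<close>

type_synonym coeffs = "(real \<times> real \<times> real) \<times> (real \<times> real \<times> real)"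

fun resultant :: "coeffs => real" where
 "resultant ((a, a', a''), (b, b', b'')) = (a * b'' - b * a'')^2 - (a * b' - b * a') * (a' * b'' - a'' * b')"

lemma nondegenerate_resultant:
 assumes "resultant c ~= 0" shows "nondegenerate (quad_field c)"
proof (rule nondegenerateI[OF quad_field_in], rule notI)
 obtain a a' a'' b b' b'' where c: "c = ((a, a', a''), (b, b', b''))" by (metis prod.exhaust)
 fix u :: complex assume u: "norm u = 1" and z: "quad_field c u = 0"
 define x y where "x = Re u" and "y = Im u"
 have xy: "\<not> (x = 0 & y = 0)"
 proof
  assume "x = 0 & y = 0"
  then have "u = 0" by (simp add: complex_eq_iff x_def y_def)
  then show False using u by simp
 qed
 have P: "a * x^2 + a' * x * y + a'' * y^2 = 0" and Q: "b * x^2 + b' * x * y + b'' * y^2 = 0"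
  using z by (simp_all add: c quad_field_def complex_eq_iff x_def y_def)
 define m n k where "m = a * b' - b * a'" and "n = a * b'' - b * a''" and "k = a' * b'' - a'' * b'"
 have 1: "y * (m * x + n * y) = 0"
 proof -
  have "y * (m * x + n * y) = a * (b * x^2 + b' * x * y + b'' * y^2) - b * (a * x^2 + a' * x * y + a'' * y^2)"
   by (simp add: m_def n_def power2_eq_square algebra_simps)
  then show ?thesis using P Q by simp
 qed
 have 2: "x * (n * x + k * y) = 0"
 proof -
  have "x * (n * x + k * y) = b'' * (a * x^2 + a' * x * y + a'' * y^2) - a'' * (b * x^2 + b' * x * y + b'' * y^2)"
   by (simp add: k_def n_def power2_eq_square algebra_simps)
  then show ?thesis using P Q by simp
 qed
 have "n^2 - m * k = 0"
 proof (cases "x = 0")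
  case True
  then have "a'' = 0" "b'' = 0" using P Q xy by auto
  then show ?thesis by (simp add: n_def k_def)
 next
  case x: False
  show ?thesis
  proof (cases "y = 0")
   case True
   then have "a = 0" "b = 0" using P Q x by auto
   then show ?thesis by (simp add: n_def m_def)
  next
   case False
   then have e: "m * x + n * y = 0" "n * x + k * y = 0" using 1 2 x by auto
   have "(n^2 - m * k) * x = n * (n * x + k * y) - k * (m * x + n * y)" by (simp add: power2_eq_square algebra_simps)
   then show ?thesis using e x by simp
  qed
 qed
 then show False using assms by (simp add: c m_def n_def k_def)
qed

lemma card_three_disc:
 assumes card: "card (zero_angles (quad_field c)) = 3" shows "0 < field_disc c"
proof -
 let ?F = "quad_field c"
 obtain e e' e'' f f' f'' where c: "c = ((e, e', e''), (f, f', f''))" by (metis prod.exhaust)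
 obtain x y z where Z: "zero_angles ?F = {x, y, z}" "x ~= y" "y ~= z" "x ~= z" using card by (auto simp: card_3_iff)
 have in_Z: "0 <= u & u < pi & angular ?F u = 0" if "u \<in> {x, y, z}" for u using that Z(1) by (auto simp: zero_angles_def)
 have ne: "sin (v - u) ~= 0" if "u \<in> {x, y, z}" "v \<in> {x, y, z}" "u ~= v" for u v
 proof
  assume "sin (v - u) = 0"
  moreover have "\<bar>v - u\<bar> < pi" using in_Z[OF that(1)] in_Z[OF that(2)] by linarith
  ultimately show False using sin_zero_small[of "v - u"] that(3) by simp
 qed
 obtain k where k: "!!t. angular ?F t = k * (sin (t - x) * sin (t - y) * sin (t - z))"
  using angular_factor[OF quad_field_in[of c], of x y z] in_Z ne Z by blast
 have k0: "k ~= 0"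
 proof
  assume "k = 0"
  then have "{0..<pi} \<subseteq> {x, y, z}" using k Z(1) by (auto simp: zero_angles_def)
  then have "finite {0..<pi}" by (rule finite_subset) simp
  then show False by (simp add: infinite_Ico)
 qed
 let ?f = "cubic_form f (f' - e) (f'' - e') (- e'')"
 have g: "angular ?F t = ?f (cos t) (sin t)" for t
  by (simp add: c angular_def quad_field_def cubic_form_def power2_eq_square power3_eq_cube algebra_simps)
 define \<alpha> \<beta> \<gamma> where "\<alpha> = k * (sin y * sin z)" and "\<beta> = - k * (sin y * cos z + cos y * sin z)" and "\<gamma> = k * (cos y * cos z)"
 have fac: "?f X Y = (cos x * Y - sin x * X) * (\<alpha> * X^2 + \<beta> * X * Y + \<gamma> * Y^2)" for X Y
 proof -
  obtain t where t: "Complex X Y = of_real (norm (Complex X Y)) * cis t" using polar_coordinates[of 0 "Complex X Y"] by blast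
  define R where "R = norm (Complex X Y)"
  have XY: "X = R * cos t" "Y = R * sin t" using arg_cong[OF t, of Re] arg_cong[OF t, of Im] by (simp_all add: R_def)
  have "?f X Y = R ^ 3 * ?f (cos t) (sin t)" unfolding XY cubic_form_def by (simp add: power2_eq_square power3_eq_cube algebra_simps)
  also have "?f (cos t) (sin t) = k * (sin (t - x) * sin (t - y) * sin (t - z))" using g[of t] k[of t] by simp
  also have "R ^ 3 * \<dots> = (cos x * Y - sin x * X) * (\<alpha> * X^2 + \<beta> * X * Y + \<gamma> * Y^2)"
   unfolding XY sin_diff \<alpha>_def \<beta>_def \<gamma>_def by (simp add: power2_eq_square power3_eq_cube algebra_simps)
  finally show ?thesis .
 qed
 have "field_disc c = (\<beta>\<^sup>2 - 4 * \<alpha> * \<gamma>) * (\<alpha> * (cos x)^2 + \<beta> * cos x * sin x + \<gamma> * (sin x)^2)^2"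
  unfolding c field_disc.simps by (rule cubic_disc_factor[OF fac])
 moreover have "\<beta>\<^sup>2 - 4 * \<alpha> * \<gamma> = (k * sin (z - y))^2"
  unfolding \<alpha>_def \<beta>_def \<gamma>_def sin_diff by (simp add: power2_eq_square algebra_simps)
 moreover have "\<alpha> * (cos x)^2 + \<beta> * cos x * sin x + \<gamma> * (sin x)^2 = k * (sin (y - x) * sin (z - x))"
  unfolding \<alpha>_def \<beta>_def \<gamma>_def sin_diff by (simp add: power2_eq_square algebra_simps)
 ultimately show ?thesis using k0 ne[of x y] ne[of x z] ne[of y z] Z by simp
qed

lemma card_three_iff_disc: "card (zero_angles (quad_field c)) = 3 \<longleftrightarrow> 0 < field_disc c"
 using card_three_disc card_lines_disc(1) by blast

lemma continuous_angular_joint: "continuous_on A (%p. angular (quad_field (fst p)) (snd p))"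
proof -
 have "angular (quad_field (fst p)) (snd p) = cubic_form (fst (snd (fst p))) (fst (snd (snd (fst p))) - fst (fst (fst p)))
   (snd (snd (snd (fst p))) - fst (snd (fst (fst p)))) (- snd (snd (fst (fst p)))) (cos (snd p)) (sin (snd p))" for p
  by (cases "fst p" rule: field_disc.cases)
   (simp add: angular_def quad_field_def cubic_form_def power2_eq_square power3_eq_cube algebra_simps)
 then show ?thesis unfolding cubic_form_def by (simp only:) (intro continuous_intros)
qed

lemma zero_angle_in_range:
 assumes F: "F \<in> hom_fields 2" and x: "0 <= x" "x <= pi" "angular F x = 0"
 obtains x' where "x' \<in> zero_angles F" "!!y. sin (x' - y) = 0 \<longleftrightarrow> sin (x - y) = 0"
proof (cases "x = pi")
 case True
 then have "angular F 0 = 0" using x(3) radial_angular_add_pi(2)[OF F, of 0] by simp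
 then show ?thesis using that[of 0] True by (simp add: zero_angles_def sin_diff)
next
 case False
 then show ?thesis using that[of x] x by (simp add: zero_angles_def)
qed

text \<open>Having two zeros at a given minimal distance is a closed condition on the coefficients, by compactness of
the set of pairs of angles.\<close>

lemma card_one_borel: "{c. card (zero_angles (quad_field c)) = 1} \<in> sets borel"
proof -
 define K where "K = (%n. {p \<in> {0..pi} \<times> {0..pi}. 1 / real (Suc n) <= \<bar>sin (fst p - snd p)\<bar>})"
 define U where "U = (%n. {c. \<forall>p\<in>K n. angular (quad_field c) (fst p) ~= 0 | angular (quad_field c) (snd p) ~= 0})"
 have "compact (K n)" for n
 proof -
  have "closed {p :: real \<times> real. 1 / real (Suc n) <= \<bar>sin (fst p - snd p)\<bar>}" by (intro closed_Collect_le continuous_intros)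
  moreover have "K n = ({0..pi} \<times> {0..pi}) \<inter> {p. 1 / real (Suc n) <= \<bar>sin (fst p - snd p)\<bar>}" unfolding K_def by blast
  ultimately show ?thesis by (simp add: compact_Int_closed compact_Times)
 qed
 have "open (U n)" for n
 proof (subst open_subopen, intro ballI)
  fix c assume c: "c \<in> U n"
  define W where "W = {q :: coeffs \<times> real \<times> real. angular (quad_field (fst q)) (fst (snd q)) ~= 0} \<union> {q. angular (quad_field (fst q)) (snd (snd q)) ~= 0}"
  have "continuous_on UNIV (%q :: coeffs \<times> real \<times> real. angular (quad_field (fst q)) (fst (snd q)))"
   using continuous_on_compose2[OF continuous_angular_joint[of UNIV], of UNIV "%q. (fst q, fst (snd q))"] by (simp add: continuous_intros)
  moreover have "continuous_on UNIV (%q :: coeffs \<times> real \<times> real. angular (quad_field (fst q)) (snd (snd q)))"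
   using continuous_on_compose2[OF continuous_angular_joint[of UNIV], of UNIV "%q. (fst q, snd (snd q))"] by (simp add: continuous_intros)
  ultimately have W: "open W" unfolding W_def by (intro open_Un open_Collect_neq continuous_on_const)
  have sub: "{c} \<times> K n \<subseteq> W"
  proof
   fix q assume "q \<in> {c} \<times> K n"
   then obtain p where "q = (c, p)" "p \<in> K n" by blast
   then show "q \<in> W" using c by (simp add: U_def W_def)
  qed
  obtain X where X: "c \<in> X" "open X" "X \<times> K n \<subseteq> W"
   using Elementary_Topology.tube_lemma[OF \<open>compact (K n)\<close> W sub] by (elim exE conjE)
  have "X \<subseteq> U n"
  proof
   fix d assume d: "d \<in> X"
   show "d \<in> U n" unfolding U_def mem_Collect_eq
   proof
    fix p assume "p \<in> K n"
    then have "(d, p) \<in> W" using X(3) d by (meson SigmaI subsetD)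
    then show "angular (quad_field d) (fst p) ~= 0 | angular (quad_field d) (snd p) ~= 0" by (simp add: W_def)
   qed
  qed
  then show "\<exists>T. open T & c \<in> T & T \<subseteq> U n" using X(1,2) by (intro exI[of _ X] conjI)
 qed
 then have "(\<Inter>n. U n) \<in> sets borel" by (intro sets.countable_INT) auto
 moreover have "card (zero_angles (quad_field c)) = 1 \<longleftrightarrow> c \<in> (\<Inter>n. U n)" for c
 proof
  assume one: "card (zero_angles (quad_field c)) = 1"
  then obtain z where z: "zero_angles (quad_field c) = {z}" by (metis card_1_singletonE)
  have "angular (quad_field c) (fst p) ~= 0 | angular (quad_field c) (snd p) ~= 0" if p: "p \<in> K n" for n p
  proof (rule ccontr)
   assume "\<not> ?thesis"
   then have 0: "angular (quad_field c) (fst p) = 0" "angular (quad_field c) (snd p) = 0" by auto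
   have r: "0 <= fst p" "fst p <= pi" "0 <= snd p" "snd p <= pi" and s: "1 / real (Suc n) <= \<bar>sin (fst p - snd p)\<bar>" using p by (auto simp: K_def)
   obtain x where x: "x \<in> zero_angles (quad_field c)" "!!y. sin (x - y) = 0 \<longleftrightarrow> sin (fst p - y) = 0"
    using zero_angle_in_range[OF quad_field_in r(1,2) 0(1)] by blast
   obtain y where y: "y \<in> zero_angles (quad_field c)" "!!u. sin (y - u) = 0 \<longleftrightarrow> sin (snd p - u) = 0"
    using zero_angle_in_range[OF quad_field_in r(3,4) 0(2)] by blast
   have xy: "x = y" using x(1) y(1) z by simp
   have "sin (snd p - snd p) = 0" by simp
   then have "sin (x - snd p) = 0" using y(2) xy by blast
   then have "sin (fst p - snd p) = 0" using x(2) by blast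
   then have "1 / real (Suc n) <= 0" using s by simp
   then show False by (simp add: divide_le_0_iff)
  qed
  then show "c \<in> (\<Inter>n. U n)" unfolding U_def by blast
 next
  assume c: "c \<in> (\<Inter>n. U n)"
  obtain z where z: "z \<in> zero_angles (quad_field c)" using angular_zero_exists[OF quad_field_in[of c]] unfolding zero_angles_def by blast
  have "x = z" if x: "x \<in> zero_angles (quad_field c)" for x
  proof (rule ccontr)
   assume ne: "x ~= z"
   have r: "0 <= x" "x < pi" "angular (quad_field c) x = 0" "0 <= z" "z < pi" "angular (quad_field c) z = 0"
    using x z by (auto simp: zero_angles_def)
   have "sin (x - z) ~= 0" using sin_zero_small[of "x - z"] ne r by (auto simp: abs_less_iff)
   then obtain n where "1 / real (Suc n) < \<bar>sin (x - z)\<bar>" using nat_approx_posE[of "\<bar>sin (x - z)\<bar>"] by auto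
   then have "(x, z) \<in> K n" using r by (auto simp: K_def)
   then show False using c r unfolding U_def by fastforce
  qed
  then have "zero_angles (quad_field c) = {z}" using z by blast
  then show "card (zero_angles (quad_field c)) = 1" by simp
 qed
 ultimately show ?thesis by (simp only: Collect_mem_eq)
qed

definition coefficient_class :: "int => nat => coeffs set" where
 "coefficient_class i l = {c. has_index (quad_field c) 0 i & card (zero_angles (quad_field c)) = l}"

lemma coefficient_class_borel: "l = 1 | l = 3 ==> coefficient_class i l \<in> sets borel"
proof -
 assume l: "l = 1 | l = 3"
 have "{c. card (zero_angles (quad_field c)) = l} \<in> sets borel"
  using l card_one_borel open_disc(1) by (auto simp: card_three_iff_disc)
 moreover have "coefficient_class i l = {c. has_index (quad_field c) 0 i} \<inter> {c. card (zero_angles (quad_field c)) = l}"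
  by (auto simp: coefficient_class_def)
 ultimately show ?thesis using open_index[of i] by auto
qed

definition coefficient_index :: "((nat \<times> nat) + (nat \<times> nat)) set" where
 "coefficient_index = exponents 2 <+> exponents 2"

lemma coefficient_index_eq: "coefficient_index = {Inl (2,0), Inl (1,1), Inl (0,2), Inr (2,0), Inr (1,1), Inr (0,2)}"
 by (auto simp: coefficient_index_def exponents_2)

lemma finite_coefficient_index [simp]: "finite coefficient_index" by (simp add: coefficient_index_eq)

abbreviation gauss6 :: "((nat \<times> nat) + (nat \<times> nat) => real) measure" where
 "gauss6 \<equiv> PiM coefficient_index (%_. gauss)"

definition coeffs_of :: "((nat \<times> nat) + (nat \<times> nat) => real) => coeffs" where
 "coeffs_of x = ((x (Inl (2,0)), x (Inl (1,1)), x (Inl (0,2))), (x (Inr (2,0)), x (Inr (1,1)), x (Inr (0,2))))"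

lemma prob_space_gauss6: "prob_space gauss6"
 by (intro prob_space_PiM prob_space_gauss)

lemma coeffs_of_measurable [measurable]: "coeffs_of \<in> borel_measurable gauss6"
proof -
 have c: "(%x. x k) \<in> borel_measurable gauss6" if "k \<in> coefficient_index" for k
  using measurable_component_singleton[OF that, of "%_. gauss"] by (simp cong: measurable_cong_sets)
 show ?thesis unfolding coeffs_of_def by (intro borel_measurable_Pair c) (simp_all add: coefficient_index_eq)
qed

lemma coeffs_of_sets: "E \<in> sets borel ==> {x \<in> space gauss6. coeffs_of x \<in> E} \<in> sets gauss6"
proof -
 assume E: "E \<in> sets borel"
 have "{x \<in> space gauss6. coeffs_of x \<in> E} = coeffs_of -` E \<inter> space gauss6" by blast
 then show ?thesis using measurable_sets[OF coeffs_of_measurable E] by (simp only:)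
qed

text \<open>Fubini's theorem in the remaining coordinates; a finite set has measure zero for the normal law.\<close>

lemma one_variable_null:
 assumes k: "k \<in> coefficient_index" and E: "E \<in> sets gauss6" and fin: "!!x. finite {t. x(k := t) \<in> E}"
 shows "emeasure gauss6 E = 0"
proof -
 interpret product_sigma_finite "%_ :: (nat \<times> nat) + (nat \<times> nat). gauss" ..
 let ?J = "coefficient_index - {k}"
 have I: "insert k ?J = coefficient_index" using k by blast
 have "emeasure gauss6 E = (\<integral>\<^sup>+x. indicator E x \<partial>PiM (insert k ?J) (%_. gauss))" unfolding I using E by simp
 also have "\<dots> = (\<integral>\<^sup>+x. \<integral>\<^sup>+t. indicator E (x(k := t)) \<partial>gauss \<partial>PiM ?J (%_. gauss))"
  by (rule product_nn_integral_insert) (use E I in auto)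
 also have "\<dots> = 0"
 proof -
  have "(\<integral>\<^sup>+t. indicator E (x(k := t)) \<partial>gauss) = 0" for x
  proof -
   have "(\<integral>\<^sup>+t. indicator E (x(k := t)) \<partial>gauss) = (\<integral>\<^sup>+t. indicator {t. x(k := t) \<in> E} t \<partial>gauss)"
    by (intro nn_integral_cong) (simp add: indicator_def)
   also have "\<dots> = emeasure gauss {t. x(k := t) \<in> E}"
    by (intro nn_integral_indicator) (use fin[of x] in \<open>auto intro: borel_closed finite_imp_closed\<close>)
   finally show ?thesis using gauss_finite[OF fin] by simp
  qed
  then show ?thesis by simp
 qed
 finally show ?thesis .
qed

lemma finite_quadratic_roots: "A ~= 0 ==> finite {t :: real. A * t^2 + B * t + C = 0}"
proof -
 assume "A ~= 0"
 then have "finite {t. poly [:C, B, A:] t = 0}" by (intro poly_roots_finite) simp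
 moreover have e: "poly [:C, B, A:] t = A * t^2 + B * t + C" for t by (simp add: power2_eq_square algebra_simps)
 ultimately show ?thesis unfolding e by -
qed

lemma continuous_resultant: "continuous_on A resultant"
proof -
 have eq: "resultant = (%c. (fst (fst c) * snd (snd (snd c)) - fst (snd c) * snd (snd (fst c)))^2
  - (fst (fst c) * fst (snd (snd c)) - fst (snd c) * fst (snd (fst c))) * (fst (snd (fst c)) * snd (snd (snd c)) - snd (snd (fst c)) * fst (snd (snd c))))"
  by (auto simp: fun_eq_iff)
 show ?thesis unfolding eq by (intro continuous_intros)
qed

definition generic_coeffs :: "coeffs set" where
 "generic_coeffs = {c. field_disc c ~= 0 & resultant c ~= 0}"

lemma generic_coeffs_borel: "generic_coeffs \<in> sets borel"
proof -
 have "open ({c. field_disc c ~= 0} \<inter> {c. resultant c ~= 0})"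
  by (intro open_Int open_Collect_neq continuous_field_disc continuous_resultant continuous_on_const)
 then show ?thesis unfolding generic_coeffs_def Collect_conj_eq by (rule borel_open)
qed

text \<open>Away from \<open>a'' = 0\<close> the discriminant and the resultant are quadratic polynomials in the coefficient
\<open>b\<close> with nonzero leading coefficient, so they have finitely many zeros.\<close>

lemma generic_coeffs_full: "AE x in gauss6. coeffs_of x \<in> generic_coeffs"
proof -
 let ?s = "%x :: (nat \<times> nat) + (nat \<times> nat) => real. x (Inl (0,2))"
 have s [measurable]: "?s \<in> borel_measurable gauss6"
  using measurable_component_singleton[of "Inl (0,2)" coefficient_index "%_. gauss"] by (simp add: coefficient_index_eq cong: measurable_cong_sets)
 have d [measurable]: "field_disc \<in> borel_measurable borel" "resultant \<in> borel_measurable borel"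
  by (intro borel_measurable_continuous_onI continuous_field_disc continuous_resultant)+
 have "emeasure gauss6 {x \<in> space gauss6. ?s x = 0} = 0"
 proof (rule one_variable_null[of "Inl (0,2)"])
  show "finite {t. x(Inl (0,2) := t) \<in> {x \<in> space gauss6. ?s x = 0}}" for x
   by (rule finite_subset[of _ "{0}"]) auto
 qed (simp add: coefficient_index_eq, measurable)
 then have 1: "AE x in gauss6. ?s x ~= 0" by (subst AE_iff_measurable[OF _ refl]) auto
 have fib: "finite {t. x(Inr (2,0) := t) \<in> {x \<in> space gauss6. ?s x ~= 0 & f (coeffs_of x) = 0}}" if f: "f = field_disc | f = resultant" for f x
 proof (cases "?s x = 0")
  case False
  define a a' a'' b' b'' where "a = x (Inl (2,0))" and "a' = x (Inl (1,1))" and "a'' = x (Inl (0,2))" and "b' = x (Inr (1,1))" and "b'' = x (Inr (0,2))"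
  have ct: "coeffs_of (x(Inr (2,0) := t)) = ((a, a', a''), (t, b', b''))" for t
   by (simp add: coeffs_of_def a_def a'_def a''_def b'_def b''_def)
  have a'': "a'' ~= 0" using False by (simp add: a''_def)
  have "\<exists>A B C. A ~= 0 & (\<forall>t. f ((a, a', a''), (t, b', b'')) = A * t^2 + B * t + C)"
   using f
  proof
   assume "f = field_disc"
   then have "f ((a, a', a''), (t, b', b'')) = (- 27 * a''^2) * t^2 + (- 4 * (b'' - a') ^ 3 - 18 * (b' - a) * (b'' - a') * a'') * t
     + ((b' - a)^2 * (b'' - a')^2 + 4 * (b' - a) ^ 3 * a'')" for t
    by (simp add: cubic_disc_def) (simp add: algebra_simps)
   then show ?thesis using a'' by (metis (no_types, lifting) mult_eq_0_iff neg_equal_0_iff_equal power_not_zero zero_neq_numeral)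
  next
   assume "f = resultant"
   then have "f ((a, a', a''), (t, b', b'')) = a''^2 * t^2 + (a' * (a' * b'' - a'' * b') - 2 * a * b'' * a'') * t + ((a * b'')^2 - a * b' * (a' * b'' - a'' * b'))" for t
    by (simp add: power2_eq_square algebra_simps)
   then show ?thesis using a'' by (metis power_not_zero)
  qed
  then obtain A B C where A: "A ~= 0" "!!t. f ((a, a', a''), (t, b', b'')) = A * t^2 + B * t + C" by blast
  show ?thesis
   by (rule finite_subset[OF _ finite_quadratic_roots[OF A(1), of B C]]) (auto simp: ct A(2))
 qed simp
 have 2: "AE x in gauss6. \<not> (?s x ~= 0 & f (coeffs_of x) = 0)" if f: "f = field_disc | f = resultant" for f
 proof -
  have [measurable]: "f \<in> borel_measurable borel" using f d by auto
  have "emeasure gauss6 {x \<in> space gauss6. ?s x ~= 0 & f (coeffs_of x) = 0} = 0"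
   by (rule one_variable_null[of "Inr (2,0)", OF _ _ fib[OF f]]) (simp add: coefficient_index_eq, measurable)
  then show ?thesis by (subst AE_iff_measurable[OF _ refl]) auto
 qed
 have off: "AE x in gauss6. \<not> (?s x ~= 0 & field_disc (coeffs_of x) = 0)" "AE x in gauss6. \<not> (?s x ~= 0 & resultant (coeffs_of x) = 0)"
  by (rule 2, simp)+
 show ?thesis using 1 off by eventually_elim (auto simp: generic_coeffs_def)
qed

lemma open_positive:
 assumes U: "open U" "c \<in> U" shows "0 < measure gauss6 {x \<in> space gauss6. coeffs_of x \<in> U}"
proof -
 interpret product_sigma_finite "%_ :: (nat \<times> nat) + (nat \<times> nat). gauss" ..
 interpret P: prob_space gauss6 by (rule prob_space_gauss6)
 obtain a a' a'' b b' b'' where c: "c = ((a, a', a''), (b, b', b''))" by (metis prod.exhaust)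
 obtain V W where VW0: "open V" "open W" "c \<in> V \<times> W" "V \<times> W \<subseteq> U"
  using open_prod_elim[OF U] by blast
 then have VW: "open V" "open W" "(a, a', a'') \<in> V" "(b, b', b'') \<in> W" "V \<times> W \<subseteq> U" unfolding c by auto
 have triple: "\<exists>A A' A''. open A & open A' & open A'' & u \<in> A & u' \<in> A' & u'' \<in> A'' & A \<times> A' \<times> A'' \<subseteq> V"
  if V: "open V" "(u, u', u'') \<in> V" for V :: "(real \<times> real \<times> real) set" and u u' u''
 proof -
  obtain A B where A: "open A" "open B" "u \<in> A" "(u', u'') \<in> B" "A \<times> B \<subseteq> V"
   using open_prod_elim[OF V] by (metis mem_Times_iff fst_conv snd_conv)
  obtain A' A'' where "open A'" "open A''" "u' \<in> A'" "u'' \<in> A''" "A' \<times> A'' \<subseteq> B"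
   using open_prod_elim[OF A(2,4)] by (metis mem_Times_iff fst_conv snd_conv)
  then show ?thesis using A by blast
 qed
 obtain A A' A'' where A: "open A" "open A'" "open A''" "a \<in> A" "a' \<in> A'" "a'' \<in> A''" "A \<times> A' \<times> A'' \<subseteq> V" using triple[OF VW(1,3)] by blast
 obtain B B' B'' where B: "open B" "open B'" "open B''" "b \<in> B" "b' \<in> B'" "b'' \<in> B''" "B \<times> B' \<times> B'' \<subseteq> W" using triple[OF VW(2,4)] by blast
 define S where "S = (%k :: (nat \<times> nat) + (nat \<times> nat). if k = Inl (2,0) then A else if k = Inl (1,1) then A' else if k = Inl (0,2) then A''
   else if k = Inr (2,0) then B else if k = Inr (1,1) then B' else B'')"
 have "open (S k)" for k using A B by (simp add: S_def)
 then have Sb: "S k \<in> sets gauss" for k by simp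
 have ne: "\<exists>s. s \<in> S k" for k using A B unfolding S_def by (auto split: if_splits)
 have pos: "emeasure gauss (S k) ~= 0" for k
 proof -
  obtain s where "s \<in> S k" using ne by blast
  then obtain e where e: "0 < e" "ball s e \<subseteq> S k" using \<open>open (S k)\<close> openE by blast
  have "0 < emeasure gauss {s<..<s + e}" by (rule gauss_interval_positive) (use e in simp)
  also have "\<dots> <= emeasure gauss (S k)"
   by (rule emeasure_mono) (use e Sb in \<open>auto simp: subset_eq dist_real_def\<close>)
  finally show ?thesis by simp
 qed
 have "emeasure gauss6 (PiE coefficient_index S) = (\<Prod>k\<in>coefficient_index. emeasure gauss (S k))"
  by (rule emeasure_PiM) (use Sb in auto)
 also have "\<dots> ~= 0" using pos by (simp add: coefficient_index_eq)
 finally have "emeasure gauss6 (PiE coefficient_index S) ~= 0" .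
 moreover have "PiE coefficient_index S \<subseteq> {x \<in> space gauss6. coeffs_of x \<in> U}"
 proof
  fix x assume x: "x \<in> PiE coefficient_index S"
  have xS: "x k \<in> S k" if "k \<in> coefficient_index" for k using x that by auto
  have "x (Inl (2,0)) \<in> A" "x (Inl (1,1)) \<in> A'" "x (Inl (0,2)) \<in> A''" "x (Inr (2,0)) \<in> B" "x (Inr (1,1)) \<in> B'" "x (Inr (0,2)) \<in> B''"
   using xS[of "Inl (2,0)"] xS[of "Inl (1,1)"] xS[of "Inl (0,2)"] xS[of "Inr (2,0)"] xS[of "Inr (1,1)"] xS[of "Inr (0,2)"]
   by (simp_all add: coefficient_index_eq S_def)
  then have "coeffs_of x \<in> V \<times> W" using A(7) B(7) by (auto simp: coeffs_of_def)
  moreover have "x \<in> space gauss6" using x by (auto simp: space_PiM PiE_iff)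
  ultimately show "x \<in> {x \<in> space gauss6. coeffs_of x \<in> U}" using subsetD[OF VW(5)] by simp
 qed
 then have "emeasure gauss6 (PiE coefficient_index S) <= emeasure gauss6 {x \<in> space gauss6. coeffs_of x \<in> U}"
  by (rule emeasure_mono[OF _ coeffs_of_sets[OF borel_open[OF U(1)]]])
 ultimately have "emeasure gauss6 {x \<in> space gauss6. coeffs_of x \<in> U} ~= 0" by (metis le_zero_eq)
 then show ?thesis by (simp add: P.emeasure_eq_measure zero_less_measure_iff)
qed

definition random_coeffs :: "(nat \<times> nat => 'w => real) => (nat \<times> nat => 'w => real) => 'w => coeffs" where
 "random_coeffs A B \<omega> = ((A (2,0) \<omega>, A (1,1) \<omega>, A (0,2) \<omega>), (B (2,0) \<omega>, B (1,1) \<omega>, B (0,2) \<omega>))"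

definition normal_coefficients :: "'w measure => (nat \<times> nat => 'w => real) => (nat \<times> nat => 'w => real) => bool" where
 "normal_coefficients M A B \<longleftrightarrow> prob_space M & prob_space.indep_vars M (%_. borel) (case_sum A B) coefficient_index &
   (\<forall>k\<in>exponents 2. distributed M lborel (A k) (normal_density 0 1) & distributed M lborel (B k) (normal_density 0 1))"

lemma coefficient_law:
 assumes N: "normal_coefficients M A B" and E: "E \<in> sets borel"
 shows "{\<omega> \<in> space M. random_coeffs A B \<omega> \<in> E} \<in> sets M"
  "measure M {\<omega> \<in> space M. random_coeffs A B \<omega> \<in> E} = measure gauss6 {x \<in> space gauss6. coeffs_of x \<in> E}"
proof -
 interpret prob_space M using N by (simp add: normal_coefficients_def)
 define X where "X = case_sum A B"
 have d: "distributed M lborel (X k) (normal_density 0 1)" if "k \<in> coefficient_index" for k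
  using N that unfolding normal_coefficients_def coefficient_index_def X_def by auto
 have rv: "random_variable borel (X k)" if "k \<in> coefficient_index" for k
  using distributed_measurable[OF d[OF that]] by simp
 have law: "distr M borel (X k) = gauss" if "k \<in> coefficient_index" for k
 proof -
  have "distr M borel (X k) = distr M lborel (X k)" by (rule distr_cong) auto
  also have "\<dots> = gauss" unfolding gauss_def by (rule distributed_distr_eq_density[OF d[OF that]])
  finally show ?thesis .
 qed
 define f where "f = (%\<omega>. \<lambda>k\<in>coefficient_index. X k \<omega>)"
 have "indep_vars (%_. borel) X coefficient_index" using N by (simp add: normal_coefficients_def X_def)
 then have "distr M (PiM coefficient_index (%_. borel)) f = PiM coefficient_index (%k. distr M borel (X k))"
  using indep_vars_iff_distr_eq_PiM'[where I = coefficient_index and M' = "%_. borel" and X = X] rv by (simp add: f_def coefficient_index_eq)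
 also have "\<dots> = gauss6" by (rule PiM_cong) (simp_all add: law)
 finally have D: "distr M (PiM coefficient_index (%_. borel)) f = gauss6" .
 have f: "f \<in> measurable M (PiM coefficient_index (%_. borel))" unfolding f_def by (intro measurable_restrict rv)
 have E': "{x \<in> space gauss6. coeffs_of x \<in> E} \<in> sets gauss6"
  by (rule coeffs_of_sets[OF E])
 have "sets gauss6 = sets (PiM coefficient_index (%_. borel) :: ((nat \<times> nat) + (nat \<times> nat) => real) measure)"
  using sets_distr[of M "PiM coefficient_index (%_. borel)" f] unfolding D .
 then have E'': "{x \<in> space gauss6. coeffs_of x \<in> E} \<in> sets (PiM coefficient_index (%_. borel))"
  using E' by (simp only:)
 have cf: "coeffs_of (f \<omega>) = random_coeffs A B \<omega>" for \<omega>
  by (simp add: coeffs_of_def random_coeffs_def f_def X_def coefficient_index_eq)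
 have pre: "f -` {x \<in> space gauss6. coeffs_of x \<in> E} \<inter> space M = {\<omega> \<in> space M. random_coeffs A B \<omega> \<in> E}"
 proof -
  have "f \<omega> \<in> space gauss6" for \<omega> by (simp add: space_PiM f_def)
  then show ?thesis unfolding vimage_def Int_def mem_Collect_eq cf[symmetric] by (simp add: conj_commute)
 qed
 show "{\<omega> \<in> space M. random_coeffs A B \<omega> \<in> E} \<in> sets M" using measurable_sets[OF f E''] pre by simp
 show "measure M {\<omega> \<in> space M. random_coeffs A B \<omega> \<in> E} = measure gauss6 {x \<in> space gauss6. coeffs_of x \<in> E}"
  using measure_distr[OF f E''] unfolding D pre by simp
qed

text \<open>The normal law is symmetric.\<close>

lemma reflected_coefficients:
 assumes N: "normal_coefficients M A B" shows "normal_coefficients M A (%k \<omega>. - B k \<omega>)"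
proof -
 interpret prob_space M using N by (simp add: normal_coefficients_def)
 have "distributed M lborel (%\<omega>. - B k \<omega>) (normal_density 0 1)" if "k \<in> exponents 2" for k
  using normal_density_affine[of "B k" 0 1 "-1" 0] N that by (simp add: normal_coefficients_def)
 moreover have "indep_vars (%_. borel) (case_sum A (%k \<omega>. - B k \<omega>)) coefficient_index"
 proof -
  let ?Y = "%k (t::real). case k of Inl _ => t | Inr _ => - t"
  have ind: "indep_vars (%_. borel) (case_sum A B) coefficient_index" using N by (simp add: normal_coefficients_def)
  have "?Y k \<in> borel_measurable borel" for k by (cases k) simp_all
  then have "indep_vars (%_. borel) (%k \<omega>. ?Y k (case_sum A B k \<omega>)) coefficient_index"
   by (rule indep_vars_compose2[OF ind, where Y = ?Y and N = "%_. borel"])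
  moreover have "(%k \<omega>. ?Y k (case_sum A B k \<omega>)) = case_sum A (%k \<omega>. - B k \<omega>)" by (auto simp: fun_eq_iff split: sum.split)
  ultimately show ?thesis by simp
 qed
 ultimately show ?thesis using N by (simp add: normal_coefficients_def)
qed

section \<open>The length of the curve of weight vectors\<close>

text \<open>The speed of the normalised weight vector of the angular part; with \<open>t = tan x\<close> it becomes the
integrand of \<open>\<Lambda>_2\<close> (\<open>arc_speed_tan\<close>).\<close>

definition arc_speed :: "real => real" where
 "arc_speed x = sqrt (2 + (cos x * sin x) ^ 4) / (1 - (cos x * sin x)\<^sup>2)"

lemma cos_sin_bound: "0 <= (cos x * sin x)^2" "(cos x * sin x)^2 <= 1 / 4" for x :: real
proof -
 have "(cos x * sin x)^2 = (sin (2 * x))^2 / 4" by (simp add: sin_double power_mult_distrib)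
 moreover have "(sin (2 * x))^2 <= 1" by (simp add: abs_square_le_1)
 ultimately show "(cos x * sin x)^2 <= 1 / 4" by simp
qed simp

lemma arc_speed_continuous: "continuous_on A arc_speed"
proof -
 have "1 - (cos x * sin x)\<^sup>2 ~= 0" for x :: real using cos_sin_bound(2)[of x] by linarith
 then show ?thesis unfolding arc_speed_def by (intro continuous_intros) auto
qed

lemma arc_speed_tan:
 assumes "cos x ~= 0"
 defines "t \<equiv> tan x"
 shows "sqrt (2 * t ^ 8 + 8 * t ^ 6 + 13 * t ^ 4 + 8 * t^2 + 2) / ((t^2 + 1) * (t ^ 4 + t^2 + 1)) * inverse ((cos x)^2) = arc_speed x"
proof -
 define c s where "c = cos x" and "s = sin x"
 have c: "c ~= 0" using assms(1) by (simp add: c_def)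
 have cs: "c^2 + s^2 = 1" by (simp add: c_def s_def)
 have t: "t = s / c" by (simp add: t_def tan_def c_def s_def)
 have n: "2 * t ^ 8 + 8 * t ^ 6 + 13 * t ^ 4 + 8 * t^2 + 2 = (2 * s^8 + 8 * s^6*c^2 + 13 * s^4*c^4 + 8 * s^2*c^6 + 2*c^8) / (c^4)^2"
  unfolding t using c by (simp add: field_simps power_divide power2_eq_square eval_nat_numeral)
 have n': "2 * s^8 + 8 * s^6*c^2 + 13 * s^4*c^4 + 8 * s^2*c^6 + 2*c^8 = 2 * (c^2 + s^2)^4 + (c * s)^4"
  by algebra
 have d1: "t^2 + 1 = 1 / c^2" unfolding t using c cs by (simp add: field_simps)
 have d2: "t ^ 4 + t^2 + 1 = ((c^2 + s^2)^2 - (c * s)\<^sup>2) / c^4"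
  unfolding t using c by (simp add: field_simps power2_eq_square eval_nat_numeral)
 have "sqrt (2 * t ^ 8 + 8 * t ^ 6 + 13 * t ^ 4 + 8 * t^2 + 2) = sqrt (2 + (c * s)^4) / c^4"
  unfolding n n' cs real_sqrt_divide real_sqrt_abs by simp
 then show ?thesis
  unfolding d1 d2 cs arc_speed_def c_def[symmetric] s_def[symmetric] using c
  by (simp add: field_simps power2_eq_square eval_nat_numeral)
qed

lemma Lambda2_eq: "Lambda2 = 1 / pi * integral {- (pi / 2)..pi / 2} arc_speed"
proof -
 define f where "f = (%t::real. sqrt (2 * t ^ 8 + 8 * t ^ 6 + 13 * t ^ 4 + 8 * t ^ 2 + 2) / ((t ^ 2 + 1) * (t ^ 4 + t ^ 2 + 1)))"
 have den: "(t^2 + 1) * (t ^ 4 + t^2 + 1) > 0" for t :: real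
  by (intro mult_pos_pos add_nonneg_pos add_nonneg_nonneg) auto
 have cosp: "0 < cos x" if "ereal (- (pi / 2)) < ereal x" "ereal x < ereal (pi / 2)" for x
  using that by (intro cos_gt_zero_pi) auto
 have fg: "f (tan x) * inverse ((cos x)^2) = arc_speed x" if "ereal (- (pi / 2)) < ereal x" "ereal x < ereal (pi / 2)" for x
  unfolding f_def using arc_speed_tan[of x] cosp[OF that] by simp
 have int: "set_integrable lborel (einterval (ereal (- (pi / 2))) (ereal (pi / 2))) arc_speed"
  by (rule set_integrable_subset[of _ "{- (pi / 2)..pi / 2}"])
   (auto intro!: borel_integrable_atLeastAtMost' arc_speed_continuous simp: einterval_def)
 have "(LBINT t=-\<infinity>..\<infinity>. f t) = (LBINT x=ereal (- (pi / 2))..ereal (pi / 2). f (tan x) * inverse ((cos x)^2))"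
 proof (rule interval_integral_substitution_nonneg(2))
  show "DERIV tan x :> inverse ((cos x)^2)" if "ereal (- (pi / 2)) < ereal x" "ereal x < ereal (pi / 2)" for x
   using cosp[OF that] by (intro DERIV_tan) simp
  show "isCont f (tan x)" for x
   unfolding f_def by (intro continuous_intros) (metis den less_irrefl)
  show "isCont (%x. inverse ((cos x)^2)) x" if "ereal (- (pi / 2)) < ereal x" "ereal x < ereal (pi / 2)" for x
   using cosp[OF that] by (intro continuous_intros) simp
  show "0 <= f (tan x)" for x unfolding f_def using den[of "tan x"] by (intro divide_nonneg_nonneg) auto
  show "((ereal \<circ> tan \<circ> real_of_ereal) \<longlongrightarrow> - \<infinity>) (at_right (ereal (- (pi / 2))))"
   using filterlim_tan_at_right by (simp add: ereal_tendsto_simps)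
  show "((ereal \<circ> tan \<circ> real_of_ereal) \<longlongrightarrow> \<infinity>) (at_left (ereal (pi / 2)))"
   using filterlim_tan_at_left by (simp add: ereal_tendsto_simps)
  show "set_integrable lborel (einterval (ereal (- (pi / 2))) (ereal (pi / 2))) (%x. f (tan x) * inverse ((cos x)^2))"
   using int by (rule set_integrable_cong[THEN iffD2, rotated -1]) (auto simp: fg einterval_def)
 qed auto
 also have "\<dots> = (LBINT x=ereal (- (pi / 2))..ereal (pi / 2). arc_speed x)"
  by (rule interval_integral_cong) (auto simp: fg einterval_def)
 also have "\<dots> = integral {- (pi / 2)..pi / 2} arc_speed"
  by (rule interval_integral_eq_integral) (auto intro!: borel_integrable_atLeastAtMost' arc_speed_continuous)
 finally show ?thesis
  unfolding Lambda2_def f_def by (simp add: interval_lebesgue_integral_def einterval_eq set_lebesgue_integral_def)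
qed

definition moment :: "nat => real" where
 "moment n = 1 / pi * integral {- (pi / 2)..pi / 2} (%x. ((cos x * sin x)^2) ^ n)"

lemma moment_0: "moment 0 = 1"
 by (simp add: moment_def)

lemma moment_Suc: "moment (Suc n) = (2 * n + 1) / (8 * n + 8) * moment n"
proof -
 define w :: "real => real" where "w = (%x. cos x * sin x)"
 define c :: "real => real" where "c = (%x. (cos x)^2 - (sin x)\<^sup>2)"
 have wint: "(%x. (w x)\<^sup>2 ^ k) integrable_on {- (pi / 2)..pi / 2}" for k
  unfolding w_def by (intro integrable_continuous_interval continuous_intros)
 have c2: "(c x)^2 = 1 - 4 * (w x)^2" for x
 proof -
  have "(cos x)^2 = 1 - (sin x)\<^sup>2" by (simp add: cos_squared_eq)
  then show ?thesis unfolding c_def w_def power_mult_distrib by algebra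
 qed
 have dw: "(w has_real_derivative c x) (at x)" for x
  unfolding w_def c_def by (auto intro!: derivative_eq_intros simp: power2_eq_square)
 have dc: "(c has_real_derivative - 4 * w x) (at x)" for x
  unfolding w_def c_def by (auto intro!: derivative_eq_intros)
 have "((%x. w x ^ (2 * n + 1) * c x) has_real_derivative (2 * n + 1) * (w x)\<^sup>2 ^ n - (8 * n + 8) * (w x)\<^sup>2 ^ Suc n) (at x)" for x
 proof -
  have "((%x. w x ^ (2 * n + 1)) has_real_derivative real (2 * n + 1) * (c x * w x ^ (2 * n))) (at x)"
   using DERIV_power[OF dw, of "2 * n + 1" x] by simp
  from DERIV_mult[OF this dc]
  have "((%x. w x ^ (2 * n + 1) * c x) has_real_derivative
   real (2 * n + 1) * w x ^ (2 * n) * c x * c x + (- 4 * w x) * w x ^ (2 * n + 1)) (at x)"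
   by (simp only: mult_ac)
  moreover have "real (2 * n + 1) * w x ^ (2 * n) * c x * c x + (- 4 * w x) * w x ^ (2 * n + 1)
    = (2 * n + 1) * (w x)\<^sup>2 ^ n - (8 * n + 8) * (w x)\<^sup>2 ^ Suc n"
  proof -
   have "real (2 * n + 1) * w x ^ (2 * n) * c x * c x = real (2 * n + 1) * (w x)\<^sup>2 ^ n * (c x)^2"
    by (simp add: power_mult power2_eq_square)
   moreover have "w x * w x ^ (2 * n + 1) = (w x)\<^sup>2 ^ Suc n"
    by (simp add: power_mult power2_eq_square)
   ultimately show ?thesis unfolding c2 by (simp add: algebra_simps)
  qed
  ultimately show ?thesis by simp
 qed
 then have I: "((%x. (2 * n + 1) * (w x)\<^sup>2 ^ n - (8 * n + 8) * (w x)\<^sup>2 ^ Suc n) has_integral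
   (w (pi / 2) ^ (2 * n + 1) * c (pi / 2) - w (- (pi / 2)) ^ (2 * n + 1) * c (- (pi / 2)))) {- (pi / 2)..pi / 2}"
  by (intro fundamental_theorem_of_calculus)
   (auto simp flip: has_real_derivative_iff_has_vector_derivative intro: has_field_derivative_at_within)
 have "w (pi / 2) = 0" "w (- (pi / 2)) = 0" by (auto simp: w_def)
 then have zero: "integral {- (pi / 2)..pi / 2} (%x. (2 * n + 1) * (w x)\<^sup>2 ^ n - (8 * n + 8) * (w x)\<^sup>2 ^ Suc n) = 0"
  using integral_unique[OF I] by simp
 define J where "J = (%k. integral {- (pi / 2)..pi / 2} (%x. (w x)\<^sup>2 ^ k))"
 have "(2 * n + 1) * J n - (8 * n + 8) * J (Suc n) = 0"
  using zero unfolding J_def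
  by (subst (asm) integral_diff) (use wint[of n] wint[of "Suc n"] in \<open>auto simp del: power_Suc\<close>)
 then have "J (Suc n) = (2 * n + 1) / (8 * n + 8) * J n"
  by (simp add: nonzero_eq_divide_eq)
 moreover have "moment k = 1 / pi * J k" for k by (simp only: moment_def J_def w_def)
 ultimately show ?thesis by simp
qed

text \<open>Taylor polynomials of \<open>sqrt (1 + w^2 / 2)\<close> and of the geometric series, where \<open>e = 0\<close> gives lower and
\<open>e = 1\<close> upper bounds on the range \<open>0 <= w <= 1/4\<close>.\<close>

definition speed_poly :: "real => real => real" where
 "speed_poly e w = (1 + w^2 / 4 - w ^ 4 / 32 + e * (w ^ 6 / 128)) *
   (1 + w + w^2 + w^3 + w^4 + w^5 + w^6 + w^7 + w^8 + w^9 + e * (4 / 3 * w^10))"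

lemma sqrt_2_bounds: "1.4142135 <= sqrt 2" "sqrt 2 <= 1.41421357"
proof -
 show "1.4142135 <= sqrt 2" by (rule real_le_rsqrt) (simp add: power2_eq_square)
 show "sqrt 2 <= 1.41421357" by (rule real_le_lsqrt) (simp_all add: power2_eq_square)
qed

lemma speed_bounds:
 fixes w :: real assumes w: "0 <= w" "w <= 1 / 4"
 shows "sqrt 2 * speed_poly 0 w <= sqrt (2 + w^2) / (1 - w)" "sqrt (2 + w^2) / (1 - w) <= sqrt 2 * speed_poly 1 w"
proof -
 define u where "u = w^2 / 16"
 have "w^2 <= 1" using w by (intro power_le_one) auto
 then have u: "0 <= u" "u <= 1 / 16" by (auto simp: u_def)
 have "2 + w^2 = 2 * (1 + 8 * u)" by (simp add: u_def)
 then have sq: "sqrt (2 + w^2) = sqrt 2 * sqrt (1 + 8 * u)" by (simp only: real_sqrt_mult)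
 have u8: "u^2 <= u" "u ^ 4 <= u ^ 3" "0 <= u ^ 3"
  using u power_decreasing[of 3 4 u] power_decreasing[of 1 2 u] by auto
 have lo: "1 + 4 * u - 8 * u^2 <= sqrt (1 + 8 * u)"
 proof (rule real_le_rsqrt)
  have "(1 + 4 * u - 8 * u^2)^2 = 1 + 8 * u + (64 * u ^ 4 - 64 * u ^ 3)" by algebra
  then show "(1 + 4 * u - 8 * u^2)^2 <= 1 + 8 * u" using u8 by simp
 qed
 have hi: "sqrt (1 + 8 * u) <= 1 + 4 * u - 8 * u^2 + 32 * u ^ 3"
 proof (rule real_le_lsqrt)
  have "(1 + 4 * u - 8 * u^2 + 32 * u ^ 3)^2 = 1 + 8 * u + u ^ 4 * (320 - 512 * u + 1024 * u^2)" by algebra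
  moreover have "0 <= u ^ 4 * (320 - 512 * u + 1024 * u^2)"
  proof (rule mult_nonneg_nonneg)
   show "0 <= 320 - 512 * u + 1024 * u^2" using u zero_le_power2[of u] by linarith
  qed simp
  ultimately show "1 + 8 * u <= (1 + 4 * u - 8 * u^2 + 32 * u ^ 3)^2" by simp
  show "0 <= 1 + 4 * u - 8 * u^2 + 32 * u ^ 3" using u u8 by linarith
 qed
 define g where "g = 1 + w + w^2 + w^3 + w^4 + w^5 + w^6 + w^7 + w^8 + w^9"
 have g: "g * (1 - w) = 1 - w ^ 10" unfolding g_def by algebra
 have "0 <= w ^ 10" "0 < 1 - w" using w by auto
 then have glo: "g <= 1 / (1 - w)" using g by (simp add: pos_le_divide_eq)
 have ghi: "1 / (1 - w) <= g + 4 / 3 * w ^ 10"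
 proof -
  define p where "p = w ^ 10"
  have "w * p <= 1 / 4 * p" using w \<open>0 <= w ^ 10\<close> unfolding p_def by (intro mult_right_mono) auto
  moreover have "(g + 4 / 3 * p) * (1 - w) = g * (1 - w) + 4 / 3 * p - 4 / 3 * (w * p)" by (simp add: field_simps)
  ultimately have "1 <= (g + 4 / 3 * w ^ 10) * (1 - w)" using g unfolding p_def[symmetric] by linarith
  then show ?thesis using \<open>0 < 1 - w\<close> by (simp add: pos_divide_le_eq)
 qed
 have g0: "0 <= g" using w by (auto simp: g_def intro!: add_nonneg_nonneg)
 have l0: "0 <= 1 + 4 * u - 8 * u^2" "0 <= 1 + 4 * u - 8 * u^2 + 32 * u ^ 3" using u u8 by linarith+
 have i0: "0 <= 1 / (1 - w)" using w by simp
 have poly: "1 + w^2 / 4 - w ^ 4 / 32 = 1 + 4 * u - 8 * u^2" "w ^ 6 / 128 = 32 * u ^ 3"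
  by (simp_all add: u_def power_divide flip: power_mult)
 have "(1 + 4 * u - 8 * u^2) * g <= sqrt (1 + 8 * u) * (1 / (1 - w))"
  by (rule mult_mono[OF lo glo _ g0]) (use u in simp)
 from mult_left_mono[OF this, of "sqrt 2"] show "sqrt 2 * speed_poly 0 w <= sqrt (2 + w^2) / (1 - w)"
  unfolding sq speed_poly_def poly g_def by simp
 have "sqrt (1 + 8 * u) * (1 / (1 - w)) <= (1 + 4 * u - 8 * u^2 + 32 * u ^ 3) * (g + 4 / 3 * w ^ 10)"
  by (rule mult_mono[OF hi ghi l0(2) i0])
 from mult_left_mono[OF this, of "sqrt 2"] show "sqrt (2 + w^2) / (1 - w) <= sqrt 2 * speed_poly 1 w"
  unfolding sq speed_poly_def poly g_def by simp
qed

lemma speed_poly_integral: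
 shows "(%x. speed_poly e ((cos x * sin x)^2)) integrable_on {- (pi / 2)..pi / 2}"
  and "1 / pi * integral {- (pi / 2)..pi / 2} (%x. speed_poly e ((cos x * sin x)^2)) =
   (\<Sum>k\<le>16. coeff ([:1, 0, 1/4, 0, -1/32, 0, e/128:] * [:1,1,1,1,1,1,1,1,1,1,e*4/3:]) k * moment k)"
proof -
 define p where "p = [:1, 0, 1/4, 0, -1/32, 0, e/128:] * [:1,1,1,1,1,1,1,1,1,1,e*4/3:]"
 have deg: "degree p <= 16"
  unfolding p_def by (rule order_trans[OF degree_mult_le]) (auto simp: degree_pCons_eq_if)
 have "speed_poly e w = poly p w" for w
  unfolding speed_poly_def p_def poly_mult by (simp add: eval_nat_numeral algebra_simps)
 then have sp: "speed_poly e w = (\<Sum>k\<le>16. coeff p k * w ^ k)" for w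
  unfolding poly_altdef using deg by (auto intro!: sum.mono_neutral_left coeff_eq_0)
 have int: "(%x. coeff p k * (cos x * sin x)\<^sup>2 ^ k) integrable_on {- (pi / 2)..pi / 2}" for k
  by (intro integrable_continuous_interval continuous_intros)
 show "(%x. speed_poly e ((cos x * sin x)^2)) integrable_on {- (pi / 2)..pi / 2}"
  unfolding sp by (intro integrable_sum int) auto
 have "1 / pi * integral {- (pi / 2)..pi / 2} (%x. speed_poly e ((cos x * sin x)^2)) = (\<Sum>k\<le>16. coeff p k * moment k)"
  unfolding sp by (subst integral_sum) (use int in \<open>auto simp: moment_def sum_distrib_left mult_ac\<close>)
 then show "1 / pi * integral {- (pi / 2)..pi / 2} (%x. speed_poly e ((cos x * sin x)^2)) =
   (\<Sum>k\<le>16. coeff ([:1, 0, 1/4, 0, -1/32, 0, e/128:] * [:1,1,1,1,1,1,1,1,1,1,e*4/3:]) k * moment k)"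
  unfolding p_def .
qed

lemma moment_values:
 "moment 1 = 1/8" "moment 2 = 3/128" "moment 3 = 5/1024" "moment 4 = 35/32768" "moment 5 = 63/262144"
 "moment 6 = 231/4194304" "moment 7 = 429/33554432" "moment 8 = 6435/2147483648" "moment 9 = 12155/17179869184"
 "moment 10 = 46189/274877906944" "moment 11 = 88179/2199023255552" "moment 12 = 676039/70368744177664"
 "moment 13 = 1300075/562949953421312" "moment 14 = 5014575/9007199254740992" "moment 15 = 9694845/72057594037927936"
 "moment 16 = 300540195/9223372036854775808"
proof -
 have step: "moment (Suc n) = (2 * n + 1) / (8 * n + 8) * moment n" for n by (rule moment_Suc)
 show 1: "moment 1 = 1/8" using step[of 0] by (simp add: moment_0)
 show 2: "moment 2 = 3/128" using step[of 1] 1 by (simp add: numeral_2_eq_2)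
 show 3: "moment 3 = 5/1024" using step[of 2] 2 by (simp add: numeral_3_eq_3 numeral_2_eq_2)
 show 4: "moment 4 = 35/32768" using step[of 3] 3 by simp
 show 5: "moment 5 = 63/262144" using step[of 4] 4 by simp
 show 6: "moment 6 = 231/4194304" using step[of 5] 5 by simp
 show 7: "moment 7 = 429/33554432" using step[of 6] 6 by simp
 show 8: "moment 8 = 6435/2147483648" using step[of 7] 7 by simp
 show 9: "moment 9 = 12155/17179869184" using step[of 8] 8 by simp
 show 10: "moment 10 = 46189/274877906944" using step[of 9] 9 by simp
 show 11: "moment 11 = 88179/2199023255552" using step[of 10] 10 by simp
 show 12: "moment 12 = 676039/70368744177664" using step[of 11] 11 by simp
 show 13: "moment 13 = 1300075/562949953421312" using step[of 12] 12 by simp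
 show 14: "moment 14 = 5014575/9007199254740992" using step[of 13] 13 by simp
 show 15: "moment 15 = 9694845/72057594037927936" using step[of 14] 14 by simp
 show "moment 16 = 300540195/9223372036854775808" using step[of 15] 15 by simp
qed

lemma Lambda2_bounds: "1.64343 <= Lambda2" "Lambda2 <= 1.643435"
proof -
 define S where "S = (%e. \<Sum>k\<le>16. coeff ([:1, 0, 1/4, 0, -1/32, 0, e/128:] * [:1,1,1,1,1,1,1,1,1,1,e*4/3:]) k * moment k)"
 have int: "arc_speed integrable_on {- (pi / 2)..pi / 2}"
  by (intro integrable_continuous_interval arc_speed_continuous)
 have speed: "arc_speed x = sqrt (2 + ((cos x * sin x)^2)^2) / (1 - (cos x * sin x)\<^sup>2)" for x
  by (simp add: arc_speed_def flip: power_mult)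
 have le: "sqrt 2 * speed_poly 0 ((cos x * sin x)^2) <= arc_speed x" "arc_speed x <= sqrt 2 * speed_poly 1 ((cos x * sin x)^2)" for x
  unfolding speed using speed_bounds[OF cos_sin_bound] by blast+
 have "integral {- (pi / 2)..pi / 2} (%x. sqrt 2 * speed_poly 0 ((cos x * sin x)^2)) <= integral {- (pi / 2)..pi / 2} arc_speed"
  "integral {- (pi / 2)..pi / 2} arc_speed <= integral {- (pi / 2)..pi / 2} (%x. sqrt 2 * speed_poly 1 ((cos x * sin x)^2))"
  using speed_poly_integral(1) int le by (intro integral_le integrable_on_mult_right; blast)+
 then have "sqrt 2 * (1 / pi * integral {- (pi / 2)..pi / 2} (%x. speed_poly 0 ((cos x * sin x)^2))) <= Lambda2"
  "Lambda2 <= sqrt 2 * (1 / pi * integral {- (pi / 2)..pi / 2} (%x. speed_poly 1 ((cos x * sin x)^2)))"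
  unfolding Lambda2_eq by (auto simp: field_simps)
 then have b: "sqrt 2 * S 0 <= Lambda2" "Lambda2 <= sqrt 2 * S 1"
  unfolding speed_poly_integral(2) S_def by auto
 have lo: "1.162082 <= S 0" and hi: "S 1 <= 1.162084" "0 <= S 1"
  unfolding S_def by (simp_all add: atMost_nat_numeral moment_values[unfolded One_nat_def] moment_0 coeff_pCons)
 have "1.4142135 * 1.162082 <= sqrt 2 * S 0" by (rule mult_mono) (use sqrt_2_bounds lo in auto)
 then show "1.64343 <= Lambda2" using b by simp
 have "sqrt 2 * S 1 <= 1.41421357 * 1.162084" by (rule mult_mono) (use sqrt_2_bounds hi in auto)
 then show "Lambda2 <= 1.643435" using b by simp
qed

section \<open>Sign changes between two angles\<close>

definition angular_weight :: "real => (nat \<times> nat) + (nat \<times> nat) => real" where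
 "angular_weight th k = (case k of Inl (i, j) => - sin th * (cos th ^ i * sin th ^ j) | Inr (i, j) => cos th * (cos th ^ i * sin th ^ j))"

lemma angular_sum: "angular (quad_field (coeffs_of x)) th = (\<Sum>k\<in>coefficient_index. angular_weight th k * x k)"
 by (simp add: coefficient_index_eq angular_weight_def coeffs_of_def quad_field_def angular_def power2_eq_square algebra_simps)

lemma angular_gram:
 "(\<Sum>k\<in>coefficient_index. (angular_weight th k)^2) = (3 + (cos (2 * th))^2) / 4"
 "(\<Sum>k\<in>coefficient_index. angular_weight th k * angular_weight th' k) = cos (th - th') * (3 * (cos (th - th'))^2 + (cos (th + th'))^2) / 4"
proof -
 have 1: "(\<Sum>k\<in>coefficient_index. (angular_weight th k)^2) = ((cos th)^2 + (sin th)^2) * ((3 * ((cos th)^2 + (sin th)^2)^2 + ((cos th)^2 - (sin th)\<^sup>2)^2) / 4)"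
  by (simp add: coefficient_index_eq angular_weight_def power2_eq_square field_simps del: sin_cos_squared_add sin_cos_squared_add2 sin_cos_squared_add3)
 then show "(\<Sum>k\<in>coefficient_index. (angular_weight th k)^2) = (3 + (cos (2 * th))^2) / 4"
  by (simp only: sin_cos_squared_add2 cos_double) simp
 show "(\<Sum>k\<in>coefficient_index. angular_weight th k * angular_weight th' k) = cos (th - th') * (3 * (cos (th - th'))^2 + (cos (th + th'))^2) / 4"
  unfolding cos_diff cos_add by (simp add: coefficient_index_eq angular_weight_def power2_eq_square field_simps)
qed

definition turn_radicand :: "real => real => real" where
 "turn_radicand w s = 33 - 2 * s^2 + s ^ 4 - (26 + 6 * s^2) * w^2 + 9 * w ^ 4"

definition turn_rate :: "real => real => real" where
 "turn_rate w s = sqrt (turn_radicand w s) / (sqrt (1 - w\<^sup>2) * (3 * (1 - w\<^sup>2) + s^2))"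

lemma turn_radicand_pos: "w^2 <= 1 / 4 ==> s\<^sup>2 <= 1 ==> 0 < turn_radicand w s"
proof -
 assume w: "w^2 <= 1 / 4" and s: "s^2 <= 1"
 have "(26 + 6 * s^2) * w^2 <= 32 * (1 / 4)" by (rule mult_mono) (use w s in auto)
 moreover have "0 <= s ^ 4" "0 <= w ^ 4" by simp_all
 ultimately show ?thesis using s unfolding turn_radicand_def by linarith
qed

text \<open>In terms of \<open>S = cos (\<theta> + \<theta>')\<close> and \<open>W = sin (\<theta>' - \<theta>)\<close> all entries are polynomials in \<open>S^2\<close> and \<open>W^2\<close>, and
the determinant has the factor \<open>W^2\<close>, so that the angle is proportional to the step for small steps.\<close>

lemma gram_determinant:
 fixes th th' :: real
 defines "S \<equiv> cos (th + th')" and "W \<equiv> sin (th' - th)"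
 shows "(3 + (cos (2 * th))^2) / 4 * ((3 + (cos (2 * th'))^2) / 4) - (cos (th - th') * (3 * (cos (th - th'))^2 + S^2) / 4)\<^sup>2
  = W^2 * turn_radicand W S / 16"
proof -
 define D T where "D = cos (th - th')" and "T = sin (th + th')"
 have W: "W = - sin (th - th')" unfolding W_def by (metis minus_diff_eq sin_minus)
 have a: "cos (2 * th) = S * D + T * W" "cos (2 * th') = S * D - T * W"
 proof -
  have "2 * th = (th + th') + (th - th')" "2 * th' = (th + th') - (th - th')" by simp_all
  then show "cos (2 * th) = S * D + T * W" "cos (2 * th') = S * D - T * W"
   unfolding S_def D_def T_def W by (simp_all only: cos_add[of "th + th'" "th - th'"] cos_diff[of "th + th'" "th - th'"])
 qed
 define s v where "s = S^2" and "v = W^2"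
 have T2: "T^2 = 1 - s" unfolding T_def s_def S_def by (simp add: sin_squared_eq)
 have D2: "D^2 = 1 - v" unfolding D_def v_def W by (simp add: cos_squared_eq)
 have "(S * D + T * W)^2 + (S * D - T * W)^2 = 2 * (S^2 * D^2 + T^2 * W^2)"
  "(S * D + T * W)^2 * (S * D - T * W)^2 = (S^2 * D^2 - T\<^sup>2 * W^2)^2"
  by (simp_all add: power2_eq_square algebra_simps)
 then have sums: "(S * D + T * W)^2 + (S * D - T * W)^2 = 2 * (s + v - 2 * s * v)" "(S * D + T * W)^2 * (S * D - T * W)^2 = (s - v)^2"
  unfolding T2 D2 s_def[symmetric] v_def[symmetric] by (simp_all add: power2_eq_square algebra_simps)
 have "(3 + (S * D + T * W)^2) / 4 * ((3 + (S * D - T * W)^2) / 4)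
   = (9 + 3 * ((S * D + T * W)^2 + (S * D - T * W)^2) + (S * D + T * W)^2 * (S * D - T * W)^2) / 16"
  by (simp add: algebra_simps)
 also have "\<dots> = (9 + 6 * (s + v - 2 * s * v) + (s - v)^2) / 16" unfolding sums by simp
 finally have pr: "(3 + (S * D + T * W)^2) / 4 * ((3 + (S * D - T * W)^2) / 4) = (9 + 6 * (s + v - 2 * s * v) + (s - v)^2) / 16" .
 have q: "(D * (3 * D^2 + S^2) / 4)^2 = (1 - v) * (3 * (1 - v) + s)^2 / 16"
  unfolding power_divide power_mult_distrib D2 s_def[symmetric] by simp
 have rad: "turn_radicand W S = 33 - 2 * s + s^2 - (26 + 6 * s) * v + 9 * v^2"
  unfolding turn_radicand_def s_def v_def by (simp add: power_mult[symmetric])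
 show ?thesis unfolding D_def[symmetric] a pr q rad v_def[symmetric]
  by (simp add: power2_eq_square field_simps)
qed

lemma sign_change_probability:
 assumes h: "0 < th' - th" "th' - th <= pi / 6"
 shows "measure gauss6 {x \<in> space gauss6. (0 < angular (quad_field (coeffs_of x)) th) ~= (0 < angular (quad_field (coeffs_of x)) th')}
  = arctan (sin (th' - th) * turn_rate (sin (th' - th)) (cos (th + th'))) / pi"
proof -
 interpret P: prob_space gauss6 by (rule prob_space_gauss6)
 define W S D where "W = sin (th' - th)" and "S = cos (th + th')" and "D = cos (th - th')"
 define p q r where "p = (3 + (cos (2 * th))^2) / 4" and "q = D * (3 * D^2 + S^2) / 4" and "r = (3 + (cos (2 * th'))^2) / 4"
 have W: "0 < W" unfolding W_def by (rule sin_gt_zero) (use h pi_gt_zero in linarith)+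
 have "W <= sin (pi / 6)" unfolding W_def by (rule sin_monotone_2pi_le) (use h pi_gt_zero in linarith)+
 then have W2: "W <= 1 / 2" by (simp add: sin_30)
 then have "W^2 <= (1 / 2)^2" using W by (intro power_mono) auto
 then have W4: "W^2 <= 1 / 4" by (simp add: power2_eq_square)
 have S1: "S^2 <= 1" unfolding S_def by (simp add: abs_square_le_1)
 have rad: "0 < turn_radicand W S" by (rule turn_radicand_pos[OF W4 S1])
 have D: "0 < D" unfolding D_def by (rule cos_gt_zero_pi) (use h pi_gt_zero in linarith)+
 have "D = cos (th' - th)" unfolding D_def by (metis cos_minus minus_diff_eq)
 then have "D^2 = 1 - W\<^sup>2" unfolding W_def by (simp add: cos_squared_eq)
 then have Dr: "D = sqrt (1 - W\<^sup>2)" using D by (metis abs_of_pos real_sqrt_abs)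
 have det: "p * r - q\<^sup>2 = W^2 * turn_radicand W S / 16"
  unfolding p_def q_def r_def D_def S_def W_def by (rule gram_determinant)
 have q0: "0 < q" unfolding q_def using D by (intro divide_pos_pos mult_pos_pos add_pos_nonneg) auto
 have root: "sqrt (p * r - q\<^sup>2) = W * sqrt (turn_radicand W S) / 4"
  unfolding det real_sqrt_divide real_sqrt_mult using W by simp
 have pos: "0 < p * r - q\<^sup>2" unfolding det using W rad by simp
 have "emeasure gauss6 {x \<in> space gauss6. (0 < angular (quad_field (coeffs_of x)) th) ~= (0 < angular (quad_field (coeffs_of x)) th')}
  = ennreal (1 / 2 - arctan (q / sqrt (p * r - q\<^sup>2)) / pi)"
  unfolding angular_sum
  by (rule sign_disagreement[OF finite_coefficient_index _ _ _ pos]) (simp_all add: p_def q_def r_def D_def S_def angular_gram)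
 moreover have "0 <= 1 / 2 - arctan (q / sqrt (p * r - q\<^sup>2)) / pi"
  using arctan_ubound[of "q / sqrt (p * r - q\<^sup>2)"] pi_gt_zero by (simp add: field_simps)
 ultimately have "measure gauss6 {x \<in> space gauss6. (0 < angular (quad_field (coeffs_of x)) th) ~= (0 < angular (quad_field (coeffs_of x)) th')}
  = 1 / 2 - arctan (q / sqrt (p * r - q\<^sup>2)) / pi"
  by (simp add: measure_def)
 also have "\<dots> = arctan (1 / (q / sqrt (p * r - q\<^sup>2))) / pi"
 proof -
  have y: "0 < q / sqrt (p * r - q\<^sup>2)" using q0 pos by simp
  then have "arctan (1 / (q / sqrt (p * r - q\<^sup>2))) = pi / 2 - arctan (q / sqrt (p * r - q\<^sup>2))"
   using arctan_inverse[of "q / sqrt (p * r - q\<^sup>2)"] by (simp only: sgn_pos) simp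
  then show ?thesis using pi_gt_zero by (simp only: diff_divide_distrib) simp
 qed
 also have "1 / (q / sqrt (p * r - q\<^sup>2)) = W * turn_rate W S"
 proof -
  have "1 / (q / sqrt (p * r - q\<^sup>2)) = (W * sqrt (turn_radicand W S)) / (D * (3 * D^2 + S^2))" unfolding root unfolding q_def by simp
  then show ?thesis unfolding turn_rate_def Dr[symmetric] \<open>D^2 = 1 - W\<^sup>2\<close> by simp
 qed
 finally show ?thesis unfolding W_def S_def .
qed

text \<open>The continuous extension to \<open>0\<close>, which turns the angle into \<open>W\<close> times a function that is continuous
up to \<open>W = 0\<close>.\<close>

definition arctan_quotient :: "real => real" where
 "arctan_quotient x = (if x = 0 then 1 else arctan x / x)"

lemma continuous_arctan_quotient: "continuous_on A arctan_quotient"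
proof (rule continuous_at_imp_continuous_on, intro ballI)
 fix x :: real
 show "isCont arctan_quotient x"
 proof (cases "x = 0")
  case True
  have "((%h. (arctan (0 + h) - arctan 0) / h) \<longlongrightarrow> inverse (1 + 0^2)) (at (0::real))" by (rule DERIV_D[OF DERIV_arctan])
  then have "((%h. arctan h / h) \<longlongrightarrow> 1) (at (0::real))" by simp
  moreover have "\<forall>\<^sub>F h in at (0::real). arctan h / h = arctan_quotient h"
   by (auto simp: eventually_at arctan_quotient_def intro: exI[of _ 1])
  ultimately have "(arctan_quotient \<longlongrightarrow> 1) (at 0)" by (rule Lim_transform_eventually)
  then show ?thesis using True by (simp add: isCont_def arctan_quotient_def)
 next
  case False
  have "isCont (%x. arctan x / x) x" by (intro continuous_intros False)
  moreover have "\<forall>\<^sub>F y in nhds x. arctan_quotient y = arctan y / y"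
   using t1_space_nhds[OF False] by eventually_elim (simp add: arctan_quotient_def)
  ultimately show ?thesis by (simp add: isCont_cong)
 qed
qed

definition turn_density :: "real => real => real" where
 "turn_density w y = turn_rate w (cos y) * arctan_quotient (w * turn_rate w (cos y))"

lemma turn_density_arctan: "arctan (w * turn_rate w (cos y)) = w * turn_density w y"
 by (auto simp: turn_density_def arctan_quotient_def)

lemma turn_density_0: "turn_density 0 (2 * x) = arc_speed x"
proof -
 define k where "k = (cos x * sin x)^2"
 have "(sin (2 * x))^2 = 4 * k" by (simp add: sin_double k_def power2_eq_square)
 then have c: "(cos (2 * x))^2 = 1 - 4 * k" by (simp add: cos_squared_eq)
 then have c4: "cos (2 * x) ^ 4 = (1 - 4 * k)^2" by (metis power2_eq_square power4_eq_xxxx mult.assoc)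
 have "turn_radicand 0 (cos (2 * x)) = 4^2 * (2 + k^2)"
  unfolding turn_radicand_def c c4 by (simp add: power2_eq_square algebra_simps)
 then have "sqrt (turn_radicand 0 (cos (2 * x))) = sqrt (4^2) * sqrt (2 + k^2)" by (simp only: real_sqrt_mult)
 then have "sqrt (turn_radicand 0 (cos (2 * x))) = 4 * sqrt (2 + k^2)" by (simp only: real_sqrt_abs)
 then have "turn_rate 0 (cos (2 * x)) = (4 * sqrt (2 + k^2)) / (4 * (1 - k))" unfolding turn_rate_def c by simp
 also have "\<dots> = sqrt (2 + k^2) / (1 - k)" by (rule mult_divide_mult_cancel_left) simp
 finally have "turn_rate 0 (cos (2 * x)) = sqrt (2 + k^2) / (1 - k)" .
 then show ?thesis by (simp add: turn_density_def arctan_quotient_def arc_speed_def k_def power_mult[symmetric])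
qed

lemma continuous_turn_density: "continuous_on ({0..1/2} \<times> UNIV) (%p. turn_density (fst p) (snd p))"
proof -
 have w: "w^2 <= 1 / 4" if "w \<in> {0..1/2}" for w :: real
  using power_mono[of w "1/2" 2] that by (simp add: power2_eq_square)
 have "1 - w\<^sup>2 > 0" if "w \<in> {0..1/2}" for w :: real using w[OF that] by linarith
 moreover have "3 * (1 - w\<^sup>2) + (cos y)^2 > 0" if "w \<in> {0..1/2}" for w y :: real
  by (rule add_pos_nonneg) (use w[OF that] in auto)
 ultimately have "continuous_on ({0..1/2} \<times> UNIV) (%p. turn_rate (fst p) (cos (snd p)))"
  unfolding turn_rate_def turn_radicand_def by (intro continuous_intros) (fastforce simp: less_imp_neq[symmetric])+
 then show ?thesis unfolding turn_density_def
  by (intro continuous_intros continuous_on_compose2[OF continuous_arctan_quotient[of UNIV]]) auto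
qed

text \<open>The mean value theorem on each cell writes the integral of the speed as a sum without error; uniform
continuity of \<open>turn_density\<close> compares its terms with the angles. Since the speed has period \<open>\<pi> / 2\<close>,
the interval of integration may be shifted.\<close>

lemma turn_sum_limit:
 "(%n. \<Sum>i<n. arctan (sin (pi / real n) * turn_rate (sin (pi / real n)) (cos (real i * pi / real n + real (Suc i) * pi / real n))) / pi) \<longlonglongrightarrow> Lambda2"
proof (rule LIMSEQ_I)
 fix e :: real assume e: "0 < e"
 let ?J = "%p. turn_density (fst p) (snd p)"
 let ?K = "{0..1/2 :: real} \<times> {0..2 * pi}"
 have cK: "continuous_on ?K ?J" by (rule continuous_on_subset[OF continuous_turn_density]) auto
 have K: "compact ?K" by (intro compact_Times compact_Icc)
 obtain B where B: "0 < B" "!!p. p \<in> ?K ==> \<bar>?J p\<bar> <= B"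
 proof -
  have "bounded (?J ` ?K)" by (rule compact_imp_bounded[OF compact_continuous_image[OF cK K]])
  then show ?thesis using that unfolding bounded_pos by force
 qed
 have "uniformly_continuous_on ?K ?J" by (rule compact_uniformly_continuous[OF cK K])
 then obtain d where d: "0 < d" "!!p p'. p \<in> ?K ==> p' \<in> ?K ==> dist p' p < d ==> dist (?J p') (?J p) < e / 4"
  unfolding uniformly_continuous_on_def using e by (metis zero_less_divide_iff zero_less_numeral)
 have "(%n. sin (pi / real n) * real n / pi) \<longlonglongrightarrow> 1" by real_asymp
 then have "\<forall>\<^sub>F n in sequentially. dist (sin (pi / real n) * real n / pi) 1 < e / (4 * B)" using e B by (intro tendstoD) auto
 moreover have "\<forall>\<^sub>F n in sequentially. 2 * (pi / real n) < d" using d by real_asymp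
 ultimately have "\<forall>\<^sub>F n in sequentially. 6 <= n & 2 * (pi / real n) < d & \<bar>sin (pi / real n) * real n / pi - 1\<bar> < e / (4 * B)"
  using eventually_ge_at_top[of 6] by eventually_elim (simp add: dist_real_def)
 then obtain N where N: "!!n. N <= n ==> 6 <= n & 2 * (pi / real n) < d & \<bar>sin (pi / real n) * real n / pi - 1\<bar> < e / (4 * B)"
  unfolding eventually_sequentially by blast
 have "norm ((\<Sum>i<n. arctan (sin (pi / real n) * turn_rate (sin (pi / real n)) (cos (real i * pi / real n + real (Suc i) * pi / real n))) / pi) - Lambda2) < e"
  if n: "N <= n" for n
 proof -
  have n6: "6 <= n" and nd: "2 * (pi / real n) < d" and nB: "\<bar>sin (pi / real n) * real n / pi - 1\<bar> < e / (4 * B)" using N[OF n] by auto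
  have n0: "0 < real n" using n6 by simp
  define W where "W = sin (pi / real n)"
  define t where "t = (%i. real i * pi / real n)"
  have t_step: "t (Suc i) - t i = pi / real n" for i by (simp add: t_def diff_divide_distrib[symmetric] algebra_simps)
  have t_mono: "t i < t (Suc i)" for i using t_step[of i] n0 pi_gt_zero by (metis diff_gt_0_iff_gt divide_pos_pos)
  have t_le: "t i <= pi" if "i <= n" for i using that n0 by (simp add: t_def field_simps)
  have t_ge: "0 <= t i" for i by (simp add: t_def)
  have pn: "pi / real n <= pi / 6" using n6 by (intro divide_left_mono) auto
  have W: "0 <= W" "W <= 1 / 2" "W <= pi / real n"
  proof -
   show "0 <= W" unfolding W_def by (rule sin_ge_zero) (use n0 pn pi_gt_zero in \<open>auto simp: field_simps\<close>)
   have "W <= sin (pi / 6)" unfolding W_def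
   proof (rule sin_monotone_2pi_le)
    have "0 <= pi / real n" using n0 by simp
    then show "- (pi / 2) <= pi / real n" using pi_gt_zero by linarith
   qed (use pn pi_gt_zero in linarith)+
   then show "W <= 1 / 2" by (simp add: sin_30)
   show "W <= pi / real n" unfolding W_def by (rule sin_x_le_x) simp
  qed
  define \<Phi> where "\<Phi> = (%x. integral {- (pi / 2)..x} arc_speed)"
  have mvt: "\<exists>\<xi>. t i <= \<xi> & \<xi> <= t (Suc i) & \<Phi> (t (Suc i) - pi / 2) - \<Phi> (t i - pi / 2) = (pi / real n) * arc_speed \<xi>" if i: "i < n" for i
  proof -
   have deriv: "(\<Phi> has_real_derivative arc_speed x) (at x within {t i - pi / 2..t (Suc i) - pi / 2})" if "t i - pi / 2 <= x" "x <= t (Suc i) - pi / 2" for x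
   proof -
    have "(\<Phi> has_real_derivative arc_speed x) (at x within {- (pi / 2)..pi})"
     unfolding \<Phi>_def by (rule integral_has_real_derivative[OF arc_speed_continuous]) (use that t_ge[of i] t_le[of "Suc i"] i pi_gt_zero in auto)
    then show ?thesis by (rule DERIV_subset) (use t_ge[of i] t_le[of "Suc i"] i pi_gt_zero in auto)
   qed
   have "\<exists>z\<in>{t i - pi / 2<..<t (Suc i) - pi / 2}. \<Phi> (t (Suc i) - pi / 2) - \<Phi> (t i - pi / 2) = (%y. y * arc_speed z) ((t (Suc i) - pi / 2) - (t i - pi / 2))"
   proof (rule mvt_simple)
    show "t i - pi / 2 < t (Suc i) - pi / 2" using t_mono[of i] by simp
    fix x assume "t i - pi / 2 <= x" "x <= t (Suc i) - pi / 2"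
    then show "(\<Phi> has_derivative (%y. y * arc_speed x)) (at x within {t i - pi / 2..t (Suc i) - pi / 2})"
     using deriv[of x] by (simp add: has_field_derivative_def mult_commute_abs)
   qed
   then obtain z where z: "t i - pi / 2 < z" "z < t (Suc i) - pi / 2"
    "\<Phi> (t (Suc i) - pi / 2) - \<Phi> (t i - pi / 2) = ((t (Suc i) - pi / 2) - (t i - pi / 2)) * arc_speed z"
    by auto
   have "arc_speed z = arc_speed (z + pi / 2)"
    by (simp add: arc_speed_def cos_add sin_add power_mult_distrib mult.commute)
   then have "\<Phi> (t (Suc i) - pi / 2) - \<Phi> (t i - pi / 2) = (pi / real n) * arc_speed (z + pi / 2)"
    using z(3) t_step[of i] by simp
   then show ?thesis using z(1,2) by (intro exI[of _ "z + pi / 2"]) auto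
  qed
  then obtain \<xi> where \<xi>: "!!i. i < n ==> t i <= \<xi> i & \<xi> i <= t (Suc i) & \<Phi> (t (Suc i) - pi / 2) - \<Phi> (t i - pi / 2) = (pi / real n) * arc_speed (\<xi> i)"
   by metis
  have "(\<Sum>i<n. (pi / real n) * arc_speed (\<xi> i)) = (\<Sum>i<n. \<Phi> (t (Suc i) - pi / 2) - \<Phi> (t i - pi / 2))"
   using \<xi> by (intro sum.cong) auto
  also have "\<dots> = \<Phi> (t n - pi / 2) - \<Phi> (t 0 - pi / 2)" by (rule sum_lessThan_telescope)
  also have "\<dots> = integral {- (pi / 2)..pi / 2} arc_speed" using n0 by (simp add: \<Phi>_def t_def)
  finally have int: "(\<Sum>i<n. (pi / real n) * arc_speed (\<xi> i)) = pi * Lambda2" unfolding Lambda2_eq by simp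
  have cell_error: "\<bar>W * turn_density W (t i + t (Suc i)) - (pi / real n) * arc_speed (\<xi> i)\<bar> <= (pi / real n) * (e / 2)" if i: "i < n" for i
  proof -
   define u where "u = turn_density W (t i + t (Suc i))"
   have in_K: "(W, t i + t (Suc i)) \<in> ?K" "(0, 2 * \<xi> i) \<in> ?K"
    using W t_ge[of i] t_ge[of "Suc i"] t_le[of i] t_le[of "Suc i"] \<xi>[OF i] i by auto
   have u: "\<bar>u\<bar> <= B" using B(2)[OF in_K(1)] by (simp add: u_def)
   have "dist (W, t i + t (Suc i)) (0, 2 * \<xi> i) <= dist W 0 + dist (t i + t (Suc i)) (2 * \<xi> i)"
    unfolding dist_Pair_Pair by (rule sqrt_sum_squares_le_sum) auto
   also have "\<dots> <= pi / real n + pi / real n"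
   proof (rule add_mono)
    show "dist W 0 <= pi / real n" using W by (simp add: dist_real_def)
    show "dist (t i + t (Suc i)) (2 * \<xi> i) <= pi / real n" unfolding dist_real_def using \<xi>[OF i] t_step[of i] by linarith
   qed
   finally have "dist (W, t i + t (Suc i)) (0, 2 * \<xi> i) < d" using nd by simp
   from d(2)[OF in_K(2,1) this] have ua: "\<bar>u - arc_speed (\<xi> i)\<bar> < e / 4" by (simp add: u_def turn_density_0 dist_real_def)
   have "\<bar>(W * real n / pi - 1) * u\<bar> <= (e / (4 * B)) * B" unfolding abs_mult
    by (rule mult_mono) (use nB u in \<open>auto simp: W_def\<close>)
   also have "\<dots> = e / 4" using B by simp
   finally have uW: "\<bar>(W * real n / pi - 1) * u\<bar> <= e / 4" .
   have "\<bar>(W * real n / pi - 1) * u + (u - arc_speed (\<xi> i))\<bar> <= \<bar>(W * real n / pi - 1) * u\<bar> + \<bar>u - arc_speed (\<xi> i)\<bar>"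
    by (rule abs_triangle_ineq)
   also have "\<dots> <= e / 4 + e / 4" by (rule add_mono[OF uW less_imp_le[OF ua]])
   also have "\<dots> = e / 2" by simp
   finally have "\<bar>(W * real n / pi - 1) * u + (u - arc_speed (\<xi> i))\<bar> <= e / 2" .
   then have a1: "(pi / real n) * \<bar>(W * real n / pi - 1) * u + (u - arc_speed (\<xi> i))\<bar> <= (pi / real n) * (e / 2)"
    by (rule mult_left_mono) (use n0 in simp)
   have a2: "(pi / real n) * \<bar>(W * real n / pi - 1) * u + (u - arc_speed (\<xi> i))\<bar> = \<bar>(pi / real n) * ((W * real n / pi - 1) * u + (u - arc_speed (\<xi> i)))\<bar>"
    using n0 by (simp add: abs_mult)
   have a3: "(pi / real n) * ((W * real n / pi - 1) * u + (u - arc_speed (\<xi> i))) = W * u - (pi / real n) * arc_speed (\<xi> i)"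
    using n0 by (simp add: field_simps)
   show ?thesis using a1 unfolding a2 a3 unfolding u_def .
  qed
  have "\<bar>(\<Sum>i<n. W * turn_density W (t i + t (Suc i))) - pi * Lambda2\<bar> = \<bar>\<Sum>i<n. W * turn_density W (t i + t (Suc i)) - (pi / real n) * arc_speed (\<xi> i)\<bar>"
   unfolding int[symmetric] sum_subtractf ..
  also have "\<dots> <= (\<Sum>i<n. \<bar>W * turn_density W (t i + t (Suc i)) - (pi / real n) * arc_speed (\<xi> i)\<bar>)" by (rule sum_abs)
  also have "\<dots> <= (\<Sum>i<n. (pi / real n) * (e / 2))" by (rule sum_mono) (use cell_error in auto)
  also have "\<dots> = pi * (e / 2)" using n0 by simp
  finally have "\<bar>(\<Sum>i<n. W * turn_density W (t i + t (Suc i))) - pi * Lambda2\<bar> <= pi * (e / 2)" .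
  moreover have "(\<Sum>i<n. W * turn_density W (t i + t (Suc i))) - pi * Lambda2
   = pi * ((\<Sum>i<n. W * turn_density W (t i + t (Suc i)) / pi) - Lambda2)"
   by (simp add: sum_divide_distrib[symmetric] right_diff_distrib)
  ultimately have "\<bar>(\<Sum>i<n. W * turn_density W (t i + t (Suc i)) / pi) - Lambda2\<bar> <= e / 2"
   by (simp only: abs_mult) simp
  then show ?thesis unfolding turn_density_arctan W_def t_def real_norm_def using e by linarith
 qed
 then show "\<exists>N. \<forall>n\<ge>N. norm ((\<Sum>i<n. arctan (sin (pi / real n) * turn_rate (sin (pi / real n)) (cos (real i * pi / real n + real (Suc i) * pi / real n))) / pi) - Lambda2) < e"
  by blast
qed

section \<open>The expected number of invariant lines\<close>

text \<open>A nonzero discriminant means that the cofactor of the zero does not vanish there.\<close>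

lemma simple_zero:
 assumes d: "field_disc c ~= 0" and z: "angular (quad_field c) z = 0"
 obtains Q where "continuous_on UNIV Q" "!!x. angular (quad_field c) x = sin (x - z) * Q x" "Q z ~= (0::real)"
proof -
 obtain e e' e'' f f' f'' where c: "c = ((e, e', e''), (f, f', f''))" by (metis prod.exhaust)
 let ?f = "cubic_form f (f' - e) (f'' - e') (- e'')"
 have g: "angular (quad_field c) t = ?f (cos t) (sin t)" for t
  by (simp add: c angular_def quad_field_def cubic_form_def power2_eq_square power3_eq_cube algebra_simps)
 have cs: "(cos z)^2 + (sin z)^2 = 1" by simp
 obtain \<alpha> \<beta> \<gamma> where fac: "!!x y. ?f x y = (cos z * y - sin z * x) * (\<alpha> * x^2 + \<beta> * x * y + \<gamma> * y^2)"
  using cubic_form_factor[OF z[unfolded g] cs] by blast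
 define Q where "Q = (%x. \<alpha> * (cos x)^2 + \<beta> * cos x * sin x + \<gamma> * (sin x)^2)"
 show thesis
 proof (rule that[of Q])
  show "continuous_on UNIV Q" unfolding Q_def by (intro continuous_intros)
  show "angular (quad_field c) x = sin (x - z) * Q x" for x
   unfolding g fac Q_def sin_diff by (simp add: mult.commute)
  have "field_disc c = (\<beta>\<^sup>2 - 4 * \<alpha> * \<gamma>) * (Q z)^2" unfolding c field_disc.simps Q_def by (rule cubic_disc_factor[OF fac])
  then show "Q z ~= 0" using d by auto
 qed
qed

definition grid :: "nat => nat => real" where
 "grid n i = real i * pi / real n"

definition sign_changes :: "coeffs => nat => nat set" where
 "sign_changes c n = {i. i < n & (0 < angular (quad_field c) (grid n i)) ~= (0 < angular (quad_field c) (grid n (Suc i)))}"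

lemma grid_bounds:
 assumes "0 < n"
 shows "0 <= grid n i" "grid n i < grid n (Suc i)" "grid n (Suc i) - grid n i = pi / real n" "i <= n ==> grid n i <= pi"
proof -
 show 1: "0 <= grid n i" by (simp add: grid_def)
 show 2: "grid n (Suc i) - grid n i = pi / real n" by (simp add: grid_def diff_divide_distrib[symmetric] algebra_simps)
 have "0 < pi / real n" using assms by simp
 then show "grid n i < grid n (Suc i)" using 2 by linarith
 show "grid n i <= pi" if "i <= n" using that assms by (simp add: grid_def divide_le_eq)
qed

lemma grid_cell:
 assumes n: "0 < n" and z: "grid n i < z" "z < grid n (Suc i)" shows "nat \<lfloor>z * real n / pi\<rfloor> = i"
proof -
 have "real i * pi < z * real n" "z * real n < real (Suc i) * pi"
  using z n by (simp_all add: grid_def divide_less_eq less_divide_eq)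
 then have "real i < z * real n / pi" "z * real n / pi < real i + 1"
  by (simp_all add: less_divide_eq divide_less_eq add.commute)
 then have "\<lfloor>z * real n / pi\<rfloor> = int i" by (intro floor_unique) auto
 then show ?thesis by simp
qed

lemma zero_between:
 assumes n: "0 < n" and nz: "!!i. angular (quad_field c) (grid n i) ~= 0" and i: "i \<in> sign_changes c n"
 obtains z where "z \<in> zero_angles (quad_field c)" "grid n i < z" "z < grid n (Suc i)"
proof -
 let ?g = "angular (quad_field c)"
 have i': "i < n" "(0 < ?g (grid n i)) ~= (0 < ?g (grid n (Suc i)))" using i by (auto simp: sign_changes_def)
 have cont: "continuous_on {grid n i..grid n (Suc i)} ?g" by (rule continuous_radial_angular[OF quad_field_in])
 have le: "grid n i <= grid n (Suc i)" using grid_bounds(2)[OF n, of i] by simp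
 have "\<exists>z\<ge>grid n i. z <= grid n (Suc i) & ?g z = 0"
 proof (cases "0 < ?g (grid n i)")
  case True
  then have "?g (grid n (Suc i)) <= 0" using i' by simp
  then show ?thesis using IVT2'[of ?g "grid n (Suc i)" 0 "grid n i", OF _ _ le cont] True by auto
 next
  case False
  then have "0 <= ?g (grid n (Suc i))" using i' by auto
  then show ?thesis using IVT'[of ?g "grid n i" 0 "grid n (Suc i)", OF _ _ le cont] False by auto
 qed
 then obtain z where z: "grid n i <= z" "z <= grid n (Suc i)" "?g z = 0" by blast
 have "z ~= grid n i" "z ~= grid n (Suc i)" using nz z(3) by auto
 then have z': "grid n i < z" "z < grid n (Suc i)" using z by auto
 have "grid n (Suc i) <= pi" using grid_bounds(4)[OF n, of "Suc i"] i' by simp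
 then have "z \<in> zero_angles (quad_field c)" using z' z(3) grid_bounds(1)[OF n, of i] by (simp add: zero_angles_def)
 then show thesis using z' by (rule that)
qed

lemma sign_changes_subset:
 assumes n: "0 < n" and nz: "!!i. angular (quad_field c) (grid n i) ~= 0"
 shows "sign_changes c n \<subseteq> (%z. nat \<lfloor>z * real n / pi\<rfloor>) ` zero_angles (quad_field c)"
proof
 fix i assume "i \<in> sign_changes c n"
 then obtain z where "z \<in> zero_angles (quad_field c)" "grid n i < z" "z < grid n (Suc i)" using zero_between[OF n nz] by blast
 then show "i \<in> (%z. nat \<lfloor>z * real n / pi\<rfloor>) ` zero_angles (quad_field c)" using grid_cell[OF n] by force
qed

text \<open>Once the grid is finer than the gaps between the zeros, each cell contains at most one zero, which is
simple and therefore changes the sign.\<close>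

lemma sign_changes_fine_grid:
 assumes n: "0 < n" and nz: "!!i. angular (quad_field c) (grid n i) ~= 0" and d: "field_disc c ~= 0"
  and fine: "!!x y. x \<in> zero_angles (quad_field c) ==> y \<in> zero_angles (quad_field c) ==> x ~= y ==> pi / real n < \<bar>x - y\<bar>"
 shows "card (sign_changes c n) = card (zero_angles (quad_field c))"
proof -
 let ?g = "angular (quad_field c)" and ?Z = "zero_angles (quad_field c)" and ?h = "%z. nat \<lfloor>z * real n / pi\<rfloor>"
 have cell: "?h z < n & grid n (?h z) < z & z < grid n (Suc (?h z))" if z: "z \<in> ?Z" for z
 proof -
  have z': "0 <= z" "z < pi" "?g z = 0" using z by (auto simp: zero_angles_def)
  define i where "i = ?h z"
  have "0 <= z * real n / pi" using z' by simp
  then have i: "real i <= z * real n / pi" "z * real n / pi < real i + 1" unfolding i_def by linarith+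
  then have "real i * pi <= z * real n" "z * real n < real (Suc i) * pi" by (simp_all add: le_divide_eq divide_less_eq add.commute)
  then have g: "grid n i <= z" "z < grid n (Suc i)" using n by (simp_all add: grid_def divide_le_eq less_divide_eq)
  have "z * real n / pi < real n" using z' n by (simp add: divide_less_eq)
  then have "i < n" using i by linarith
  moreover have "grid n i ~= z" using nz[of i] z'(3) by auto
  ultimately show ?thesis using g by (simp add: i_def[symmetric])
 qed
 have inj: "inj_on ?h ?Z"
 proof (rule inj_onI, rule ccontr)
  fix x y assume xy: "x \<in> ?Z" "y \<in> ?Z" "?h x = ?h y" "x ~= y"
  define i where "i = ?h x"
  have "grid n i < x" "x < grid n (Suc i)" "grid n i < y" "y < grid n (Suc i)" using cell[OF xy(1)] cell[OF xy(2)] xy(3) by (auto simp: i_def)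
  then have "\<bar>x - y\<bar> < pi / real n" using grid_bounds(3)[OF n, of i] by linarith
  then show False using fine[OF xy(1,2,4)] by simp
 qed
 have "?h ` ?Z \<subseteq> sign_changes c n"
 proof
  fix i assume "i \<in> ?h ` ?Z"
  then obtain z where z: "z \<in> ?Z" "i = ?h z" by blast
  have i: "i < n" "grid n i < z" "z < grid n (Suc i)" using cell[OF z(1)] z(2) by auto
  have up: "grid n (Suc i) <= pi" using grid_bounds(4)[OF n, of "Suc i"] i(1) by simp
  obtain Q where Q: "continuous_on UNIV Q" "!!x. ?g x = sin (x - z) * Q x" "Q z ~= 0"
   using simple_zero[OF d, of z] z(1) by (auto simp: zero_angles_def)
  have Qnz: "Q y ~= 0" if y: "grid n i <= y" "y <= grid n (Suc i)" for y
  proof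
   assume Q0: "Q y = 0"
   then have gy: "?g y = 0" using Q(2) by simp
   then have ne: "y ~= grid n i" "y ~= grid n (Suc i)" using nz by auto
   then have yZ: "y \<in> ?Z" using y gy up grid_bounds(1)[OF n, of i] by (simp add: zero_angles_def)
   have "\<bar>y - z\<bar> < pi / real n" using y ne i grid_bounds(3)[OF n, of i] by linarith
   then have "y = z" using fine[OF yZ z(1)] by fastforce
   then show False using Q0 Q(3) by simp
  qed
  have le: "grid n i <= grid n (Suc i)" using i by simp
  have contQ: "continuous_on {grid n i..grid n (Suc i)} Q" by (rule continuous_on_subset[OF Q(1)]) simp
  have same: "0 < Q (grid n i) \<longleftrightarrow> 0 < Q (grid n (Suc i))"
  proof (rule ccontr)
   assume "\<not> ?thesis"
   then consider "0 <= Q (grid n i)" "Q (grid n (Suc i)) <= 0" | "Q (grid n i) <= 0" "0 <= Q (grid n (Suc i))" by linarith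
   then show False
   proof cases
    case 1
    then show ?thesis using IVT2'[of Q "grid n (Suc i)" 0 "grid n i", OF _ _ le contQ] Qnz by blast
   next
    case 2
    then show ?thesis using IVT'[of Q "grid n i" 0 "grid n (Suc i)", OF _ _ le contQ] Qnz by blast
   qed
  qed
  have zb: "0 <= grid n i" "grid n (Suc i) <= pi" using up grid_bounds(1)[OF n] by auto
  have s1: "sin (grid n i - z) < 0"
  proof -
   have "0 < sin (z - grid n i)" by (rule sin_gt_zero) (use i zb in linarith)+
   then show ?thesis by (metis minus_diff_eq neg_0_less_iff_less neg_less_0_iff_less sin_minus)
  qed
  have s2: "0 < sin (grid n (Suc i) - z)" by (rule sin_gt_zero) (use i zb in linarith)+
  have "Q (grid n i) ~= 0" "Q (grid n (Suc i)) ~= 0" using Qnz le by auto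
  then have "(0 < ?g (grid n i)) ~= (0 < ?g (grid n (Suc i)))"
   using same s1 s2 unfolding Q(2) zero_less_mult_iff by auto
  then show "i \<in> sign_changes c n" using i(1) by (simp add: sign_changes_def)
 qed
 then have "sign_changes c n = ?h ` ?Z" using sign_changes_subset[OF n nz] by blast
 then show ?thesis using card_image[OF inj] by simp
qed

lemma zero_angles_generic:
 assumes "field_disc c ~= 0"
 shows "finite (zero_angles (quad_field c))" "card (zero_angles (quad_field c)) = (if 0 < field_disc c then 3 else 1)"
proof -
 show c: "card (zero_angles (quad_field c)) = (if 0 < field_disc c then 3 else 1)"
  using assms card_lines_disc[of c] by auto
 show "finite (zero_angles (quad_field c))" by (rule card_ge_0_finite) (simp add: c)
qed

lemma sign_changes_eventually:
 assumes d: "field_disc c ~= 0" and nz: "!!n i. angular (quad_field c) (grid n i) ~= 0"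
 shows "\<forall>\<^sub>F n in sequentially. card (sign_changes c n) = card (zero_angles (quad_field c))"
proof -
 let ?Z = "zero_angles (quad_field c)"
 define D where "D = insert 1 ((%(x, y). \<bar>x - y\<bar>) ` {p \<in> ?Z \<times> ?Z. fst p ~= snd p})"
 have "finite D" using zero_angles_generic(1)[OF d] by (simp add: D_def)
 moreover have "\<forall>u\<in>D. 0 < u" by (auto simp: D_def)
 ultimately have "0 < Min D" by (subst Min_gr_iff) (auto simp: D_def)
 then have "\<forall>\<^sub>F n in sequentially. pi / real n < Min D" by real_asymp
 then show ?thesis using eventually_gt_at_top[of 0]
 proof eventually_elim
  case (elim n)
  show ?case
  proof (rule sign_changes_fine_grid[OF elim(2) nz d])
   fix x y assume "x \<in> ?Z" "y \<in> ?Z" "x ~= y"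
   then have "\<bar>x - y\<bar> \<in> D" by (force simp: D_def)
   then show "pi / real n < \<bar>x - y\<bar>" using elim(1) Min_le[OF \<open>finite D\<close>] by fastforce
  qed
 qed
qed

lemma angular_measurable [measurable]: "(%x. angular (quad_field (coeffs_of x)) th) \<in> borel_measurable gauss6"
proof -
 have c: "(%x. x k) \<in> borel_measurable gauss6" if "k \<in> coefficient_index" for k
  using measurable_component_singleton[OF that, of "%_. gauss"] by (simp cong: measurable_cong_sets)
 show ?thesis unfolding angular_sum by (intro borel_measurable_sum borel_measurable_times borel_measurable_const c)
qed

lemma angular_nonzero: "AE x in gauss6. angular (quad_field (coeffs_of x)) th ~= 0"
proof -
 define k :: "(nat \<times> nat) + (nat \<times> nat)" where "k = (if cos th ~= 0 then Inr (2,0) else Inl (0,2))"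
 have k: "k \<in> coefficient_index" by (simp add: k_def coefficient_index_eq)
 have "sin th ~= 0" if "cos th = 0" using that sin_cos_squared_add[of th] by auto
 then have w: "angular_weight th k ~= 0" by (auto simp: k_def angular_weight_def)
 have "emeasure gauss6 {x \<in> space gauss6. angular (quad_field (coeffs_of x)) th = 0} = 0"
 proof (rule one_variable_null[OF k])
  fix x :: "(nat \<times> nat) + (nat \<times> nat) => real"
  define r where "r = (\<Sum>j\<in>coefficient_index - {k}. angular_weight th j * x j)"
  have "angular (quad_field (coeffs_of (x(k := t)))) th = angular_weight th k * t + r" for t
  proof -
   have "(\<Sum>j\<in>coefficient_index - {k}. angular_weight th j * (x(k := t)) j) = r" unfolding r_def by (intro sum.cong) auto
   then show ?thesis unfolding angular_sum using sum.remove[OF finite_coefficient_index k, of "%j. angular_weight th j * (x(k := t)) j"] by simp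
  qed
  then have "{t. x(k := t) \<in> {x \<in> space gauss6. angular (quad_field (coeffs_of x)) th = 0}} \<subseteq> {- r / angular_weight th k}"
   using w by (auto simp: field_simps eq_neg_iff_add_eq_0)
  then show "finite {t. x(k := t) \<in> {x \<in> space gauss6. angular (quad_field (coeffs_of x)) th = 0}}" by (rule finite_subset) simp
 qed measurable
 then show ?thesis by (subst AE_iff_measurable[OF _ refl]) auto
qed

text \<open>Both sides are the expected number of sign changes in the limit: almost surely the count is eventually
the number \<open>1\<close> or \<open>3\<close> of lines, and it is bounded by \<open>3\<close>, so limit and expectation commute.\<close>

theorem three_lines_probability:
 "measure gauss6 {x \<in> space gauss6. 0 < field_disc (coeffs_of x)} = (Lambda2 - 1) / 2"
proof -
 interpret P: prob_space gauss6 by (rule prob_space_gauss6)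
 let ?g = "%x. angular (quad_field (coeffs_of x))"
 define E where "E = (%n i. {x \<in> space gauss6. (0 < ?g x (grid n i)) ~= (0 < ?g x (grid n (Suc i)))})"
 define C where "C = (%n x. \<Sum>i<n. indicator (E n i) x :: real)"
 define T where "T = {x \<in> space gauss6. 0 < field_disc (coeffs_of x)}"
 have [measurable]: "E n i \<in> sets gauss6" for n i unfolding E_def by measurable
 have T [measurable]: "T \<in> sets gauss6" unfolding T_def using coeffs_of_sets[OF borel_open[OF open_disc(1)]] by simp
 have intE: "integrable gauss6 (indicat_real (E n i))" for n i
  by (rule P.integrable_const_bound[where B = 1]) (auto simp: indicator_def)
 have C_card: "C n x = real (card (sign_changes (coeffs_of x) n))" if "x \<in> space gauss6" for n x
 proof -
  have "C n x = (\<Sum>i<n. if i \<in> sign_changes (coeffs_of x) n then 1 else 0)"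
   unfolding C_def by (intro sum.cong) (auto simp: E_def sign_changes_def indicator_def that)
  also have "\<dots> = real (card ({..<n} \<inter> sign_changes (coeffs_of x) n))" by (simp add: sum.If_cases)
  also have "{..<n} \<inter> sign_changes (coeffs_of x) n = sign_changes (coeffs_of x) n" by (auto simp: sign_changes_def)
  finally show ?thesis .
 qed
 have AE_good: "AE x in gauss6. field_disc (coeffs_of x) ~= 0 & (\<forall>n i. ?g x (grid n i) ~= 0)"
 proof -
  have "AE x in gauss6. \<forall>n i. ?g x (grid n i) ~= 0" unfolding AE_all_countable by (intro allI angular_nonzero)
  then show ?thesis using generic_coeffs_full by eventually_elim (auto simp: generic_coeffs_def)
 qed
 have lim: "(%n. \<integral>x. C n x \<partial>gauss6) \<longlonglongrightarrow> (\<integral>x. 1 + 2 * indicator T x \<partial>gauss6)"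
 proof (rule integral_dominated_convergence[where w = "%_. 3"])
  show "AE x in gauss6. (%n. C n x) \<longlonglongrightarrow> 1 + 2 * indicator T x"
   using AE_good AE_space
  proof eventually_elim
   case (elim x)
   have "\<forall>\<^sub>F n in sequentially. C n x = real (card (zero_angles (quad_field (coeffs_of x))))"
    using sign_changes_eventually[of "coeffs_of x"] elim by (auto elim!: eventually_mono simp: C_card)
   moreover have "real (card (zero_angles (quad_field (coeffs_of x)))) = 1 + 2 * indicator T x"
    using zero_angles_generic(2)[of "coeffs_of x"] elim by (simp add: T_def indicator_def)
   ultimately show ?case by (simp add: tendsto_eventually)
  qed
  show "AE x in gauss6. norm (C n x) <= 3" for n
   using AE_good AE_space
  proof eventually_elim
   case (elim x)
   show ?case
   proof (cases "n = 0")
    case False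
    then have "card (sign_changes (coeffs_of x) n) <= card ((%z. nat \<lfloor>z * real n / pi\<rfloor>) ` zero_angles (quad_field (coeffs_of x)))"
     using sign_changes_subset[of n "coeffs_of x"] elim zero_angles_generic(1)[of "coeffs_of x"] by (intro card_mono) auto
    also have "\<dots> <= card (zero_angles (quad_field (coeffs_of x)))" using elim zero_angles_generic(1)[of "coeffs_of x"] by (intro card_image_le) auto
    also have "\<dots> <= 3" using zero_angles_generic(2)[of "coeffs_of x"] elim by simp
    finally show ?thesis using C_card[of x n] elim by simp
   qed (simp add: C_def)
  qed
 qed (auto simp: C_def)
 have "integrable gauss6 (indicat_real T)"
  by (rule P.integrable_const_bound[where B = 1]) (auto simp: indicator_def)
 then have "(\<integral>x. 1 + 2 * indicator T x \<partial>gauss6) = 1 + 2 * measure gauss6 T"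
  by (subst Bochner_Integration.integral_add) (auto simp: P.prob_space)
 moreover have "\<forall>\<^sub>F n in sequentially. (\<integral>x. C n x \<partial>gauss6)
  = (\<Sum>i<n. arctan (sin (pi / real n) * turn_rate (sin (pi / real n)) (cos (real i * pi / real n + real (Suc i) * pi / real n))) / pi)"
  using eventually_ge_at_top[of 6]
 proof eventually_elim
  case (elim n)
  then have n: "0 < n" by simp
  have step: "pi / real n <= pi / 6" using elim by (intro divide_left_mono) auto
  have pos: "0 < pi / real n" using n by simp
  have "(\<integral>x. C n x \<partial>gauss6) = (\<Sum>i<n. measure gauss6 (E n i))"
   unfolding C_def by (subst Bochner_Integration.integral_sum) (use intE in auto)
  also have "\<dots> = (\<Sum>i<n. arctan (sin (pi / real n) * turn_rate (sin (pi / real n)) (cos (real i * pi / real n + real (Suc i) * pi / real n))) / pi)"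
  proof (rule sum.cong[OF refl])
   fix i
   have "measure gauss6 (E n i) = arctan (sin (grid n (Suc i) - grid n i) * turn_rate (sin (grid n (Suc i) - grid n i)) (cos (grid n i + grid n (Suc i)))) / pi"
    unfolding E_def by (rule sign_change_probability) (use grid_bounds(3)[OF n, of i] step pos in linarith)+
   then show "measure gauss6 (E n i) = arctan (sin (pi / real n) * turn_rate (sin (pi / real n)) (cos (real i * pi / real n + real (Suc i) * pi / real n))) / pi"
    unfolding grid_bounds(3)[OF n] unfolding grid_def .
  qed
  finally show ?case .
 qed
 ultimately have "(%n. \<Sum>i<n. arctan (sin (pi / real n) * turn_rate (sin (pi / real n)) (cos (real i * pi / real n + real (Suc i) * pi / real n))) / pi)
   \<longlonglongrightarrow> 1 + 2 * measure gauss6 T"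
  using lim by (simp add: Lim_transform_eventually)
 then have "1 + 2 * measure gauss6 T = Lambda2" using turn_sum_limit by (rule LIMSEQ_unique)
 then show ?thesis unfolding T_def by (simp add: field_simps)
qed

section \<open>The five classes and their probabilities\<close>

definition portrait_types :: "(int \<times> nat) set" where
 "portrait_types = {(-2, 3), (0, 3), (2, 3), (0, 1), (2, 1)}"

definition portrait_example :: "int \<times> nat => coeffs" where
 "portrait_example p = (if p = (-2, 3) then ((1,0,-1),(0,-2,0)) else if p = (0, 3) then ((-1,0,-3),(0,-2,0))
   else if p = (2, 3) then ((3,0,-3),(0,2,0)) else if p = (0, 1) then ((1,0,1),(0,0,0)) else ((1,0,-1),(0,2,0)))"

lemma portrait_example_type:
 assumes "p \<in> portrait_types"
 shows "has_index (quad_field (portrait_example p)) 0 (fst p)"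
  "snd p = 3 & 0 < field_disc (portrait_example p) | snd p = 1 & field_disc (portrait_example p) < 0"
proof -
 show "has_index (quad_field (portrait_example p)) 0 (fst p)"
  using assms unfolding portrait_types_def insert_iff empty_iff
  by (elim disjE) (simp_all add: portrait_example_def example_fields(1,3,5,7,9) del: field_disc.simps)
 show "snd p = 3 & 0 < field_disc (portrait_example p) | snd p = 1 & field_disc (portrait_example p) < 0"
  using assms unfolding portrait_types_def insert_iff empty_iff
  by (elim disjE) (simp_all add: portrait_example_def cubic_disc_def)
qed

definition portrait_of_type :: "int \<times> nat => (complex => complex) set" where
 "portrait_of_type p = phase_portrait 2 (quad_field (portrait_example p))"

lemma portrait_of_type_iff:
 assumes p: "p \<in> portrait_types"
 shows "determined_by (portrait_of_type p) (fst p) (snd p)"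
  "phase_portrait 2 (quad_field c) = portrait_of_type p \<longleftrightarrow> c \<in> coefficient_class (fst p) (snd p)"
proof -
 have l: "card (zero_angles (quad_field (portrait_example p))) = snd p" "snd p = 1 | snd p = 3"
  using portrait_example_type(2)[OF p] card_lines_disc[of "portrait_example p"] by auto
 show d: "determined_by (portrait_of_type p) (fst p) (snd p)"
  unfolding portrait_of_type_def by (rule portrait_of_example(1)[OF portrait_example_type(1)[OF p] l])
 have "finite (invariant_lines (quad_field c))" if "card (zero_angles (quad_field c)) = snd p"
  using that l(2) card_invariant_lines(1)[OF quad_field_in, of c] by (metis card.infinite zero_neq_numeral zero_neq_one)
 then show "phase_portrait 2 (quad_field c) = portrait_of_type p \<longleftrightarrow> c \<in> coefficient_class (fst p) (snd p)"
  using d card_invariant_lines(2)[OF quad_field_in, of c] unfolding determined_by_def coefficient_class_def by auto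
qed

text \<open>A generic field is nondegenerate and has one or three lines, so it has portrait data; the possible
numbers of nodes leave these five pairs.\<close>

lemma generic_type:
 assumes c: "c \<in> generic_coeffs" shows "\<exists>p\<in>portrait_types. c \<in> coefficient_class (fst p) (snd p)"
proof -
 let ?l = "card (zero_angles (quad_field c))"
 have d: "field_disc c ~= 0" "nondegenerate (quad_field c)" using c nondegenerate_resultant by (auto simp: generic_coeffs_def)
 have l: "?l = 1 | ?l = 3" using zero_angles_generic(2)[OF d(1)] by (simp split: if_splits)
 obtain N where N: "portrait_data (quad_field c) ?l N" using portrait_data_exists[OF d(2) refl l] by blast
 define i where "i = 1 - int ?l + 2 * int N"
 have i: "has_index (quad_field c) 0 i" unfolding i_def by (rule portrait_data_index[OF N])
 have "(i, ?l) \<in> portrait_types"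
  using portrait_of_example(2,3)[OF i refl l] l by (auto simp: portrait_types_def)
 then show ?thesis using i by (intro bexI[of _ "(i, ?l)"]) (simp_all add: coefficient_class_def)
qed

lemma type_unique:
 assumes "c \<in> coefficient_class i l" "c \<in> coefficient_class j m" shows "(i, l) = (j, m)"
 using assms has_index_unique by (auto simp: coefficient_class_def)

abbreviation coeff_prob :: "coeffs set => real" where
 "coeff_prob E \<equiv> measure gauss6 {x \<in> space gauss6. coeffs_of x \<in> E}"

lemma coeff_prob_cong:
 assumes "E \<in> sets borel" "E' \<in> sets borel" "!!c. c \<in> generic_coeffs ==> c \<in> E \<longleftrightarrow> c \<in> E'"
 shows "coeff_prob E = coeff_prob E'"
proof -
 interpret P: prob_space gauss6 by (rule prob_space_gauss6)
 have "AE x in gauss6. x \<in> {x \<in> space gauss6. coeffs_of x \<in> E} \<longleftrightarrow> x \<in> {x \<in> space gauss6. coeffs_of x \<in> E'}"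
  using generic_coeffs_full by eventually_elim (use assms(3) in auto)
 then show ?thesis by (rule P.finite_measure_eq_AE) (use assms coeffs_of_sets in auto)
qed

text \<open>The classes are disjoint because index and number of lines are unique.\<close>

lemma coeff_prob_types:
 assumes S: "S \<subseteq> portrait_types" and E: "E \<in> sets borel"
  and iff: "!!c. c \<in> generic_coeffs ==> c \<in> E \<longleftrightarrow> (\<exists>p\<in>S. c \<in> coefficient_class (fst p) (snd p))"
 shows "coeff_prob E = (\<Sum>p\<in>S. coeff_prob (coefficient_class (fst p) (snd p)))"
proof -
 interpret P: prob_space gauss6 by (rule prob_space_gauss6)
 let ?A = "%p. {x \<in> space gauss6. coeffs_of x \<in> coefficient_class (fst p) (snd p)}"
 have fin: "finite S" using S by (rule finite_subset) (simp add: portrait_types_def)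
 have B: "coefficient_class (fst p) (snd p) \<in> sets borel" if "p \<in> S" for p
  using that S by (intro coefficient_class_borel) (auto simp: portrait_types_def)
 have "(\<Union>p\<in>S. coefficient_class (fst p) (snd p)) \<in> sets borel" using B fin by (intro sets.finite_UN) auto
 then have "coeff_prob E = coeff_prob (\<Union>p\<in>S. coefficient_class (fst p) (snd p))"
  using iff by (intro coeff_prob_cong E) auto
 also have "{x \<in> space gauss6. coeffs_of x \<in> (\<Union>p\<in>S. coefficient_class (fst p) (snd p))} = (\<Union>p\<in>S. ?A p)" by auto
 also have "measure gauss6 (\<Union>p\<in>S. ?A p) = (\<Sum>p\<in>S. measure gauss6 (?A p))"
 proof (rule P.finite_measure_finite_Union[OF fin])
  show "?A ` S \<subseteq> sets gauss6" using B coeffs_of_sets by blast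
  show "disjoint_family_on ?A S" unfolding disjoint_family_on_def
  proof (intro ballI impI)
   fix p q :: "int \<times> nat" assume "p ~= q"
   show "?A p \<inter> ?A q = {}"
   proof (rule ccontr)
    assume "\<not> ?thesis"
    then obtain x where "coeffs_of x \<in> coefficient_class (fst p) (snd p)" "coeffs_of x \<in> coefficient_class (fst q) (snd q)" by blast
    then have "(fst p, snd p) = (fst q, snd q)" by (rule type_unique)
    then show False using \<open>p ~= q\<close> by (simp add: prod_eq_iff)
   qed
  qed
 qed
 finally show ?thesis .
qed

text \<open>Composing the field with complex conjugation changes the sign of the index and preserves the law.\<close>

lemma opposite_index_probability:
 assumes N: "normal_coefficients M A B"
 shows "coeff_prob {c. has_index (quad_field c) 0 (- i)} = coeff_prob {c. has_index (quad_field c) 0 i}"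
proof -
 let ?B = "%k \<omega>. - B k \<omega>"
 have B: "{c. has_index (quad_field c) 0 j} \<in> sets borel" for j by (rule borel_open[OF open_index])
 have cnj: "quad_field (random_coeffs A ?B \<omega>) = (%z. cnj (quad_field (random_coeffs A B \<omega>) z))"
  "quad_field (random_coeffs A B \<omega>) = (%z. cnj (quad_field (random_coeffs A ?B \<omega>) z))" for \<omega>
  by (auto simp: fun_eq_iff random_coeffs_def quad_field_def complex_eq_iff)
 have "has_index (quad_field (random_coeffs A B \<omega>)) 0 (- i) \<longleftrightarrow> has_index (quad_field (random_coeffs A ?B \<omega>)) 0 i" for \<omega>
 proof
  assume h: "has_index (quad_field (random_coeffs A B \<omega>)) 0 (- i)"
  show "has_index (quad_field (random_coeffs A ?B \<omega>)) 0 i"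
   using wind_cnj[OF has_index_nondegenerate[OF quad_field_in h] cnj(1) quad_field_in h] by simp
 next
  assume h: "has_index (quad_field (random_coeffs A ?B \<omega>)) 0 i"
  show "has_index (quad_field (random_coeffs A B \<omega>)) 0 (- i)"
   by (rule wind_cnj[OF has_index_nondegenerate[OF quad_field_in h] cnj(2) quad_field_in h])
 qed
 then show ?thesis
  using coefficient_law(2)[OF N B[of "- i"]] coefficient_law(2)[OF reflected_coefficients[OF N] B[of i]] by simp
qed

theorem theorem2:
  fixes M :: "'w measure" and A B :: "nat \<times> nat \<Rightarrow> 'w \<Rightarrow> real"
    and F\<^sub>2 :: "'w \<Rightarrow> complex \<Rightarrow> complex" and P :: "(complex \<Rightarrow> complex) set \<Rightarrow> real"
  assumes "prob_space M"
    and "prob_space.indep_vars M (\<lambda>_. borel) (case_sum A B) (exponents 2 <+> exponents 2)"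
    and "\<And>k. k \<in> exponents 2 \<Longrightarrow> distributed M lborel (A k) (normal_density 0 1)"
    and "\<And>k. k \<in> exponents 2 \<Longrightarrow> distributed M lborel (B k) (normal_density 0 1)"
  defines "F\<^sub>2 \<equiv> \<lambda>\<omega>. hom_field 2 (\<lambda>k. A k \<omega>) (\<lambda>k. B k \<omega>)"
    and "P \<equiv> portrait_prob M F\<^sub>2"
  shows "\<exists>Q\<^sub>1 Q\<^sub>2 Q\<^sub>3 Q\<^sub>4 Q\<^sub>5.
      distinct [Q\<^sub>1, Q\<^sub>2, Q\<^sub>3, Q\<^sub>4, Q\<^sub>5] \<and>
      {Q \<in> phase_portrait 2 ` hom_fields 2. P Q > 0} = {Q\<^sub>1, Q\<^sub>2, Q\<^sub>3, Q\<^sub>4, Q\<^sub>5} \<and>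
      determined_by Q\<^sub>1 (-2) 3 \<and> determined_by Q\<^sub>2 0 3 \<and> determined_by Q\<^sub>3 2 3 \<and>
      determined_by Q\<^sub>4 0 1 \<and> determined_by Q\<^sub>5 2 1 \<and>
      P Q\<^sub>1 + P Q\<^sub>2 + P Q\<^sub>3 + P Q\<^sub>4 + P Q\<^sub>5 = 1 \<and>
      P Q\<^sub>1 + P Q\<^sub>2 + P Q\<^sub>3 = (Lambda2 - 1) / 2 \<and>
      \<bar>(Lambda2 - 1) / 2 - 0.32172\<bar> \<le> 0.000005 \<and>
      P Q\<^sub>1 = P Q\<^sub>3 + P Q\<^sub>5 \<and>
      \<bar>Lambda2 - 1.64343\<bar> \<le> 0.000005"
proof -
 interpret prob_space M by fact
 interpret G: prob_space gauss6 by (rule prob_space_gauss6)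
 have N: "normal_coefficients M A B" using assms(1-4) by (simp add: normal_coefficients_def coefficient_index_def)
 have F2: "F\<^sub>2 \<omega> = quad_field (random_coeffs A B \<omega>)" for \<omega>
  unfolding F\<^sub>2_def quad_field_hom random_coeffs_def ..
 let ?Q = portrait_of_type and ?cls = "%p. coefficient_class (fst p) (snd p)"
 have types: "snd p = 1 | snd p = 3" if "p \<in> portrait_types" for p using that by (auto simp: portrait_types_def)
 have PQ: "P (?Q p) = coeff_prob (?cls p)" if p: "p \<in> portrait_types" for p
  unfolding P_def portrait_prob_def F2 portrait_of_type_iff(2)[OF p]
  by (rule coefficient_law(2)[OF N coefficient_class_borel[OF types[OF p]]])
 have positive: "0 < P (?Q p)" if p: "p \<in> portrait_types" for p
 proof -
  let ?U = "{c. has_index (quad_field c) 0 (fst p)} \<inter> (if snd p = 3 then {c. field_disc c > 0} else {c. field_disc c < 0})"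
  have "open ?U" using open_index open_disc by auto
  moreover have "portrait_example p \<in> ?U" using portrait_example_type[OF p] by auto
  ultimately have "0 < coeff_prob ?U" by (rule open_positive)
  also have "\<dots> <= coeff_prob (?cls p)"
  proof (rule G.finite_measure_mono)
   have "?U \<subseteq> ?cls p" using card_lines_disc types[OF p] by (auto simp: coefficient_class_def split: if_splits)
   then show "{x \<in> space gauss6. coeffs_of x \<in> ?U} \<subseteq> {x \<in> space gauss6. coeffs_of x \<in> ?cls p}" by blast
  qed (rule coeffs_of_sets[OF coefficient_class_borel[OF types[OF p]]])
  finally show ?thesis unfolding PQ[OF p] .
 qed
 have inj: "p = q" if pq: "p \<in> portrait_types" "q \<in> portrait_types" "?Q p = ?Q q" for p q
 proof -
  have "portrait_example p \<in> ?cls p" "portrait_example p \<in> ?cls q"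
   using portrait_of_type_iff(2)[OF pq(1), of "portrait_example p"] portrait_of_type_iff(2)[OF pq(2), of "portrait_example p"] pq(3)
   by (simp_all add: portrait_of_type_def)
  then show ?thesis using type_unique by (metis prod.collapse)
 qed
 have only: "\<exists>p\<in>portrait_types. Q = ?Q p" if Q: "0 < P Q" for Q
 proof (rule ccontr)
  assume none: "\<not> ?thesis"
  have "{\<omega> \<in> space M. phase_portrait 2 (F\<^sub>2 \<omega>) = Q} \<subseteq> {\<omega> \<in> space M. random_coeffs A B \<omega> \<in> - generic_coeffs}"
  proof
   fix \<omega> assume w: "\<omega> \<in> {\<omega> \<in> space M. phase_portrait 2 (F\<^sub>2 \<omega>) = Q}"
   have "random_coeffs A B \<omega> \<notin> generic_coeffs"
   proof
    assume "random_coeffs A B \<omega> \<in> generic_coeffs"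
    then obtain p where p: "p \<in> portrait_types" "random_coeffs A B \<omega> \<in> ?cls p" using generic_type by blast
    then have "phase_portrait 2 (F\<^sub>2 \<omega>) = ?Q p" unfolding F2 using portrait_of_type_iff(2)[OF p(1)] by blast
    then show False using w p(1) none by blast
   qed
   then show "\<omega> \<in> {\<omega> \<in> space M. random_coeffs A B \<omega> \<in> - generic_coeffs}" using w by simp
  qed
  moreover have b: "- generic_coeffs \<in> sets borel" using generic_coeffs_borel by (metis borel_comp)
  ultimately have "P Q <= coeff_prob (- generic_coeffs)"
   unfolding P_def portrait_prob_def coefficient_law(2)[OF N b, symmetric]
   by - (rule finite_measure_mono[OF _ coefficient_law(1)[OF N b]], assumption)
  also have "\<dots> = coeff_prob {}" by (rule coeff_prob_cong[OF b]) auto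
  finally show False using Q by simp
 qed
 have set_eq: "{Q \<in> phase_portrait 2 ` hom_fields 2. P Q > 0} = ?Q ` portrait_types"
 proof (intro equalityI subsetI)
  fix Q assume "Q \<in> ?Q ` portrait_types"
  then obtain p where p: "p \<in> portrait_types" "Q = ?Q p" by blast
  then have "Q \<in> phase_portrait 2 ` hom_fields 2" unfolding portrait_of_type_def using quad_field_in by blast
  then show "Q \<in> {Q \<in> phase_portrait 2 ` hom_fields 2. P Q > 0}" using positive p by simp
 qed (use only in blast)
 have sum: "(\<Sum>p\<in>S. P (?Q p)) = coeff_prob E"
  if "S \<subseteq> portrait_types" "E \<in> sets borel" "!!c. c \<in> generic_coeffs ==> c \<in> E \<longleftrightarrow> (\<exists>p\<in>S. c \<in> ?cls p)" for S E
 proof -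
  have "(\<Sum>p\<in>S. P (?Q p)) = (\<Sum>p\<in>S. coeff_prob (?cls p))" using that(1) PQ by (intro sum.cong) auto
  then show ?thesis using coeff_prob_types[OF that] by simp
 qed
 have "(\<Sum>p\<in>portrait_types. P (?Q p)) = coeff_prob UNIV" by (rule sum) (auto dest: generic_type)
 then have total: "P (?Q (-2,3)) + P (?Q (0,3)) + P (?Q (2,3)) + P (?Q (0,1)) + P (?Q (2,1)) = 1"
  by (simp add: portrait_types_def G.prob_space)
 have "(\<Sum>p\<in>{(-2,3), (0,3), (2,3)}. P (?Q p)) = coeff_prob {c. 0 < field_disc c}"
 proof (rule sum)
  fix c assume c: "c \<in> generic_coeffs"
  show "c \<in> {c. 0 < field_disc c} \<longleftrightarrow> (\<exists>p\<in>{(-2,3), (0,3), (2,3)}. c \<in> ?cls p)"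
  proof
   assume "c \<in> {c. 0 < field_disc c}"
   then have three: "card (zero_angles (quad_field c)) = 3" by (simp add: card_three_iff_disc)
   obtain p where p: "p \<in> portrait_types" "c \<in> ?cls p" using generic_type[OF c] by blast
   then have "snd p = 3" using three by (simp add: coefficient_class_def)
   then have "p \<in> {(-2,3), (0,3), (2,3)}" using p(1) by (auto simp: portrait_types_def)
   then show "\<exists>p\<in>{(-2,3), (0,3), (2,3)}. c \<in> ?cls p" using p(2) by blast
  qed (auto simp: coefficient_class_def card_three_iff_disc)
 qed (use open_disc(1) in \<open>auto simp: portrait_types_def\<close>)
 then have three: "P (?Q (-2,3)) + P (?Q (0,3)) + P (?Q (2,3)) = (Lambda2 - 1) / 2"
  using three_lines_probability by simp
 have index_sum: "(\<Sum>p\<in>{p \<in> portrait_types. fst p = i}. P (?Q p)) = coeff_prob {c. has_index (quad_field c) 0 i}" for i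
 proof (rule sum)
  fix c assume c: "c \<in> generic_coeffs"
  show "c \<in> {c. has_index (quad_field c) 0 i} \<longleftrightarrow> (\<exists>p\<in>{p \<in> portrait_types. fst p = i}. c \<in> ?cls p)"
  proof
   assume i: "c \<in> {c. has_index (quad_field c) 0 i}"
   obtain p where p: "p \<in> portrait_types" "c \<in> ?cls p" using generic_type[OF c] by blast
   then have "fst p = i" using i has_index_unique by (auto simp: coefficient_class_def)
   then show "\<exists>p\<in>{p \<in> portrait_types. fst p = i}. c \<in> ?cls p" using p by blast
  qed (auto simp: coefficient_class_def)
 qed (auto intro: borel_open[OF open_index])
 have "{p \<in> portrait_types. fst p = -2} = {(-2,3)}" "{p \<in> portrait_types. fst p = 2} = {(2,3), (2,1)}"
  by (auto simp: portrait_types_def)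
 then have sym: "P (?Q (-2,3)) = P (?Q (2,3)) + P (?Q (2,1))"
  using index_sum[of "-2"] index_sum[of 2] opposite_index_probability[OF N, of 2] by simp
 have L: "\<bar>(Lambda2 - 1) / 2 - 0.32172\<bar> <= 0.000005" "\<bar>Lambda2 - 1.64343\<bar> <= 0.000005"
  using Lambda2_bounds by (simp_all add: abs_le_iff)
 have dist: "distinct [?Q (-2,3), ?Q (0,3), ?Q (2,3), ?Q (0,1), ?Q (2,1)]"
  using inj[of "(-2,3)" "(0,3)"] inj[of "(-2,3)" "(2,3)"] inj[of "(-2,3)" "(0,1)"] inj[of "(-2,3)" "(2,1)"]
   inj[of "(0,3)" "(2,3)"] inj[of "(0,3)" "(0,1)"] inj[of "(0,3)" "(2,1)"] inj[of "(2,3)" "(0,1)"] inj[of "(2,3)" "(2,1)"] inj[of "(0,1)" "(2,1)"]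
  by (auto simp: portrait_types_def)
 have det: "determined_by (?Q (-2,3)) (-2) 3" "determined_by (?Q (0,3)) 0 3" "determined_by (?Q (2,3)) 2 3"
  "determined_by (?Q (0,1)) 0 1" "determined_by (?Q (2,1)) 2 1"
  using portrait_of_type_iff(1) by (force simp: portrait_types_def)+
 have five: "{Q \<in> phase_portrait 2 ` hom_fields 2. P Q > 0} = {?Q (-2,3), ?Q (0,3), ?Q (2,3), ?Q (0,1), ?Q (2,1)}"
  unfolding set_eq by (simp add: portrait_types_def)
 show ?thesis
  by (rule exI[of _ "?Q (-2,3)"], rule exI[of _ "?Q (0,3)"], rule exI[of _ "?Q (2,3)"], rule exI[of _ "?Q (0,1)"], rule exI[of _ "?Q (2,1)"])
   (intro conjI dist five det total three sym L)
qed

end
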